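(* Let $d\ge 3$, let $V\in RH_s$ with $s\ge d/2$, and let $\rho$ be the critical radius function of $V$. Let $0<\alpha<d$, $p=1$, $q=d/(d-\alpha)$, $w\in A^{\rho,\infty}_{1,q}$ and $0<\kappa<1/q$. Then the $\mathcal L$-fractional integral operator $\mathcal I_\alpha=\mathcal L^{-\alpha/2}$ is bounded from $L^{1,\kappa}_{\rho,\infty}(w,w^q)$ into $WL^{q,(\kappa q)}_{\rho,\infty}(w^q)$; that is, for every $\theta>0$ there exist $\vartheta>0$ and $C>0$ such that for all $f\in L^{1,\kappa}_{\rho,\theta}(w,w^q)$, $$\|\mathcal I_\alpha f\|_{WL^{q,\kappa q}_{\rho,\vartheta}(w^q)}\le C\,\|f\|_{L^{1,\kappa}_{\rho,\theta}(w,w^q)}.$$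
   Context: Potential. $V:\mathbb R^d\to\mathbb R$ is nonnegative, locally integrable and not identically zero. $V\in RH_s$ ($1<s<\infty$) means there is $C>0$ with $\left(\frac1{|B|}\int_B V^s\right)^{1/s}\le C\,\frac1{|B|}\int_B V$ for every ball $B\subset\mathbb R^d$. The critical radius function is $\rho(x)=\sup\{r>0:\ r^{2-d}\int_{B(x,r)}V(y)\,dy\le 1\}$, where $B(x,r)$ is the open ball with center $x$ and radius $r$; if $d\ge 3$ and $V$ is nonnegative, locally integrable, not identically zero and belongs to $RH_s$ with $s\ge d/2$, one has $0<\rho(x)<\infty$ for all $x$. Operator. $\mathcal L=-\Delta+V$ is the Schrödinger operator on $\mathbb R^d$, $p_t(x,y)$ ($t>0$) is the integral kernel of the semigroup $e^{-t\mathcal L}$, $\mathcal K_\alpha(x,y)=\int_0^\infty p_t(x,y)\,t^{\alpha/2-1}\,dt$, and $\mathcal I_\alpha f(x)=\mathcal L^{-\alpha/2}f(x)=\int_0^\infty e^{-t\mathcal L}f(x)\,t^{\alpha/2-1}dt=\int_{\mathbb R^d}\mathcal K_\alpha(x,y)f(y)\,dy$ (this is the definition; no normalizing constant is used). Weights. A weight is a nonnegative locally integrable function on $\mathbb R^d$ (not a.e. zero); $w(E)=\int_E w\,dx$ and $w^\gamma(x)=w(x)^\gamma$, so $w^q(B)=\int_B w^q\,dx$. For $1<q<\infty$ and $0<\theta<\infty$: $w\in A^{\rho,\theta}_{1,q}$ if there is $C>0$ such that for every ball $B=B(x_0,r)$, $$\Big(\frac1{|B|}\int_B w^q\,dx\Big)^{1/q}\le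 C\Big(1+\frac{r}{\rho(x_0)}\Big)^{\theta}\operatorname*{ess\,inf}_{x\in B}w(x).$$ $A^{\rho,\infty}_{1,q}=\bigcup_{\theta>0}A^{\rho,\theta}_{1,q}$. Morrey spaces. For $1\le p<\infty$, $0\le\kappa<1$, weights $\mu,\nu$ and $0<\theta<\infty$, $L^{p,\kappa}_{\rho,\theta}(\mu,\nu)$ is the set of all measurable $f$, with $|f|^p\mu$ locally integrable, such that $$\|f\|_{L^{p,\kappa}_{\rho,\theta}(\mu,\nu)}=\sup_{B=B(x_0,r)}\Big(1+\frac r{\rho(x_0)}\Big)^{-\theta}\Big(\frac1{\nu(B)^\kappa}\int_B|f|^p\mu\,dx\Big)^{1/p}<\infty,$$ and $L^{p,\kappa}_{\rho,\infty}(\mu,\nu)=\bigcup_{\theta>0}L^{p,\kappa}_{\rho,\theta}(\mu,\nu)$. For a weight $w$, the weighted weak Morrey space $WL^{p,\kappa}_{\rho,\theta}(w)$ is the set of all measurable $f$ with $$\|f\|_{WL^{p,\kappa}_{\rho,\theta}(w)}=\sup_{B=B(x_0,r)}\Big(1+\frac r{\rho(x_0)}\Big)^{-\theta}\frac1{w(B)^{\kappa/p}}\sup_{\lambda>0}\lambda\,\big[w(\{x\in B:|f(x)|>\lambda\})\big]^{1/p}<\infty,$$ and $WL^{p,\kappa}_{\rho,\infty}(w)=\bigcup_{\theta>0}WL^{p,\kappa}_{\rho,\theta}(w)$. Suprema over $B$ are over all balls of $\mathbb R^d$. *)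

theory Defs
  imports "HOL-Analysis.Analysis"
begin

text \<open>
  \<open>\<real>\<^sup>d\<close> is an arbitrary Euclidean space \<open>'a\<close> with \<open>d = DIM('a)\<close>; all balls are open with positive
  radius, and measurability, null sets and integrals refer to Lebesgue measure.
\<close>

definition locally_integrable :: "('a::euclidean_space \<Rightarrow> real) \<Rightarrow> bool" where
  "locally_integrable f \<longleftrightarrow> (\<forall>K. compact K \<longrightarrow> f absolutely_integrable_on K)"

text \<open>
  Functions are representatives of their almost-everywhere classes, so for \<open>V\<close> and \<open>w\<close>
  ``not identically zero'' means not almost everywhere zero.
\<close>

definition weight :: "('a::euclidean_space \<Rightarrow> real) \<Rightarrow> bool" where
  "weight w \<longleftrightarrow> (\<forall>x. 0 \<le> w x) \<and> locally_integrable w \<and> \<not> (AE x in lebesgue. w x = 0)"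

definition wmeas :: "('a::euclidean_space \<Rightarrow> real) \<Rightarrow> 'a set \<Rightarrow> real" where
  "wmeas w E = (LINT x:E|lebesgue. w x)"

definition avg :: "'a::euclidean_space set \<Rightarrow> ('a \<Rightarrow> real) \<Rightarrow> real" where
  "avg B f = (LINT x:B|lebesgue. f x) / measure lebesgue B"

text \<open>
  The integrability clause says that the left-hand side of the inequality is finite; without it the
  Bochner integral of a non-integrable \<open>V\<^sup>s\<close> would be \<open>0\<close>.
\<close>

definition reverse_Holder :: "real \<Rightarrow> ('a::euclidean_space \<Rightarrow> real) \<Rightarrow> bool" where
  "reverse_Holder s V \<longleftrightarrow> 1 < s \<and>
     (\<exists>C>0. \<forall>x r. 0 < r \<longrightarrow>
        (\<lambda>y. V y powr s) absolutely_integrable_on ball x r \<and>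
        avg (ball x r) (\<lambda>y. V y powr s) powr (1 / s) \<le> C * avg (ball x r) V)"

definition critical_radius :: "('a::euclidean_space \<Rightarrow> real) \<Rightarrow> 'a \<Rightarrow> real" where
  "critical_radius V x =
     Sup {r. 0 < r \<and> r powr (2 - real DIM('a)) * (LINT y:ball x r|lebesgue. V y) \<le> 1}"


subsection \<open>The Schroedinger operator and its heat kernel\<close>

definition square_integrable :: "('a::euclidean_space \<Rightarrow> 'b::euclidean_space) \<Rightarrow> bool" where
  "square_integrable f \<longleftrightarrow>
     f \<in> borel_measurable lebesgue \<and> integrable lebesgue (\<lambda>x. (norm (f x))\<^sup>2)"

definition l2norm :: "('a::euclidean_space \<Rightarrow> real) \<Rightarrow> real" where
  "l2norm f = sqrt (LINT x|lebesgue. (f x)\<^sup>2)"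

text \<open>Weak gradient, tested against compactly supported \<open>C\<^sup>1\<close> functions \<open>\<phi>\<close> with gradient \<open>G\<close>.\<close>

definition weak_gradient :: "('a::euclidean_space \<Rightarrow> real) \<Rightarrow> ('a \<Rightarrow> 'a) \<Rightarrow> bool" where
  "weak_gradient u g \<longleftrightarrow>
     (\<forall>\<phi> G. (\<forall>x. GDERIV \<phi> x :> G x) \<and> continuous_on UNIV G \<and> bounded {x. \<phi> x \<noteq> 0} \<longrightarrow>
        (LINT x|lebesgue. u x *\<^sub>R G x) = - (LINT x|lebesgue. \<phi> x *\<^sub>R g x))"

text \<open>
  \<open>u\<close> lies in the form domain \<open>{u \<in> H\<^sup>1. V\<^sup>1\<^sup>/\<^sup>2 u \<in> L\<^sup>2}\<close> and \<open>g\<close> is its weak gradient.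
\<close>

definition form_domain ::
    "('a::euclidean_space \<Rightarrow> real) \<Rightarrow> ('a \<Rightarrow> real) \<Rightarrow> ('a \<Rightarrow> 'a) \<Rightarrow> bool" where
  "form_domain V u g \<longleftrightarrow> square_integrable u \<and> square_integrable g \<and> weak_gradient u g \<and>
     integrable lebesgue (\<lambda>x. V x * (u x)\<^sup>2)"

text \<open>
  For \<open>V \<ge> 0\<close> locally integrable, \<open>\<L> = -\<Delta> + V\<close> is the self-adjoint operator on \<open>L\<^sup>2\<close> associated with the
  closed form \<open>\<integral> \<nabla>u \<cdot> \<nabla>v + \<integral> V u v\<close>.  The relation below is its graph: \<open>u \<in> D(\<L>)\<close> and \<open>\<L> u = h\<close>.
\<close>

definition schroedinger ::
    "('a::euclidean_space \<Rightarrow> real) \<Rightarrow> ('a \<Rightarrow> real) \<Rightarrow> ('a \<Rightarrow> real) \<Rightarrow> bool" where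
  "schroedinger V u h \<longleftrightarrow> square_integrable h \<and>
     (\<exists>g. form_domain V u g \<and>
        (\<forall>v k. form_domain V v k \<longrightarrow>
           (LINT x|lebesgue. g x \<bullet> k x) + (LINT x|lebesgue. V x * u x * v x)
             = (LINT x|lebesgue. h x * v x)))"

text \<open>
  \<open>S t = e\<^sup>-\<^sup>t\<^sup>\<L>\<close>, the strongly continuous semigroup on (real) \<open>L\<^sup>2\<close> whose generator is \<open>-\<L>\<close>.
  The boundedness clause, with linearity, makes each \<open>S t\<close> well defined on almost-everywhere classes.
  The last clause equates the generator with \<open>-\<L>\<close>, domains included.
\<close>

definition schroedinger_semigroup ::
    "('a::euclidean_space \<Rightarrow> real) \<Rightarrow> (real \<Rightarrow> ('a \<Rightarrow> real) \<Rightarrow> 'a \<Rightarrow> real) \<Rightarrow> bool" where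
  "schroedinger_semigroup V S \<longleftrightarrow>
     (\<forall>t\<ge>0. \<forall>f. square_integrable f \<longrightarrow> square_integrable (S t f)) \<and>
     (\<forall>t\<ge>0. \<forall>f g c. square_integrable f \<and> square_integrable g \<longrightarrow>
        (AE x in lebesgue. S t (\<lambda>y. c * f y + g y) x = c * S t f x + S t g x)) \<and>
     (\<forall>t\<ge>0. \<exists>M. \<forall>f. square_integrable f \<longrightarrow> l2norm (S t f) \<le> M * l2norm f) \<and>
     (\<forall>f. square_integrable f \<longrightarrow> (AE x in lebesgue. S 0 f x = f x)) \<and>
     (\<forall>s\<ge>0. \<forall>t\<ge>0. \<forall>f. square_integrable f \<longrightarrow>
        (AE x in lebesgue. S (s + t) f x = S s (S t f) x)) \<and>
     (\<forall>f. square_integrable f \<longrightarrow>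
        ((\<lambda>t. l2norm (\<lambda>x. S t f x - f x)) \<longlongrightarrow> 0) (at_right 0)) \<and>
     (\<forall>u h. square_integrable u \<and> square_integrable h \<longrightarrow>
        (schroedinger V u h \<longleftrightarrow>
           ((\<lambda>t. l2norm (\<lambda>x. (S t u x - u x) / t - (- h x))) \<longlongrightarrow> 0) (at_right 0)))"

text \<open>
  \<open>p\<close> is a jointly measurable version of the integral kernel of \<open>e\<^sup>-\<^sup>t\<^sup>\<L>\<close>, \<open>t > 0\<close>.  Any two such versions
  agree almost everywhere on \<open>(0,\<infinity>) \<times> \<real>\<^sup>d \<times> \<real>\<^sup>d\<close>.
\<close>

definition heat_kernel ::
    "('a::euclidean_space \<Rightarrow> real) \<Rightarrow> (real \<Rightarrow> 'a \<Rightarrow> 'a \<Rightarrow> real) \<Rightarrow> bool" where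
  "heat_kernel V p \<longleftrightarrow>
     (\<lambda>(t, x, y). p t x y) \<in> borel_measurable (lebesgue_on ({0<..} \<times> UNIV)) \<and>
     (\<exists>S. schroedinger_semigroup V S \<and>
        (\<forall>t>0. \<forall>f. square_integrable f \<longrightarrow>
           (AE x in lebesgue. integrable lebesgue (\<lambda>y. p t x y * f y) \<and>
              S t f x = (LINT y|lebesgue. p t x y * f y))))"


subsection \<open>The fractional integral operator\<close>

definition frac_kernel ::
    "(real \<Rightarrow> 'a \<Rightarrow> 'a \<Rightarrow> real) \<Rightarrow> real \<Rightarrow> 'a::euclidean_space \<Rightarrow> 'a \<Rightarrow> real" where
  "frac_kernel p \<alpha> x y = (LINT t:{0<..}|lebesgue. p t x y * t powr (\<alpha> / 2 - 1))"

definition frac_integral ::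
    "(real \<Rightarrow> 'a \<Rightarrow> 'a \<Rightarrow> real) \<Rightarrow> real \<Rightarrow> ('a::euclidean_space \<Rightarrow> complex) \<Rightarrow> 'a \<Rightarrow> complex" where
  "frac_integral p \<alpha> f x = (LINT y|lebesgue. frac_kernel p \<alpha> x y *\<^sub>R f y)"

text \<open>
  Absolute convergence at \<open>x\<close> of the integrals defining \<open>frac_integral p \<alpha> f x\<close>, so that its value is
  not the default \<open>0\<close> of a divergent Bochner integral.
\<close>

definition frac_integral_converges ::
    "(real \<Rightarrow> 'a \<Rightarrow> 'a \<Rightarrow> real) \<Rightarrow> real \<Rightarrow> ('a::euclidean_space \<Rightarrow> complex) \<Rightarrow> 'a \<Rightarrow> bool" where
  "frac_integral_converges p \<alpha> f x \<longleftrightarrow>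
     (AE y in lebesgue. (\<lambda>t. p t x y * t powr (\<alpha> / 2 - 1)) absolutely_integrable_on {0<..}) \<and>
     integrable lebesgue (\<lambda>y. frac_kernel p \<alpha> x y *\<^sub>R f y)"


subsection \<open>Weight classes and Morrey spaces\<close>

definition ess_inf_on :: "'a::euclidean_space set \<Rightarrow> ('a \<Rightarrow> real) \<Rightarrow> real" where
  "ess_inf_on B w = Sup {m. AE x in lebesgue. x \<in> B \<longrightarrow> m \<le> w x}"

definition A1q ::
    "('a::euclidean_space \<Rightarrow> real) \<Rightarrow> real \<Rightarrow> real \<Rightarrow> ('a \<Rightarrow> real) \<Rightarrow> bool" where
  "A1q \<rho> \<theta> q w \<longleftrightarrow> weight w \<and>
     (\<exists>C>0. \<forall>x r. 0 < r \<longrightarrow>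
        (\<lambda>y. w y powr q) absolutely_integrable_on ball x r \<and>
        avg (ball x r) (\<lambda>y. w y powr q) powr (1 / q)
          \<le> C * (1 + r / \<rho> x) powr \<theta> * ess_inf_on (ball x r) w)"

definition A1q_infinity :: "('a::euclidean_space \<Rightarrow> real) \<Rightarrow> real \<Rightarrow> ('a \<Rightarrow> real) \<Rightarrow> bool" where
  "A1q_infinity \<rho> q w \<longleftrightarrow> (\<exists>\<theta>>0. A1q \<rho> \<theta> q w)"

definition morrey_norm ::
    "('a::euclidean_space \<Rightarrow> real) \<Rightarrow> real \<Rightarrow> real \<Rightarrow> real \<Rightarrow> ('a \<Rightarrow> real) \<Rightarrow> ('a \<Rightarrow> real)
       \<Rightarrow> ('a \<Rightarrow> complex) \<Rightarrow> ennreal" where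
  "morrey_norm \<rho> \<theta> p \<kappa> \<mu> \<nu> f =
     (SUP (x, r) \<in> UNIV \<times> {0<..}.
        ennreal ((1 + r / \<rho> x) powr (- \<theta>) *
          (1 / wmeas \<nu> (ball x r) powr \<kappa> *
             (LINT y:ball x r|lebesgue. norm (f y) powr p * \<mu> y)) powr (1 / p)))"

definition morrey ::
    "('a::euclidean_space \<Rightarrow> real) \<Rightarrow> real \<Rightarrow> real \<Rightarrow> real \<Rightarrow> ('a \<Rightarrow> real) \<Rightarrow> ('a \<Rightarrow> real)
       \<Rightarrow> ('a \<Rightarrow> complex) set" where
  "morrey \<rho> \<theta> p \<kappa> \<mu> \<nu> =
     {f \<in> borel_measurable lebesgue.
        locally_integrable (\<lambda>x. norm (f x) powr p * \<mu> x) \<and> morrey_norm \<rho> \<theta> p \<kappa> \<mu> \<nu> f < \<infinity>}"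

definition weak_morrey_norm ::
    "('a::euclidean_space \<Rightarrow> real) \<Rightarrow> real \<Rightarrow> real \<Rightarrow> real \<Rightarrow> ('a \<Rightarrow> real)
       \<Rightarrow> ('a \<Rightarrow> complex) \<Rightarrow> ennreal" where
  "weak_morrey_norm \<rho> \<theta> p \<kappa> w f =
     (SUP (x, r) \<in> UNIV \<times> {0<..}.
        ennreal ((1 + r / \<rho> x) powr (- \<theta>) * (1 / wmeas w (ball x r) powr (\<kappa> / p))) *
        (SUP l \<in> {0<..}.
           ennreal (l * wmeas w {y \<in> ball x r. norm (f y) > l} powr (1 / p))))"

definition weak_morrey ::
    "('a::euclidean_space \<Rightarrow> real) \<Rightarrow> real \<Rightarrow> real \<Rightarrow> real \<Rightarrow> ('a \<Rightarrow> real)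
       \<Rightarrow> ('a \<Rightarrow> complex) set" where
  "weak_morrey \<rho> \<theta> p \<kappa> w =
     {f \<in> borel_measurable lebesgue. weak_morrey_norm \<rho> \<theta> p \<kappa> w f < \<infinity>}"

end

theory Submission imports Defs "HOL-Probability.Distributions" begin

text \<open>The kernel of the semigroup is dominated by the heat kernel by parabolic comparison. On balls of
radius at least \<open>\<rho>\<close> the potential absorbs a fixed proportion of the mass; iterating this gives
a decay factor \<open>(1 + sqrt t / \<rho> x) powr (- N)\<close>, and integrating in \<open>t\<close> bounds \<open>K x y\<close> by a multiple of
\<open>dist x y powr (\<alpha> - d) * (1 + dist x y / \<rho> x) powr (- N)\<close> for every \<open>N\<close>. For the part of \<open>f\<close> near a
ball, the weak type bound follows by pairing with \<open>w powr q\<close> and the condition on \<open>w\<close>; the far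
part is a convergent geometric series over dyadic annuli.\<close>

section \<open>The Hilbert space of square integrable functions\<close>

text \<open>The semigroup is given only through its generator and the kernel only up to null sets,
  so no pointwise regularity is at hand: every estimate is an almost everywhere inequality between
  elements of a Hilbert space. The quotient \<open>((u - heat_op k u) \<bullet> v) / k\<close> takes
  the place of Sobolev theory. Its limit for small \<open>k\<close> is the Dirichlet form, it
  decreases under truncation, and its boundedness produces a weak gradient; hence positive parts of
  differences may be inserted into the weak equation. Absorption rests on a barrier made of the heat
  accumulated from a set where V is large. Each absorption step loses a collar in space up to a
  Gaussian tail, and the slow variation of \<rho> fixes how many steps fit into a given time; this
  number is a power of \<open>1 + sqrt t / \<rho> x\<close>, which is why the decay has arbitrary
  order. For the near part it matters that \<alpha> - d = - d / q. For the far part the weight is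
  reverse doubling only below the critical radius, and the decay of the kernel supplies convergence
  above it.\<close>

abbreviation AE_lborel (binder "AE " 10) where "AE_lborel P \<equiv> AE x in lborel. P x"

abbreviation nn_integral_lborel (binder "\<integral>\<^sup>+" 10) where "nn_integral_lborel \<equiv> nn_integral lborel"

abbreviation Borel where "Borel \<equiv> borel_measurable borel"

text \<open>Borel measurability, instead of the Lebesgue measurability in
  \<open>square_integrable\<close>, keeps translations, products and Fubini within the Borel sets;
  \<open>lmk\<close> later chooses such representatives.\<close>

definition sqi :: "('a::euclidean_space => real) => bool" where
 "sqi f \<longleftrightarrow> f \<in> Borel & integrable lborel (%x. (f x)\<^sup>2)"

lemma sqi_measurable [measurable_dest]: "sqi f ==> f \<in> Borel"
 by (simp add: sqi_def)

lemma sqi_dominated: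
 assumes "sqi g" and [measurable]: "f \<in> Borel" and "AE x. \<bar>f x\<bar> <= \<bar>g x\<bar>"
 shows "sqi f"
proof -
 have "integrable lborel (%x. (f x)\<^sup>2)"
 proof (rule Bochner_Integration.integrable_bound)
  show "integrable lborel (%x. (g x)\<^sup>2)" using assms by (simp add: sqi_def)
  show "AE x. norm ((f x)\<^sup>2) <= norm ((g x)\<^sup>2)"
   using assms(3) by eventually_elim (simp add: abs_le_square_iff)
 qed simp
 then show ?thesis by (simp add: sqi_def)
qed

lemma sqi_add [intro]:
 assumes "sqi f" "sqi g" shows "sqi (%x. f x + g x)"
proof -
 note [measurable] = assms[THEN sqi_measurable]
 have "integrable lborel (%x. (f x + g x)\<^sup>2)"
 proof (rule Bochner_Integration.integrable_bound)
  show "integrable lborel (%x. 2 * (f x)\<^sup>2 + 2 * (g x)\<^sup>2)" using assms by (auto simp: sqi_def)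
  have "(a + b)\<^sup>2 <= 2 * a\<^sup>2 + 2 * b\<^sup>2" for a b :: real
   using sum_squares_bound[of a b] by (simp add: power2_sum)
  then show "AE x. norm ((f x + g x)\<^sup>2) <= norm (2 * (f x)\<^sup>2 + 2 * (g x)\<^sup>2)" by auto
 qed simp
 with assms show ?thesis by (simp add: sqi_def)
qed

lemma sqi_scale [intro]: "sqi f ==> sqi (%x. c * f x)"
 by (auto simp: sqi_def power_mult_distrib)

lemma sqi_uminus [intro]: "sqi f ==> sqi (%x. - f x)"
 by (auto simp: sqi_def)

lemma sqi_diff [intro]: "sqi f ==> sqi g ==> sqi (%x. f x - g x)"
 using sqi_add[of f "%x. - g x"] by auto

lemma sqi_zero [simp, intro]: "sqi (%x. 0)"
 by (auto simp: sqi_def)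

lemma sqi_integrable_mult:
 assumes "sqi f" "sqi g" shows "integrable lborel (%x. f x * g x)"
proof (rule Bochner_Integration.integrable_bound)
 note [measurable] = assms[THEN sqi_measurable]
 show "integrable lborel (%x. (f x)\<^sup>2 + (g x)\<^sup>2)" using assms by (auto simp: sqi_def)
 have "\<bar>a * b\<bar> <= a\<^sup>2 + b\<^sup>2" for a b :: real
 proof -
  have "0 <= (\<bar>a\<bar> - \<bar>b\<bar>)\<^sup>2" by simp
  then have "2 * (\<bar>a\<bar> * \<bar>b\<bar>) <= a\<^sup>2 + b\<^sup>2" by (simp add: power2_diff)
  moreover have "0 <= \<bar>a\<bar> * \<bar>b\<bar>" by simp
  ultimately show ?thesis unfolding abs_mult by linarith
 qed
 then show "AE x. norm (f x * g x) <= norm ((f x)\<^sup>2 + (g x)\<^sup>2)" by auto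
 show "(%x. f x * g x) \<in> borel_measurable lborel" by simp
qed

lemma sqi_mult_bounded:
 assumes "sqi f" and [measurable]: "m \<in> Borel" and "!!x. \<bar>m x\<bar> <= c"
 shows "sqi (%x. m x * f x)"
proof (rule sqi_dominated[where g = "%x. c * f x"])
 note [measurable] = assms(1)[THEN sqi_measurable]
 show "sqi (%x. c * f x)" using assms by auto
 have "\<bar>m x * f x\<bar> <= \<bar>c * f x\<bar>" for x
  using mult_right_mono[OF assms(3)[of x], of "\<bar>f x\<bar>"] assms(3)[of x] by (simp add: abs_mult)
 then show "AE x. \<bar>m x * f x\<bar> <= \<bar>c * f x\<bar>" by auto
 show "(%x. m x * f x) \<in> Borel"
  using sqi_measurable[OF assms(1)] by measurable
qed

lemma sqi_indicator:
 assumes "A \<in> sets lborel" "emeasure lborel A < \<infinity>"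
 shows "sqi (indicator A)"
proof -
 have "(%x. (indicator A x)\<^sup>2 :: real) = indicator A" by (auto simp: indicator_def)
 then show ?thesis using assms by (auto simp: sqi_def)
qed

section \<open>The quotient by almost everywhere equality\<close>

definition l2rel :: "('a::euclidean_space => real) => ('a => real) => bool" where
 "l2rel f g \<longleftrightarrow> sqi f & sqi g & (AE x. f x = g x)"

\<comment> \<open>\<open>l2rel\<close> is a partial equivalence that relates only square integrable
  functions, so every class has square integrable representatives and no carrier set is
  needed.\<close>
quotient_type (overloaded) 'a l2 = "'a::euclidean_space => real" / partial: l2rel
proof (rule part_equivpI)
 show "EX x. l2rel x x" by (rule exI[of _ "%x. 0"]) (simp add: l2rel_def)
 show "symp l2rel" by (auto simp: l2rel_def symp_def)
 show "transp l2rel" by (auto simp: l2rel_def transp_def)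
qed

definition fn :: "'a::euclidean_space l2 => 'a => real" where "fn = rep_l2"
definition mk :: "('a::euclidean_space => real) => 'a l2" where "mk = abs_l2"

lemma sqi_fn [simp, intro]: "sqi (fn F)"
 using Quotient_rep_reflp[OF Quotient_l2, of F] by (simp add: fn_def l2rel_def)

lemma fn_measurable [measurable]: "fn F \<in> Borel"
 by (rule sqi_measurable) simp

lemma fn_mk: "sqi f ==> AE x. fn (mk f) x = f x"
 using Quotient3_rep_abs[OF Quotient3_l2, of f] by (simp add: fn_def mk_def l2rel_def)

lemma mk_fn [simp]: "mk (fn F) = F"
 using Quotient3_abs_rep[OF Quotient3_l2] by (simp add: fn_def mk_def)

lemma mk_eqI: "sqi f ==> sqi g ==> AE x. f x = g x ==> mk f = mk g"
 unfolding mk_def using Quotient3_rel_abs[OF Quotient3_l2] by (auto simp: l2rel_def)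

lemma l2_eqI: "AE x. fn F x = fn G x ==> F = G"
 by (metis mk_eqI mk_fn sqi_fn)

instantiation l2 :: (euclidean_space) real_vector
begin

definition "0 = mk (%x. 0)"
definition "F + G = mk (%x. fn F x + fn G x)"
definition "- F = mk (%x. - fn F x)"
definition "F - G = mk (%x. fn F x - fn G x)" for F G :: "'a l2"
definition "c *\<^sub>R F = mk (%x. c * fn F x)"

lemma fn_zero: "AE x. fn 0 x = 0"
 unfolding zero_l2_def by (rule fn_mk) simp
lemma fn_add: "AE x. fn (F + G) x = fn F x + fn G x"
 unfolding plus_l2_def by (rule fn_mk) auto
lemma fn_uminus: "AE x. fn (- F) x = - fn F x"
 unfolding uminus_l2_def by (rule fn_mk) auto
lemma fn_diff: "AE x. fn (F - G) x = fn F x - fn G x"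
 unfolding minus_l2_def by (rule fn_mk) auto
lemma fn_scale: "AE x. fn (c *\<^sub>R F) x = c * fn F x"
 unfolding scaleR_l2_def by (rule fn_mk) auto

instance
proof
 fix F G K :: "'a l2" and c d :: real
 show "F + G + K = F + (G + K)"
  by (rule l2_eqI) (use fn_add[of "F + G" K] fn_add[of F G] fn_add[of F "G + K"] fn_add[of G K] in eventually_elim, simp)
 show "F + G = G + F"
  by (rule l2_eqI) (use fn_add[of F G] fn_add[of G F] in eventually_elim, simp)
 show "0 + F = F"
  by (rule l2_eqI) (use fn_add[of 0 F] fn_zero in eventually_elim, simp)
 show "- F + F = 0"
  by (rule l2_eqI) (use fn_add[of "- F" F] fn_zero fn_uminus[of F] in eventually_elim, simp)
 show "F - G = F + - G"
  by (rule l2_eqI) (use fn_add[of F "- G"] fn_diff[of F G] fn_uminus[of G] in eventually_elim, simp)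
 show "c *\<^sub>R (F + G) = c *\<^sub>R F + c *\<^sub>R G"
  by (rule l2_eqI) (use fn_add[of F G] fn_scale[of c "F + G"] fn_scale[of c F] fn_scale[of c G]
    fn_add[of "c *\<^sub>R F" "c *\<^sub>R G"] in eventually_elim, simp add: algebra_simps)
 show "(c + d) *\<^sub>R F = c *\<^sub>R F + d *\<^sub>R F"
  by (rule l2_eqI) (use fn_scale[of "c + d" F] fn_scale[of c F] fn_scale[of d F]
    fn_add[of "c *\<^sub>R F" "d *\<^sub>R F"] in eventually_elim, simp add: algebra_simps)
 show "c *\<^sub>R d *\<^sub>R F = (c * d) *\<^sub>R F"
  by (rule l2_eqI) (use fn_scale[of c "d *\<^sub>R F"] fn_scale[of d F] fn_scale[of "c * d" F] in eventually_elim, simp)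
 show "1 *\<^sub>R F = F"
  by (rule l2_eqI) (use fn_scale[of 1 F] in eventually_elim, simp)
qed

end

instantiation l2 :: (euclidean_space) real_inner
begin

definition "F \<bullet> G = (LBINT x. fn F x * fn G x)"
definition "norm (F :: 'a l2) = sqrt (F \<bullet> F)"
definition "sgn (F :: 'a l2) = F /\<^sub>R norm F"
definition "dist (F :: 'a l2) G = norm (F - G)"
definition "(uniformity :: ('a l2 \<times> 'a l2) filter) = (INF e\<in>{0 <..}. principal {(x, y). dist x y < e})"
definition "open (U :: 'a l2 set) \<longleftrightarrow> (ALL x:U. \<forall>\<^sub>F (x', y) in uniformity. x' = x --> y \<in> U)"

lemma l2_inner_eq:
 assumes "AE x. fn F x = f x" "AE x. fn G x = g x"
  "f \<in> Borel" "g \<in> Borel"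
 shows "F \<bullet> G = (LBINT x. f x * g x)"
 unfolding inner_l2_def
proof (rule integral_cong_AE)
 show "AE x. fn F x * fn G x = f x * g x" using assms(1,2) by eventually_elim simp
qed (use assms in auto)

instance
proof
 fix F G K :: "'a l2" and c :: real
 show "F \<bullet> G = G \<bullet> F" by (simp add: inner_l2_def mult.commute)
 show "(F + G) \<bullet> K = F \<bullet> K + G \<bullet> K"
 proof -
  have "(F + G) \<bullet> K = (LBINT x. (fn F x + fn G x) * fn K x)"
   by (rule l2_inner_eq) (use fn_add in auto)
  also have "... = F \<bullet> K + G \<bullet> K"
   by (simp add: distrib_right inner_l2_def sqi_integrable_mult)
  finally show ?thesis .
 qed
 show "c *\<^sub>R F \<bullet> G = c * (F \<bullet> G)"
 proof -
  have "c *\<^sub>R F \<bullet> G = (LBINT x. (c * fn F x) * fn G x)"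
   by (rule l2_inner_eq) (use fn_scale in auto)
  then show ?thesis by (simp add: mult.assoc inner_l2_def)
 qed
 show "0 <= F \<bullet> F" by (simp add: inner_l2_def)
 show "(F \<bullet> F = 0) = (F = 0)"
 proof
  assume "F \<bullet> F = 0"
  then have "(LBINT x. (fn F x)\<^sup>2) = 0" by (simp add: inner_l2_def power2_eq_square)
  moreover have "integrable lborel (%x. (fn F x)\<^sup>2)" using sqi_fn[of F] by (simp add: sqi_def)
  ultimately have "AE x. (fn F x)\<^sup>2 = 0"
   by (subst (asm) integral_nonneg_eq_0_iff_AE) auto
  then have "AE x. fn F x = 0" by simp
  with fn_zero have "AE x. fn F x = fn 0 x" by eventually_elim simp
  then show "F = 0" by (rule l2_eqI)
 next
  assume F: "F = 0"
  have "(0::'a l2) \<bullet> 0 = (LBINT x::'a. (0::real) * 0)"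
   by (rule l2_inner_eq[of _ "%x. 0" _ "%x. 0"]) (auto intro: fn_zero)
  then show "F \<bullet> F = 0" using F by simp
 qed
qed (simp_all add: norm_l2_def sgn_l2_def dist_l2_def uniformity_l2_def open_l2_def)

end

lemma fn_eq_mk: "sqi f ==> F = mk f \<longleftrightarrow> (AE x. fn F x = f x)"
proof
 assume "sqi f" "AE x. fn F x = f x"
 from this(2) fn_mk[OF this(1)] have "AE x. fn F x = fn (mk f) x" by eventually_elim simp
 then show "F = mk f" by (rule l2_eqI)
qed (auto intro: fn_mk)

lemma mk_add: "sqi f ==> sqi g ==> mk (%x. f x + g x) = mk f + mk g"
 by (rule l2_eqI) (use fn_mk[of f] fn_mk[of g] fn_mk[of "%x. f x + g x"] fn_add[of "mk f" "mk g"] in \<open>auto simp: sqi_add\<close>)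

lemma mk_diff: "sqi f ==> sqi g ==> mk (%x. f x - g x) = mk f - mk g"
 by (rule l2_eqI) (use fn_mk[of f] fn_mk[of g] fn_mk[of "%x. f x - g x"] fn_diff[of "mk f" "mk g"] in \<open>auto simp: sqi_diff\<close>)

lemma mk_scale: "sqi f ==> mk (%x. c * f x) = c *\<^sub>R mk f"
 by (rule l2_eqI) (use fn_mk[of f] fn_mk[of "%x. c * f x"] fn_scale[of c "mk f"] in \<open>auto simp: sqi_scale\<close>)

lemma inner_mk: "sqi f ==> sqi g ==> mk f \<bullet> mk g = (LBINT x. f x * g x)"
 by (rule l2_inner_eq) (auto intro: fn_mk)

lemma norm_l2_sq: "(norm F)\<^sup>2 = (LBINT x. (fn F x)\<^sup>2)" for F :: "'a::euclidean_space l2"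
 unfolding power2_norm_eq_inner inner_l2_def by (simp add: power2_eq_square)

lemma norm_mk_sq: "sqi f ==> (norm (mk f))\<^sup>2 = (LBINT x. (f x)\<^sup>2)"
 unfolding power2_norm_eq_inner by (simp add: inner_mk power2_eq_square)

lemma nn_integral_norm_l2_sq: "(\<integral>\<^sup>+x. ennreal ((fn F x)\<^sup>2)) = ennreal ((norm F)\<^sup>2)"
 unfolding norm_l2_sq by (rule nn_integral_eq_integral) (use sqi_fn[of F] in \<open>auto simp: sqi_def\<close>)

lemma l2_norm_mono:
 assumes "AE x. \<bar>fn F x\<bar> <= \<bar>fn G x\<bar>" shows "norm F <= norm G"
proof -
 have "(norm F)\<^sup>2 <= (norm G)\<^sup>2"
  unfolding norm_l2_sq
 proof (rule integral_mono_AE)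
  show "AE x. (fn F x)\<^sup>2 <= (fn G x)\<^sup>2"
   using assms by eventually_elim (simp add: abs_le_square_iff)
 qed (use sqi_fn[of F] sqi_fn[of G] in \<open>auto simp: sqi_def\<close>)
 then show ?thesis by (simp add: abs_le_square_iff)
qed

lemma sqiI_nn_integral:
 assumes [measurable]: "f \<in> Borel"
  and "(\<integral>\<^sup>+x. ennreal ((f x)\<^sup>2)) < \<infinity>"
 shows "sqi f"
 using assms unfolding sqi_def by (auto intro!: integrableI_nonneg)

text \<open>Riesz-Fischer: a fast Cauchy subsequence converges almost everywhere, and Fatou's lemma
  turns the pointwise limit into a norm limit of the whole sequence.\<close>

instance l2 :: (euclidean_space) complete_space
proof
 fix X :: "nat => 'a l2" assume X: "Cauchy X"
 have "EX r. strict_mono r & (ALL n. norm (X (r (Suc n)) - X (r n)) < (1/2) ^ n)"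
 proof -
  have "EX N. ALL m>=N. ALL n>=N. norm (X m - X n) < (1/2) ^ k" for k
   using X[unfolded Cauchy_def, rule_format, of "(1/2)^k"] by (simp add: dist_norm)
  then obtain N where N: "!!k m n. m >= N k ==> n >= N k ==> norm (X m - X n) < (1/2) ^ k"
   by metis
  define r where "r = rec_nat (N 0) (%k a. max (Suc a) (N (Suc k)))"
  have r: "r 0 = N 0" "r (Suc k) = max (Suc (r k)) (N (Suc k))" for k by (simp_all add: r_def)
  have "r k >= N k" for k by (cases k) (auto simp: r)
  moreover have "r (Suc k) >= r k" for k by (simp add: r)
  moreover have "strict_mono r" by (simp add: strict_mono_Suc_iff r less_max_iff_disj)
  ultimately show ?thesis by (intro exI[of _ r]) (meson N order_trans)
 qed
 then obtain r where r: "strict_mono r" and rn: "!!n. norm (X (r (Suc n)) - X (r n)) < (1/2) ^ n"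
  by auto
 define D where "D n = X (r (Suc n)) - X (r n)" for n
 have "(\<integral>\<^sup>+x. (\<Sum>n. ennreal (2 ^ n * (fn (D n) x)\<^sup>2)))
   = (\<Sum>n. \<integral>\<^sup>+x. ennreal (2 ^ n * (fn (D n) x)\<^sup>2))"
  by (rule nn_integral_suminf) simp
 also have "... = (\<Sum>n. ennreal (2 ^ n * (norm (D n))\<^sup>2))"
  by (simp add: ennreal_mult nn_integral_cmult nn_integral_norm_l2_sq)
 also have "... <= (\<Sum>n. ennreal ((1/2) ^ n))"
 proof (rule suminf_le)
  fix n
  have "(norm (D n))\<^sup>2 <= ((1/2) ^ n)\<^sup>2" using rn[of n] by (intro power_mono) (auto simp: D_def)
  then have "2 ^ n * (norm (D n))\<^sup>2 <= 2 ^ n * ((1/2) ^ n)\<^sup>2" by simp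
  also have "... = (1/2) ^ n" by (simp add: power_divide power2_eq_square)
  finally show "ennreal (2 ^ n * (norm (D n))\<^sup>2) <= ennreal ((1/2) ^ n)" by (rule ennreal_leI)
 qed auto
 also have "... = ennreal (\<Sum>n. (1/2) ^ n)"
  by (rule suminf_ennreal2) (auto intro: summable_geometric)
 also have "... < \<infinity>" by simp
 finally have "(\<integral>\<^sup>+x. (\<Sum>n. ennreal (2 ^ n * (fn (D n) x)\<^sup>2))) ~= \<infinity>" by simp
 then have "AE x. (\<Sum>n. ennreal (2 ^ n * (fn (D n) x)\<^sup>2)) ~= \<infinity>"
  by (rule nn_integral_noteq_infinite[rotated]) simp
 moreover have "AE x. ALL n. fn (D n) x = fn (X (r (Suc n))) x - fn (X (r n)) x"
  unfolding D_def AE_all_countable by (intro allI fn_diff)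
 ultimately have conv: "AE x. convergent (%n. fn (X (r n)) x)"
 proof eventually_elim
  fix x assume *: "(\<Sum>n. ennreal (2 ^ n * (fn (D n) x)\<^sup>2)) ~= \<infinity>"
   and d: "ALL n. fn (D n) x = fn (X (r (Suc n))) x - fn (X (r n)) x"
  have "summable (%n. 2 ^ n * (fn (D n) x)\<^sup>2)"
   using * by (intro summable_suminf_not_top) auto
  then have "summable (%n. (1/2) ^ n + 2 ^ n * (fn (D n) x)\<^sup>2)" by (intro summable_add summable_geometric) auto
  \<comment> \<open>The weight \<open>2 ^ n\<close> was put into the series for this inequality
    between a number and its square: finiteness of the weighted sum of squares then gives absolute
    summability of the increments.\<close>
  moreover have "norm (fn (D n) x) <= (1/2) ^ n + 2 ^ n * (fn (D n) x)\<^sup>2" for n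
  proof -
   let ?a = "\<bar>fn (D n) x\<bar>" and ?b = "2 ^ n :: real"
   have "0 <= (?b * ?a - 1)\<^sup>2 + ?b * ?a" by simp
   then have "?b * ?a <= ?b * ((1/2) ^ n + ?b * (fn (D n) x)\<^sup>2)"
    by (simp add: power2_diff power_mult_distrib power2_eq_square[of ?b] power_divide distrib_left mult_ac)
   then show ?thesis by simp
  qed
  ultimately have "summable (%n. fn (D n) x)" by (rule summable_comparison_test'[where N = 0])
  then have "summable (%n. fn (X (r (Suc n))) x - fn (X (r n)) x)" by (simp add: d)
  then have "convergent (%n. \<Sum>k<n. fn (X (r (Suc k))) x - fn (X (r k)) x)"
   by (simp add: summable_iff_convergent)
  then have "convergent (%n. fn (X (r n)) x - fn (X (r 0)) x)"
   using sum_lessThan_telescope[of "%n. fn (X (r n)) x"] by simp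
  then show "convergent (%n. fn (X (r n)) x)"
   using convergent_add[of "%n. fn (X (r n)) x - fn (X (r 0)) x" "%n. fn (X (r 0)) x"]
   by (simp add: convergent_const)
 qed
 define f where "f x = lim (%n. fn (X (r n)) x)" for x
 have [measurable]: "f \<in> Borel" unfolding f_def by measurable
 have bound: "(\<integral>\<^sup>+x. ennreal ((fn (X m) x - f x)\<^sup>2)) <= ennreal (e\<^sup>2)"
  if "!!n. n >= N ==> norm (X m - X (r n)) <= e" for m e N
 proof -
  have e: "e >= 0" using that[of N] norm_ge_zero order_trans by blast
  have "(\<integral>\<^sup>+x. ennreal ((fn (X m) x - f x)\<^sup>2))
    = (\<integral>\<^sup>+x. liminf (%n. ennreal ((fn (X m) x - fn (X (r n)) x)\<^sup>2)))"
  proof (rule nn_integral_cong_AE, use conv in eventually_elim)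
   fix x assume "convergent (%n. fn (X (r n)) x)"
   then have "(%n. fn (X (r n)) x) \<longlonglongrightarrow> f x" by (simp add: f_def convergent_LIMSEQ_iff)
   then have "(%n. ennreal ((fn (X m) x - fn (X (r n)) x)\<^sup>2)) \<longlonglongrightarrow> ennreal ((fn (X m) x - f x)\<^sup>2)"
    by (intro tendsto_intros)
   then show "ennreal ((fn (X m) x - f x)\<^sup>2) = liminf (%n. ennreal ((fn (X m) x - fn (X (r n)) x)\<^sup>2))"
    by (rule lim_imp_Liminf[OF trivial_limit_sequentially, symmetric])
  qed
  also have "... <= liminf (%n. \<integral>\<^sup>+x. ennreal ((fn (X m) x - fn (X (r n)) x)\<^sup>2))"
   by (rule nn_integral_liminf) simp
  also have "... = liminf (%n. ennreal ((norm (X m - X (r n)))\<^sup>2))"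
  proof -
   have "(\<integral>\<^sup>+x. ennreal ((fn (X m) x - fn (X (r n)) x)\<^sup>2)) = ennreal ((norm (X m - X (r n)))\<^sup>2)" for n
    unfolding nn_integral_norm_l2_sq[symmetric]
    by (rule nn_integral_cong_AE) (use fn_diff[of "X m" "X (r n)"] in eventually_elim, simp)
   then show ?thesis by simp
  qed
  also have "... <= ennreal (e\<^sup>2)"
   by (rule Liminf_le) (auto intro!: eventually_sequentiallyI[of N] ennreal_leI power_mono that)
  finally show ?thesis .
 qed
 have ev: "EX N. ALL m>=N. ALL n>=N. norm (X m - X (r n)) <= e" if "e > 0" for e
 proof -
  have "EX N. ALL m>=N. ALL n>=N. norm (X m - X n) < e"
   using X that by (simp add: Cauchy_def dist_norm)
  then obtain N where "!!m n. m >= N ==> n >= N ==> norm (X m - X n) < e"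
   by blast
  then show ?thesis using seq_suble[OF r] by (intro exI[of _ N]) (meson less_imp_le order_trans)
 qed
 obtain N where "ALL m>=N. ALL n>=N. norm (X m - X (r n)) <= 1" using ev[of 1] by auto
 then have "(\<integral>\<^sup>+x. ennreal ((fn (X N) x - f x)\<^sup>2)) <= ennreal (1\<^sup>2)"
  by (intro bound[of N]) auto
 then have "sqi (%x. fn (X N) x - f x)" by (intro sqiI_nn_integral) (auto simp: le_less_trans)
 from sqi_diff[OF sqi_fn[of "X N"] this] have f: "sqi f" by simp
 have "X \<longlonglongrightarrow> mk f"
 proof (rule LIMSEQ_I)
  fix e :: real assume e: "0 < e"
  obtain N where N: "ALL m>=N. ALL n>=N. norm (X m - X (r n)) <= e / 2" using ev[of "e/2"] e by auto
  have "norm (X m - mk f) < e" if "m >= N" for m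
  proof -
   have "ennreal ((norm (X m - mk f))\<^sup>2) = (\<integral>\<^sup>+x. ennreal ((fn (X m) x - f x)\<^sup>2))"
    unfolding nn_integral_norm_l2_sq[symmetric]
    by (rule nn_integral_cong_AE) (use fn_diff[of "X m" "mk f"] fn_mk[OF f] in eventually_elim, simp)
   also have "... <= ennreal ((e / 2)\<^sup>2)" by (rule bound[of N]) (use N that in auto)
   finally have "norm (X m - mk f) <= e / 2"
    using e by (simp add: abs_le_square_iff[symmetric])
   then show ?thesis using e by simp
  qed
  then show "EX N. ALL m>=N. norm (X m - mk f) < e" by auto
 qed
 then show "convergent X" by (auto simp: convergent_def)
qed

instance l2 :: (euclidean_space) banach ..

subsection \<open>Order structure\<close>

lemma sqi_pos_part:
 assumes "sqi f" "0 <= c" shows "sqi (%x. max 0 (f x - c))"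
proof (rule sqi_dominated[OF assms(1)])
 note [measurable] = sqi_measurable[OF assms(1)]
 show "(%x. max 0 (f x - c)) \<in> Borel" by simp
 have "\<bar>max 0 (f x - c)\<bar> <= \<bar>f x\<bar>" for x using assms(2) by (auto simp: max_def)
 then show "AE x. \<bar>max 0 (f x - c)\<bar> <= \<bar>f x\<bar>" by simp
qed

text \<open>For \<open>0 \<le> c\<close> the truncation is dominated by the modulus of
  \<open>F\<close> and hence square integrable, although \<open>F - c\<close> in general is
  not.\<close>

definition ppart :: "real => 'a::euclidean_space l2 => 'a l2" where
 "ppart c F = mk (%x. max 0 (fn F x - c))"

lemma fn_ppart: "0 <= c ==> AE x. fn (ppart c F) x = max 0 (fn F x - c)"
 unfolding ppart_def by (intro fn_mk sqi_pos_part) auto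

lemma norm_ppart_diff:
 assumes "0 <= c" shows "norm (ppart c F - ppart c G) <= norm (F - G)"
proof (rule l2_norm_mono)
 show "AE x. \<bar>fn (ppart c F - ppart c G) x\<bar> <= \<bar>fn (F - G) x\<bar>"
  using fn_diff[of F G] fn_diff[of "ppart c F" "ppart c G"] fn_ppart[OF assms, of F] fn_ppart[OF assms, of G]
  by eventually_elim (auto simp: max_def)
qed

lemma ppart_eq_0_iff:
 assumes "0 <= c" shows "ppart c F = 0 \<longleftrightarrow> (AE x. fn F x <= c)"
proof
 assume "ppart c F = 0"
 with fn_ppart[OF assms, of F] fn_zero have "AE x. max 0 (fn F x - c) = 0"
  by (auto elim: eventually_elim2)
 then show "AE x. fn F x <= c" by eventually_elim (auto simp: max_def split: if_splits)
next
 assume "AE x. fn F x <= c"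
 with fn_ppart[OF assms, of F] fn_zero have "AE x. fn (ppart c F) x = fn 0 x"
  by eventually_elim auto
 then show "ppart c F = 0" by (rule l2_eqI)
qed

lemma tendsto_ppart:
 assumes "(X \<longlongrightarrow> F) A" "0 <= c" shows "((%n. ppart c (X n)) \<longlongrightarrow> ppart c F) A"
proof -
 have "((%n. norm (ppart c (X n) - ppart c F)) \<longlongrightarrow> 0) A"
 proof (rule tendsto_0_le[where K = 1])
  show "((%n. norm (X n - F)) \<longlongrightarrow> 0) A" using assms by (simp add: tendsto_norm_zero_iff LIM_zero_iff)
  show "\<forall>\<^sub>F n in A. norm (norm (ppart c (X n) - ppart c F)) <= norm (norm (X n - F)) * 1"
   by (simp add: norm_ppart_diff[OF assms(2)])
 qed
 then show ?thesis by (simp add: tendsto_norm_zero_iff LIM_zero_iff)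
qed

text \<open>The positive part is the gradient of this functional, with a quadratic remainder.\<close>

lemma half_norm_ppart_sq_expansion:
 assumes c: "0 <= c"
 shows "\<bar>(norm (ppart c G))\<^sup>2 / 2 - (norm (ppart c F))\<^sup>2 / 2 - (G - F) \<bullet> ppart c F\<bar> <= (norm (G - F))\<^sup>2 / 2"
proof -
 let ?p = "%s. max 0 (s - c)"
 have pt: "\<bar>(?p a)\<^sup>2 / 2 - (?p b)\<^sup>2 / 2 - (a - b) * ?p b\<bar> <= (a - b)\<^sup>2 / 2" for a b :: real
 proof -
  have "(?p a)\<^sup>2 / 2 - (?p b)\<^sup>2 / 2 - (a - b) * ?p b
    = (if a >= c then (if b >= c then (a - b)\<^sup>2 / 2 else (a - c)\<^sup>2 / 2)
      else if b >= c then - (b - c)\<^sup>2 / 2 - (a - b) * (b - c) else 0)"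
   by (auto simp: power2_eq_square field_simps)
  moreover have "(a - c)\<^sup>2 <= (a - b)\<^sup>2" if "a >= c" "b < c"
   using that by (intro power_mono) auto
  moreover have "- (b - c)\<^sup>2 / 2 - (a - b) * (b - c) = (a - b)\<^sup>2 / 2 - (c - a)\<^sup>2 / 2"
   by (simp add: power2_eq_square field_simps)
  moreover have "(c - a)\<^sup>2 <= (a - b)\<^sup>2" if "a < c" "b >= c"
   using that power_mono[of "c - a" "b - a" 2] by (simp add: power2_commute)
  ultimately show ?thesis by (auto simp: not_le)
 qed
 have [simp]: "integrable lborel (%x. (fn H x)\<^sup>2)" for H :: "'a l2" using sqi_fn[of H] by (simp add: sqi_def)
 have [simp]: "integrable lborel (%x. fn H x * fn K x)" for H K :: "'a l2" by (simp add: sqi_integrable_mult)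
 have "(norm (ppart c G))\<^sup>2 / 2 - (norm (ppart c F))\<^sup>2 / 2 - (G - F) \<bullet> ppart c F
   = (LBINT x. (fn (ppart c G) x)\<^sup>2 / 2 - (fn (ppart c F) x)\<^sup>2 / 2 - fn (G - F) x * fn (ppart c F) x)"
  by (simp add: norm_l2_sq inner_l2_def)
 also have "\<bar>...\<bar> <= (LBINT x. \<bar>(fn (ppart c G) x)\<^sup>2 / 2 - (fn (ppart c F) x)\<^sup>2 / 2 - fn (G - F) x * fn (ppart c F) x\<bar>)"
  by (rule integral_abs_bound)
 also have "... <= (LBINT x. (fn (G - F) x)\<^sup>2 / 2)"
 proof (rule integral_mono_AE)
  show "AE x. \<bar>(fn (ppart c G) x)\<^sup>2 / 2 - (fn (ppart c F) x)\<^sup>2 / 2 - fn (G - F) x * fn (ppart c F) x\<bar>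
    <= (fn (G - F) x)\<^sup>2 / 2"
   using fn_diff[of G F] fn_ppart[OF c, of F] fn_ppart[OF c, of G]
  proof eventually_elim
   case (elim x)
   show ?case unfolding elim by (rule pt)
  qed
 qed auto
 finally show ?thesis by (simp add: norm_l2_sq)
qed

lemma has_derivative_half_norm_ppart_sq:
 assumes "0 <= c"
 shows "((%F. (norm (ppart c F))\<^sup>2 / 2) has_derivative (%H. H \<bullet> ppart c F)) (at F)"
proof (rule has_derivativeI_sandwich[where e = 1])
 show "bounded_linear (%H. H \<bullet> ppart c F)" by (rule bounded_linear_inner_left)
 show "((%G. norm (G - F) / 2) \<longlongrightarrow> 0) (at F)"
  by (auto intro!: tendsto_eq_intros)
 fix G assume "G \<in> UNIV" "G ~= F" "dist G F < 1"
 show "norm ((norm (ppart c G))\<^sup>2 / 2 - (norm (ppart c F))\<^sup>2 / 2 - (G - F) \<bullet> ppart c F) / norm (G - F)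
   <= norm (G - F) / 2"
  using half_norm_ppart_sq_expansion[OF assms, of G F] \<open>G ~= F\<close>
  by (simp add: divide_le_eq power2_eq_square)
qed simp

section \<open>Strongly continuous semigroups\<close>

text \<open>Baire category: one of the closed sets on which all \<open>A n\<close> are bounded by
  \<open>k\<close> contains a ball, and linearity spreads the bound to the whole space. Sequences
  suffice, since a family without a common bound contains such a sequence.\<close>

lemma uniform_boundedness:
 fixes A :: "nat => 'h::banach => 'k::real_normed_vector"
 assumes lin: "!!n. bounded_linear (A n)" and bd: "!!x. bounded (range (%n. A n x))"
 shows "EX M. ALL n x. norm (A n x) <= M * norm x"
proof -
 define C where "C k = {x. ALL n. norm (A n x) <= real k}" for k :: nat
 have clC: "closed (C k)" for k
 proof -
  have "continuous_on UNIV (A n)" for n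
   using lin linear_continuous_on by blast
  then have "closed {x. norm (A n x) <= real k}" for n
   by (intro closed_Collect_le continuous_intros) auto
  moreover have "C k = (\<Inter>n. {x. norm (A n x) <= real k})" by (auto simp: C_def)
  ultimately show ?thesis by auto
 qed
 have "\<Union>(range C) = UNIV"
 proof -
  have "EX k. x \<in> C k" for x
  proof -
   obtain B where B: "!!n. norm (A n x) <= B" using bd[of x] by (auto simp: bounded_iff)
   obtain k :: nat where "B <= real k" using real_arch_simple by blast
   then have "norm (A n x) <= real k" for n using B[of n] by linarith
   then show ?thesis by (auto simp: C_def)
  qed
  then show ?thesis by blast
 qed
 moreover have "interior (\<Union>(range C)) = {}" if "!!k. interior (C k) = {}"
 proof -
  have "Met_TC.mtopology interior_of \<Union>(range C) = {}"
  proof (rule Met_TC.metric_Baire_category_alt)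
   show "Met_TC.mcomplete TYPE('h)"
    unfolding Met_TC.mcomplete_def by (auto simp: convergent_eq_Cauchy[symmetric])
   show "countable (range C)" by simp
   show "closedin Met_TC.mtopology T & Met_TC.mtopology interior_of T = {}" if "T \<in> range C" for T
    using that clC \<open>!!k. interior (C k) = {}\<close> by auto
  qed
  then show ?thesis by simp
 qed
 ultimately obtain k where "interior (C k) ~= {}" by auto
 then obtain x e where e: "e > 0" "ball x e \<subseteq> C k" by (auto simp: mem_interior)
 \<comment> \<open>The vector \<open>c *\<^sub>R y\<close> has norm \<open>e / 2\<close>, so
   \<open>x\<close> and \<open>x + c *\<^sub>R y\<close> both lie in the ball; the difference of
   their images produces the factor 4.\<close>
 have "norm (A n y) <= (4 * real k / e) * norm y" for n y
 proof (cases "y = 0")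
  case True then show ?thesis using linear_simps(3)[OF lin[of n]] by simp
 next
  case False
  define c where "c = e / (2 * norm y)"
  have c: "c > 0" using e False by (simp add: c_def)
  have "x + c *\<^sub>R y \<in> ball x e" using e False by (simp add: dist_norm c_def)
  then have "norm (A n (x + c *\<^sub>R y)) <= k" using e by (auto simp: C_def)
  moreover have "norm (A n x) <= k" using e(2) centre_in_ball[of x e] e(1) unfolding C_def by blast
  moreover have "A n (x + c *\<^sub>R y) = A n x + c *\<^sub>R A n y"
   using linear_simps(1,5)[OF lin[of n]] by simp
  ultimately have "norm (c *\<^sub>R A n y) <= 2 * k"
   using norm_triangle_ineq4[of "A n x + c *\<^sub>R A n y" "A n x"] by simp
  then have "c * norm (A n y) <= 2 * k" using c by simp
  then show ?thesis using e False by (simp add: c_def field_simps)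
 qed
 then show ?thesis by blast
qed

lemma has_vector_derivative_right_quotient:
 assumes "(f has_vector_derivative D) (at t within {t..b})" "t < b"
 shows "((%h. (f (t + h) - f t) /\<^sub>R h) \<longlongrightarrow> D) (at_right (0::real))"
proof (rule tendstoI)
 fix e :: real assume e: "e > 0"
 from assms(1) obtain d where d: "d > 0"
  "!!y. y \<in> {t..b} ==> norm (y - t) < d ==> norm (f y - f t - (y - t) *\<^sub>R D) <= e / 2 * norm (y - t)"
  unfolding has_vector_derivative_def has_derivative_within_alt using e
  by (metis half_gt_zero)
 have "dist ((f (t + h) - f t) /\<^sub>R h) D < e" if h: "0 < h" "h < min d (b - t)" for h
 proof -
  have "norm (f (t + h) - f t - h *\<^sub>R D) <= e / 2 * h" using d(2)[of "t + h"] h by simp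
  moreover have "(f (t + h) - f t) /\<^sub>R h - D = (f (t + h) - f t - h *\<^sub>R D) /\<^sub>R h"
   using h by (simp add: scaleR_diff_right)
  ultimately have "norm ((f (t + h) - f t) /\<^sub>R h - D) <= e / 2"
   using h by (simp add: inverse_eq_divide divide_le_eq mult.commute)
  then show ?thesis using e by (simp add: dist_norm)
 qed
 then show "\<forall>\<^sub>F h in at_right 0. dist ((f (t + h) - f t) /\<^sub>R h) D < e"
  using d(1) assms(2) by (auto simp: eventually_at_right_field intro!: exI[of _ "min d (b - t)"])
qed

lemma has_vector_derivative_quotientI:
 fixes t :: real
 assumes "((%s. (f s - f t) /\<^sub>R (s - t)) \<longlongrightarrow> D) (at t)"
 shows "(f has_vector_derivative D) (at t)"
proof -
 have "((%s. norm ((f s - f t) /\<^sub>R (s - t) - D)) \<longlongrightarrow> 0) (at t)"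
  using assms by (simp add: tendsto_norm_zero_iff LIM_zero_iff)
 moreover have "\<forall>\<^sub>F s in at t. norm ((f s - f t) /\<^sub>R (s - t) - D) = norm ((1 / norm (s - t)) *\<^sub>R (f s - (f t + (s - t) *\<^sub>R D)))"
  unfolding eventually_at_filter
 proof (intro always_eventually allI impI)
  fix s assume "s ~= t"
  then have "(f s - f t) /\<^sub>R (s - t) - D = (f s - (f t + (s - t) *\<^sub>R D)) /\<^sub>R (s - t)"
   by (simp add: scaleR_diff_right scaleR_add_right)
  then show "norm ((f s - f t) /\<^sub>R (s - t) - D) = norm ((1 / norm (s - t)) *\<^sub>R (f s - (f t + (s - t) *\<^sub>R D)))"
   by (simp add: divide_inverse)
 qed
 ultimately have "((%s. norm ((1 / norm (s - t)) *\<^sub>R (f s - (f t + (s - t) *\<^sub>R D)))) \<longlongrightarrow> 0) (at t)"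
  by (rule Lim_transform_eventually)
 then have "((%s. (1 / norm (s - t)) *\<^sub>R (f s - (f t + (s - t) *\<^sub>R D))) \<longlongrightarrow> 0) (at t)"
  by (rule tendsto_norm_zero_cancel)
 then show ?thesis
  unfolding has_vector_derivative_def has_derivative_within
  by (simp add: bounded_linear_scaleR_left)
qed

locale c0_semigroup =
 fixes T :: "real => 'h::banach => 'h"
 assumes lin: "0 <= t ==> bounded_linear (T t)"
  and zero: "T 0 x = x"
  and add: "0 <= s ==> 0 <= t ==> T (s + t) x = T s (T t x)"
  and continuous_zero: "((%t. T t x) \<longlongrightarrow> x) (at_right 0)"
begin

lemma apply_simps:
 assumes "0 <= t"
 shows "T t (x + y) = T t x + T t y" "T t (x - y) = T t x - T t y" "T t (c *\<^sub>R x) = c *\<^sub>R T t x" "T t 0 = 0"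
 using lin[OF assms] by (simp_all add: linear_simps)

lemma continuous_zero': "((%t. T t x) \<longlongrightarrow> x) (at 0 within {0..})"
proof -
 show ?thesis using continuous_zero by (simp add: at_within_Ici_at_right)
qed

text \<open>Continuity at 0 is assumed orbit by orbit. Without a common bound near 0 there would be
  times tending to 0 with operators of unbounded norm, against
  \<open>uniform_boundedness\<close>.\<close>

lemma locally_bounded_zero:
 "EX d>0. EX M. ALL t:{0..d}. ALL x. norm (T t x) <= M * norm x"
proof (rule ccontr)
 assume contr: "~ ?thesis"
 have "EX t x. 0 <= t & t <= 1 / (Suc n) & ~ norm (T t x) <= real n * norm x" for n
  using contr[simplified, rule_format, of "1 / Suc n" "real n"] by (auto simp: field_simps)
 then obtain \<tau> \<xi> where *: "!!n. 0 <= \<tau> n" "!!n. \<tau> n <= 1 / (Suc n)"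
   "!!n. ~ norm (T (\<tau> n) (\<xi> n)) <= real n * norm (\<xi> n)" by metis
 have "EX M. ALL n x. norm (T (\<tau> n) x) <= M * norm x"
 proof (rule uniform_boundedness)
  show "bounded_linear (T (\<tau> n))" for n by (rule lin) (rule *)
  fix x
  have "\<tau> \<longlonglongrightarrow> 0"
  proof (rule tendsto_sandwich[of "%n. 0"])
   show "(%n. 1 / (real (Suc n))) \<longlonglongrightarrow> 0" by (rule LIMSEQ_Suc[OF lim_1_over_n])
  qed (use * in \<open>auto simp del: of_nat_Suc\<close>)
  moreover have "continuous (at 0 within {0..}) (%t. T t x)"
   using continuous_zero' by (simp add: continuous_within zero)
  ultimately have "(%n. T (\<tau> n) x) \<longlonglongrightarrow> T 0 x"
   using *(1) by (simp add: continuous_within_sequentially comp_def)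
  then show "bounded (range (%n. T (\<tau> n) x))" by (rule convergent_imp_bounded)
 qed
 then obtain M where M: "!!n x. norm (T (\<tau> n) x) <= M * norm x" by blast
 obtain n :: nat where "M <= real n" using real_arch_simple by blast
 then have "M * norm (\<xi> n) <= real n * norm (\<xi> n)" by (simp add: mult_right_mono)
 with M[of n "\<xi> n"] *(3)[of n] show False by linarith
qed

lemma locally_bounded: "EX M>0. ALL t:{0..a}. ALL x. norm (T t x) <= M * norm x"
proof -
 obtain d M0 where d: "d > 0" and M0: "!!t x. 0 <= t ==> t <= d ==> norm (T t x) <= M0 * norm x"
  using locally_bounded_zero by (metis atLeastAtMost_iff)
 define M1 where "M1 = max 1 M0"
 have M1: "norm (T t x) <= M1 * norm x" if "0 <= t" "t <= d" for t x
  using M0[OF that, of x] mult_right_mono[of M0 M1 "norm x"] by (simp add: M1_def)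
 have "EX M>0. ALL t:{0..real n * d}. ALL x. norm (T t x) <= M * norm x" for n
 proof (induction n)
  case 0 then show ?case by (intro exI[of _ 1]) (auto simp: zero)
 next
  case (Suc n)
  then obtain M where M: "M > 0" "!!t x. 0 <= t ==> t <= real n * d ==> norm (T t x) <= M * norm x" by auto
  have "norm (T t x) <= M1 * M * norm x" if t: "0 <= t" "t <= real (Suc n) * d" for t x
  proof (cases "t <= real n * d")
   case True
   have "norm (T t x) <= M * norm x" using M(2) True t by auto
   also have "... <= M1 * (M * norm x)" using M(1) mult_right_mono[of 1 M1 "M * norm x"] by (simp add: M1_def)
   finally show ?thesis by (simp add: mult.assoc)
  next
   case False
   have "T t x = T (t - real n * d) (T (real n * d) x)"
    using add[of "t - real n * d" "real n * d" x] False d by simp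
   also have "norm ... <= M1 * norm (T (real n * d) x)" using False t by (intro M1) (auto simp: algebra_simps)
   also have "... <= M1 * (M * norm x)" using M d by (intro mult_left_mono) (auto simp: M1_def)
   finally show ?thesis by (simp add: mult.assoc)
  qed
  then show ?case using M(1) by (intro exI[of _ "M1 * M"]) (auto simp: M1_def)
 qed
 moreover obtain n :: nat where "a / d <= real n" using real_arch_simple by blast
 then have "a <= real n * d" using d by (simp add: field_simps)
 ultimately show ?thesis by (meson atLeastAtMost_iff order_trans)
qed

lemma diff_le:
 assumes "!!t x. t \<in> {0..a} ==> norm (T t x) <= M * norm x" "s \<in> {0..a}" "t \<in> {0..a}"
 shows "norm (T t x - T s x) <= M * norm (T \<bar>t - s\<bar> x - x)"
proof (cases "s <= t")
 case True
 then have "T t x - T s x = T s (T \<bar>t - s\<bar> x - x)"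
  using add[of s "t - s" x] assms by (simp add: apply_simps)
 then show ?thesis using assms by simp
next
 case False
 then have "T s x - T t x = T t (T \<bar>t - s\<bar> x - x)"
  using add[of t "s - t" x] assms by (simp add: apply_simps)
 then show ?thesis using assms by (metis norm_minus_commute)
qed

lemma continuous: "continuous_on {0..} (%t. T t x)"
 unfolding continuous_on_def
proof
 fix s :: real assume s: "s \<in> {0..}"
 obtain M where M: "M > 0" "!!t x. t \<in> {0..s+1} ==> norm (T t x) <= M * norm x"
  using locally_bounded[of "s + 1"] by auto
 have "filterlim (%t. \<bar>t - s\<bar>) (at_right 0) (at s within {0..})"
  unfolding filterlim_at by (auto intro!: tendsto_eq_intros simp: eventually_at_filter)
 then have "((%t. T \<bar>t - s\<bar> x) \<longlongrightarrow> x) (at s within {0..})"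
  by (rule filterlim_compose[OF continuous_zero])
 then have "((%t. M * norm (T \<bar>t - s\<bar> x - x)) \<longlongrightarrow> M * norm (x - x)) (at s within {0..})"
  by (intro tendsto_intros)
 then have lim: "((%t. M * norm (T \<bar>t - s\<bar> x - x)) \<longlongrightarrow> 0) (at s within {0..})" by simp
 have "((%t. T t x - T s x) \<longlongrightarrow> 0) (at s within {0..})"
 proof (rule Lim_null_comparison[OF _ lim])
  have "\<forall>\<^sub>F t in at s within {0..}. t < s + 1"
   using order_tendstoD(2)[OF tendsto_ident_at, of s "s+1"] by auto
  moreover have "\<forall>\<^sub>F t in at s within {0..}. t \<in> {0..}" by (simp add: eventually_at_topological, blast)
  ultimately show "\<forall>\<^sub>F t in at s within {0..}. norm (T t x - T s x) <= M * norm (T \<bar>t - s\<bar> x - x)"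
   by eventually_elim (use s in \<open>auto intro!: diff_le[OF M(2)]\<close>)
 qed
 then show "((%t. T t x) \<longlongrightarrow> T s x) (at s within {0..})" by (simp add: LIM_zero_iff)
qed

lemma continuous_within: "0 <= s ==> ((%t. T t x) \<longlongrightarrow> T s x) (at s within {0..})"
 using continuous unfolding continuous_on_def by auto

text \<open>A relation instead of a partial operator: it expresses membership of \<open>x\<close> in
  the domain of the generator together with the value there.\<close>

definition gen :: "'h => 'h => bool" where
 "gen x y \<longleftrightarrow> ((%h. (T h x - x) /\<^sub>R h) \<longlongrightarrow> y) (at_right 0)"

lemma gen_invariant:
 assumes "gen x y" "0 <= t" shows "gen (T t x) (T t y)"
proof -
 have "((%h. T t ((T h x - x) /\<^sub>R h)) \<longlongrightarrow> T t y) (at_right 0)"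
  using assms bounded_linear.tendsto[OF lin[OF assms(2)]] by (simp add: gen_def)
 moreover have "\<forall>\<^sub>F h in at_right 0. T t ((T h x - x) /\<^sub>R h) = (T h (T t x) - T t x) /\<^sub>R h"
  unfolding eventually_at_right_field using assms(2) add[of t _ x] add[of _ t x]
  by (intro exI[of _ 1]) (auto simp: apply_simps add.commute)
 ultimately show ?thesis unfolding gen_def by (rule Lim_transform_eventually)
qed

text \<open>The generator is only a right derivative at 0. The quotients on both sides of
  \<open>t\<close> are \<open>T (min s t)\<close> applied to the right quotient of \<open>x\<close>
  at 0, so local boundedness makes the two limits agree.\<close>

lemma gen_has_vector_derivative:
 assumes g: "gen x y" and t: "0 < t"
 shows "((%s. T s x) has_vector_derivative T t y) (at t)"
proof -
 obtain M where M: "M > 0" "!!s x. s \<in> {0..t+1} ==> norm (T s x) <= M * norm x"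
  using locally_bounded[of "t + 1"] by auto
 define q where "q h = (T h x - x) /\<^sub>R h" for h
 have q: "(q \<longlongrightarrow> y) (at_right 0)" using g by (simp add: gen_def q_def[abs_def])
 have "filterlim (%s. \<bar>s - t\<bar>) (at_right 0) (at t)"
  unfolding filterlim_at
  by (auto intro!: tendsto_eq_intros simp: eventually_at_filter)
 then have q': "((%s. q \<bar>s - t\<bar>) \<longlongrightarrow> y) (at t)" by (rule filterlim_compose[OF q])
 have "((%s. T (min s t) y) \<longlongrightarrow> T t y) (at t)"
 proof -
  have "continuous_on {0..} (%s. T (min s t) y)"
   by (rule continuous_on_compose2[OF continuous]) (use t in \<open>auto intro!: continuous_intros\<close>)
  then have "((%s. T (min s t) y) \<longlongrightarrow> T t y) (at t within {0..})"
   using t unfolding continuous_on_def by (metis atLeast_iff less_imp_le min.idem)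
  moreover have "at t within {0..} = at t" using t by (intro at_within_interior) auto
  ultimately show ?thesis by simp
 qed
 then have "((%s. M * norm (q \<bar>s - t\<bar> - y) + norm (T (min s t) y - T t y)) \<longlongrightarrow> M * norm (y - y) + norm (T t y - T t y)) (at t)"
  by (intro tendsto_intros q')
 then have lim: "((%s. M * norm (q \<bar>s - t\<bar> - y) + norm (T (min s t) y - T t y)) \<longlongrightarrow> 0) (at t)" by simp
 have "((%s. (T s x - T t x) /\<^sub>R (s - t) - T t y) \<longlongrightarrow> 0) (at t)"
 proof (rule Lim_null_comparison[OF _ lim])
  have "\<forall>\<^sub>F s in at t. 0 < s" using order_tendstoD(1)[OF tendsto_ident_at t] .
  moreover have "\<forall>\<^sub>F s in at t. s < t + 1" using order_tendstoD(2)[OF tendsto_ident_at, of t "t+1"] by simp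
  moreover have "\<forall>\<^sub>F s in at t. s ~= t" by (simp add: eventually_at_filter)
  ultimately show "\<forall>\<^sub>F s in at t. norm ((T s x - T t x) /\<^sub>R (s - t) - T t y) <= M * norm (q \<bar>s - t\<bar> - y) + norm (T (min s t) y - T t y)"
  proof eventually_elim
   case (elim s)
   have "(T s x - T t x) /\<^sub>R (s - t) = T (min s t) (q \<bar>s - t\<bar>)"
   proof (cases "s < t")
    case True
    have "T t x = T s (T (t - s) x)" using add[of s "t - s" x] True elim by simp
    then have "(T s x - T t x) /\<^sub>R (s - t) = (T s (x - T (t - s) x)) /\<^sub>R (s - t)"
     using elim by (simp add: apply_simps)
    also have "... = T s ((T (t - s) x - x) /\<^sub>R (t - s))"
    proof -
     have "inverse (s - t) = - inverse (t - s)" by (simp add: inverse_minus_eq[symmetric])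
     then show ?thesis using elim by (simp add: apply_simps scaleR_diff_right)
    qed
    finally show ?thesis using True by (simp add: q_def)
   next
    case False
    then have "s > t" using elim by simp
    then show ?thesis using add[of t "s - t" x] t by (simp add: q_def apply_simps)
   qed
   moreover have "T (min s t) (q \<bar>s - t\<bar>) - T t y = T (min s t) (q \<bar>s - t\<bar> - y) + (T (min s t) y - T t y)"
    using elim t by (simp add: apply_simps)
   moreover have "norm (T (min s t) (q \<bar>s - t\<bar> - y)) <= M * norm (q \<bar>s - t\<bar> - y)"
    using elim t by (intro M) auto
   ultimately show ?case by (metis norm_triangle_le add_right_mono)
  qed
 qed
 then have "((%s. (T s x - T t x) /\<^sub>R (s - t)) \<longlongrightarrow> T t y) (at t)" by (simp add: LIM_zero_iff)
 then show ?thesis by (rule has_vector_derivative_quotientI)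
qed

text \<open>The averages \<open>tint h x /\<^sub>R h\<close> lie in the domain of the generator and
  tend to \<open>x\<close>; they carry estimates proved for smooth data over to arbitrary
  data.\<close>

definition tint :: "real => 'h => 'h" where "tint t x = integral {0..t} (%s. T s x)"

lemma integrable [intro, simp]: "0 <= a ==> (%s. T s x) integrable_on {a..b}"
 by (rule integrable_continuous_real) (rule continuous_on_subset[OF continuous], auto)

lemma tint_has_vector_derivative:
 "0 < t ==> ((%t. tint t x) has_vector_derivative T t x) (at t)"
proof -
 assume t: "0 < t"
 have "((%u. integral {0..u} (%s. T s x)) has_vector_derivative T t x) (at t within {0..t+1})"
  using t by (intro integral_has_vector_derivative continuous_on_subset[OF continuous]) auto
 moreover have "at t within {0..t+1} = at t" using t by (intro at_within_interior) auto
 ultimately show ?thesis by (simp add: tint_def)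
qed

lemma tint_right_quotient:
 assumes t: "0 <= t" shows "((%h. (tint (t + h) x - tint t x) /\<^sub>R h) \<longlongrightarrow> T t x) (at_right 0)"
proof (rule has_vector_derivative_right_quotient)
 have "((%u. integral {0..u} (%s. T s x)) has_vector_derivative T t x) (at t within {0..t+1})"
  using t by (intro integral_has_vector_derivative continuous_on_subset[OF continuous]) auto
 then show "((%t. tint t x) has_vector_derivative T t x) (at t within {t..t+1})"
  unfolding tint_def by (rule has_vector_derivative_within_subset) (use t in auto)
qed simp

lemma continuous_tint: "continuous_on {0..b} (%t. tint t x)"
 unfolding tint_def by (rule indefinite_integral_continuous_1) simp

lemma tint_average: "((%h. tint h x /\<^sub>R h) \<longlongrightarrow> x) (at_right 0)"
 using tint_right_quotient[of 0 x] by (simp add: tint_def zero)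

lemma apply_tint:
 assumes "0 <= h" "0 <= t" shows "T h (tint t x) = tint (t + h) x - tint h x"
proof -
 have "T h (tint t x) = integral {0..t} (%s. T h (T s x))"
  unfolding tint_def using integral_linear[of "%s. T s x" "{0..t}", OF _ lin[OF assms(1)]]
  by (simp add: comp_def)
 also have "... = integral {0..t} (%s. T (s + h) x)"
  by (rule integral_cong) (use assms add[of h _ x] in \<open>simp add: add.commute\<close>)
 also have "... = integral {h..t + h} (%s. T s x)"
  using integral_shift_Icc_real[of 0 t "%s. T s x" h] by (simp add: comp_def add.commute)
 also have "... = tint (t + h) x - tint h x"
  using Henstock_Kurzweil_Integration.integral_combine[of 0 h "t + h" "%s. T s x"] assms by (simp add: tint_def algebra_simps)
 finally show ?thesis .
qed

lemma gen_tint: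
 assumes t: "0 <= t" shows "gen (tint t x) (T t x - x)"
proof -
 have "((%h. (tint (t + h) x - tint t x) /\<^sub>R h - tint h x /\<^sub>R h) \<longlongrightarrow> T t x - x) (at_right 0)"
  by (intro tendsto_intros tint_right_quotient tint_average t)
 moreover have "\<forall>\<^sub>F h in at_right 0. (tint (t + h) x - tint t x) /\<^sub>R h - tint h x /\<^sub>R h = (T h (tint t x) - tint t x) /\<^sub>R h"
  unfolding eventually_at_right_field using t
  by (intro exI[of _ 1]) (auto simp: apply_tint scaleR_diff_right)
 ultimately show ?thesis unfolding gen_def by (rule Lim_transform_eventually)
qed

lemma gen_scale: "gen x y ==> gen (c *\<^sub>R x) (c *\<^sub>R y)"
 unfolding gen_def
proof -
 assume "((%h. (T h x - x) /\<^sub>R h) \<longlongrightarrow> y) (at_right 0)"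
 then have "((%h. c *\<^sub>R ((T h x - x) /\<^sub>R h)) \<longlongrightarrow> c *\<^sub>R y) (at_right 0)" by (intro tendsto_intros)
 moreover have "\<forall>\<^sub>F h in at_right 0. c *\<^sub>R ((T h x - x) /\<^sub>R h) = (T h (c *\<^sub>R x) - c *\<^sub>R x) /\<^sub>R h"
  unfolding eventually_at_right_field
  by (intro exI[of _ 1]) (auto simp: apply_simps scaleR_diff_right mult.commute)
 ultimately show "((%h. (T h (c *\<^sub>R x) - c *\<^sub>R x) /\<^sub>R h) \<longlongrightarrow> c *\<^sub>R y) (at_right 0)" by (rule Lim_transform_eventually)
qed

end

section \<open>The Gaussian heat kernel\<close>

lemma nn_integral_lborel_affine:
 fixes f :: "'a::euclidean_space => ennreal"
 assumes [measurable]: "f \<in> Borel" and c: "c ~= 0"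
 shows "(\<integral>\<^sup>+x. f x) = ennreal (\<bar>c\<bar> ^ DIM('a)) * (\<integral>\<^sup>+x. f (t + c *\<^sub>R x))"
 by (subst lborel_affine[OF c, of t])
   (simp add: nn_integral_density nn_integral_distr nn_integral_cmult)

lemma integrable_lborel_affine_iff:
 fixes f :: "'a::euclidean_space => real"
 assumes [measurable]: "f \<in> Borel" and c: "c ~= 0"
 shows "integrable lborel (%x. f (t + c *\<^sub>R x)) \<longleftrightarrow> integrable lborel f"
 using nn_integral_lborel_affine[of "%x. ennreal (norm (f x))" c t] c
 by (auto simp: integrable_iff_bounded ennreal_mult_less_top less_top[symmetric] ennreal_mult_eq_top_iff)

lemma integral_lborel_affine:
 fixes f :: "'a::euclidean_space => real"
 assumes [measurable]: "f \<in> Borel" and c: "c ~= 0"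
 shows "(LBINT x. f x) = \<bar>c\<bar> ^ DIM('a) * (LBINT x. f (t + c *\<^sub>R x))"
 by (subst lborel_affine[OF c, of t]) (simp add: integral_density integral_distr)

lemma nn_integral_lborel_diff:
 fixes f :: "'a::euclidean_space => ennreal"
 assumes [measurable]: "f \<in> Borel"
 shows "(\<integral>\<^sup>+y. f (x - y)) = (\<integral>\<^sup>+y. f y)" "(\<integral>\<^sup>+y. f (y - x)) = (\<integral>\<^sup>+y. f y)"
 using nn_integral_lborel_affine[of f "-1" x] nn_integral_lborel_affine[of f 1 "-x"] by simp_all

lemma integral_lborel_diff:
 fixes f :: "'a::euclidean_space => real"
 assumes [measurable]: "f \<in> Borel"
 shows "(LBINT y. f (x - y)) = (LBINT y. f y)" "(LBINT y. f (y - x)) = (LBINT y. f y)"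
  "(LBINT y. f (y + x)) = (LBINT y. f y)" "(LBINT y. f (- y)) = (LBINT y. f y)"
 using integral_lborel_affine[of f "-1" x] integral_lborel_affine[of f 1 "-x"]
  integral_lborel_affine[of f 1 "x"]  integral_lborel_affine[of f "-1" 0] by (simp_all add: add.commute)

lemma integrable_lborel_diff:
 fixes f :: "'a::euclidean_space => real"
 assumes "integrable lborel f"
 shows "integrable lborel (%y. f (x - y))" "integrable lborel (%y. f (y - x))" "integrable lborel (%y. f (y + x))"
   "integrable lborel (%y. f (- y))"
 using integrable_lborel_affine_iff[of f "-1" x] integrable_lborel_affine_iff[of f 1 "-x"]
  integrable_lborel_affine_iff[of f 1 "x"] integrable_lborel_affine_iff[of f "-1" 0]
  borel_measurable_integrable[OF assms] assms by (simp_all add: add.commute)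

definition heat_mass :: "real => 'a::euclidean_space itself => real" where
 "heat_mass t _ = (4 * pi * t) powr (real DIM('a) / 2)"

definition heat :: "real => 'a::euclidean_space => real" where
 "heat t x = exp (- (norm x)\<^sup>2 / (4 * t)) / heat_mass t TYPE('a)"

lemma heat_mass_scale: "t > 0 ==> heat_mass t TYPE('a::euclidean_space) = t powr (real DIM('a) / 2) * heat_mass 1 TYPE('a)"
 by (simp add: heat_mass_def powr_mult)

lemma heat_mass_pos: "t > 0 ==> heat_mass t TYPE('a::euclidean_space) > 0"
 by (simp add: heat_mass_def)

lemma heat_measurable [measurable]: "heat t \<in> Borel"
 unfolding heat_def[abs_def] by simp

lemma heat_pos: "t > 0 ==> heat t x > 0"
 by (simp add: heat_def heat_mass_pos)

lemma heat_uminus [simp]: "heat t (- x) = heat t x"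
 by (simp add: heat_def)

lemma heat_commute: "heat t (x - y) = heat t (y - x)"
 by (simp add: heat_def norm_minus_commute)

text \<open>The coordinates are independent centred normal variables of variance
  \<open>2 * t\<close>; total mass, second moments and the convolution law are thereby reduced to
  one dimension.\<close>

lemma heat_prod: "t > 0 ==> heat t x = (\<Prod>b\<in>Basis. normal_density 0 (sqrt (2 * t)) (x \<bullet> b))"
proof -
 assume t: "t > 0"
 have "(norm x)\<^sup>2 = (\<Sum>b\<in>Basis. (x \<bullet> b)\<^sup>2)"
  unfolding power2_norm_eq_inner by (subst euclidean_inner) (simp add: power2_eq_square)
 then have e: "exp (- (norm x)\<^sup>2 / (4 * t)) = (\<Prod>b\<in>Basis. exp (- (x \<bullet> b)\<^sup>2 / (4 * t)))"
  by (subst exp_sum[symmetric]) (simp_all add: sum_divide_distrib sum_negf)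
 have m: "heat_mass t TYPE('a) = (\<Prod>b\<in>(Basis::'a set). sqrt (4 * pi * t))"
  using t by (simp add: heat_mass_def powr_half_sqrt[symmetric] powr_powr powr_realpow[symmetric] del: powr_half_sqrt)
 show ?thesis unfolding heat_def e m prod_dividef[symmetric] using t
  by (intro prod.cong refl) (simp add: normal_density_def mult_ac)
qed

lemma nn_integral_heat_prod:
 fixes f :: "'a::euclidean_space => real => ennreal"
 assumes t: "t > 0" and [measurable]: "!!b. f b \<in> Borel"
 shows "(\<integral>\<^sup>+x. ennreal (heat t x) * (\<Prod>b\<in>Basis. f b (x \<bullet> b)))
  = (\<Prod>b\<in>Basis. \<integral>\<^sup>+s. ennreal (normal_density 0 (sqrt (2 * t)) s) * f b s)"
 by (subst nn_integral_lborel_prod[symmetric]) (simp_all add: heat_prod[OF t] prod_ennreal prod.distrib)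

lemma nn_integral_normal_density: "\<sigma> > 0 ==> (\<integral>\<^sup>+s. ennreal (normal_density \<mu> \<sigma> s)) = 1"
 by (subst nn_integral_eq_integral) auto

lemma nn_integral_heat: "t > 0 ==> (\<integral>\<^sup>+x. ennreal (heat t (x::'a::euclidean_space))) = 1"
 using nn_integral_heat_prod[of t "%(b::'a) s. 1"] by (simp add: nn_integral_normal_density)

lemma integrable_heat: "t > 0 ==> integrable lborel (heat t :: 'a::euclidean_space => real)"
 by (rule integrableI_nonneg) (auto simp: nn_integral_heat less_imp_le[OF heat_pos])

lemma integral_heat: "t > 0 ==> (LBINT x. heat t (x::'a::euclidean_space)) = 1"
 by (subst integral_eq_nn_integral) (auto simp: nn_integral_heat less_imp_le[OF heat_pos])

lemma integrable_gaussian: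
 assumes c: "c > 0" shows "integrable lborel (%x::'a::euclidean_space. exp (- c * (norm x)\<^sup>2))"
 using integrable_mult_right[OF integrable_heat[of "1 / (4 * c)", where 'a = 'a], of "heat_mass (1 / (4 * c)) TYPE('a)"]
  heat_mass_pos[of "1 / (4 * c)", where 'a = 'a] c by (simp add: heat_def mult.commute)

text \<open>The power is at most \<open>exp (m * r)\<close>, and completing a square absorbs the
  linear exponent into half of the quadratic one.\<close>

lemma power_exp_bound:
 fixes m :: nat and c :: real
 assumes c: "c > 0" shows "EX C>0. ALL r>=0. r ^ m * exp (- c * r\<^sup>2) <= C * exp (- (c / 2) * r\<^sup>2)"
proof -
 have "r ^ m * exp (- c * r\<^sup>2) <= (exp ((real m)\<^sup>2 / (2 * c))) * exp (- (c / 2) * r\<^sup>2)" if r: "r >= 0" for r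
 proof -
  have "r <= exp r" using exp_ge_add_one_self[of r] by linarith
  then have "r ^ m <= exp r ^ m" using r by (intro power_mono)
  also have "... = exp (real m * r)" by (simp add: exp_of_nat_mult)
  finally have 1: "r ^ m <= exp (real m * r)" .
  have "0 <= (sqrt (c / 2) * r - real m / (2 * sqrt (c / 2)))\<^sup>2" by simp
  also have "... = c / 2 * r\<^sup>2 - real m * r + (real m)\<^sup>2 / (2 * c)"
   using c by (simp add: power2_diff power_mult_distrib power_divide)
  finally have "real m * r - c * r\<^sup>2 <= (real m)\<^sup>2 / (2 * c) - (c / 2) * r\<^sup>2" by simp
  then have "exp (real m * r) * exp (- c * r\<^sup>2) <= exp ((real m)\<^sup>2 / (2 * c)) * exp (- (c / 2) * r\<^sup>2)"
   by (simp add: exp_add[symmetric])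
  moreover have "r ^ m * exp (- c * r\<^sup>2) <= exp (real m * r) * exp (- c * r\<^sup>2)"
   by (rule mult_right_mono[OF 1]) simp
  ultimately show ?thesis by linarith
 qed
 then show ?thesis by (intro exI[of _ "exp ((real m)\<^sup>2 / (2 * c))"]) auto
qed

lemma integrable_gaussian_moment:
 fixes m :: nat
 assumes c: "c > 0" shows "integrable lborel (%x::'a::euclidean_space. norm x ^ m * exp (- c * (norm x)\<^sup>2))"
proof -
 obtain C where C: "C > 0" "!!r. r >= 0 ==> r ^ m * exp (- c * r\<^sup>2) <= C * exp (- (c / 2) * r\<^sup>2)"
  using power_exp_bound[OF c, of m] by auto
 show ?thesis
 proof (rule Bochner_Integration.integrable_bound)
  show "integrable lborel (%x::'a. C * exp (- (c / 2) * (norm x)\<^sup>2))"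
   using integrable_gaussian[of "c / 2", where 'a = 'a] c by simp
  show "AE x::'a. norm (norm x ^ m * exp (- c * (norm x)\<^sup>2)) <= norm (C * exp (- (c / 2) * (norm x)\<^sup>2))"
   using C by (auto simp: abs_mult)
 qed auto
qed

lemma integrable_heat_moment: "t > 0 ==> integrable lborel (%x::'a::euclidean_space. norm x ^ m * heat t x)"
 using integrable_gaussian_moment[of "1 / (4 * t)" m, where 'a = 'a] by (simp add: heat_def)

lemma heat_le: "t > 0 ==> heat t (x::'a::euclidean_space) <= t powr (- real DIM('a) / 2) / heat_mass 1 TYPE('a)"
 using heat_mass_pos[of 1, where 'a = 'a]
 by (simp add: heat_def heat_mass_scale[of t] powr_minus divide_simps)

lemma sqi_heat: assumes t: "t > 0" shows "sqi (heat t :: 'a::euclidean_space => real)"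
proof -
 have "(%x::'a. (heat t x)\<^sup>2) = (%x. exp (- (1 / (2 * t)) * (norm x)\<^sup>2) / (heat_mass t TYPE('a))\<^sup>2)"
  by (auto simp: heat_def power_divide exp_double[symmetric] fun_eq_iff)
 then show ?thesis unfolding sqi_def using integrable_gaussian[of "1 / (2 * t)", where 'a = 'a] t by simp
qed

lemma heat_scale:
 fixes x :: "'a::euclidean_space"
 assumes t: "t > 0" shows "heat t (sqrt t *\<^sub>R x) = heat 1 x / t powr (real DIM('a) / 2)"
 using t by (simp add: heat_def heat_mass_scale[of t] power_mult_distrib)

text \<open>The time moves from the density to the argument, so that limits of small times can be
  taken by dominated convergence against the fixed density \<open>heat 1\<close>.\<close>

lemma integral_heat_scale:
 fixes f :: "'a::euclidean_space => real"
 assumes t: "t > 0" and [measurable]: "f \<in> Borel"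
 shows "(LBINT z. heat t z * f z) = (LBINT z. heat 1 z * f (sqrt t *\<^sub>R z))"
proof -
 have "(LBINT z. heat t z * f z) = \<bar>sqrt t\<bar> ^ DIM('a) * (LBINT z. heat t (0 + sqrt t *\<^sub>R z) * f (0 + sqrt t *\<^sub>R z))"
  by (rule integral_lborel_affine) (use t in auto)
 also have "... = (LBINT z. \<bar>sqrt t\<bar> ^ DIM('a) * (heat t (0 + sqrt t *\<^sub>R z) * f (0 + sqrt t *\<^sub>R z)))" by simp
 also have "... = (LBINT z. heat 1 z * f (sqrt t *\<^sub>R z))"
 proof (rule Bochner_Integration.integral_cong[OF refl])
  fix z :: 'a
  have "\<bar>sqrt t\<bar> ^ DIM('a) = t powr (real DIM('a) / 2)"
   using t by (simp add: powr_half_sqrt[symmetric] powr_powr powr_realpow[symmetric])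
  then show "\<bar>sqrt t\<bar> ^ DIM('a) * (heat t (0 + sqrt t *\<^sub>R z) * f (0 + sqrt t *\<^sub>R z)) = heat 1 z * f (sqrt t *\<^sub>R z)"
   using t by (simp add: heat_scale)
 qed
 finally show ?thesis .
qed

lemma heat_convolution:
 fixes x z :: "'a::euclidean_space"
 assumes s: "s > 0" and t: "t > 0"
 shows "(\<integral>\<^sup>+y. ennreal (heat s (x - y) * heat t (y - z))) = ennreal (heat (s + t) (x - z))"
proof -
 let ?n = "%t. normal_density 0 (sqrt (2 * t))"
 have "(\<integral>\<^sup>+y. ennreal (heat s (x - y) * heat t (y - z)))
   = (\<integral>\<^sup>+y. ennreal (heat s (x - z - y) * heat t y))"
  using nn_integral_lborel_diff(2)[of "%y. ennreal (heat s (x - z - y) * heat t y)" z] by simp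
 also have "... = (\<integral>\<^sup>+y. (\<Prod>b\<in>Basis. ennreal (?n s ((x - z) \<bullet> b - y \<bullet> b) * ?n t (y \<bullet> b))))"
  by (simp add: heat_prod s t prod.distrib[symmetric] prod_ennreal inner_diff_left)
 also have "... = (\<Prod>b\<in>Basis. \<integral>\<^sup>+y. ennreal (?n s ((x - z) \<bullet> b - y) * ?n t y))"
  by (rule nn_integral_lborel_prod) auto
 also have "... = (\<Prod>b\<in>Basis. ennreal (?n (s + t) ((x - z) \<bullet> b)))"
  using s t fun_cong[OF conv_normal_density_zero_mean[of "sqrt (2 * s)" "sqrt (2 * t)"]]
  by (intro prod.cong refl) (simp add: distrib_left)
 also have "... = ennreal (heat (s + t) (x - z))" using s t by (simp add: heat_prod prod_ennreal)
 finally show ?thesis .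
qed

text \<open>A diagonal map with entries 1 and a single -1 has determinant of modulus one. This
  reflection makes the mixed second moments of the Gaussian vanish.\<close>

lemma lborel_integral_reflect:
 fixes f :: "'a::euclidean_space => real"
 assumes b: "b \<in> Basis" and [measurable]: "f \<in> Borel"
 shows "(LBINT x. f x) = (LBINT x. f (x - (2 * (x \<bullet> b)) *\<^sub>R b))"
proof -
 let ?c = "%j. if j = b then - 1 else 1 :: real"
 have T: "0 + (\<Sum>j\<in>Basis. (?c j * (x \<bullet> j)) *\<^sub>R j) = x - (2 * (x \<bullet> b)) *\<^sub>R b" for x :: 'a
  by (rule euclidean_eqI) (use b in \<open>auto simp: inner_diff_left inner_Basis\<close>)
 have "(\<Prod>j\<in>Basis. \<bar>?c j\<bar>) = (1::real)" by (rule prod.neutral) simp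
 then have "(lborel :: 'a measure) = distr lborel borel (%x. x - (2 * (x \<bullet> b)) *\<^sub>R b)"
  using lborel_affine_euclidean[of ?c 0] unfolding T by (simp add: density_1)
 then have "(LBINT x. f x) = integral\<^sup>L (distr lborel borel (%x. x - (2 * (x \<bullet> b)) *\<^sub>R b)) f" by (rule arg_cong)
 then show ?thesis by (simp add: integral_distr)
qed

lemma heat_second_moment_Basis:
 fixes b c :: "'a::euclidean_space"
 assumes b: "b \<in> Basis" and c: "c \<in> Basis"
 shows "(LBINT z. heat 1 z * ((z \<bullet> b) * (z \<bullet> c))) = (if b = c then 2 else 0)"
proof (cases "b = c")
 case True
 let ?f = "%j s. if j = b then ennreal (s\<^sup>2) else 1"
 have p: "(\<Prod>j\<in>Basis. ?f j (z \<bullet> j)) = ennreal ((z \<bullet> b)\<^sup>2)" for z :: 'a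
  using b by (simp add: prod.delta)
 have m: "(\<integral>\<^sup>+s. ennreal (normal_density 0 (sqrt 2) s) * ennreal (s\<^sup>2)) = 2"
  using normal_moment_even[of "sqrt 2" 0 1]
  by (subst ennreal_mult'[symmetric]) (simp_all add: has_bochner_integral_iff nn_integral_eq_integral fact_numeral)
 have "(\<integral>\<^sup>+s. ennreal (normal_density 0 (sqrt 2) s) * ?f j s) = (if j = b then 2 else 1)" for j
  using m nn_integral_normal_density[of "sqrt 2" 0] by simp
 then have "(\<integral>\<^sup>+z. ennreal (heat 1 z * (z \<bullet> b)\<^sup>2)) = (\<Prod>j\<in>Basis. if j = b then 2 else 1)"
  using nn_integral_heat_prod[of 1 ?f] by (simp add: p ennreal_mult' less_imp_le[OF heat_pos])
 then have "(\<integral>\<^sup>+z. ennreal (heat 1 z * (z \<bullet> b)\<^sup>2)) = 2" using b by (simp add: prod.delta)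
 then show ?thesis using True
  by (subst integral_eq_nn_integral) (auto simp: power2_eq_square less_imp_le[OF heat_pos])
next
 case False
 have n: "norm (z - (2 * (z \<bullet> b)) *\<^sub>R b) = norm z" for z :: 'a
  using b by (simp add: norm_eq_sqrt_inner inner_diff_left inner_diff_right inner_commute algebra_simps)
 have "(LBINT z. heat 1 z * ((z \<bullet> b) * (z \<bullet> c))) = (LBINT z. - (heat 1 z * ((z \<bullet> b) * (z \<bullet> c))))"
  by (subst lborel_integral_reflect[OF b]) (use b c False in \<open>auto simp: heat_def n inner_diff_left inner_Basis\<close>)
 then show ?thesis using False by simp
qed

section \<open>Convolutions and translations of square integrable functions\<close>

definition conv :: "('a::euclidean_space => real) => ('a => real) => 'a => real" where
 "conv k g x = (LBINT y. k (x - y) * g y)"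

lemma conv_measurable [measurable]:
 assumes [measurable]: "k \<in> Borel" "g \<in> Borel"
 shows "conv k g \<in> Borel"
 unfolding conv_def[abs_def] by (rule lborel.borel_measurable_lebesgue_integral) simp

text \<open>Young's inequality for an integrable kernel: the kernel is split into two square roots,
  Cauchy-Schwarz is applied to the inner integral, and Tonelli does the rest.\<close>

lemma young_nn:
 fixes k g :: "'a::euclidean_space => real"
 assumes [measurable]: "k \<in> Borel" "g \<in> Borel"
 shows "(\<integral>\<^sup>+x. (\<integral>\<^sup>+y. ennreal \<bar>k (x - y) * g y\<bar>)\<^sup>2)
   <= (\<integral>\<^sup>+x. ennreal \<bar>k x\<bar>)\<^sup>2 * (\<integral>\<^sup>+x. ennreal ((g x)\<^sup>2))"
proof -
 define K where "K = (\<integral>\<^sup>+x. ennreal \<bar>k x\<bar>)"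
 have "(\<integral>\<^sup>+y. ennreal \<bar>k (x - y) * g y\<bar>)\<^sup>2 <= K * (\<integral>\<^sup>+y. ennreal (\<bar>k (x - y)\<bar> * (g y)\<^sup>2))" for x
 proof -
  have "(\<integral>\<^sup>+y. ennreal \<bar>k (x - y) * g y\<bar>)
    = (\<integral>\<^sup>+y. ennreal (sqrt \<bar>k (x - y)\<bar>) * ennreal (sqrt \<bar>k (x - y)\<bar> * \<bar>g y\<bar>))"
   by (rule nn_integral_cong) (simp add: ennreal_mult[symmetric] abs_mult mult.assoc[symmetric])
  also have "...\<^sup>2 <= (\<integral>\<^sup>+y. (ennreal (sqrt \<bar>k (x - y)\<bar>))\<^sup>2) * (\<integral>\<^sup>+y. (ennreal (sqrt \<bar>k (x - y)\<bar> * \<bar>g y\<bar>))\<^sup>2)"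
   by (rule Cauchy_Schwarz_nn_integral) auto
  also have "(\<integral>\<^sup>+y. (ennreal (sqrt \<bar>k (x - y)\<bar>))\<^sup>2) = (\<integral>\<^sup>+y. ennreal \<bar>k (x - y)\<bar>)"
   by (simp add: ennreal_power)
  also have "... = K" using nn_integral_lborel_diff(1)[of "%y. ennreal \<bar>k y\<bar>" x] by (simp add: K_def)
  also have "(\<integral>\<^sup>+y. (ennreal (sqrt \<bar>k (x - y)\<bar> * \<bar>g y\<bar>))\<^sup>2) = (\<integral>\<^sup>+y. ennreal (\<bar>k (x - y)\<bar> * (g y)\<^sup>2))"
   by (simp add: ennreal_power power_mult_distrib)
  finally show ?thesis .
 qed
 then have "(\<integral>\<^sup>+x. (\<integral>\<^sup>+y. ennreal \<bar>k (x - y) * g y\<bar>)\<^sup>2)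
  <= (\<integral>\<^sup>+x. K * (\<integral>\<^sup>+y. ennreal (\<bar>k (x - y)\<bar> * (g y)\<^sup>2)))"
  by (rule nn_integral_mono)
 also have "... = K * (\<integral>\<^sup>+x. (\<integral>\<^sup>+y. ennreal (\<bar>k (x - y)\<bar> * (g y)\<^sup>2)))"
  by (rule nn_integral_cmult) measurable
 also have "(\<integral>\<^sup>+x. (\<integral>\<^sup>+y. ennreal (\<bar>k (x - y)\<bar> * (g y)\<^sup>2)))
   = (\<integral>\<^sup>+y. (\<integral>\<^sup>+x. ennreal (\<bar>k (x - y)\<bar> * (g y)\<^sup>2)))"
  by (rule lborel_pair.Fubini') measurable
 also have "... = (\<integral>\<^sup>+y. K * ennreal ((g y)\<^sup>2))"
 proof (rule nn_integral_cong)
  fix y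
  have "(\<integral>\<^sup>+x. ennreal (\<bar>k (x - y)\<bar> * (g y)\<^sup>2)) = (\<integral>\<^sup>+x. ennreal \<bar>k (x - y)\<bar>) * ennreal ((g y)\<^sup>2)"
   by (subst nn_integral_multc[symmetric]) (auto simp: ennreal_mult)
  also have "(\<integral>\<^sup>+x. ennreal \<bar>k (x - y)\<bar>) = K"
   using nn_integral_lborel_diff(2)[of "%y. ennreal \<bar>k y\<bar>" y] by (simp add: K_def)
  finally show "(\<integral>\<^sup>+x. ennreal (\<bar>k (x - y)\<bar> * (g y)\<^sup>2)) = K * ennreal ((g y)\<^sup>2)" .
 qed
 also have "... = K * (\<integral>\<^sup>+y. ennreal ((g y)\<^sup>2))" by (rule nn_integral_cmult) simp
 finally show ?thesis by (simp add: K_def power2_eq_square mult.assoc)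
qed

lemma sqi_nn_integral: "sqi g ==> (\<integral>\<^sup>+x. ennreal ((g x)\<^sup>2)) = ennreal (LBINT x. (g x)\<^sup>2)"
 by (rule nn_integral_eq_integral) (auto simp: sqi_def)

lemma young:
 fixes k g :: "'a::euclidean_space => real"
 assumes k: "integrable lborel k" and g: "sqi g"
 shows "AE x. integrable lborel (%y. k (x - y) * g y)"
  and "sqi (%x. LBINT y. \<bar>k (x - y) * g y\<bar>)"
  and "sqi (conv k g)"
  and "norm (mk (conv k g)) <= (LBINT x. \<bar>k x\<bar>) * norm (mk g)"
proof -
 have [measurable]: "k \<in> Borel" using k by (simp add: borel_measurable_integrable)
 note [measurable] = sqi_measurable[OF g]
 define G where "G x = (\<integral>\<^sup>+y. ennreal \<bar>k (x - y) * g y\<bar>)" for x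
 have [measurable]: "G \<in> Borel" unfolding G_def[abs_def] by measurable
 let ?K = "LBINT x. \<bar>k x\<bar>"
 have K: "(\<integral>\<^sup>+x. ennreal \<bar>k x\<bar>) = ennreal ?K" by (rule nn_integral_eq_integral) (use k in auto)
 have K0: "0 <= ?K" by simp
 have G2: "(\<integral>\<^sup>+x. (G x)\<^sup>2) <= ennreal ((?K * norm (mk g))\<^sup>2)"
  using young_nn[of k g] K0 unfolding G_def K sqi_nn_integral[OF g] norm_mk_sq[OF g, symmetric]
  by (simp add: ennreal_power ennreal_mult power_mult_distrib)
 then have "(\<integral>\<^sup>+x. (G x)\<^sup>2) < \<infinity>" by (rule le_less_trans) simp
 then have "AE x. (G x)\<^sup>2 ~= \<infinity>" by (intro nn_integral_noteq_infinite) auto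
 then have fin: "AE x. G x < \<infinity>"
  by eventually_elim (auto simp: less_top power_eq_top_ennreal)
 have absmeas: "(%x. LBINT y. \<bar>k (x - y) * g y\<bar>) \<in> Borel"
  by (rule lborel.borel_measurable_lebesgue_integral) simp
 show int: "AE x. integrable lborel (%y. k (x - y) * g y)"
  using fin by eventually_elim (auto simp: integrable_iff_bounded G_def)
 have eq: "AE x. ennreal ((LBINT y. \<bar>k (x - y) * g y\<bar>)\<^sup>2) = (G x)\<^sup>2"
  using int
 proof eventually_elim
  case (elim x)
  have "G x = ennreal (LBINT y. \<bar>k (x - y) * g y\<bar>)" unfolding G_def
   by (rule nn_integral_eq_integral) (use elim in auto)
  then show ?case by (simp add: ennreal_power)
 qed
 have nnabs: "(\<integral>\<^sup>+x. ennreal ((LBINT y. \<bar>k (x - y) * g y\<bar>)\<^sup>2)) <= ennreal ((?K * norm (mk g))\<^sup>2)"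
  using G2 by (subst nn_integral_cong_AE[OF eq])
 show s1: "sqi (%x. LBINT y. \<bar>k (x - y) * g y\<bar>)"
  by (rule sqiI_nn_integral[OF absmeas]) (use nnabs in \<open>rule le_less_trans\<close>, simp)
 have le: "\<bar>conv k g x\<bar> <= \<bar>LBINT y. \<bar>k (x - y) * g y\<bar>\<bar>" for x
  unfolding conv_def using integral_abs_bound[of lborel "%y. k (x - y) * g y"] by linarith
 show s2: "sqi (conv k g)" by (rule sqi_dominated[OF s1]) (use le in auto)
 have "ennreal ((norm (mk (conv k g)))\<^sup>2) = (\<integral>\<^sup>+x. ennreal ((conv k g x)\<^sup>2))"
  by (simp add: norm_mk_sq[OF s2] sqi_nn_integral[OF s2])
 also have "... <= (\<integral>\<^sup>+x. ennreal ((LBINT y. \<bar>k (x - y) * g y\<bar>)\<^sup>2))"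
  by (rule nn_integral_mono, rule ennreal_leI) (use le in \<open>simp only: abs_le_square_iff\<close>)
 also note nnabs
 finally have "(norm (mk (conv k g)))\<^sup>2 <= (?K * norm (mk g))\<^sup>2" by simp
 then show "norm (mk (conv k g)) <= ?K * norm (mk g)"
  by (rule power2_le_imp_le) (rule mult_nonneg_nonneg[OF K0 norm_ge_zero])
qed

lemma conv_cong_AE:
 assumes [measurable]: "k \<in> Borel" "f \<in> Borel" "g \<in> Borel"
  and "AE x. f x = g x"
 shows "conv k f = conv k g"
 unfolding conv_def[abs_def] using assms(4)
 by (intro ext integral_cong_AE) (auto elim: eventually_mono)

lemma conv_integrand_integrable_pair:
 fixes k g \<phi> :: "'a::euclidean_space => real"
 assumes k: "integrable lborel k" and g: "sqi g" and \<phi>: "sqi \<phi>"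
 shows "integrable (lborel \<Otimes>\<^sub>M lborel) (%(x, y). k (x - y) * g y * \<phi> x)"
proof -
 have [measurable]: "k \<in> Borel" using k by (simp add: borel_measurable_integrable)
 note [measurable] = sqi_measurable[OF g] sqi_measurable[OF \<phi>]
 define A where "A x = (LBINT y. \<bar>k (x - y) * g y\<bar>)" for x
 have A: "sqi A" unfolding A_def by (rule young(2)[OF k g])
 show ?thesis
 proof (rule integrableI_bounded)
  show "(%(x, y). k (x - y) * g y * \<phi> x) \<in> borel_measurable (lborel \<Otimes>\<^sub>M lborel)" by measurable
  have "(\<integral>\<^sup>+z. ennreal (norm (case z of (x, y) => k (x - y) * g y * \<phi> x)) \<partial>(lborel \<Otimes>\<^sub>M lborel))
    = (\<integral>\<^sup>+x. \<integral>\<^sup>+y. ennreal (norm (k (x - y) * g y * \<phi> x)))"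
   by (subst lborel.nn_integral_fst[symmetric]) auto
  also have "... = (\<integral>\<^sup>+x. ennreal \<bar>A x * \<phi> x\<bar>)"
  proof (rule nn_integral_cong_AE, use young(1)[OF k g] in eventually_elim)
   case (elim x)
   have "(\<integral>\<^sup>+y. ennreal (norm (k (x - y) * g y * \<phi> x))) = (\<integral>\<^sup>+y. ennreal \<bar>k (x - y) * g y\<bar>) * ennreal \<bar>\<phi> x\<bar>"
    by (subst nn_integral_multc[symmetric]) (auto simp: ennreal_mult abs_mult)
   also have "(\<integral>\<^sup>+y. ennreal \<bar>k (x - y) * g y\<bar>) = ennreal (A x)"
    unfolding A_def by (rule nn_integral_eq_integral) (use elim in auto)
   finally show ?case by (simp add: ennreal_mult abs_mult A_def)
  qed
  also have "... < \<infinity>"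
   using sqi_integrable_mult[OF A \<phi>] by (simp add: integrable_iff_bounded)
  finally show "(\<integral>\<^sup>+z. ennreal (norm (case z of (x, y) => k (x - y) * g y * \<phi> x)) \<partial>(lborel \<Otimes>\<^sub>M lborel)) < \<infinity>" .
 qed
qed

lemma conv_adjoint:
 fixes k g \<phi> :: "'a::euclidean_space => real"
 assumes k: "integrable lborel k" and g: "sqi g" and \<phi>: "sqi \<phi>"
 shows "(LBINT x. conv k g x * \<phi> x) = (LBINT y. g y * conv (%z. k (- z)) \<phi> y)"
proof -
 have "(LBINT x. conv k g x * \<phi> x) = (LBINT x. LBINT y. k (x - y) * g y * \<phi> x)"
  unfolding conv_def by simp
 also have "... = (LBINT y. LBINT x. k (x - y) * g y * \<phi> x)"
  using lborel_pair.Fubini_integral[OF conv_integrand_integrable_pair[OF k g \<phi>]] by simp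
 also have "... = (LBINT y. g y * conv (%z. k (- z)) \<phi> y)"
 proof -
  have "(LBINT x. k (x - y) * g y * \<phi> x) = (LBINT x. g y * (k (- (y - x)) * \<phi> x))" for y
   by (rule Bochner_Integration.integral_cong) (auto simp: mult_ac)
  then show ?thesis unfolding conv_def by simp
 qed
 finally show ?thesis .
qed

lemma integrable_conv_inner_translate:
 fixes k g \<phi> :: "'a::euclidean_space => real"
 assumes k: "integrable lborel k" and g: "sqi g" and \<phi>: "sqi \<phi>"
 shows "integrable (lborel \<Otimes>\<^sub>M lborel) (%(x, z). k (- z) * g (x + z) * \<phi> x)"
proof -
 have [measurable]: "k \<in> Borel" using k by (simp add: borel_measurable_integrable)
 note [measurable] = sqi_measurable[OF g] sqi_measurable[OF \<phi>]
 show ?thesis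
 proof (rule integrableI_bounded)
  show "(%(x, z). k (- z) * g (x + z) * \<phi> x) \<in> borel_measurable (lborel \<Otimes>\<^sub>M lborel)" by measurable
  have "(\<integral>\<^sup>+z. ennreal (norm (case z of (x, z) => k (- z) * g (x + z) * \<phi> x)) \<partial>(lborel \<Otimes>\<^sub>M lborel))
    = (\<integral>\<^sup>+x. \<integral>\<^sup>+z. ennreal (norm (k (- z) * g (x + z) * \<phi> x)))"
   by (subst lborel.nn_integral_fst[symmetric]) auto
  also have "... = (\<integral>\<^sup>+x. \<integral>\<^sup>+y. ennreal (norm (k (x - y) * g y * \<phi> x)))"
  proof (rule nn_integral_cong)
   fix x
   show "(\<integral>\<^sup>+z. ennreal (norm (k (- z) * g (x + z) * \<phi> x))) = (\<integral>\<^sup>+y. ennreal (norm (k (x - y) * g y * \<phi> x)))"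
    using nn_integral_lborel_affine[of "%y. ennreal (norm (k (x - y) * g y * \<phi> x))" 1 x] by simp
  qed
  also have "... = (\<integral>\<^sup>+z. ennreal (norm (case z of (x, y) => k (x - y) * g y * \<phi> x)) \<partial>(lborel \<Otimes>\<^sub>M lborel))"
   by (subst lborel.nn_integral_fst[symmetric]) auto
  also have "... < \<infinity>"
   using conv_integrand_integrable_pair[OF k g \<phi>] by (simp add: integrable_iff_bounded)
  finally show "(\<integral>\<^sup>+z. ennreal (norm (case z of (x, z) => k (- z) * g (x + z) * \<phi> x)) \<partial>(lborel \<Otimes>\<^sub>M lborel)) < \<infinity>" .
 qed
qed

section \<open>Translations on the Hilbert space\<close>

lemma sqi_translate: "sqi g ==> sqi (%x. g (x + z))"
 using integrable_lborel_diff(3)[of "%x. (g x)\<^sup>2" z] by (auto simp: sqi_def)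

definition tr :: "'a::euclidean_space => 'a l2 => 'a l2" where
 "tr z F = mk (%x. fn F (x + z))"

lemma fn_tr: "AE x. fn (tr z F) x = fn F (x + z)"
 unfolding tr_def by (rule fn_mk) (simp add: sqi_translate)

lemma AE_translate:
 assumes "AE x. P (x :: 'a::euclidean_space)" shows "AE x. P (x + z)"
proof -
 obtain N where N: "N \<in> null_sets lborel" "{x. ~ P x} \<subseteq> N"
  using assms by (auto simp: eventually_ae_filter)
 then have [measurable]: "N \<in> sets borel" by auto
 have "(\<integral>\<^sup>+x. indicator N (z + x)) = emeasure lborel N"
  using nn_integral_lborel_affine[of "indicator N" 1 z] by simp
 then have "(\<integral>\<^sup>+x. indicator N (z + x)) = 0"
  using N by auto
 then have "AE x. indicator N (z + x) = (0::ennreal)"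
  by (subst (asm) nn_integral_0_iff_AE) auto
 then show ?thesis using N by (auto elim!: eventually_mono simp: indicator_def add.commute split: if_splits)
qed

lemma inner_tr: "tr z F \<bullet> G = (LBINT x. fn F (x + z) * fn G x)"
 by (rule l2_inner_eq) (auto intro: fn_tr)

lemma tr_adjoint: "tr z F \<bullet> G = F \<bullet> tr (- z) G"
proof -
 have "F \<bullet> tr (- z) G = (LBINT x. fn F x * fn G (x - z))"
  by (rule l2_inner_eq) (use fn_tr[of "-z" G] in auto)
 also have "... = (LBINT x. fn F (x + z) * fn G (x + z - z))"
  by (rule integral_lborel_diff(3)[symmetric]) simp
 finally show ?thesis by (simp add: inner_tr)
qed

lemma tr_tr: "tr z (tr w F) = tr (z + w) F"
proof (rule l2_eqI)
 show "AE x. fn (tr z (tr w F)) x = fn (tr (z + w) F) x"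
  using fn_tr[of z "tr w F"] AE_translate[OF fn_tr[of w F], of z] fn_tr[of "z + w" F]
  by eventually_elim (simp add: add.assoc)
qed

lemma tr_0 [simp]: "tr 0 F = F"
 by (rule l2_eqI) (use fn_tr[of 0 F] in simp)

lemma norm_tr [simp]: "norm (tr z F) = norm F"
proof -
 have "tr z F \<bullet> tr z F = F \<bullet> F" by (simp add: tr_adjoint tr_tr)
 then show ?thesis by (simp add: norm_eq_sqrt_inner)
qed

lemma tr_add: "tr z (F + G) = tr z F + tr z G"
proof (rule l2_eqI)
 show "AE x. fn (tr z (F + G)) x = fn (tr z F + tr z G) x"
  using fn_tr[of z "F + G"] AE_translate[OF fn_add[of F G], of z] fn_add[of "tr z F" "tr z G"] fn_tr[of z F] fn_tr[of z G]
  by eventually_elim simp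
qed

lemma tr_scale: "tr z (c *\<^sub>R F) = c *\<^sub>R tr z F"
proof (rule l2_eqI)
 show "AE x. fn (tr z (c *\<^sub>R F)) x = fn (c *\<^sub>R tr z F) x"
  using fn_tr[of z "c *\<^sub>R F"] AE_translate[OF fn_scale[of c F], of z] fn_scale[of c "tr z F"] fn_tr[of z F]
  by eventually_elim simp
qed

lemma bounded_linear_tr: "bounded_linear (tr z)"
 by (rule bounded_linear_intro[where K = 1]) (auto simp: tr_add tr_scale)

lemma tr_diff: "tr z (F - G) = tr z F - tr z G"
 using bounded_linear_tr[of z] by (simp add: linear_simps)

text \<open>For an even kernel the convolution is an average of translations. Testing against
  \<open>G\<close> expresses this with scalar integrals only, without integrating Hilbert space
  valued functions over the whole space.\<close>

lemma conv_inner_translate: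
 fixes k :: "'a::euclidean_space => real"
 assumes k: "integrable lborel k" and ev: "!!z. k (- z) = k z"
 shows "mk (conv k (fn F)) \<bullet> G = (LBINT z. k z * (tr z F \<bullet> G))"
  and "integrable lborel (%z. k z * (tr z F \<bullet> G))"
proof -
 have [measurable]: "k \<in> Borel" using k by (simp add: borel_measurable_integrable)
 note int = integrable_conv_inner_translate[OF k sqi_fn[of F] sqi_fn[of G]]
 have "mk (conv k (fn F)) \<bullet> G = (LBINT x. conv k (fn F) x * fn G x)"
  by (rule l2_inner_eq) (auto intro!: fn_mk young k)
 also have "... = (LBINT x. (LBINT z. k (- z) * fn F (x + z) * fn G x))"
 proof -
  have "conv k (fn F) x = (LBINT z. k (- z) * fn F (x + z))" for x
   unfolding conv_def
   using integral_lborel_diff(3)[of "%y. k (x - y) * fn F y" x] by (simp add: add.commute)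
  then show ?thesis by simp
 qed
 also have "... = (LBINT z. (LBINT x. k (- z) * fn F (x + z) * fn G x))"
  using lborel_pair.Fubini_integral[OF int] by simp
 also have "... = (LBINT z. k z * (tr z F \<bullet> G))"
  by (simp add: inner_tr ev mult.assoc)
 finally show "mk (conv k (fn F)) \<bullet> G = (LBINT z. k z * (tr z F \<bullet> G))" .
 show "integrable lborel (%z. k z * (tr z F \<bullet> G))"
  using lborel_pair.integrable_snd[OF int] by (simp add: inner_tr ev mult.assoc)
qed

lemma inner_tr_measurable [measurable]: "(%z. tr z F \<bullet> G) \<in> Borel"
 unfolding inner_tr by (rule lborel.borel_measurable_lebesgue_integral) simp

lemma norm_diff_sq_l2: "(norm (F - G))\<^sup>2 = (norm F)\<^sup>2 + (norm G)\<^sup>2 - 2 * (F \<bullet> G)" for F G :: "'a::real_inner"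
 unfolding power2_norm_eq_inner by (simp add: inner_diff_left inner_diff_right inner_commute)

text \<open>For contractions, strong convergence to the identity passes to limits of vectors, by
  splitting the error into three parts. This extends the continuity of translations from a dense
  set.\<close>

lemma contraction_tendsto_closed:
 fixes T :: "'b => 'h::real_normed_vector => 'h"
 assumes contr: "!!z G. norm (T z G) <= norm G" and diff: "!!z F G. T z (F - G) = T z F - T z G"
  and X: "!!n. ((%z. T z (X n)) \<longlongrightarrow> X n) A" "X \<longlonglongrightarrow> F"
 shows "((%z. T z F) \<longlongrightarrow> F) A"
proof (rule tendstoI)
 fix e :: real assume e: "e > 0"
 obtain n where n: "norm (X n - F) < e / 3"
  using X(2)[unfolded LIMSEQ_iff, rule_format, of "e/3"] e by auto
 have "\<forall>\<^sub>F z in A. dist (T z (X n)) (X n) < e / 3" using X(1) e by (intro tendstoD) auto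
 then show "\<forall>\<^sub>F z in A. dist (T z F) F < e"
 proof eventually_elim
  case (elim z)
  have "T z F - F = T z (F - X n) + (T z (X n) - X n) + (X n - F)" by (simp add: diff)
  also have "norm ... <= norm (T z (F - X n)) + norm (T z (X n) - X n) + norm (X n - F)"
   by (intro norm_triangle_le add_right_mono norm_triangle_ineq)
  also have "... <= norm (F - X n) + norm (T z (X n) - X n) + norm (X n - F)"
   using contr[of z "F - X n"] by simp
  also have "... < e" using n elim by (simp add: dist_norm norm_minus_commute[of F])
  finally show ?case by (simp add: dist_norm)
 qed
qed

lemma sqi_bounded_support:
 assumes [measurable]: "f \<in> Borel" and "!!x::'a::euclidean_space. \<bar>f x\<bar> <= M" "!!x. norm x > R ==> f x = 0"
 shows "sqi f" "integrable lborel f"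
proof -
 have le: "\<bar>f x\<bar> <= \<bar>M * indicator (cball 0 R) x\<bar>" for x
  using assms(2)[of x] assms(3)[of x] by (auto simp: indicator_def not_le)
 have fin: "emeasure lborel (cball 0 R :: 'a set) < \<infinity>" using emeasure_bounded_finite[OF bounded_cball] by blast
 show "sqi f"
  by (rule sqi_dominated[OF sqi_scale[OF sqi_indicator[of "cball 0 R"], of M]]) (use le fin in auto)
 show "integrable lborel f"
  by (rule Bochner_Integration.integrable_bound[of _ "%x. M * indicator (cball 0 R) x"]) (use le fin in auto)
qed

lemma tr_mk: "sqi f ==> tr z (mk f) = mk (%x. f (x + z))"
proof -
 assume f: "sqi f"
 have "AE x. fn (tr z (mk f)) x = f (x + z)"
  using fn_tr[of z "mk f"] AE_translate[OF fn_mk[OF f], of z] by eventually_elim simp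
 then show ?thesis using fn_eq_mk[OF sqi_translate[OF f]] by blast
qed

lemma norm_mk_tendsto_zero:
 assumes "!!n::nat. sqi (f n)" "AE x. (%n. f n x) \<longlonglongrightarrow> 0" "sqi w" "!!n. AE x. \<bar>f n x\<bar> <= \<bar>w x\<bar>"
 shows "(%n. mk (f n)) \<longlonglongrightarrow> 0"
proof -
 note [measurable] = sqi_measurable[OF assms(1)] sqi_measurable[OF assms(3)]
 have "(%n. LBINT x. (f n x)\<^sup>2) \<longlonglongrightarrow> (LBINT x::'a. (0::real))"
 proof (rule integral_dominated_convergence[where w = "%x. (w x)\<^sup>2"])
  show "integrable lborel (%x. (w x)\<^sup>2)" using assms(3) by (simp add: sqi_def)
  show "AE x. (%n. (f n x)\<^sup>2) \<longlonglongrightarrow> 0"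
   using assms(2) by eventually_elim (auto intro!: tendsto_eq_intros)
  show "AE x. norm ((f n x)\<^sup>2) <= (w x)\<^sup>2" for n
   using assms(4)[of n] by eventually_elim (simp add: abs_le_square_iff)
 qed auto
 then have "(%n. (norm (mk (f n)))\<^sup>2) \<longlonglongrightarrow> 0" by (simp add: norm_mk_sq[OF assms(1)])
 then show ?thesis by (simp add: tendsto_norm_zero_iff)
qed

subsection \<open>Strong continuity of translations\<close>

lemma tr_continuous_mk:
 fixes h :: "'a::euclidean_space => real"
 assumes h: "continuous_on UNIV h" "!!x. \<bar>h x\<bar> <= M" "!!x. norm x > R ==> h x = 0"
 shows "((%z. tr z (mk h)) \<longlongrightarrow> mk h) (at 0)"
 unfolding tendsto_at_iff_sequentially comp_def
proof (intro allI impI)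
 fix z :: "nat => 'a" assume z: "z \<longlonglongrightarrow> 0"
 obtain K where K: "!!n. norm (z n) <= K" using convergent_imp_bounded[OF z] by (auto simp: bounded_iff)
 have [measurable]: "h \<in> Borel" by (rule borel_measurable_continuous_onI[OF h(1)])
 have s: "sqi h" by (rule sqi_bounded_support[OF _ h(2,3)]) simp
 have "(%n. mk (%x. h (x + z n) - h x)) \<longlonglongrightarrow> 0"
 proof (rule norm_mk_tendsto_zero)
  show "sqi (%x. h (x + z n) - h x)" for n by (intro sqi_diff sqi_translate s)
  show "AE x. (%n. h (x + z n) - h x) \<longlonglongrightarrow> 0"
  proof (rule AE_I2)
   fix x
   have "(%n. x + z n) \<longlonglongrightarrow> x + 0" by (intro tendsto_intros z)
   then have "(%n. h (x + z n)) \<longlonglongrightarrow> h x"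
    using continuous_on_tendsto_compose[OF h(1)] by simp
   then show "(%n. h (x + z n) - h x) \<longlonglongrightarrow> 0" by (rule LIM_zero)
  qed
  let ?w = "%x::'a. 2 * M * indicator (cball 0 (R + K)) x :: real"
  show "sqi ?w" by (intro sqi_scale sqi_indicator) (use emeasure_bounded_finite[OF bounded_cball] in auto)
  show "AE x. \<bar>h (x + z n) - h x\<bar> <= \<bar>?w x\<bar>" for n
  proof (rule AE_I2)
   fix x
   show "\<bar>h (x + z n) - h x\<bar> <= \<bar>?w x\<bar>"
   proof (cases "norm x <= R + K")
    case True
    then show ?thesis using h(2)[of x] h(2)[of "x + z n"] by simp
   next
    case False
    then have "norm x > R" "norm (x + z n) > R"
     using norm_diff_ineq[of x "z n"] K[of n] norm_ge_zero[of "z n"] by linarith+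
    then show ?thesis by (simp add: h(3))
   qed
  qed
 qed
 then show "(%n. tr (z n) (mk h)) \<longlonglongrightarrow> mk h"
  by (simp add: mk_diff sqi_translate s tr_mk LIM_zero_iff)
qed

text \<open>Two density steps: bounded functions of bounded support are limits of continuous ones,
  and every element is a limit of its truncations in height and in space.\<close>

lemma tr_continuous: "((%z. tr z F) \<longlongrightarrow> F) (at 0)" for F :: "'a::euclidean_space l2"
proof -
 have closed: "((%z. tr z F) \<longlongrightarrow> F) (at 0)"
  if "!!n. ((%z. tr z (X n)) \<longlongrightarrow> X n) (at 0)" "X \<longlonglongrightarrow> F" for X and F :: "'a l2"
  by (rule contraction_tendsto_closed[OF _ _ that]) (simp_all add: tr_diff)
 have bounded: "((%z. tr z (mk f)) \<longlongrightarrow> mk f) (at 0)"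
  if [measurable]: "f \<in> Borel" and f: "!!x. \<bar>f x\<bar> <= M" "!!x. norm x > R ==> f x = 0" for f :: "'a => real" and M R
 proof -
  have "f measurable_on UNIV"
   by (rule lebesgue_measurable_imp_measurable_on[OF measurable_completion]) auto
  then obtain N g where N: "negligible N" and g: "!!n. continuous_on UNIV (g n)" "!!x. x \<notin> N ==> (%n. g n x) \<longlonglongrightarrow> f x"
   unfolding measurable_on_def by auto
  have M: "0 <= M" using f(1)[of 0] by simp
  \<comment> \<open>Clipping the values and cutting off continuously in space gives a common
    dominating function, and alters nothing in the limit because \<open>f\<close> already obeys both
    bounds.\<close>
  define h where "h n x = max (- M) (min M (g n x)) * max 0 (min 1 (R + 1 - norm x))" for n x
  have h: "continuous_on UNIV (h n)" "\<bar>h n x\<bar> <= M" "norm x > R + 1 ==> h n x = 0" for n x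
  proof -
   show "continuous_on UNIV (h n)" unfolding h_def by (intro continuous_intros g)
   have "\<bar>max (- M) (min M (g n x))\<bar> * \<bar>max 0 (min 1 (R + 1 - norm x))\<bar> <= M * 1" using M by (intro mult_mono) auto
   then show "\<bar>h n x\<bar> <= M" by (simp add: h_def abs_mult)
  qed (simp add: h_def)
  have [measurable]: "h n \<in> Borel" for n by (rule borel_measurable_continuous_onI[OF h(1)])
  have s: "sqi (h n)" for n by (rule sqi_bounded_support(1)[of _ M "R + 1"]) (simp_all add: h)
  have sf: "sqi f" by (rule sqi_bounded_support(1)[of _ M R]) (simp_all add: f)
  have "(%n. mk (%x. h n x - f x)) \<longlonglongrightarrow> 0"
  proof (rule norm_mk_tendsto_zero)
   show "sqi (%x. h n x - f x)" for n by (intro sqi_diff s sf)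
   have "AE x in lebesgue. x \<notin> N" using N by (intro AE_not_in) (simp add: negligible_iff_null_sets)
   then have "AE x. x \<notin> N" by (simp only: AE_completion_iff)
   then show "AE x. (%n. h n x - f x) \<longlonglongrightarrow> 0"
   proof eventually_elim
    case (elim x)
    have "(%n. h n x) \<longlonglongrightarrow> max (- M) (min M (f x)) * max 0 (min 1 (R + 1 - norm x))"
     unfolding h_def by (intro tendsto_intros g(2)[OF elim])
    moreover have "max (- M) (min M (f x)) * max 0 (min 1 (R + 1 - norm x)) = f x"
     using f(1)[of x] f(2)[of x] by (cases "norm x <= R") auto
    ultimately show ?case by (simp add: LIM_zero)
   qed
   let ?w = "%x::'a. 2 * M * indicator (cball 0 (R + 1)) x :: real"
   show "sqi ?w" by (intro sqi_scale sqi_indicator) (use emeasure_bounded_finite[OF bounded_cball] in auto)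
   show "AE x. \<bar>h n x - f x\<bar> <= \<bar>?w x\<bar>" for n
   proof (rule AE_I2)
    fix x show "\<bar>h n x - f x\<bar> <= \<bar>?w x\<bar>"
     using h(2)[of n x] f(1)[of x] h(3)[of x n] f(2)[of x] M by (cases "norm x <= R + 1") auto
   qed
  qed
  then have "(%n. mk (h n)) \<longlonglongrightarrow> mk f" by (simp add: mk_diff s sf LIM_zero_iff)
  with tr_continuous_mk[OF h] show ?thesis by (rule closed)
 qed
 let ?A = "%n. {x. norm x <= real n & \<bar>fn F x\<bar> <= real n}"
 let ?f = "%n x. indicator (?A n) x * fn F x"
 have le: "\<bar>?f n x\<bar> <= \<bar>fn F x\<bar>" for n x by (simp add: indicator_def)
 have s: "sqi (?f n)" for n by (rule sqi_dominated[OF sqi_fn[of F]]) (use le[of n] in auto)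
 have "(%n. mk (%x. ?f n x - fn F x)) \<longlonglongrightarrow> 0"
 proof (rule norm_mk_tendsto_zero)
  show "sqi (%x. ?f n x - fn F x)" for n by (intro sqi_diff s sqi_fn)
  show "AE x. (%n. ?f n x - fn F x) \<longlonglongrightarrow> 0"
  proof (intro AE_I2 tendsto_eventually)
   fix x :: 'a
   obtain n where "max (norm x) \<bar>fn F x\<bar> <= real n" using real_arch_simple by blast
   then show "\<forall>\<^sub>F n in sequentially. ?f n x - fn F x = 0"
    by (intro eventually_sequentiallyI[of n]) (auto simp: indicator_def)
  qed
  show "sqi (%x. fn F x)" by simp
  show "AE x. \<bar>?f n x - fn F x\<bar> <= \<bar>fn F x\<bar>" for n by (auto simp: indicator_def)
 qed
 then have "(%n. mk (?f n)) \<longlonglongrightarrow> F" by (simp add: mk_diff s LIM_zero_iff)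
 moreover have "((%z. tr z (mk (?f n))) \<longlongrightarrow> mk (?f n)) (at 0)" for n
  by (rule bounded[of _ "real n" "real n"]) (auto simp: indicator_def)
 ultimately show ?thesis by (rule closed[rotated])
qed

subsection \<open>The heat semigroup\<close>

text \<open>At \<open>t = 0\<close> the Gaussian formula degenerates, so the identity is put in by
  hand to obtain a semigroup on all nonnegative times.\<close>

definition heat_op :: "real => 'a::euclidean_space l2 => 'a l2" where
 "heat_op t F = (if t = 0 then F else mk (conv (heat t) (fn F)))"

lemma heat_conv_integrable:
 "t > 0 ==> sqi g ==> integrable lborel (%y. heat t (x - y) * g y)"
 by (rule sqi_integrable_mult) (use sqi_translate[OF sqi_heat, of t "- x"] in \<open>simp_all add: heat_commute[of t x]\<close>)

lemma fn_heat_op: "t > 0 ==> AE x. fn (heat_op t F) x = conv (heat t) (fn F) x"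
 unfolding heat_op_def by (simp add: fn_mk young(3) integrable_heat)

lemma heat_op_mk: "t > 0 ==> sqi g ==> heat_op t (mk g) = mk (conv (heat t) g)"
 unfolding heat_op_def using conv_cong_AE[of "heat t" "fn (mk g)" g] fn_mk[of g] sqi_measurable[of g] by simp

lemma norm_heat_op_le: "t >= 0 ==> norm (heat_op t F) <= norm F"
proof (cases "t = 0")
 case False
 assume "t >= 0"
 with False have t: "t > 0" by simp
 have "norm (mk (conv (heat t) (fn F))) <= (LBINT x::'a. \<bar>heat t x\<bar>) * norm (mk (fn F))"
  by (rule young(4)[OF integrable_heat[OF t] sqi_fn])
 also have "(%x::'a. \<bar>heat t x\<bar>) = heat t" using heat_pos[OF t] by (auto simp: fun_eq_iff intro!: abs_of_pos)
 finally show ?thesis using t by (simp add: heat_op_def integral_heat)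
qed (simp add: heat_op_def)

lemma heat_op_add: assumes "t >= 0" shows "heat_op t (F + G) = heat_op t F + heat_op t G"
proof (cases "t = 0")
 case False
 then have t: "t > 0" using assms by simp
 have "conv (heat t) (fn (F + G)) = conv (heat t) (%x. fn F x + fn G x)"
  by (rule conv_cong_AE) (use fn_add in auto)
 also have "... = (%x. conv (heat t) (fn F) x + conv (heat t) (fn G) x)"
  unfolding conv_def[abs_def] using t by (simp add: distrib_left heat_conv_integrable)
 finally show ?thesis using t by (simp add: heat_op_def mk_add young(3) integrable_heat)
qed (simp add: heat_op_def)

lemma heat_op_scale: assumes "t >= 0" shows "heat_op t (c *\<^sub>R F) = c *\<^sub>R heat_op t F"
proof (cases "t = 0")
 case False
 then have t: "t > 0" using assms by simp
 have "conv (heat t) (fn (c *\<^sub>R F)) = conv (heat t) (%x. c * fn F x)"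
  by (rule conv_cong_AE) (use fn_scale in auto)
 also have "... = (%x. c * conv (heat t) (fn F) x)"
 proof
  fix x
  have "(%y. heat t (x - y) * (c * fn F y)) = (%y. c * (heat t (x - y) * fn F y))" by (simp only: mult.left_commute)
  then show "conv (heat t) (%x. c * fn F x) x = c * conv (heat t) (fn F) x" unfolding conv_def by simp
 qed
 finally show ?thesis using t by (simp add: heat_op_def mk_scale young(3) integrable_heat)
qed (simp add: heat_op_def)

lemma bounded_linear_heat_op:
 assumes "t >= 0" shows "bounded_linear (heat_op t)"
proof (rule bounded_linear_intro[where K = 1])
 fix F G :: "'a l2" and c
 show "heat_op t (F + G) = heat_op t F + heat_op t G" by (rule heat_op_add[OF assms])
 show "heat_op t (c *\<^sub>R F) = c *\<^sub>R heat_op t F" by (rule heat_op_scale[OF assms])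
 show "norm (heat_op t F) <= norm F * 1" using norm_heat_op_le[OF assms, of F] by simp
qed

lemma conv_heat_conv_heat:
 assumes s: "s > 0" and t: "t > 0" and g: "sqi g"
 shows "conv (heat s) (conv (heat t) g) = conv (heat (s + t)) g"
proof
 fix x
 note [measurable] = sqi_measurable[OF g]
 have int: "integrable (lborel \<Otimes>\<^sub>M lborel) (%(y, z). heat s (x - y) * heat t (y - z) * g z)"
 proof (rule integrableI_bounded)
  have "(\<integral>\<^sup>+yz. ennreal (norm (case yz of (y, z) => heat s (x - y) * heat t (y - z) * g z)) \<partial>(lborel \<Otimes>\<^sub>M lborel))
    = (\<integral>\<^sup>+z. \<integral>\<^sup>+y. ennreal (norm (heat s (x - y) * heat t (y - z) * g z)))"
   by (subst lborel_pair.nn_integral_snd[symmetric]) auto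
  also have "... = (\<integral>\<^sup>+z. ennreal (norm (heat (s + t) (x - z) * g z)))"
  proof (rule nn_integral_cong)
   fix z
   have "(\<integral>\<^sup>+y. ennreal (norm (heat s (x - y) * heat t (y - z) * g z)))
     = (\<integral>\<^sup>+y. ennreal (heat s (x - y) * heat t (y - z))) * ennreal \<bar>g z\<bar>"
    using s t by (subst nn_integral_multc[symmetric]) (auto simp: ennreal_mult[symmetric] abs_mult less_imp_le[OF heat_pos])
   also have "... = ennreal (heat (s + t) (x - z)) * ennreal \<bar>g z\<bar>"
    unfolding heat_convolution[OF s t] ..
   also have "... = ennreal (norm (heat (s + t) (x - z) * g z))"
    using s t by (simp add: ennreal_mult[symmetric] abs_mult less_imp_le[OF heat_pos])
   finally show "(\<integral>\<^sup>+y. ennreal (norm (heat s (x - y) * heat t (y - z) * g z))) = ennreal (norm (heat (s + t) (x - z) * g z))" .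
  qed
  also have "... < \<infinity>"
   using heat_conv_integrable[OF _ g, of "s + t" x] s t by (simp add: integrable_iff_bounded)
  finally show "(\<integral>\<^sup>+yz. ennreal (norm (case yz of (y, z) => heat s (x - y) * heat t (y - z) * g z)) \<partial>(lborel \<Otimes>\<^sub>M lborel)) < \<infinity>" .
 qed measurable
 have ck: "(LBINT y. heat s (x - y) * heat t (y - z)) = heat (s + t) (x - z)" for z
  by (subst integral_eq_nn_integral) (use s t in \<open>auto simp: heat_convolution less_imp_le[OF heat_pos]\<close>)
 have "conv (heat s) (conv (heat t) g) x = (LBINT y. LBINT z. heat s (x - y) * heat t (y - z) * g z)"
  unfolding conv_def by (simp add: mult.assoc)
 also have "... = (LBINT z. LBINT y. heat s (x - y) * heat t (y - z) * g z)"
  using lborel_pair.Fubini_integral[OF int] by simp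
 also have "... = conv (heat (s + t)) g x" by (simp add: ck conv_def)
 finally show "conv (heat s) (conv (heat t) g) x = conv (heat (s + t)) g x" .
qed

lemma heat_op_heat_op:
 assumes "s >= 0" "t >= 0" shows "heat_op (s + t) F = heat_op s (heat_op t F)"
proof (cases "s = 0 \<or> t = 0")
 case True
 then show ?thesis by (elim disjE) (simp_all add: heat_op_def[of 0])
next
 case False
 with assms have st: "s > 0" "t > 0" "s + t ~= 0" by auto
 have "heat_op s (heat_op t F) = heat_op s (mk (conv (heat t) (fn F)))" using st by (simp add: heat_op_def[of t])
 also have "... = mk (conv (heat s) (conv (heat t) (fn F)))"
  by (rule heat_op_mk[OF st(1) young(3)[OF integrable_heat[OF st(2)] sqi_fn]])
 also have "... = mk (conv (heat (s + t)) (fn F))" by (simp only: conv_heat_conv_heat[OF st(1,2) sqi_fn])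
 finally show ?thesis using st by (simp only: heat_op_def if_False)
qed

lemma heat_op_inner:
 assumes t: "t > 0"
 shows "heat_op t F \<bullet> G = (LBINT z. heat t z * (tr z F \<bullet> G))"
  and "integrable lborel (%z. heat t z * (tr z F \<bullet> G))"
 using t conv_inner_translate[OF integrable_heat[OF t] heat_uminus, of F G]
 by (simp_all only: heat_op_def if_False less_irrefl refl if_not_P[OF less_imp_neq[OF t, symmetric]])

lemma heat_op_inner_scaled:
 assumes t: "t > 0"
 shows "heat_op t F \<bullet> G = (LBINT z. heat 1 z * (tr (sqrt t *\<^sub>R z) F \<bullet> G))"
 unfolding heat_op_inner(1)[OF t] by (rule integral_heat_scale[OF t inner_tr_measurable])

text \<open>Convergence of \<open>heat_op t F \<bullet> F\<close> suffices: as
  \<open>heat_op t\<close> is a contraction, the squared norm of \<open>heat_op t F - F\<close> is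
  at most \<open>2 * (F \<bullet> F) - 2 * (heat_op t F \<bullet> F)\<close>.\<close>

lemma heat_op_continuous_zero: "((%t. heat_op t F) \<longlongrightarrow> F) (at_right 0)"
proof -
 have "((%t. heat_op t F \<bullet> F) \<longlongrightarrow> F \<bullet> F) (at_right 0)"
  unfolding tendsto_at_iff_sequentially comp_def
 proof (intro allI impI)
  fix t :: "nat => real" assume t: "ALL i. t i \<in> {0<..} - {0}" "t \<longlonglongrightarrow> 0"
  have "(%n. LBINT z. heat 1 z * (tr (sqrt (t n) *\<^sub>R z) F \<bullet> F)) \<longlonglongrightarrow> (LBINT z::'a. heat 1 z * (F \<bullet> F))"
  proof (rule integral_dominated_convergence[where w = "%z. heat 1 z * (norm F)\<^sup>2"])
   show "integrable lborel (%z::'a. heat 1 z * (norm F)\<^sup>2)" by (simp add: integrable_heat)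
   have m: "(%z. tr z F \<bullet> F) \<in> Borel" by (rule inner_tr_measurable)
   show "(%z. heat 1 z * (tr (sqrt (t n) *\<^sub>R z) F \<bullet> F)) \<in> borel_measurable lborel" for n
    using measurable_compose[OF _ m, of "%z. sqrt (t n) *\<^sub>R z" borel] by simp
   show "AE z. (%n. heat 1 z * (tr (sqrt (t n) *\<^sub>R z) F \<bullet> F)) \<longlonglongrightarrow> heat 1 z * (F \<bullet> F)"
   proof (rule AE_I2)
    fix z :: 'a
    have "continuous (at 0) (%z. tr z F)" using tr_continuous[of F] by (simp add: continuous_at)
    moreover have "(%n. sqrt (t n) *\<^sub>R z) \<longlonglongrightarrow> 0"
     using tendsto_scaleR[OF tendsto_real_sqrt[OF t(2)] tendsto_const, of z] by simp
    ultimately have "(%n. tr (sqrt (t n) *\<^sub>R z) F) \<longlonglongrightarrow> tr 0 F"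
     by (rule isCont_tendsto_compose)
    then show "(%n. heat 1 z * (tr (sqrt (t n) *\<^sub>R z) F \<bullet> F)) \<longlonglongrightarrow> heat 1 z * (F \<bullet> F)"
     by (auto intro!: tendsto_intros)
   qed
   show "AE z. norm (heat 1 z * (tr (sqrt (t n) *\<^sub>R z) F \<bullet> F)) <= heat 1 z * (norm F)\<^sup>2" for n
    using Cauchy_Schwarz_ineq2[of "tr (sqrt (t n) *\<^sub>R _) F" F]
    by (auto simp: abs_mult power2_eq_square less_imp_le[OF heat_pos] intro!: mult_left_mono)
  qed auto
  then show "(%n. heat_op (t n) F \<bullet> F) \<longlonglongrightarrow> F \<bullet> F"
   using t(1) by (simp add: heat_op_inner_scaled integral_heat)
 qed
 then have lim: "((%t. 2 * (F \<bullet> F) - 2 * (heat_op t F \<bullet> F)) \<longlongrightarrow> 2 * (F \<bullet> F) - 2 * (F \<bullet> F)) (at_right 0)"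
  by (intro tendsto_diff tendsto_const tendsto_mult)
 have "((%t. (norm (heat_op t F - F))\<^sup>2) \<longlongrightarrow> 0) (at_right 0)"
 proof (rule tendsto_sandwich[OF _ _ tendsto_const])
  show "((%t. 2 * (F \<bullet> F) - 2 * (heat_op t F \<bullet> F)) \<longlongrightarrow> 0) (at_right 0)" using lim by simp
  show "\<forall>\<^sub>F t in at_right 0. (norm (heat_op t F - F))\<^sup>2 <= 2 * (F \<bullet> F) - 2 * (heat_op t F \<bullet> F)"
   unfolding eventually_at_right_field
  proof (intro exI[of _ 1] conjI allI impI)
   fix t :: real assume "0 < t"
   then have "(norm (heat_op t F))\<^sup>2 <= (norm F)\<^sup>2" by (intro power_mono norm_heat_op_le) auto
   then show "(norm (heat_op t F - F))\<^sup>2 <= 2 * (F \<bullet> F) - 2 * (heat_op t F \<bullet> F)"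
    unfolding norm_diff_sq_l2 by (simp add: power2_norm_eq_inner)
  qed simp
 qed simp
 then have "((%t. norm (heat_op t F - F)) \<longlongrightarrow> 0) (at_right 0)"
  using tendsto_real_sqrt[of "%t. (norm (heat_op t F - F))\<^sup>2" 0] by simp
 then show ?thesis by (simp add: tendsto_norm_zero_iff LIM_zero_iff)
qed

interpretation heat: c0_semigroup heat_op
 by (rule c0_semigroup.intro, rule bounded_linear_heat_op, assumption, simp add: heat_op_def[of 0],
   rule heat_op_heat_op, assumption, assumption, rule heat_op_continuous_zero)

section \<open>Weak derivatives of square integrable functions\<close>

subsection \<open>Test functions\<close>

definition test_fun :: "('a::euclidean_space => real) => ('a => 'a) => bool" where
 "test_fun \<phi> G \<longleftrightarrow> (ALL x. GDERIV \<phi> x :> G x) & continuous_on UNIV G & bounded {x. \<phi> x ~= 0}"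

lemma test_fun_bounds:
 assumes "test_fun \<phi> G"
 obtains R M where "R > 0" "M > 0" "!!x. norm x > R ==> \<phi> x = 0" "!!x. norm x > R ==> G x = 0"
  "!!x. \<bar>\<phi> x\<bar> <= M" "!!x. norm (G x) <= M" "continuous_on UNIV \<phi>"
proof -
 have der: "!!x. (\<phi> has_derivative (%h. h \<bullet> G x)) (at x)" and cG: "continuous_on UNIV G"
  using assms by (auto simp: test_fun_def gderiv_def)
 have c\<phi>: "continuous_on UNIV \<phi>"
  using der by (intro differentiable_imp_continuous_on) (auto simp: differentiable_on_def differentiable_def)
 obtain R where R: "R > 0" "!!x. \<phi> x ~= 0 ==> norm x <= R"
  using assms unfolding test_fun_def bounded_pos by auto
 have \<phi>0: "\<phi> x = 0" if "norm x > R" for x using R(2)[of x] that by fastforce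
 have G0: "G x = 0" if x: "norm x > R" for x
 proof -
  have "open {x::'a. norm x > R}" by (intro open_Collect_less continuous_intros)
  then have "((%x. 0) has_derivative (%h. h \<bullet> G x)) (at x)"
   using x \<phi>0 by (intro has_derivative_transform_within_open[OF der]) auto
  then have "(%h. h \<bullet> G x) = (%h. 0)" by (rule has_derivative_unique) simp
  then have "G x \<bullet> G x = 0" by metis
  then show ?thesis by simp
 qed
 have "bounded (\<phi> ` cball 0 R)" "bounded (G ` cball 0 R)"
  by (intro compact_imp_bounded compact_continuous_image continuous_on_subset[OF c\<phi>] continuous_on_subset[OF cG]; simp)+
 then obtain M1 M2 where M: "M1 > 0" "M2 > 0" "!!x. norm x <= R ==> \<bar>\<phi> x\<bar> <= M1" "!!x. norm x <= R ==> norm (G x) <= M2"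
  unfolding bounded_pos by auto
 show ?thesis
 proof (rule that[of R "M1 + M2"])
  fix x
  show "\<bar>\<phi> x\<bar> <= M1 + M2" using M(1,2) M(3)[of x] \<phi>0[of x] by (cases "norm x <= R") auto
  show "norm (G x) <= M1 + M2" using M(1,2) M(4)[of x] G0[of x] by (cases "norm x <= R") auto
 qed (use R \<phi>0 G0 M c\<phi> in auto)
qed

lemma test_fun_measurable:
 assumes "test_fun \<phi> G" shows "\<phi> \<in> Borel" "(%x. G x \<bullet> b) \<in> Borel"
proof -
 obtain R M where "continuous_on UNIV \<phi>" using test_fun_bounds[OF assms] by metis
 then show "\<phi> \<in> Borel" by (rule borel_measurable_continuous_onI)
 have "continuous_on UNIV G" using assms by (simp add: test_fun_def)
 then have "continuous_on UNIV (%x. G x \<bullet> b)" by (intro continuous_intros)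
 then show "(%x. G x \<bullet> b) \<in> Borel" by (rule borel_measurable_continuous_onI)
qed

lemma test_fun_sqi:
 assumes t: "test_fun \<phi> G"
 shows "sqi \<phi>" "sqi (%x. G x \<bullet> b)" "integrable lborel \<phi>" "integrable lborel (%x. G x \<bullet> b)"
proof -
 obtain R M where b: "M > 0" "!!x. norm x > R ==> \<phi> x = 0" "!!x. norm x > R ==> G x = 0"
  "!!x. \<bar>\<phi> x\<bar> <= M" "!!x. norm (G x) <= M" using test_fun_bounds[OF t] by metis
 have "\<bar>G x \<bullet> b\<bar> <= M * norm b" for x
  using Cauchy_Schwarz_ineq2[of "G x" b] mult_right_mono[OF b(5)[of x], of "norm b"] by simp
 moreover have "G x \<bullet> b = 0" if "norm x > R" for x using b(3)[OF that] by simp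
 ultimately show "sqi \<phi>" "sqi (%x. G x \<bullet> b)" "integrable lborel \<phi>" "integrable lborel (%x. G x \<bullet> b)"
  using sqi_bounded_support[OF test_fun_measurable(1)[OF t] b(4) b(2)]
   sqi_bounded_support[OF test_fun_measurable(2)[OF t], of b "M * norm b" R] by auto
qed

lemma test_fun_translate:
 assumes "test_fun \<phi> G" shows "test_fun (%x. \<phi> (x + z)) (%x. G (x + z))"
 unfolding test_fun_def
proof (intro conjI allI)
 have der: "!!x. (\<phi> has_derivative (%h. h \<bullet> G x)) (at x)" and cG: "continuous_on UNIV G"
  using assms by (auto simp: test_fun_def gderiv_def)
 show "GDERIV (%x. \<phi> (x + z)) x :> G (x + z)" for x
  unfolding gderiv_def
  by (rule has_derivative_compose[of "%x. x + z" "%h. h", simplified]) (auto intro!: derivative_eq_intros der)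
 show "continuous_on UNIV (%x. G (x + z))"
  by (rule continuous_on_compose2[OF cG]) (auto intro!: continuous_intros)
 have "{x. \<phi> (x + z) ~= 0} = (%x. x - z) ` {x. \<phi> x ~= 0}"
  by (auto simp: image_iff) (metis add_diff_cancel)
 then show "bounded {x. \<phi> (x + z) ~= 0}"
  using assms bounded_translation_minus[of "{x. \<phi> x ~= 0}" z] by (simp add: test_fun_def)
qed

lemma test_fun_mult:
 assumes t: "test_fun \<phi> G" and "!!x. GDERIV \<psi> x :> P x" "continuous_on UNIV P"
 shows "test_fun (%x. \<psi> x * \<phi> x) (%x. \<psi> x *\<^sub>R G x + \<phi> x *\<^sub>R P x)"
 unfolding test_fun_def
proof (intro conjI allI)
 show "GDERIV (%x. \<psi> x * \<phi> x) x :> \<psi> x *\<^sub>R G x + \<phi> x *\<^sub>R P x" for x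
  using t assms(2) by (intro GDERIV_mult) (auto simp: test_fun_def)
 have "\<psi> differentiable at x within UNIV" for x
  using assms(2)[of x] unfolding gderiv_def by (auto simp: differentiable_def)
 then have c: "continuous_on UNIV \<psi>"
  by (intro differentiable_imp_continuous_on) (auto simp: differentiable_on_def)
 have "continuous_on UNIV \<phi>" using test_fun_bounds[OF t] by metis
 then show "continuous_on UNIV (%x. \<psi> x *\<^sub>R G x + \<phi> x *\<^sub>R P x)"
  using t assms(3) c by (intro continuous_intros) (auto simp: test_fun_def)
 show "bounded {x. \<psi> x * \<phi> x ~= 0}"
  using t by (auto simp: test_fun_def intro: bounded_subset)
qed

lemma test_fun_lipschitz:
 assumes t: "test_fun \<phi> G" and M: "!!x. norm (G x) <= M"
 shows "\<bar>\<phi> x - \<phi> y\<bar> <= M * norm (x - y)"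
proof -
 have "norm (\<phi> x - \<phi> y) <= M * norm (x - y)"
 proof (rule differentiable_bound[of UNIV])
  show "(\<phi> has_derivative (%h. h \<bullet> G x)) (at x within UNIV)" for x
   using t by (auto simp: test_fun_def gderiv_def)
  show "onorm (%h. h \<bullet> G x) <= M" for x
  proof (rule onorm_le)
   fix h
   show "norm (h \<bullet> G x) <= M * norm h"
    using Cauchy_Schwarz_ineq2[of h "G x"] mult_left_mono[OF M[of x], of "norm h"] by (simp add: mult.commute)
  qed
 qed auto
 then show ?thesis by simp
qed

lemma test_fun_directional_limit:
 assumes t: "test_fun \<phi> G" and h: "h \<longlonglongrightarrow> 0" "!!n. h n ~= (0::real)"
 shows "(%n. (\<phi> (x + h n *\<^sub>R z) - \<phi> x) / h n) \<longlonglongrightarrow> G x \<bullet> z"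
proof -
 have der: "(\<phi> has_derivative (%h. h \<bullet> G x)) (at x)"
  using t by (auto simp: test_fun_def gderiv_def)
 have "((%s. x + s *\<^sub>R z) has_derivative (%s. s *\<^sub>R z)) (at 0)"
  by (auto intro!: derivative_eq_intros)
 then have "((%s. \<phi> (x + s *\<^sub>R z)) has_derivative (%s. (s *\<^sub>R z) \<bullet> G x)) (at 0)"
  by (rule has_derivative_compose) (use der in simp)
 then have "((%s. \<phi> (x + s *\<^sub>R z)) has_field_derivative (z \<bullet> G x)) (at 0)"
  by (simp add: has_field_derivative_def mult.commute[of _ "z \<bullet> G x"])
 then have "((%s. (\<phi> (x + s *\<^sub>R z) - \<phi> x) / s) \<longlongrightarrow> z \<bullet> G x) (at 0)"
  by (simp add: has_field_derivative_iff)
 then show ?thesis using h unfolding tendsto_at_iff_sequentially comp_def by (simp add: inner_commute)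
qed

lemma mk_sum:
 "finite I ==> (!!i. i \<in> I ==> sqi (f i)) ==> sqi (%x. \<Sum>i\<in>I. f i x) & mk (%x. \<Sum>i\<in>I. f i x) = (\<Sum>i\<in>I. mk (f i))"
proof (induction I rule: finite_induct)
 case empty then show ?case by (simp add: zero_l2_def)
next
 case (insert i I)
 then show ?case by (simp add: sqi_add mk_add)
qed

text \<open>Pointwise convergence is differentiability; a Lipschitz bound and a common bounded
  support dominate the quotients, which lifts the convergence to the norm.\<close>

lemma test_fun_tr_quotient:
 assumes t: "test_fun \<phi> G"
 shows "((%h. (tr (h *\<^sub>R z) (mk \<phi>) - mk \<phi>) /\<^sub>R h) \<longlongrightarrow> mk (%x. G x \<bullet> z)) (at 0)"
 unfolding tendsto_at_iff_sequentially comp_def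
proof (intro allI impI)
 fix h :: "nat => real" assume "ALL i. h i \<in> UNIV - {0}" and h: "h \<longlonglongrightarrow> 0"
 then have h0: "h n ~= 0" for n by auto
 obtain K where K: "K > 0" "!!n. \<bar>h n\<bar> <= K"
  using convergent_imp_bounded[OF h] by (auto simp: bounded_pos)
 obtain R M where b: "M > 0" "!!x. norm x > R ==> \<phi> x = 0" "!!x. norm x > R ==> G x = 0"
  "!!x. norm (G x) <= M" using test_fun_bounds[OF t] by metis
 note [measurable] = test_fun_measurable[OF t]
 let ?f = "%n x. (\<phi> (x + h n *\<^sub>R z) - \<phi> x) / h n - G x \<bullet> z"
 have s1: "sqi (%x. (1 / h n) * (\<phi> (x + h n *\<^sub>R z) - \<phi> x))" for n
  by (intro sqi_scale sqi_diff sqi_translate test_fun_sqi[OF t])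
 then have sf: "sqi (?f n)" for n
  using sqi_diff[OF s1[of n] test_fun_sqi(2)[OF t, of z]] by simp
 have eq: "(tr (h n *\<^sub>R z) (mk \<phi>) - mk \<phi>) /\<^sub>R h n - mk (%x. G x \<bullet> z) = mk (?f n)" for n
 proof -
  have "mk (?f n) = mk (%x. (1 / h n) * (\<phi> (x + h n *\<^sub>R z) - \<phi> x)) - mk (%x. G x \<bullet> z)"
   using mk_diff[OF s1[of n] test_fun_sqi(2)[OF t, of z]] by simp
  also have "mk (%x. (1 / h n) * (\<phi> (x + h n *\<^sub>R z) - \<phi> x)) = (1 / h n) *\<^sub>R (mk (%x. \<phi> (x + h n *\<^sub>R z)) - mk \<phi>)"
   by (simp only: mk_scale mk_diff sqi_diff sqi_translate test_fun_sqi[OF t])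
  finally show ?thesis by (simp add: tr_mk test_fun_sqi[OF t] inverse_eq_divide)
 qed
 have "(%n. mk (?f n)) \<longlonglongrightarrow> 0"
 proof (rule norm_mk_tendsto_zero[OF sf])
  let ?w = "%x. (2 * M * norm z) * indicator (cball 0 (R + K * norm z)) x :: real"
  show "sqi ?w" by (intro sqi_scale sqi_indicator) (use emeasure_bounded_finite[OF bounded_cball] in auto)
  show "AE x. (%n. ?f n x) \<longlonglongrightarrow> 0"
   using test_fun_directional_limit[OF t h h0, of _ z] by (intro AE_I2) (simp only: LIM_zero)
  show "AE x. \<bar>?f n x\<bar> <= \<bar>?w x\<bar>" for n
  proof (rule AE_I2)
   fix x
   show "\<bar>?f n x\<bar> <= \<bar>?w x\<bar>"
   proof (cases "norm x <= R + K * norm z")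
    case True
    have "\<bar>\<phi> (x + h n *\<^sub>R z) - \<phi> x\<bar> <= M * (\<bar>h n\<bar> * norm z)"
     using test_fun_lipschitz[OF t b(4), of "x + h n *\<^sub>R z" x] by simp
    then have "\<bar>(\<phi> (x + h n *\<^sub>R z) - \<phi> x) / h n\<bar> <= M * norm z"
     using h0[of n] by (simp add: abs_divide divide_le_eq mult_ac)
    moreover have "\<bar>G x \<bullet> z\<bar> <= M * norm z"
     using Cauchy_Schwarz_ineq2[of "G x" z] mult_right_mono[OF b(4)[of x], of "norm z"] by simp
    ultimately have "\<bar>?f n x\<bar> <= 2 * (M * norm z)" by linarith
    then show ?thesis using True b(1) by (simp add: abs_mult)
   next
    case False
    have "norm (h n *\<^sub>R z) <= K * norm z" using K(2)[of n] by (simp add: mult_right_mono)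
    then have "norm (x + h n *\<^sub>R z) > R" using False norm_diff_ineq[of x "h n *\<^sub>R z"] by linarith
    moreover have "0 <= K * norm z" using K(1) by simp
    then have "norm x > R" using False by linarith
    ultimately show ?thesis using b by simp
   qed
  qed
 qed
 then show "(%n. (tr (h n *\<^sub>R z) (mk \<phi>) - mk \<phi>) /\<^sub>R h n) \<longlonglongrightarrow> mk (%x. G x \<bullet> z)"
  unfolding eq[symmetric] by (rule LIM_zero_cancel)
qed

text \<open>The integral is invariant under translation, so its derivative along \<open>z\<close>
  vanishes. Pairing with the indicator of a ball that contains all supports involved turns the
  integral into an inner product, where the norm limit of the quotients applies.\<close>

lemma integral_test_fun_gradient:
 assumes t: "test_fun \<phi> G" shows "(LBINT x. G x \<bullet> z) = 0"
proof -
 obtain R M where b: "!!x. norm x > R ==> \<phi> x = 0" "!!x. norm x > R ==> G x = 0"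
  using test_fun_bounds[OF t] by metis
 note [measurable] = test_fun_measurable[OF t]
 define I where "I = mk (indicator (cball 0 (R + norm z)) :: 'a => real)"
 have sI: "sqi (indicator (cball 0 (R + norm z)) :: 'a => real)"
  by (intro sqi_indicator) (use emeasure_bounded_finite[OF bounded_cball] in auto)
 have 1: "mk f \<bullet> I = (LBINT x. f x)" if "sqi f" "!!x. norm x > R + norm z ==> f x = 0" for f
  unfolding I_def inner_mk[OF that(1) sI]
  by (rule Bochner_Integration.integral_cong) (use that(2) in \<open>auto simp: indicator_def not_le\<close>)
 have "((%h. ((tr (h *\<^sub>R z) (mk \<phi>) - mk \<phi>) /\<^sub>R h) \<bullet> I) \<longlongrightarrow> mk (%x. G x \<bullet> z) \<bullet> I) (at 0)"
  by (intro tendsto_inner test_fun_tr_quotient[OF t] tendsto_const)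
 moreover have "\<forall>\<^sub>F h in at 0. ((tr (h *\<^sub>R z) (mk \<phi>) - mk \<phi>) /\<^sub>R h) \<bullet> I = 0"
  unfolding eventually_at
 proof (intro exI[of _ 1] conjI ballI impI)
  fix h :: real assume h: "h ~= 0 & dist h 0 < 1"
  have "mk (%x. \<phi> (x + h *\<^sub>R z)) \<bullet> I = (LBINT x. \<phi> (x + h *\<^sub>R z))"
  proof (rule 1)
   fix x :: 'a assume x: "norm x > R + norm z"
   have "norm (h *\<^sub>R z) <= norm z" using h mult_right_mono[of "\<bar>h\<bar>" 1 "norm z"] by simp
   then show "\<phi> (x + h *\<^sub>R z) = 0" using x norm_diff_ineq[of x "h *\<^sub>R z"] by (intro b(1)) linarith
  qed (intro sqi_translate test_fun_sqi[OF t])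
  also have "... = (LBINT x. \<phi> x)" by (rule integral_lborel_diff(3)) simp
  also have "... = mk \<phi> \<bullet> I"
  proof (rule 1[symmetric])
   fix x :: 'a assume "norm x > R + norm z"
   then have "norm x > R" using norm_ge_zero[of z] by linarith
   then show "\<phi> x = 0" by (rule b(1))
  qed (rule test_fun_sqi[OF t])
  finally show "((tr (h *\<^sub>R z) (mk \<phi>) - mk \<phi>) /\<^sub>R h) \<bullet> I = 0"
   by (simp add: tr_mk test_fun_sqi[OF t] inner_diff_left)
 qed simp
 ultimately have "mk (%x. G x \<bullet> z) \<bullet> I = 0"
  by (rule tendsto_unique[OF trivial_limit_at _ tendsto_eventually])
 moreover have "mk (%x. G x \<bullet> z) \<bullet> I = (LBINT x. G x \<bullet> z)"
 proof (rule 1)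
  fix x :: 'a assume "norm x > R + norm z"
  then have "norm x > R" using norm_ge_zero[of z] by linarith
  then show "G x \<bullet> z = 0" by (simp add: b(2))
 qed (rule test_fun_sqi[OF t])
 ultimately show ?thesis by simp
qed

subsection \<open>Cut-off functions and density of test functions\<close>

text \<open>Squaring the positive part makes the function continuously differentiable, which is the
  smoothness required of test functions.\<close>

definition cutoff :: "real => 'a::euclidean_space => real" where
 "cutoff n x = (max 0 (1 - (x \<bullet> x) / n\<^sup>2))\<^sup>2"

lemma has_real_derivative_max0_sq:
 "((%s. (max 0 s)\<^sup>2) has_real_derivative 2 * max 0 s) (at (s::real))"
proof (cases s "0::real" rule: linorder_cases)
 case less
 then have "((%s. 0) has_real_derivative 0) (at s)" by simp
 then have "((%s. (max 0 s)\<^sup>2) has_real_derivative 0) (at s)"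
  by (rule has_field_derivative_transform_within_open[of _ _ _ "{..<0}"]) (use less in auto)
 then show ?thesis using less by simp
next
 case greater
 have "((%s. s\<^sup>2) has_real_derivative 2 * s) (at s)" by (auto intro!: derivative_eq_intros)
 then have "((%s. (max 0 s)\<^sup>2) has_real_derivative 2 * s) (at s)"
  by (rule has_field_derivative_transform_within_open[of _ _ _ "{0<..}"]) (use greater in auto)
 then show ?thesis using greater by simp
next
 case equal
 have "((%h. (max 0 h)\<^sup>2 / h) \<longlongrightarrow> 0) (at (0::real))"
 proof (rule Lim_null_comparison)
  show "\<forall>\<^sub>F h in at (0::real). norm ((max 0 h)\<^sup>2 / h) <= \<bar>h\<bar>"
   by (rule always_eventually) (auto simp: max_def power2_eq_square)
 qed (auto intro!: tendsto_eq_intros)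
 then show ?thesis using equal by (simp add: has_field_derivative_iff)
qed

lemma test_fun_cutoff:
 assumes n: "n > 0"
 shows "test_fun (cutoff n) (%x::'a::euclidean_space. (- (4 / n\<^sup>2) * max 0 (1 - (x \<bullet> x) / n\<^sup>2)) *\<^sub>R x)"
 unfolding test_fun_def
proof (intro conjI allI)
 fix x :: 'a
 have "((%x. 1 - inverse (n\<^sup>2) * (x \<bullet> x)) has_derivative (%h. - (2 * inverse (n\<^sup>2)) * (h \<bullet> x))) (at x)"
  by (rule derivative_eq_intros refl | simp add: inner_commute mult_ac)+
 then have "((%x. 1 - (x \<bullet> x) / n\<^sup>2) has_derivative (%h. - (2 / n\<^sup>2) * (h \<bullet> x))) (at x)"
  by (simp add: divide_inverse mult.commute)
 from has_derivative_compose[OF this has_field_derivative_imp_has_derivative[OF has_real_derivative_max0_sq]]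
 show "GDERIV (cutoff n) x :> (- (4 / n\<^sup>2) * max 0 (1 - (x \<bullet> x) / n\<^sup>2)) *\<^sub>R x"
  unfolding gderiv_def cutoff_def by (simp add: mult_ac)
next
 show "continuous_on UNIV (%x::'a. (- (4 / n\<^sup>2) * max 0 (1 - (x \<bullet> x) / n\<^sup>2)) *\<^sub>R x)"
  using n by (intro continuous_intros) auto
 have "{x::'a. cutoff n x ~= 0} \<subseteq> cball 0 n"
 proof
  fix x :: 'a assume "x \<in> {x. cutoff n x ~= 0}"
  then have c0: "(max 0 (1 - (x \<bullet> x) / n\<^sup>2))\<^sup>2 ~= 0" unfolding cutoff_def by blast
  have "(x \<bullet> x) / n\<^sup>2 < 1"
  proof (rule ccontr)
   assume "~ (x \<bullet> x) / n\<^sup>2 < 1"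
   then have "max 0 (1 - (x \<bullet> x) / n\<^sup>2) = 0" by linarith
   with c0 show False by (simp only: zero_power2 not_True_eq_False)
  qed
  then have "(norm x)\<^sup>2 < n\<^sup>2" using n by (simp add: power2_norm_eq_inner)
  then show "x \<in> cball 0 n" using n by (simp add: power2_less_imp_less less_imp_le)
 qed
 then show "bounded {x::'a. cutoff n x ~= 0}" by (rule bounded_subset[OF bounded_cball])
qed

lemma cutoff_bounds: "0 <= cutoff n x" "cutoff n x <= 1"
 by (auto simp: cutoff_def max_def power_le_one)

lemma cutoff_tendsto: "(%n. cutoff (real (Suc n)) x) \<longlonglongrightarrow> 1"
proof -
 have "(%n. (max 0 (1 - (x \<bullet> x) * (1 / real (Suc n))\<^sup>2))\<^sup>2) \<longlonglongrightarrow> (max 0 (1 - (x \<bullet> x) * 0\<^sup>2))\<^sup>2"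
  by (intro tendsto_intros LIMSEQ_Suc[OF lim_1_over_n])
 then show ?thesis by (simp add: cutoff_def power_divide)
qed

lemma heat_gderiv: "GDERIV (heat t) x :> (- heat t x / (2 * t)) *\<^sub>R x"
proof -
 have "((%x. - (x \<bullet> x)) has_derivative (%h. - (2 * (h \<bullet> x)))) (at x)"
  by (rule derivative_eq_intros refl | simp add: inner_commute)+
 from has_derivative_mult_left[OF this, of "inverse (4 * t)"]
 have "((%x. - (x \<bullet> x) / (4 * t)) has_derivative (%h. - (2 * (h \<bullet> x)) / (4 * t))) (at x)"
  by (simp only: divide_inverse)
 from has_derivative_compose[OF this DERIV_exp[unfolded has_field_derivative_def]]
 have "((%x. exp (- (x \<bullet> x) / (4 * t))) has_derivative (%h. exp (- (x \<bullet> x) / (4 * t)) * (- (2 * (h \<bullet> x)) / (4 * t)))) (at x)" .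
 from has_derivative_mult_left[OF this, of "inverse (heat_mass t TYPE('a))"]
 show ?thesis
  unfolding gderiv_def heat_def[abs_def] power2_norm_eq_inner inner_scaleR_right divide_inverse[symmetric]
  by (simp add: divide_simps mult_ac)
qed

lemma heat_diff_gderiv: "GDERIV (%y. heat t (x - y)) y :> (heat t (x - y) / (2 * t)) *\<^sub>R (x - y)"
proof -
 have "((%y. x - y) has_derivative (%h. - h)) (at y)" by (auto intro!: derivative_eq_intros)
 from has_derivative_compose[OF this heat_gderiv[unfolded gderiv_def]]
 show ?thesis unfolding gderiv_def by simp
qed

lemma continuous_heat: "continuous_on UNIV (heat t)"
proof -
 have "heat t differentiable at x within UNIV" for x
  using heat_gderiv[of t x] unfolding gderiv_def by (auto simp: differentiable_def)
 then show ?thesis by (intro differentiable_imp_continuous_on) (auto simp: differentiable_on_def)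
qed

lemma continuous_heat_diff_gradient: "continuous_on UNIV (%y. (heat t (x - y) / (2 * t)) *\<^sub>R (x - y))"
proof -
 have "continuous_on UNIV (%y. heat t (x - y))"
  by (rule continuous_on_compose2[OF continuous_heat]) (auto intro!: continuous_intros)
 then show ?thesis unfolding divide_inverse by (intro continuous_intros)
qed

text \<open>Cut-off Gaussians centred at any point are test functions. Removing the cut-off by
  dominated convergence shows that \<open>heat_op t E\<close> vanishes for all positive
  \<open>t\<close>, and it tends to \<open>E\<close> as \<open>t\<close> tends to 0.\<close>

lemma test_functions_total:
 assumes E: "!!\<phi> G. test_fun \<phi> G ==> E \<bullet> mk \<phi> = 0"
 shows "E = (0 :: 'a::euclidean_space l2)"
proof -
 have "heat_op t E = 0" if t: "t > 0" for t
 proof -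
  have "conv (heat t) (fn E) x = 0" for x
  proof -
   let ?\<phi> = "%n y. heat t (x - y) * cutoff (real (Suc n)) y"
   have tf: "test_fun (?\<phi> n) (%y. heat t (x - y) *\<^sub>R ((- (4 / (real (Suc n))\<^sup>2) * max 0 (1 - (y \<bullet> y) / (real (Suc n))\<^sup>2)) *\<^sub>R y)
      + cutoff (real (Suc n)) y *\<^sub>R ((heat t (x - y) / (2 * t)) *\<^sub>R (x - y)))" for n
    by (rule test_fun_mult[OF test_fun_cutoff heat_diff_gderiv continuous_heat_diff_gradient]) simp
   have "(LBINT y. fn E y * ?\<phi> n y) = 0" for n
   proof -
    have "E \<bullet> mk (?\<phi> n) = (LBINT y. fn E y * ?\<phi> n y)"
     by (rule l2_inner_eq) (use fn_mk[OF test_fun_sqi(1)[OF tf]] test_fun_measurable(1)[OF tf] in auto)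
    then show ?thesis using E[OF tf] by simp
   qed
   moreover have "(%n. LBINT y. fn E y * ?\<phi> n y) \<longlonglongrightarrow> (LBINT y. heat t (x - y) * fn E y)"
   proof (rule integral_dominated_convergence[where w = "%y. \<bar>heat t (x - y) * fn E y\<bar>"])
    show "integrable lborel (%y. \<bar>heat t (x - y) * fn E y\<bar>)"
     using heat_conv_integrable[OF t, of "fn E" x] by simp
    show "(%y. fn E y * ?\<phi> n y) \<in> borel_measurable lborel" for n
     using test_fun_measurable(1)[OF tf[of n]] by simp
    show "AE y. (%n. fn E y * ?\<phi> n y) \<longlonglongrightarrow> heat t (x - y) * fn E y"
    proof (rule AE_I2)
     fix y
     have "(%n. fn E y * ?\<phi> n y) \<longlonglongrightarrow> fn E y * (heat t (x - y) * 1)"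
      by (intro tendsto_intros cutoff_tendsto)
     then show "(%n. fn E y * ?\<phi> n y) \<longlonglongrightarrow> heat t (x - y) * fn E y" by (simp add: mult.commute)
    qed
    show "AE y. norm (fn E y * ?\<phi> n y) <= \<bar>heat t (x - y) * fn E y\<bar>" for n
    proof (rule AE_I2)
     fix y
     have "\<bar>fn E y\<bar> * \<bar>heat t (x - y)\<bar> * \<bar>cutoff (real (Suc n)) y\<bar> <= \<bar>fn E y\<bar> * \<bar>heat t (x - y)\<bar> * 1"
      using cutoff_bounds[of "real (Suc n)" y] by (intro mult_left_mono) auto
     then show "norm (fn E y * ?\<phi> n y) <= \<bar>heat t (x - y) * fn E y\<bar>" by (simp add: abs_mult mult_ac)
    qed
   qed simp
   ultimately have "(%n::nat. 0::real) \<longlonglongrightarrow> (LBINT y. heat t (x - y) * fn E y)" by simp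
   from LIMSEQ_unique[OF this tendsto_const] show ?thesis unfolding conv_def .
  qed
  then have "conv (heat t) (fn E) = (%x. 0)" by (rule ext)
  then show ?thesis using t by (simp add: heat_op_def zero_l2_def)
 qed
 then have "\<forall>\<^sub>F t in at_right 0. heat_op t E = 0" by (auto simp: eventually_at_right_field intro!: exI[of _ 1])
 then have "((%t. 0) \<longlongrightarrow> E) (at_right (0::real))"
  by (rule Lim_transform_eventually[OF heat_op_continuous_zero])
 from tendsto_unique[OF trivial_limit_at_right_real this tendsto_const] show ?thesis .
qed

subsection \<open>Weak gradients and translations\<close>

text \<open>One Hilbert space element per coordinate, so that the vector-valued integrals of
  \<open>weak_gradient\<close> become scalar products.\<close>

definition wgrad :: "'a::euclidean_space l2 => ('a => 'a l2) => bool" where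
 "wgrad F D \<longleftrightarrow> (ALL \<phi> G. test_fun \<phi> G --> (ALL b:Basis. F \<bullet> mk (%x. G x \<bullet> b) = - (D b \<bullet> mk \<phi>)))"

definition ddir :: "('a::euclidean_space => 'a l2) => 'a => 'a l2" where
 "ddir D z = (\<Sum>b\<in>Basis. (z \<bullet> b) *\<^sub>R D b)"

lemma ddir_scale: "ddir D (c *\<^sub>R z) = c *\<^sub>R ddir D z"
 by (simp add: ddir_def scaleR_sum_right)

lemma norm_ddir_le: "norm (ddir D z) <= norm z * (\<Sum>b\<in>Basis. norm (D b))"
proof -
 have "norm (ddir D z) <= (\<Sum>b\<in>Basis. norm ((z \<bullet> b) *\<^sub>R D b))" unfolding ddir_def by (rule norm_sum)
 also have "... <= (\<Sum>b\<in>Basis. norm z * norm (D b))"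
  by (rule sum_mono) (simp add: Basis_le_norm mult_right_mono)
 finally show ?thesis by (simp add: sum_distrib_left)
qed

lemma wgrad_ddir:
 assumes F: "wgrad F D" and t: "test_fun \<phi> G"
 shows "F \<bullet> mk (%x. G x \<bullet> z) = - (ddir D z \<bullet> mk \<phi>)"
proof -
 have "(%x. G x \<bullet> z) = (%x. \<Sum>b\<in>Basis. (z \<bullet> b) * (G x \<bullet> b))"
  by (subst euclidean_inner) (simp add: mult.commute)
 then have "mk (%x. G x \<bullet> z) = (\<Sum>b\<in>Basis. (z \<bullet> b) *\<^sub>R mk (%x. G x \<bullet> b))"
  using mk_sum[of Basis "%b x. (z \<bullet> b) * (G x \<bullet> b)"] test_fun_sqi(2)[OF t]
  by (simp add: sqi_scale mk_scale)
 then show ?thesis using F t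
  by (simp add: ddir_def inner_sum_right inner_sum_left wgrad_def sum_negf)
qed

lemma wgrad_translation_derivative:
 assumes F: "wgrad F D" and t: "test_fun \<phi> G"
 shows "((%\<tau>. tr (\<tau> *\<^sub>R z) F \<bullet> mk \<phi>) has_real_derivative tr (\<tau> *\<^sub>R z) (ddir D z) \<bullet> mk \<phi>) (at \<tau>)"
proof -
 define w where "w = - (\<tau> *\<^sub>R z)"
 have t': "test_fun (%x. \<phi> (x + w)) (%x. G (x + w))" by (rule test_fun_translate[OF t])
 have mkw: "mk (%x. \<phi> (x + w)) = tr w (mk \<phi>)" by (simp add: tr_mk test_fun_sqi[OF t])
 have "((%h. F \<bullet> ((tr (h *\<^sub>R - z) (tr w (mk \<phi>)) - tr w (mk \<phi>)) /\<^sub>R h)) \<longlongrightarrow> F \<bullet> mk (%x. G (x + w) \<bullet> (- z))) (at 0)"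
  unfolding mkw[symmetric] by (intro tendsto_inner tendsto_const test_fun_tr_quotient[OF t'])
 moreover have "F \<bullet> mk (%x. G (x + w) \<bullet> (- z)) = tr (\<tau> *\<^sub>R z) (ddir D z) \<bullet> mk \<phi>"
 proof -
  have "ddir D (- z) = - ddir D z" using ddir_scale[of D "-1" z] by simp
  then have "F \<bullet> mk (%x. G (x + w) \<bullet> (- z)) = ddir D z \<bullet> tr w (mk \<phi>)"
   using wgrad_ddir[OF F t', of "- z"] by (simp add: mkw)
  then show ?thesis by (simp add: tr_adjoint w_def)
 qed
 moreover have "F \<bullet> ((tr (h *\<^sub>R - z) (tr w (mk \<phi>)) - tr w (mk \<phi>)) /\<^sub>R h)
   = (tr ((\<tau> + h) *\<^sub>R z) F \<bullet> mk \<phi> - tr (\<tau> *\<^sub>R z) F \<bullet> mk \<phi>) / h" for h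
 proof -
  have "tr ((\<tau> + h) *\<^sub>R z) F \<bullet> mk \<phi> = F \<bullet> tr (h *\<^sub>R - z) (tr w (mk \<phi>))"
   by (simp add: tr_adjoint tr_tr w_def scaleR_add_left algebra_simps)
  moreover have "tr (\<tau> *\<^sub>R z) F \<bullet> mk \<phi> = F \<bullet> tr w (mk \<phi>)" by (simp add: tr_adjoint w_def)
  ultimately show ?thesis by (simp add: inner_diff_right divide_inverse mult.commute)
 qed
 ultimately show ?thesis by (simp add: DERIV_def)
qed

lemma continuous_on_tr: "continuous_on S (%\<tau>. tr (\<tau> *\<^sub>R z) F)"
proof -
 have "continuous_on UNIV (%w. tr w F)"
  unfolding continuous_on_def
 proof
  fix w :: 'a
  have "((%v. tr w (tr v F)) \<longlongrightarrow> tr w F) (at 0)"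
   by (rule bounded_linear.tendsto[OF bounded_linear_tr tr_continuous])
  then have "((%v. tr (w + v) F) \<longlongrightarrow> tr w F) (at 0)" by (simp add: tr_tr)
  then show "((%w. tr w F) \<longlongrightarrow> tr w F) (at w within UNIV)" by (simp add: LIM_offset_zero_iff)
 qed
 then show ?thesis by (rule continuous_on_compose2) (auto intro!: continuous_intros)
qed

text \<open>The fundamental theorem of calculus along the segment from 0 to \<open>z\<close>, proved
  after pairing with a test function and freed of it by \<open>test_functions_total\<close>. Both
  the bound and the convergence of difference quotients follow for every element with a weak
  gradient.\<close>

lemma wgrad_translation_formula:
 assumes F: "wgrad F D"
 shows "tr z F - F = integral {0..1} (%\<tau>. tr (\<tau> *\<^sub>R z) (ddir D z))"
proof -
 let ?I = "integral {0..1} (%\<tau>. tr (\<tau> *\<^sub>R z) (ddir D z))"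
 have int: "(%\<tau>. tr (\<tau> *\<^sub>R z) (ddir D z)) integrable_on {0..1}"
  by (rule integrable_continuous_real[OF continuous_on_tr])
 have "tr z F - F - ?I = 0"
 proof (rule test_functions_total)
  fix \<phi> :: "'a => real" and G assume t: "test_fun \<phi> G"
  have "((%\<tau>. tr (\<tau> *\<^sub>R z) (ddir D z) \<bullet> mk \<phi>) has_integral (tr (1 *\<^sub>R z) F \<bullet> mk \<phi> - tr (0 *\<^sub>R z) F \<bullet> mk \<phi>)) {0..1}"
   by (rule fundamental_theorem_of_calculus)
     (auto simp: has_real_derivative_iff_has_vector_derivative[symmetric]
      intro!: DERIV_subset[OF wgrad_translation_derivative[OF F t]])
  moreover have "((%\<tau>. tr (\<tau> *\<^sub>R z) (ddir D z) \<bullet> mk \<phi>) has_integral (?I \<bullet> mk \<phi>)) {0..1}"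
   using has_integral_linear[OF integrable_integral[OF int] bounded_linear_inner_left[of "mk \<phi>"]]
   by (simp add: comp_def)
  ultimately have "tr (1 *\<^sub>R z) F \<bullet> mk \<phi> - tr (0 *\<^sub>R z) F \<bullet> mk \<phi> = ?I \<bullet> mk \<phi>"
   by (rule has_integral_unique)
  then have "tr z F \<bullet> mk \<phi> - F \<bullet> mk \<phi> = ?I \<bullet> mk \<phi>" by simp
  then show "(tr z F - F - ?I) \<bullet> mk \<phi> = 0" by (simp add: inner_diff_left)
 qed
 then show ?thesis by simp
qed

lemma norm_tr_diff_le:
 assumes F: "wgrad F D" shows "norm (tr z F - F) <= norm (ddir D z)"
proof -
 have "norm (integral {0..1} (%\<tau>. tr (\<tau> *\<^sub>R z) (ddir D z))) <= integral {0..1} (%\<tau>::real. norm (ddir D z))"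
  by (rule integral_norm_bound_integral) (auto intro!: integrable_continuous_real continuous_on_tr)
 then show ?thesis by (simp add: wgrad_translation_formula[OF F])
qed

lemma wgrad_tr_quotient:
 assumes F: "wgrad F D"
 shows "((%h. (tr (h *\<^sub>R z) F - F) /\<^sub>R h) \<longlongrightarrow> ddir D z) (at 0)"
proof (rule tendstoI)
 fix e :: real assume e: "e > 0"
 let ?D = "ddir D z"
 have "\<forall>\<^sub>F w in at 0. dist (tr w ?D) ?D < e / 2" using tendstoD[OF tr_continuous half_gt_zero[OF e]] .
 then obtain d where d: "d > 0" "!!w. w ~= 0 ==> norm w < d ==> norm (tr w ?D - ?D) < e / 2"
  unfolding eventually_at dist_norm by (metis UNIV_I diff_zero)
 have d': "norm (tr w ?D - ?D) <= e / 2" if "norm w < d" for w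
 proof (cases "w = 0")
  case True then show ?thesis using e by simp
 next
  case False from d(2)[OF this that] show ?thesis by (rule less_imp_le)
 qed
 have close: "dist ((tr (h *\<^sub>R z) F - F) /\<^sub>R h) ?D < e" if h: "h ~= 0" "\<bar>h\<bar> * norm z < d" for h
 proof -
  have int: "(%\<tau>. tr (\<tau> *\<^sub>R h *\<^sub>R z) G) integrable_on {0..1}" for G :: "'a l2"
   by (rule integrable_continuous_real[OF continuous_on_tr])
  have "(tr (h *\<^sub>R z) F - F) /\<^sub>R h = integral {0..1} (%\<tau>. tr (\<tau> *\<^sub>R h *\<^sub>R z) ?D)"
   using h unfolding wgrad_translation_formula[OF F] ddir_scale tr_scale by simp
  then have "(tr (h *\<^sub>R z) F - F) /\<^sub>R h - ?D = integral {0..1} (%\<tau>. tr (\<tau> *\<^sub>R h *\<^sub>R z) ?D - ?D)"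
   using int by (subst Henstock_Kurzweil_Integration.integral_diff) auto
  also have "norm ... <= integral {0..1} (%\<tau>::real. e / 2)"
  proof (rule integral_norm_bound_integral)
   fix \<tau> :: real assume "\<tau> \<in> {0..1}"
   then have "norm (\<tau> *\<^sub>R h *\<^sub>R z) <= \<bar>h\<bar> * norm z" by (simp add: abs_mult mult.assoc mult_left_le_one_le)
   then show "norm (tr (\<tau> *\<^sub>R h *\<^sub>R z) ?D - ?D) <= e / 2" using h by (intro d') auto
  qed (use int in \<open>auto intro!: integrable_diff\<close>)
  finally show ?thesis using e by (simp add: dist_norm)
 qed
 have "\<forall>\<^sub>F h in at (0::real). \<bar>h\<bar> * norm z < d"
 proof -
  have "((%h. \<bar>h\<bar> * norm z) \<longlongrightarrow> \<bar>0\<bar> * norm z) (at (0::real))" by (intro tendsto_intros)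
  then show ?thesis using d(1) by (intro order_tendstoD(2)) auto
 qed
 moreover have "\<forall>\<^sub>F h in at (0::real). h ~= 0" by (simp add: eventually_at_filter)
 ultimately show "\<forall>\<^sub>F h in at 0. dist ((tr (h *\<^sub>R z) F - F) /\<^sub>R h) ?D < e"
  by eventually_elim (rule close)
qed

subsection \<open>The Dirichlet form of the heat semigroup\<close>

text \<open>The derivative of the Gaussian in direction \<open>b\<close>, whose convolution with
  \<open>F\<close> is the corresponding component of the gradient of
  \<open>heat_op t F\<close>.\<close>

definition dheat :: "real => 'a::euclidean_space => 'a => real" where
 "dheat t b x = - (x \<bullet> b) / (2 * t) * heat t x"

lemma dheat_measurable [measurable]: "dheat t b \<in> Borel"
 unfolding dheat_def[abs_def] by simp

lemma dheat_uminus: "dheat t b (- x) = - dheat t b x"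
 by (simp add: dheat_def)

lemma integrable_dheat:
 assumes t: "t > 0" shows "integrable lborel (dheat t b)"
proof (rule Bochner_Integration.integrable_bound)
 show "integrable lborel (%x::'a. norm b / (2 * t) * (norm x ^ 1 * heat t x))"
  using integrable_heat_moment[OF t, of 1] by (rule integrable_mult_right)
 show "AE x. norm (dheat t b x) <= norm (norm b / (2 * t) * (norm x ^ 1 * heat t x))"
 proof (rule AE_I2)
  fix x :: 'a
  have "\<bar>x \<bullet> b\<bar> * (heat t x / (2 * t)) <= (norm x * norm b) * (heat t x / (2 * t))"
   using Cauchy_Schwarz_ineq2[of x b] t heat_pos[OF t, of x] by (intro mult_right_mono) auto
  then show "norm (dheat t b x) <= norm (norm b / (2 * t) * (norm x ^ 1 * heat t x))"
   using t heat_pos[OF t, of x] by (simp add: dheat_def abs_mult mult_ac)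
 qed
qed simp

text \<open>Integration by parts without boundary terms: the Gaussian times the test function is
  again a test function, so its gradient has integral zero.\<close>

lemma conv_heat_gradient:
 assumes t: "test_fun \<phi> G" and s: "s > 0"
 shows "conv (heat s) (%x. G x \<bullet> b) x = conv (dheat s b) \<phi> x"
proof -
 have tf: "test_fun (%y. heat s (x - y) * \<phi> y) (%y. heat s (x - y) *\<^sub>R G y + \<phi> y *\<^sub>R ((heat s (x - y) / (2 * s)) *\<^sub>R (x - y)))"
  by (rule test_fun_mult[OF t heat_diff_gderiv continuous_heat_diff_gradient])
 have "integrable lborel (%y. heat s (x - y) * (G y \<bullet> b))"
  by (rule heat_conv_integrable[OF s test_fun_sqi(2)[OF t]])
 moreover have eq: "(heat s (x - y) *\<^sub>R G y + \<phi> y *\<^sub>R ((heat s (x - y) / (2 * s)) *\<^sub>R (x - y))) \<bullet> b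
   = heat s (x - y) * (G y \<bullet> b) - dheat s b (x - y) * \<phi> y" for y
  using s by (simp add: inner_add_left dheat_def)
 moreover have "integrable lborel (%y. heat s (x - y) * (G y \<bullet> b) - dheat s b (x - y) * \<phi> y)"
  using test_fun_sqi(4)[OF tf, of b] unfolding eq .
 ultimately have "integrable lborel (%y. dheat s b (x - y) * \<phi> y)"
  using Bochner_Integration.integrable_diff[of lborel "%y. heat s (x - y) * (G y \<bullet> b)" "%y. heat s (x - y) * (G y \<bullet> b) - dheat s b (x - y) * \<phi> y"]
  by simp
 moreover have "(LBINT y. heat s (x - y) * (G y \<bullet> b) - dheat s b (x - y) * \<phi> y) = 0"
  using integral_test_fun_gradient[OF tf, of b] unfolding eq .
 ultimately show ?thesis unfolding conv_def
  using \<open>integrable lborel (%y. heat s (x - y) * (G y \<bullet> b))\<close> by simp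
qed

lemma wgrad_heat_op:
 assumes t: "t > 0"
 shows "wgrad (heat_op t F) (%b. mk (conv (dheat t b) (fn F)))"
 unfolding wgrad_def
proof (intro allI impI ballI)
 fix \<phi> :: "'a => real" and G :: "'a => 'a" and b :: 'a
 assume tf: "test_fun \<phi> G" and b: "b \<in> Basis"
 note s\<phi> = test_fun_sqi(1)[OF tf] and sG = test_fun_sqi(2)[OF tf, of b]
 have "heat_op t F \<bullet> mk (%x. G x \<bullet> b) = (LBINT x. conv (heat t) (fn F) x * (G x \<bullet> b))"
  by (rule l2_inner_eq[OF fn_heat_op[OF t] fn_mk[OF sG] _ sqi_measurable[OF sG]]) simp
 also have "... = (LBINT x. fn F x * conv (%z. heat t (- z)) (%x. G x \<bullet> b) x)"
  by (rule conv_adjoint[OF integrable_heat[OF t] sqi_fn sG])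
 also have "... = (LBINT x. fn F x * conv (dheat t b) \<phi> x)"
  by (simp add: conv_heat_gradient[OF tf t])
 finally have 1: "heat_op t F \<bullet> mk (%x. G x \<bullet> b) = (LBINT x. fn F x * conv (dheat t b) \<phi> x)" .
 have "mk (conv (dheat t b) (fn F)) \<bullet> mk \<phi> = (LBINT x. conv (dheat t b) (fn F) x * \<phi> x)"
  by (rule inner_mk[OF young(3)[OF integrable_dheat[OF t] sqi_fn] s\<phi>])
 also have "... = (LBINT x. fn F x * conv (%z. dheat t b (- z)) \<phi> x)"
  by (rule conv_adjoint[OF integrable_dheat[OF t] sqi_fn s\<phi>])
 also have "... = - (LBINT x. fn F x * conv (dheat t b) \<phi> x)"
  unfolding dheat_uminus conv_def by simp
 finally show "heat_op t F \<bullet> mk (%x. G x \<bullet> b) = - (mk (conv (dheat t b) (fn F)) \<bullet> mk \<phi>)" using 1 by simp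
qed

text \<open>Evenness of the Gaussian writes the energy as a symmetric form in the differences
  \<open>tr w u - u\<close>; it is visibly positive and involves translations only, whatever the
  regularity of \<open>u\<close> and \<open>v\<close>.\<close>

lemma heat_op_symmetrized:
 assumes t: "t > 0"
 shows "(u - heat_op t u) \<bullet> v = (LBINT z. heat 1 z * ((tr (sqrt t *\<^sub>R z) u - u) \<bullet> (tr (sqrt t *\<^sub>R z) v - v))) / 2"
  and "integrable lborel (%z. heat 1 z * ((tr (sqrt t *\<^sub>R z) u - u) \<bullet> (tr (sqrt t *\<^sub>R z) v - v)))"
proof -
 let ?s = "sqrt t"
 have int: "integrable lborel (%z::'a. heat 1 z * (tr (?s *\<^sub>R z) u \<bullet> v))" for u v :: "'a l2"
 proof (rule Bochner_Integration.integrable_bound)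
  show "integrable lborel (%z::'a. heat 1 z * (norm u * norm v))" by (simp add: integrable_heat)
  show "(%z. heat 1 z * (tr (?s *\<^sub>R z) u \<bullet> v)) \<in> borel_measurable lborel"
   using measurable_compose[OF _ inner_tr_measurable, of "%z. ?s *\<^sub>R z" borel u v] by simp
  show "AE z. norm (heat 1 z * (tr (?s *\<^sub>R z) u \<bullet> v)) <= norm (heat 1 z * (norm u * norm v))"
  proof (rule AE_I2)
   fix z :: 'a
   show "norm (heat 1 z * (tr (?s *\<^sub>R z) u \<bullet> v)) <= norm (heat 1 z * (norm u * norm v))"
    unfolding norm_mult using Cauchy_Schwarz_ineq2[of "tr (?s *\<^sub>R z) u" v] by (intro mult_left_mono) auto
  qed
 qed
 have refl: "(LBINT z. heat 1 z * (u \<bullet> tr (?s *\<^sub>R z) v)) = heat_op t u \<bullet> v"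
    "integrable lborel (%z. heat 1 z * (u \<bullet> tr (?s *\<^sub>R z) v))"
 proof -
  have eq: "heat 1 z * (u \<bullet> tr (?s *\<^sub>R z) v) = heat 1 (- z) * (tr (?s *\<^sub>R (- z)) u \<bullet> v)" for z
   by (simp add: tr_adjoint)
  show "(LBINT z. heat 1 z * (u \<bullet> tr (?s *\<^sub>R z) v)) = heat_op t u \<bullet> v"
   unfolding eq heat_op_inner_scaled[OF t]
   by (rule integral_lborel_diff(4)) (use borel_measurable_integrable[OF int[of u v]] in simp)
  show "integrable lborel (%z. heat 1 z * (u \<bullet> tr (?s *\<^sub>R z) v))"
   unfolding eq by (rule integrable_lborel_diff(4)[OF int])
 qed
 have "(tr (?s *\<^sub>R z) u - u) \<bullet> (tr (?s *\<^sub>R z) v - v) = 2 * (u \<bullet> v) - tr (?s *\<^sub>R z) u \<bullet> v - u \<bullet> tr (?s *\<^sub>R z) v" for z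
  by (simp add: inner_diff_left inner_diff_right tr_adjoint tr_tr)
 then have eq: "heat 1 z * ((tr (?s *\<^sub>R z) u - u) \<bullet> (tr (?s *\<^sub>R z) v - v))
   = heat 1 z * (2 * (u \<bullet> v)) - heat 1 z * (tr (?s *\<^sub>R z) u \<bullet> v) - heat 1 z * (u \<bullet> tr (?s *\<^sub>R z) v)" for z
  by (simp add: right_diff_distrib)
 show "integrable lborel (%z. heat 1 z * ((tr (?s *\<^sub>R z) u - u) \<bullet> (tr (?s *\<^sub>R z) v - v)))"
  unfolding eq using int[of u v] refl by (simp add: integrable_heat)
 show "(u - heat_op t u) \<bullet> v = (LBINT z. heat 1 z * ((tr (?s *\<^sub>R z) u - u) \<bullet> (tr (?s *\<^sub>R z) v - v))) / 2"
  unfolding eq using int[of u v] refl heat_op_inner_scaled[OF t, of u v]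
  by (simp add: integrable_heat integral_heat inner_diff_left)
qed

text \<open>The energy form of the heat semigroup is the classical Dirichlet form.\<close>

lemma heat_dirichlet_form:
 assumes u: "wgrad u D" and v: "wgrad v E"
 shows "((%k. ((u - heat_op k u) \<bullet> v) / k) \<longlongrightarrow> (\<Sum>b\<in>Basis. D b \<bullet> E b)) (at_right 0)"
 unfolding tendsto_at_iff_sequentially comp_def
proof (intro allI impI)
 fix k :: "nat => real" assume k: "ALL i. k i \<in> {0<..} - {0}" "k \<longlonglongrightarrow> 0"
 then have kp: "k n > 0" for n by simp
 define A where "A = (\<Sum>b\<in>Basis. norm (D b))"
 define B where "B = (\<Sum>b\<in>Basis. norm (E b))"
 have A: "A >= 0" and B: "B >= 0" by (auto simp: A_def B_def sum_nonneg)
 let ?q = "%n z u. (tr (sqrt (k n) *\<^sub>R z) u - u) /\<^sub>R sqrt (k n)"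
 have sk: "(%n. sqrt (k n)) \<longlonglongrightarrow> 0" using tendsto_real_sqrt[OF k(2)] by simp
 have "(%n. LBINT z. heat 1 z * (?q n z u \<bullet> ?q n z v)) \<longlonglongrightarrow> (LBINT z. heat 1 z * (ddir D z \<bullet> ddir E z))"
 proof (rule integral_dominated_convergence[where w = "%z. A * B * (norm z ^ 2 * heat 1 z)"])
  show "integrable lborel (%z::'a. A * B * (norm z ^ 2 * heat 1 z))"
   by (intro integrable_mult_right integrable_heat_moment) simp
  show "(%z. heat 1 z * (ddir D z \<bullet> ddir E z)) \<in> borel_measurable lborel"
   by (simp add: ddir_def inner_sum_left inner_sum_right)
  have "(%z. heat 1 z * (inverse (sqrt (k n)) * (inverse (sqrt (k n)) * (2 * (u \<bullet> v) - tr (sqrt (k n) *\<^sub>R z) u \<bullet> v - tr (sqrt (k n) *\<^sub>R z) v \<bullet> u)))) \<in> Borel" for n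
   using measurable_compose[OF _ inner_tr_measurable, of "%z. sqrt (k n) *\<^sub>R z" borel u v]
    measurable_compose[OF _ inner_tr_measurable, of "%z. sqrt (k n) *\<^sub>R z" borel v u] by simp
  moreover have "?q n z u \<bullet> ?q n z v = inverse (sqrt (k n)) * (inverse (sqrt (k n)) * (2 * (u \<bullet> v) - tr (sqrt (k n) *\<^sub>R z) u \<bullet> v - tr (sqrt (k n) *\<^sub>R z) v \<bullet> u))" for n z
  proof -
   have "tr w u \<bullet> tr w v = u \<bullet> v" for w by (simp add: tr_adjoint tr_tr)
   then have "(tr w u - u) \<bullet> (tr w v - v) = 2 * (u \<bullet> v) - tr w u \<bullet> v - tr w v \<bullet> u" for w
    by (simp add: inner_diff_left inner_diff_right inner_commute)
   then show ?thesis by (simp only: inner_scaleR_left inner_scaleR_right)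
  qed
  ultimately show "(%z. heat 1 z * (?q n z u \<bullet> ?q n z v)) \<in> borel_measurable lborel" for n
   by (simp only: measurable_lborel1 measurable_lborel2)
  show "AE z. (%n. heat 1 z * (?q n z u \<bullet> ?q n z v)) \<longlonglongrightarrow> heat 1 z * (ddir D z \<bullet> ddir E z)"
  proof (rule AE_I2)
   fix z :: 'a
   have "(%n. ?q n z u) \<longlonglongrightarrow> ddir D z" "(%n. ?q n z v) \<longlonglongrightarrow> ddir E z"
    using wgrad_tr_quotient[OF u, of z] wgrad_tr_quotient[OF v, of z] sk kp
    unfolding tendsto_at_iff_sequentially comp_def by (auto simp: less_imp_neq[THEN not_sym])
   then show "(%n. heat 1 z * (?q n z u \<bullet> ?q n z v)) \<longlonglongrightarrow> heat 1 z * (ddir D z \<bullet> ddir E z)"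
    by (intro tendsto_mult tendsto_const tendsto_inner)
  qed
  show "AE z. norm (heat 1 z * (?q n z u \<bullet> ?q n z v)) <= A * B * (norm z ^ 2 * heat 1 z)" for n
  proof (rule AE_I2)
   fix z :: 'a
   have h: "heat 1 z > 0" by (rule heat_pos) simp
   have nq: "norm (?q n z u) <= norm z * (\<Sum>b\<in>Basis. norm (D b))" if "wgrad u D" for u D
   proof -
    have "norm (tr (sqrt (k n) *\<^sub>R z) u - u) <= sqrt (k n) * norm (ddir D z)"
     using norm_tr_diff_le[OF that, of "sqrt (k n) *\<^sub>R z"] kp[of n] by (simp add: ddir_scale)
    then have "norm (?q n z u) <= norm (ddir D z)" using kp[of n] by (simp add: inverse_eq_divide divide_le_eq mult.commute)
    then show ?thesis using norm_ddir_le[of D z] by linarith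
   qed
   have "\<bar>?q n z u \<bullet> ?q n z v\<bar> <= norm (?q n z u) * norm (?q n z v)" by (rule Cauchy_Schwarz_ineq2)
   also have "... <= (norm z * A) * (norm z * B)"
    using nq[OF u] nq[OF v] A by (intro mult_mono) (auto simp: A_def B_def)
   finally have "\<bar>heat 1 z\<bar> * \<bar>?q n z u \<bullet> ?q n z v\<bar> <= \<bar>heat 1 z\<bar> * ((norm z * A) * (norm z * B))" by (rule mult_left_mono) simp
   then show "norm (heat 1 z * (?q n z u \<bullet> ?q n z v)) <= A * B * (norm z ^ 2 * heat 1 z)"
    using h by (simp add: abs_mult power2_eq_square mult_ac)
  qed
 qed
 moreover have "(LBINT z. heat 1 z * (?q n z u \<bullet> ?q n z v)) = 2 * (((u - heat_op (k n) u) \<bullet> v) / k n)" for n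
 proof -
  have pt: "heat 1 z * (?q n z u \<bullet> ?q n z v) = inverse (k n) * (heat 1 z * ((tr (sqrt (k n) *\<^sub>R z) u - u) \<bullet> (tr (sqrt (k n) *\<^sub>R z) v - v)))" for z
  proof -
   have "inverse (sqrt (k n)) * inverse (sqrt (k n)) = inverse (k n)"
    using kp[of n] by (simp only: inverse_mult_distrib[symmetric] real_sqrt_mult_self abs_of_pos)
   moreover have "h * (a * (a * X)) = c * (h * X)" if "a * a = c" for a c h X :: real
    unfolding that[symmetric] by simp
   ultimately show ?thesis
    unfolding inner_scaleR_left inner_scaleR_right by blast
  qed
  have L: "(LBINT z. heat 1 z * (?q n z u \<bullet> ?q n z v))
    = inverse (k n) * (LBINT z. heat 1 z * ((tr (sqrt (k n) *\<^sub>R z) u - u) \<bullet> (tr (sqrt (k n) *\<^sub>R z) v - v)))"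
   unfolding pt by (rule integral_mult_right_zero)
  have "2 * (I / 2 / k n) = inverse (k n) * I" for I by (simp add: field_simps)
  then show ?thesis unfolding L heat_op_symmetrized(1)[OF kp[of n], of u v] by (rule sym)
 qed
 \<comment> \<open>The second moments of \<open>heat 1\<close> are 2 on the diagonal and 0 off it;
   this factor cancels the one half in \<open>heat_op_symmetrized\<close>.\<close>
 moreover have "(LBINT z. heat 1 z * (ddir D z \<bullet> ddir E z)) = 2 * (\<Sum>b\<in>Basis. D b \<bullet> E b)"
 proof -
  have m: "integrable lborel (%z::'a. heat 1 z * ((z \<bullet> b) * (z \<bullet> c)))" for b c
  proof (rule Bochner_Integration.integrable_bound)
   show "integrable lborel (%z::'a. norm b * norm c * (norm z ^ 2 * heat 1 z))"
    by (intro integrable_mult_right integrable_heat_moment) simp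
   show "AE z. norm (heat 1 z * ((z \<bullet> b) * (z \<bullet> c))) <= norm (norm b * norm c * (norm z ^ 2 * heat 1 z))"
   proof (rule AE_I2)
    fix z :: 'a
    have "\<bar>z \<bullet> b\<bar> * \<bar>z \<bullet> c\<bar> <= (norm z * norm b) * (norm z * norm c)"
     by (intro mult_mono Cauchy_Schwarz_ineq2) auto
    then have "\<bar>heat 1 z\<bar> * (\<bar>z \<bullet> b\<bar> * \<bar>z \<bullet> c\<bar>) <= \<bar>heat 1 z\<bar> * ((norm z * norm b) * (norm z * norm c))"
     by (rule mult_left_mono) simp
    then show "norm (heat 1 z * ((z \<bullet> b) * (z \<bullet> c))) <= norm (norm b * norm c * (norm z ^ 2 * heat 1 z))"
     by (simp add: abs_mult power2_eq_square mult_ac)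
   qed
  qed simp
  have "heat 1 z * (ddir D z \<bullet> ddir E z) = (\<Sum>b\<in>Basis. \<Sum>c\<in>Basis. (D c \<bullet> E b) * (heat 1 z * ((z \<bullet> c) * (z \<bullet> b))))" for z
   unfolding ddir_def inner_sum_left inner_sum_right sum_distrib_left
   by (intro sum.cong refl) (simp add: mult_ac)
  then have "(LBINT z. heat 1 z * (ddir D z \<bullet> ddir E z)) = (\<Sum>b\<in>Basis. \<Sum>c\<in>Basis. (D c \<bullet> E b) * (LBINT z. heat 1 z * ((z \<bullet> c) * (z \<bullet> b))))"
   using m by simp
  also have "... = (\<Sum>b\<in>Basis. \<Sum>c\<in>Basis. if c = b then (D b \<bullet> E b) * 2 else 0)"
   by (intro sum.cong refl) (simp add: heat_second_moment_Basis)
  also have "... = (\<Sum>b\<in>Basis. (D b \<bullet> E b) * 2)" by (rule sum.cong[OF refl]) simp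
  finally show ?thesis by (simp add: sum_distrib_right[symmetric])
 qed
 ultimately have "(%n. 2 * (((u - heat_op (k n) u) \<bullet> v) / k n)) \<longlonglongrightarrow> 2 * (\<Sum>b\<in>Basis. D b \<bullet> E b)" by simp
 from tendsto_mult[OF tendsto_const this, of "1/2"]
 show "(%n. ((u - heat_op (k n) u) \<bullet> v) / k n) \<longlonglongrightarrow> (\<Sum>b\<in>Basis. D b \<bullet> E b)" by simp
qed

lemma heat_op_adjoint: "t > 0 ==> heat_op t u \<bullet> v = u \<bullet> heat_op t v"
proof -
 assume t: "t > 0"
 have "(u - heat_op t u) \<bullet> v = (v - heat_op t v) \<bullet> u"
  unfolding heat_op_symmetrized(1)[OF t] by (subst inner_commute) (rule refl)
 then have "u \<bullet> v - heat_op t u \<bullet> v = v \<bullet> u - heat_op t v \<bullet> u" by (simp only: inner_diff_left)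
 then show ?thesis using inner_commute[of u v] inner_commute[of u "heat_op t v"] by linarith
qed

lemma heat_op_tr: "t > 0 ==> heat_op t (tr z F) = tr z (heat_op t F)"
proof -
 assume t: "t > 0"
 have "heat_op t (tr z F) \<bullet> G = tr z (heat_op t F) \<bullet> G" for G
  by (simp add: heat_op_inner(1)[OF t] tr_adjoint tr_tr add.commute)
 then show ?thesis using vector_eq_rdot by blast
qed

text \<open>\<open>heat_op s\<close> commutes with translations and contracts norms, so every
  difference in the symmetrized energy can only shrink.\<close>

lemma heat_energy_le:
 assumes s: "s > 0" and k: "k > 0"
 shows "(heat_op s F - heat_op k (heat_op s F)) \<bullet> heat_op s F <= (F - heat_op k F) \<bullet> F"
proof -
 have "(LBINT z. heat 1 z * ((tr (sqrt k *\<^sub>R z) (heat_op s F) - heat_op s F) \<bullet> (tr (sqrt k *\<^sub>R z) (heat_op s F) - heat_op s F)))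
   <= (LBINT z. heat 1 z * ((tr (sqrt k *\<^sub>R z) F - F) \<bullet> (tr (sqrt k *\<^sub>R z) F - F)))"
 proof (rule integral_mono[OF heat_op_symmetrized(2)[OF k] heat_op_symmetrized(2)[OF k]])
  fix z :: 'a
  have "tr w (heat_op s F) - heat_op s F = heat_op s (tr w F - F)" for w
   using s by (simp add: heat_op_tr heat.apply_simps)
  moreover have "heat_op s G \<bullet> heat_op s G <= G \<bullet> G" for G :: "'a l2"
   using power_mono[OF norm_heat_op_le[of s G], of 2] s by (simp add: power2_norm_eq_inner)
  ultimately show "heat 1 z * ((tr (sqrt k *\<^sub>R z) (heat_op s F) - heat_op s F) \<bullet> (tr (sqrt k *\<^sub>R z) (heat_op s F) - heat_op s F))
    <= heat 1 z * ((tr (sqrt k *\<^sub>R z) F - F) \<bullet> (tr (sqrt k *\<^sub>R z) F - F))"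
   using heat_pos[of 1 z] by (simp add: mult_left_mono)
 qed
 then show ?thesis by (simp add: heat_op_symmetrized(1)[OF k])
qed

text \<open>The gradients of \<open>heat_op t F\<close> form a Cauchy family as \<open>t\<close> tends to \<open>0\<close>: their inner products
 depend only on the sum of the two times.\<close>

lemma wgrad_of_energy:
 assumes C: "\<forall>\<^sub>F k in at_right 0. ((F - heat_op k F) \<bullet> F) / k <= C"
 shows "EX E. wgrad F E"
proof -
 define t :: "nat => real" where "t n = inverse (real (Suc n))" for n
 have t: "t n > 0" for n by (simp add: t_def)
 have t_mono: "t m <= t n" if "n <= m" for m n using that by (simp add: t_def le_imp_inverse_le del: of_nat_Suc)
 let ?U = "%n. heat_op (t n) F"
 define D where "D n b = mk (conv (dheat (t n) b) (fn F))" for n b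
 have D: "wgrad (?U n) (D n)" for n unfolding D_def by (rule wgrad_heat_op[OF t])
 define P where "P n m = (\<Sum>b\<in>Basis. D n b \<bullet> D m b)" for n m
 have lim: "((%k. ((?U n - heat_op k (?U n)) \<bullet> ?U m) / k) \<longlongrightarrow> P n m) (at_right 0)" for n m
  unfolding P_def by (rule heat_dirichlet_form[OF D D])
 have pos: "\<forall>\<^sub>F k in at_right (0::real). 0 < k" by (simp add: eventually_at_right_less)
 have PC: "P n n <= C" for n
 proof (rule tendsto_upperbound[OF lim])
  show "\<forall>\<^sub>F k in at_right 0. ((?U n - heat_op k (?U n)) \<bullet> ?U n) / k <= C"
   using C pos
  proof eventually_elim
   case (elim k)
   then show ?case using divide_right_mono[OF heat_energy_le[OF t elim(2), of n F], of k] by simp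
  qed
 qed simp
 have le: "P n n <= P n m" if "n <= m" for n m
 proof (cases "t n = t m")
  case True
  then show ?thesis by (simp add: P_def D_def)
 next
  case False
  then have less: "t m < t n" using t_mono[OF that] by simp
  define r where "r = (t n + t m) / 2"
  let ?W = "heat_op r F"
  have r: "0 < r" "0 < t n - r" "r + r = t n + t m" using t[of n] t[of m] less by (auto simp: r_def)
  have Un: "?U n = heat_op (t n - r) ?W" using heat_op_heat_op[of "t n - r" r F] r by simp
  have ip: "heat_op a F \<bullet> heat_op b F = heat_op (a + b) F \<bullet> F" if "0 < a" "0 < b" for a b
   using that heat_op_adjoint[of b F "heat_op a F"] heat_op_heat_op[of b a F] by (simp add: inner_commute add.commute)
  have "(?U n - heat_op k (?U n)) \<bullet> ?U n <= (?U n - heat_op k (?U n)) \<bullet> ?U m" if k: "0 < k" for k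
  proof -
   have hh: "heat_op k (heat_op a F) = heat_op (k + a) F" if "0 < a" for a
    using heat_op_heat_op[of k a F] that k by simp
   have "(?U n - heat_op k (?U n)) \<bullet> ?U m = (?W - heat_op k ?W) \<bullet> ?W"
    by (simp only: inner_diff_left hh t r(1) ip k add_pos_pos add.assoc r(3))
   then show ?thesis using heat_energy_le[OF r(2) k, of ?W] Un by simp
  qed
  then show ?thesis
   by (intro tendsto_le[OF trivial_limit_at_right_real lim lim])
     (use pos in \<open>eventually_elim, auto intro: divide_right_mono\<close>)
 qed
 \<comment> \<open>Expanding the square and using \<open>le\<close> leaves the difference of two
   diagonal values. The diagonal is increasing and bounded by \<open>C\<close>, so the gradients are
   Cauchy.\<close>
 have sq: "(norm (D n b - D m b))\<^sup>2 <= P m m - P n n" if "n <= m" "b \<in> Basis" for n m b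
 proof -
  have "(norm (D n b - D m b))\<^sup>2 <= (\<Sum>b\<in>Basis. (norm (D n b - D m b))\<^sup>2)"
   by (rule member_le_sum[OF that(2)]) auto
  also have "... = P n n + P m m - 2 * P n m"
   unfolding P_def norm_diff_sq_l2 sum.distrib sum_subtractf sum_distrib_left by (simp only: power2_norm_eq_inner)
  finally show ?thesis using le[OF that(1)] by simp
 qed
 have "incseq (%n. P n n)"
 proof (rule incseq_SucI)
  fix n
  obtain b :: 'a where "b \<in> Basis" using nonempty_Basis by blast
  from order_trans[OF zero_le_power2 sq[OF _ this]] show "P n n <= P (Suc n) (Suc n)" by (simp add: le_SucI)
 qed
 then obtain L where "(%n. P n n) \<longlonglongrightarrow> L" using incseq_convergent[of "%n. P n n" C] PC by blast
 then have PCau: "Cauchy (%n. P n n)" by (rule LIMSEQ_imp_Cauchy)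
 have "convergent (%n. D n b)" if b: "b \<in> Basis" for b
  unfolding Cauchy_convergent_iff[symmetric]
 proof (rule metric_CauchyI)
  fix e :: real assume e: "0 < e"
  then obtain N where N: "!!m n. N <= m ==> N <= n ==> dist (P m m) (P n n) < e\<^sup>2"
   using metric_CauchyD[OF PCau, of "e\<^sup>2"] by auto
  have "(norm (D n b - D m b))\<^sup>2 < e\<^sup>2" if "N <= m" "N <= n" for m n
   using N[OF that] sq[OF _ b, of n m] sq[OF _ b, of m n]
   by (cases "n <= m") (simp_all add: dist_real_def norm_minus_commute[of "D m b"])
  then have "dist (D m b) (D n b) < e" if "N <= m" "N <= n" for m n
   using power2_less_imp_less[of "norm (D n b - D m b)" e] that e by (simp add: dist_norm norm_minus_commute)
  then show "EX M. ALL m>=M. ALL n>=M. dist (D m b) (D n b) < e" by blast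
 qed
 then have E: "(%n. D n b) \<longlonglongrightarrow> lim (%n. D n b)" if "b \<in> Basis" for b
  using that by (simp add: convergent_LIMSEQ_iff)
 have U: "?U \<longlonglongrightarrow> F"
  using filterlim_compose[OF heat_op_continuous_zero, of t sequentially F] LIMSEQ_inverse_real_of_nat t
  by (simp add: filterlim_at t_def[abs_def])
 have "F \<bullet> mk (%x. G x \<bullet> b) = - (lim (%n. D n b) \<bullet> mk \<phi>)" if "test_fun \<phi> G" "b \<in> Basis" for \<phi> G b
 proof (rule LIMSEQ_unique)
  show "(%n. ?U n \<bullet> mk (%x. G x \<bullet> b)) \<longlonglongrightarrow> F \<bullet> mk (%x. G x \<bullet> b)" by (intro tendsto_inner U tendsto_const)
  show "(%n. ?U n \<bullet> mk (%x. G x \<bullet> b)) \<longlonglongrightarrow> - (lim (%n. D n b) \<bullet> mk \<phi>)"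
   using D that unfolding wgrad_def by (auto intro!: tendsto_minus tendsto_inner E)
 qed
 then show ?thesis unfolding wgrad_def by (intro exI[of _ "%b. lim (%n. D n b)"]) simp
qed

section \<open>The Schroedinger semigroup on the space of square integrable functions\<close>

lemma lborel_lebesgue_measurable: "f \<in> Borel ==> f \<in> borel_measurable lebesgue"
 by (rule measurable_completion) simp

lemma AE_lebesgue_iff: "(AE x in lebesgue. P x) \<longleftrightarrow> (AE x. P x)"
 by (rule AE_completion_iff)

lemma square_integrable_fn: "square_integrable (fn F)"
 unfolding square_integrable_def
 using sqi_fn[of F] by (auto simp: sqi_def integrable_completion intro!: lborel_lebesgue_measurable)

lemma square_integrable_measurable: "square_integrable f ==> f \<in> borel_measurable lebesgue"
 by (simp add: square_integrable_def)

lemma square_integrable_sqi: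
 assumes "square_integrable (f :: 'a::euclidean_space => real)"
 shows "EX g. sqi g & (AE x. f x = g x)"
proof -
 obtain g where g: "g \<in> borel_measurable lborel" "AE x. f x = g x"
  using completion_ex_borel_measurable_real[of f lborel] assms by (auto simp: square_integrable_def)
 have [measurable]: "g \<in> Borel" using g by simp
 have "integrable lebesgue (%x. (g x)\<^sup>2)"
 proof (rule integrable_cong_AE_imp)
  show "integrable lebesgue (%x. (f x)\<^sup>2)" using assms by (simp add: square_integrable_def)
  show "AE x in lebesgue. (f x)\<^sup>2 = (g x)\<^sup>2" using g(2) unfolding AE_lebesgue_iff by eventually_elim simp
  show "(%x. (g x)\<^sup>2) \<in> borel_measurable lebesgue" by (rule lborel_lebesgue_measurable) simp
 qed
 then have "sqi g" by (simp add: sqi_def integrable_completion)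
 with g show ?thesis by blast
qed

text \<open>The passage from Lebesgue measurable functions to the quotient, through a Borel function
  equal almost everywhere.\<close>

definition lmk :: "('a::euclidean_space => real) => 'a l2" where
 "lmk f = mk (SOME g. sqi g & (AE x. f x = g x))"

lemma fn_lmk:
 assumes "square_integrable f" shows "AE x. fn (lmk f) x = f x"
proof -
 define g where "g = (SOME g. sqi g & (AE x. f x = g x))"
 have "sqi g & (AE x. f x = g x)"
  unfolding g_def by (rule someI_ex[OF square_integrable_sqi[OF assms]])
 then have g: "sqi g" "AE x. f x = g x" by auto
 have "AE x. fn (mk g) x = f x" using fn_mk[OF g(1)] g(2) by eventually_elim simp
 then show ?thesis by (simp add: lmk_def g_def)
qed

lemma lmk_eqI:
 assumes "square_integrable f" "square_integrable g" "AE x. f x = g x"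
 shows "lmk f = lmk g"
 by (rule l2_eqI) (use fn_lmk[OF assms(1)] fn_lmk[OF assms(2)] assms(3) in eventually_elim, simp)

lemma lmk_fn [simp]: "lmk (fn F) = F"
 by (rule l2_eqI) (rule fn_lmk[OF square_integrable_fn])

lemma lmk_unique: "square_integrable f ==> AE x. fn F x = f x ==> lmk f = F"
 using lmk_eqI[OF square_integrable_fn, of f F] by simp

lemma integral_lebesgue_fn_cong:
 fixes f g :: "'a::euclidean_space => real"
 assumes "AE x. f x = g x" "f \<in> borel_measurable lebesgue" "g \<in> borel_measurable lebesgue"
 shows "(LINT x|lebesgue. f x) = (LINT x|lebesgue. g x)"
 using assms by (intro integral_cong_AE) (auto simp: AE_lebesgue_iff)

lemma integral_lebesgue_lborel:
 fixes f :: "'a::euclidean_space => real"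
 shows "f \<in> Borel ==> (LINT x|lebesgue. f x) = (LBINT x. f x)"
 by (rule integral_completion) simp

lemma l2norm_lmk:
 assumes f: "square_integrable f" shows "l2norm f = norm (lmk f)"
proof -
 have "(LINT x|lebesgue. (f x)\<^sup>2) = (LINT x|lebesgue. (fn (lmk f) x)\<^sup>2)"
 proof (rule integral_lebesgue_fn_cong)
  show "AE x. (f x)\<^sup>2 = (fn (lmk f) x)\<^sup>2" using fn_lmk[OF f] by eventually_elim simp
  show "(%x. (f x)\<^sup>2) \<in> borel_measurable lebesgue" using square_integrable_measurable[OF f] by measurable
  show "(%x. (fn (lmk f) x)\<^sup>2) \<in> borel_measurable lebesgue" by (rule lborel_lebesgue_measurable) simp
 qed
 also have "... = (norm (lmk f))\<^sup>2" unfolding norm_l2_sq by (rule integral_lebesgue_lborel) simp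
 finally show ?thesis by (simp add: l2norm_def)
qed

lemma inner_lmk:
 assumes "square_integrable f" "square_integrable g"
 shows "lmk f \<bullet> lmk g = (LINT x|lebesgue. f x * g x)"
proof -
 have "(LINT x|lebesgue. f x * g x) = (LINT x|lebesgue. fn (lmk f) x * fn (lmk g) x)"
 proof (rule integral_lebesgue_fn_cong)
  show "AE x. f x * g x = fn (lmk f) x * fn (lmk g) x"
   using fn_lmk[OF assms(1)] fn_lmk[OF assms(2)] by eventually_elim simp
  show "(%x. f x * g x) \<in> borel_measurable lebesgue" using assms[THEN square_integrable_measurable] by measurable
  show "(%x. fn (lmk f) x * fn (lmk g) x) \<in> borel_measurable lebesgue" by (rule lborel_lebesgue_measurable) simp
 qed
 also have "... = lmk f \<bullet> lmk g" unfolding inner_l2_def by (rule integral_lebesgue_lborel) simp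
 finally show ?thesis by simp
qed

lemma square_integrable_linear:
 fixes f g :: "'a::euclidean_space => real"
 assumes f: "square_integrable f" and g: "square_integrable g"
 shows "square_integrable (%x. c * f x + g x)" "lmk (%x. c * f x + g x) = c *\<^sub>R lmk f + lmk g"
proof -
 have meas: "(%x. c * f x + g x) \<in> borel_measurable lebesgue"
  using square_integrable_measurable[OF f] square_integrable_measurable[OF g] by measurable
 have ae: "AE x. fn (c *\<^sub>R lmk f + lmk g) x = c * f x + g x"
  using fn_lmk[OF f] fn_lmk[OF g] fn_add[of "c *\<^sub>R lmk f" "lmk g"] fn_scale[of c "lmk f"]
  by eventually_elim simp
 show s: "square_integrable (%x. c * f x + g x)"
  unfolding square_integrable_def
 proof
  show "integrable lebesgue (%x. (norm (c * f x + g x))\<^sup>2)"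
  proof (rule integrable_cong_AE_imp)
   show "integrable lebesgue (%x. (norm (fn (c *\<^sub>R lmk f + lmk g) x))\<^sup>2)"
    using square_integrable_fn[of "c *\<^sub>R lmk f + lmk g"] by (simp add: square_integrable_def)
   show "AE x in lebesgue. (norm (fn (c *\<^sub>R lmk f + lmk g) x))\<^sup>2 = (norm (c * f x + g x))\<^sup>2"
    using ae unfolding AE_lebesgue_iff by eventually_elim simp
  qed (use meas in measurable)
 qed (rule meas)
 show "lmk (%x. c * f x + g x) = c *\<^sub>R lmk f + lmk g"
  by (rule lmk_unique[OF s ae])
qed

subsection \<open>The form domain\<close>

lemma integrableI_Basis:
 fixes f :: "'b => 'a::euclidean_space"
 assumes "!!b. b \<in> Basis ==> integrable M (%x. f x \<bullet> b)"
 shows "integrable M f"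
proof -
 have "integrable M (%x. \<Sum>b\<in>Basis. (f x \<bullet> b) *\<^sub>R b)"
  by (intro Bochner_Integration.integrable_sum integrable_scaleR_left assms)
 then show ?thesis by (simp add: euclidean_representation)
qed

lemma sqi_iff_square_integrable: "f \<in> Borel ==> square_integrable f \<longleftrightarrow> sqi f"
 by (simp add: square_integrable_def sqi_def integrable_completion lborel_lebesgue_measurable)

lemma lmk_mk: "sqi f ==> lmk f = mk f"
 by (rule lmk_unique) (auto simp: sqi_iff_square_integrable sqi_measurable intro: fn_mk)

lemma form_domain_of_wgrad:
 fixes v :: "'a::euclidean_space l2"
 assumes v: "wgrad v E" and V: "integrable lebesgue (%x. V x * (fn v x)\<^sup>2)"
 shows "form_domain V (fn v) (%x. \<Sum>b\<in>Basis. fn (E b) x *\<^sub>R b)"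
proof -
 let ?k = "%x. \<Sum>b\<in>Basis. fn (E b) x *\<^sub>R b"
 have kb: "?k x \<bullet> b = fn (E b) x" if "b \<in> Basis" for x b using that by simp
 have nk: "(norm (?k x))\<^sup>2 = (\<Sum>b\<in>Basis. (fn (E b) x)\<^sup>2)" for x
 proof -
  have "(norm (?k x))\<^sup>2 = (\<Sum>b\<in>Basis. (?k x \<bullet> b) * (?k x \<bullet> b))"
   unfolding power2_norm_eq_inner by (rule euclidean_inner)
  then show ?thesis by (simp add: power2_eq_square)
 qed
 have sk: "square_integrable ?k"
  unfolding square_integrable_def nk
  using sqi_fn[of "E _"] by (auto simp: sqi_def integrable_completion intro!: lborel_lebesgue_measurable)
 have "weak_gradient (fn v) ?k"
  unfolding weak_gradient_def
 proof (intro allI impI)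
  fix \<phi> :: "'a => real" and G :: "'a => 'a"
  assume "(ALL x. GDERIV \<phi> x :> G x) & continuous_on UNIV G & bounded {x. \<phi> x ~= 0}"
  then have t: "test_fun \<phi> G" by (simp add: test_fun_def)
  note s\<phi> = test_fun_sqi(1)[OF t] and sG = test_fun_sqi(2)[OF t]
  have [measurable]: "G \<in> Borel"
   using t by (intro borel_measurable_continuous_onI) (simp add: test_fun_def)
  note [measurable] = sqi_measurable[OF s\<phi>]
  have i1: "integrable lborel (%x. fn v x *\<^sub>R G x)"
  proof (rule integrableI_Basis)
   fix b :: 'a assume "b \<in> Basis"
   show "integrable lborel (%x. (fn v x *\<^sub>R G x) \<bullet> b)" using sqi_integrable_mult[OF sqi_fn sG] by simp
  qed
  have i2: "integrable lborel (%x. \<phi> x *\<^sub>R ?k x)"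
  proof (rule integrableI_Basis)
   fix b :: 'a assume "b \<in> Basis"
   then show "integrable lborel (%x. (\<phi> x *\<^sub>R ?k x) \<bullet> b)"
    using sqi_integrable_mult[OF s\<phi> sqi_fn] by (simp add: kb)
  qed
  have "(LBINT x. fn v x *\<^sub>R G x) = - (LBINT x. \<phi> x *\<^sub>R ?k x)"
  proof (rule euclidean_eqI)
   fix b :: 'a assume b: "b \<in> Basis"
   have "(LBINT x. fn v x *\<^sub>R G x) \<bullet> b = (LBINT x. fn v x * (G x \<bullet> b))"
    using i1 by (subst integral_inner_left[symmetric]) auto
   also have "... = v \<bullet> mk (%x. G x \<bullet> b)"
    by (rule l2_inner_eq[symmetric]) (use fn_mk[OF sG] in auto)
   also have "... = - (E b \<bullet> mk \<phi>)" using v t b by (simp add: wgrad_def)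
   also have "E b \<bullet> mk \<phi> = (LBINT x. fn (E b) x * \<phi> x)"
    by (rule l2_inner_eq) (use fn_mk[OF s\<phi>] in auto)
   also have "... = (LBINT x. (\<phi> x *\<^sub>R ?k x) \<bullet> b)"
    using b by (simp add: mult.commute)
   also have "... = (LBINT x. \<phi> x *\<^sub>R ?k x) \<bullet> b"
    using i2 by (subst integral_inner_left) auto
   finally show "(LBINT x. fn v x *\<^sub>R G x) \<bullet> b = (- (LBINT x. \<phi> x *\<^sub>R ?k x)) \<bullet> b" by simp
  qed
  then show "(LINT x|lebesgue. fn v x *\<^sub>R G x) = - (LINT x|lebesgue. \<phi> x *\<^sub>R ?k x)"
   by (simp add: integral_completion)
 qed
 then show ?thesis using sk V square_integrable_fn by (simp add: form_domain_def)
qed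

lemma square_integrable_component:
 fixes g :: "'a::euclidean_space => 'a"
 assumes g: "square_integrable g" and b: "b \<in> Basis"
 shows "square_integrable (%x. g x \<bullet> b)"
 unfolding square_integrable_def
proof
 have [measurable]: "g \<in> borel_measurable lebesgue" using g by (simp add: square_integrable_def)
 show "(%x. g x \<bullet> b) \<in> borel_measurable lebesgue" by simp
 show "integrable lebesgue (%x. (norm (g x \<bullet> b))\<^sup>2)"
 proof (rule Bochner_Integration.integrable_bound)
  show "integrable lebesgue (%x. (norm (g x))\<^sup>2)" using g by (simp add: square_integrable_def)
  show "AE x in lebesgue. norm ((norm (g x \<bullet> b))\<^sup>2) <= norm ((norm (g x))\<^sup>2)"
   using Basis_le_norm[OF b] by (auto intro!: AE_I2 simp: abs_le_square_iff[symmetric])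
 qed simp
qed

lemma square_integrable_mult_integrable:
 fixes f g :: "'a::euclidean_space => real"
 assumes f: "square_integrable f" and g: "square_integrable g"
 shows "integrable lebesgue (%x. f x * g x)"
proof (rule integrable_cong_AE_imp)
 show "integrable lebesgue (%x. fn (lmk f) x * fn (lmk g) x)"
  using sqi_integrable_mult[OF sqi_fn[of "lmk f"] sqi_fn[of "lmk g"]] by (simp add: integrable_completion)
 show "(%x. f x * g x) \<in> borel_measurable lebesgue" using assms[THEN square_integrable_measurable] by measurable
 show "AE x in lebesgue. fn (lmk f) x * fn (lmk g) x = f x * g x"
  unfolding AE_lebesgue_iff using fn_lmk[OF f] fn_lmk[OF g] by eventually_elim simp
qed

lemma wgrad_of_form_domain:
 fixes u :: "'a::euclidean_space => real"
 assumes "form_domain V u g"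
 shows "wgrad (lmk u) (%b. lmk (%x. g x \<bullet> b))"
 unfolding wgrad_def
proof (intro allI impI ballI)
 fix \<phi> :: "'a => real" and G :: "'a => 'a" and b :: 'a
 assume t: "test_fun \<phi> G" and b: "b \<in> Basis"
 have u: "square_integrable u" and g: "square_integrable g" and wg: "weak_gradient u g"
  using assms by (auto simp: form_domain_def)
 note s\<phi> = test_fun_sqi(1)[OF t] and sG = test_fun_sqi(2)[OF t]
 have S\<phi>: "square_integrable \<phi>" and SG: "!!b. square_integrable (%x. G x \<bullet> b)"
  using s\<phi> sG by (auto simp: sqi_iff_square_integrable sqi_measurable)
 have Gm: "G \<in> borel_measurable lebesgue"
  using t by (intro lborel_lebesgue_measurable borel_measurable_continuous_onI) (simp add: test_fun_def)
 have um: "u \<in> borel_measurable lebesgue" and gm: "g \<in> borel_measurable lebesgue" and \<phi>m: "\<phi> \<in> borel_measurable lebesgue"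
  using u g S\<phi> by (auto simp: square_integrable_def)
 have i1: "integrable lebesgue (%x. u x *\<^sub>R G x)"
 proof (rule integrableI_Basis)
  show "integrable lebesgue (%x. (u x *\<^sub>R G x) \<bullet> b)" if "b \<in> Basis" for b
   using square_integrable_mult_integrable[OF u SG] by simp
 qed
 have i2: "integrable lebesgue (%x. \<phi> x *\<^sub>R g x)"
 proof (rule integrableI_Basis)
  show "integrable lebesgue (%x. (\<phi> x *\<^sub>R g x) \<bullet> b)" if "b \<in> Basis" for b
   using square_integrable_mult_integrable[OF S\<phi> square_integrable_component[OF g that]] by simp
 qed
 have "(LINT x|lebesgue. u x *\<^sub>R G x) = - (LINT x|lebesgue. \<phi> x *\<^sub>R g x)"
  using wg t by (simp add: weak_gradient_def test_fun_def)
 then have "(LINT x|lebesgue. u x *\<^sub>R G x) \<bullet> b = - ((LINT x|lebesgue. \<phi> x *\<^sub>R g x) \<bullet> b)" by simp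
 then have "(LINT x|lebesgue. u x * (G x \<bullet> b)) = - (LINT x|lebesgue. \<phi> x * (g x \<bullet> b))"
  using i1 i2 by (simp add: integral_inner_left[symmetric])
 then have "lmk u \<bullet> lmk (%x. G x \<bullet> b) = - (lmk \<phi> \<bullet> lmk (%x. g x \<bullet> b))"
  by (simp add: inner_lmk[OF u SG] inner_lmk[OF S\<phi> square_integrable_component[OF g b]])
 then show "lmk u \<bullet> mk (%x. G x \<bullet> b) = - (lmk (%x. g x \<bullet> b) \<bullet> mk \<phi>)"
  by (simp only: lmk_mk[OF s\<phi>] lmk_mk[OF sG] inner_commute[of "mk \<phi>"])
qed

lemma schroedinger_weak_form:
 fixes V :: "'a::euclidean_space => real" and F :: "'a l2"
 assumes "schroedinger V (fn F) h"
 shows "EX D. wgrad F D & integrable lebesgue (%x. V x * (fn F x)\<^sup>2) &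
   (ALL v E. wgrad v E --> integrable lebesgue (%x. V x * (fn v x)\<^sup>2) -->
    (\<Sum>b\<in>Basis. D b \<bullet> E b) + (LINT x|lebesgue. V x * fn F x * fn v x) = lmk h \<bullet> v)"
proof -
 obtain g where g: "form_domain V (fn F) g"
  and weak: "!!v k. form_domain V v k ==>
    (LINT x|lebesgue. g x \<bullet> k x) + (LINT x|lebesgue. V x * fn F x * v x) = (LINT x|lebesgue. h x * v x)"
  and h: "square_integrable h"
  using assms by (auto simp: schroedinger_def)
 have sg: "square_integrable g" using g by (simp add: form_domain_def)
 let ?D = "%b. lmk (%x. g x \<bullet> b)"
 have "(\<Sum>b\<in>Basis. ?D b \<bullet> E b) + (LINT x|lebesgue. V x * fn F x * fn v x) = lmk h \<bullet> v"
  if v: "wgrad v E" "integrable lebesgue (%x. V x * (fn v x)\<^sup>2)" for v E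
 proof -
  let ?k = "%x. \<Sum>b\<in>Basis. fn (E b) x *\<^sub>R b"
  have "(LINT x|lebesgue. g x \<bullet> ?k x) = (LINT x|lebesgue. (\<Sum>b\<in>Basis. (g x \<bullet> b) * fn (E b) x))"
   by (simp add: inner_sum_right mult.commute)
  also have "... = (\<Sum>b\<in>Basis. LINT x|lebesgue. (g x \<bullet> b) * fn (E b) x)"
   by (rule Bochner_Integration.integral_sum) (intro square_integrable_mult_integrable square_integrable_component sg square_integrable_fn)
  also have "... = (\<Sum>b\<in>Basis. ?D b \<bullet> E b)"
   by (rule sum.cong[OF refl]) (use inner_lmk[OF square_integrable_component[OF sg] square_integrable_fn] in simp)
  finally show ?thesis
   using weak[OF form_domain_of_wgrad[OF v]] inner_lmk[OF h square_integrable_fn, of v] by simp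
 qed
 moreover have "wgrad F ?D" using wgrad_of_form_domain[OF g] by simp
 moreover have "integrable lebesgue (%x. V x * (fn F x)\<^sup>2)" using g by (simp add: form_domain_def)
 ultimately show ?thesis by blast
qed

subsection \<open>The semigroup\<close>

locale schroedinger_flow =
 fixes V :: "'a::euclidean_space => real" and S :: "real => ('a => real) => 'a => real"
 assumes V_nonneg: "0 <= V x" and V_measurable: "V \<in> borel_measurable lebesgue"
  and flow: "schroedinger_semigroup V S"
begin

lemma S_square_integrable: "0 <= t ==> square_integrable f ==> square_integrable (S t f)"
 by (rule flow[unfolded schroedinger_semigroup_def, THEN conjunct1, rule_format])

lemma S_linear: "0 <= t ==> square_integrable f ==> square_integrable g ==>
  AE x. S t (%y. c * f y + g y) x = c * S t f x + S t g x"
 by (rule flow[unfolded schroedinger_semigroup_def, THEN conjunct2, THEN conjunct1, rule_format, unfolded AE_lebesgue_iff, OF _ conjI])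

lemma S_bounded: "0 <= t ==> EX M. ALL f. square_integrable f --> l2norm (S t f) <= M * l2norm f"
 by (rule flow[unfolded schroedinger_semigroup_def, THEN conjunct2, THEN conjunct2, THEN conjunct1, THEN spec, THEN mp])

lemma S_zero: "square_integrable f ==> AE x. S 0 f x = f x"
 by (rule flow[unfolded schroedinger_semigroup_def, THEN conjunct2, THEN conjunct2, THEN conjunct2, THEN conjunct1, rule_format, unfolded AE_lebesgue_iff])

lemma S_add: "0 <= s ==> 0 <= t ==> square_integrable f ==> AE x. S (s + t) f x = S s (S t f) x"
 by (rule flow[unfolded schroedinger_semigroup_def, THEN conjunct2, THEN conjunct2, THEN conjunct2, THEN conjunct2, THEN conjunct1, rule_format, unfolded AE_lebesgue_iff])

lemma S_continuous: "square_integrable f ==> ((%t. l2norm (%x. S t f x - f x)) \<longlongrightarrow> 0) (at_right 0)"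
 by (rule flow[unfolded schroedinger_semigroup_def, THEN conjunct2, THEN conjunct2, THEN conjunct2, THEN conjunct2, THEN conjunct2, THEN conjunct1, rule_format])

lemma S_generator:
 "square_integrable u ==> square_integrable h ==> schroedinger V u h \<longleftrightarrow>
   ((%t. l2norm (%x. (S t u x - u x) / t - (- h x))) \<longlongrightarrow> 0) (at_right 0)"
 by (rule flow[unfolded schroedinger_semigroup_def, THEN conjunct2, THEN conjunct2, THEN conjunct2, THEN conjunct2, THEN conjunct2, THEN conjunct2, rule_format, OF conjI])

definition Sop :: "real => 'a l2 => 'a l2" where "Sop t F = lmk (S t (fn F))"

lemma lmk_S_linear:
 assumes "0 <= t" "square_integrable f" "square_integrable g"
 shows "lmk (S t (%y. c * f y + g y)) = c *\<^sub>R lmk (S t f) + lmk (S t g)"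
proof -
 have "lmk (S t (%y. c * f y + g y)) = lmk (%x. c * S t f x + S t g x)"
  by (intro lmk_eqI S_linear S_square_integrable square_integrable_linear assms)
 then show ?thesis by (simp add: square_integrable_linear S_square_integrable assms)
qed

text \<open>The hypotheses on the semigroup speak about functions, not classes. Linearity applied to
  \<open>g - f\<close>, a function of norm zero, and boundedness make the action independent of the
  representative.\<close>

lemma lmk_S_cong:
 assumes t: "0 <= t" and f: "square_integrable f" and g: "square_integrable g" and ae: "AE x. f x = g x"
 shows "lmk (S t f) = lmk (S t g)"
proof -
 let ?d = "%y. (-1) * f y + g y"
 have d: "square_integrable ?d" by (rule square_integrable_linear(1)[OF f g])
 have "lmk ?d = (-1) *\<^sub>R lmk f + lmk g" by (rule square_integrable_linear(2)[OF f g])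
 also have "... = 0" using lmk_eqI[OF f g ae] by simp
 finally have "l2norm ?d = 0" unfolding l2norm_lmk[OF d] by simp
 moreover obtain M where "l2norm (S t ?d) <= M * l2norm ?d" using S_bounded[OF t] d by blast
 ultimately have "norm (lmk (S t ?d)) <= 0" unfolding l2norm_lmk[OF S_square_integrable[OF t d]] by (simp only: mult_zero_right)
 then have "(-1) *\<^sub>R lmk (S t f) + lmk (S t g) = 0"
  using lmk_S_linear[OF t f g, of "-1"] by simp
 then show ?thesis by simp
qed

lemma Sop_lmk: "0 <= t ==> square_integrable f ==> Sop t (lmk f) = lmk (S t f)"
 unfolding Sop_def by (intro lmk_S_cong square_integrable_fn fn_lmk)

lemma Sop_linear:
 assumes t: "0 <= t" shows "Sop t (c *\<^sub>R F + G) = c *\<^sub>R Sop t F + Sop t G"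
proof -
 have "Sop t (lmk (%y. c * fn F y + fn G y)) = lmk (S t (%y. c * fn F y + fn G y))"
  by (intro Sop_lmk t square_integrable_linear square_integrable_fn)
 then show ?thesis
  by (simp add: square_integrable_linear lmk_S_linear t square_integrable_fn Sop_def[symmetric])
qed

lemma bounded_linear_Sop:
 assumes t: "0 <= t" shows "bounded_linear (Sop t)"
proof -
 obtain M where M: "!!f. square_integrable f ==> l2norm (S t f) <= M * l2norm f" using S_bounded[OF t] by blast
 have z: "Sop t 0 = 0" using Sop_linear[OF t, of "-1" 0 0] by simp
 show ?thesis
 proof (rule bounded_linear_intro[where K = M])
  fix F G :: "'a l2" and c
  show "Sop t (F + G) = Sop t F + Sop t G" using Sop_linear[OF t, of 1 F G] by simp
  show "Sop t (c *\<^sub>R F) = c *\<^sub>R Sop t F" using Sop_linear[OF t, of c F 0] z by simp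
  show "norm (Sop t F) <= norm F * M"
   using M[OF square_integrable_fn, of F]
   by (simp add: l2norm_lmk S_square_integrable t square_integrable_fn Sop_def mult.commute)
 qed
qed

sublocale sg: c0_semigroup Sop
proof (rule c0_semigroup.intro)
 show "Sop 0 F = F" for F
  unfolding Sop_def by (rule lmk_unique[OF S_square_integrable[OF order_refl square_integrable_fn]])
   (use S_zero[OF square_integrable_fn, of F] in eventually_elim, simp)
next
 fix s t :: real and F :: "'a l2" assume st: "0 <= s" "0 <= t"
 have "Sop s (Sop t F) = lmk (S s (S t (fn F)))"
  unfolding Sop_def[of t] by (intro Sop_lmk st S_square_integrable square_integrable_fn)
 also have "... = lmk (S (s + t) (fn F))"
  by (rule lmk_eqI) (use S_add[OF st square_integrable_fn, of F] st in \<open>auto intro!: S_square_integrable square_integrable_fn\<close>)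
 finally show "Sop (s + t) F = Sop s (Sop t F)" by (simp add: Sop_def)
next
 fix F :: "'a l2"
 have "\<forall>\<^sub>F t in at_right 0. l2norm (%x. S t (fn F) x - fn F x) = norm (Sop t F - F)"
  unfolding eventually_at_right_field
 proof (intro exI[of _ 1] conjI allI impI)
  fix t :: real assume "0 < t"
  then have t: "0 <= t" by simp
  have g: "square_integrable (%x. S t (fn F) x - fn F x)" "lmk (%x. S t (fn F) x - fn F x) = Sop t F - F"
   using square_integrable_linear[OF square_integrable_fn[of F] S_square_integrable[OF t square_integrable_fn[of F]], of "-1"]
   by (simp_all add: Sop_def)
  then show "l2norm (%x. S t (fn F) x - fn F x) = norm (Sop t F - F)" by (simp add: l2norm_lmk)
 qed simp
 from Lim_transform_eventually[OF S_continuous[OF square_integrable_fn] this]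
 show "((%t. Sop t F) \<longlongrightarrow> F) (at_right 0)" by (simp add: tendsto_norm_zero_iff LIM_zero_iff)
qed (rule bounded_linear_Sop)

lemma gen_schroedinger:
 assumes "sg.gen F Y" shows "schroedinger V (fn F) (fn (- Y))"
proof -
 have "\<forall>\<^sub>F t in at_right 0. norm ((Sop t F - F) /\<^sub>R t - Y) = l2norm (%x. (S t (fn F) x - fn F x) / t - (- fn (- Y) x))"
  unfolding eventually_at_right_field
 proof (intro exI[of _ 1] conjI allI impI)
  fix t :: real assume "0 < t"
  then have t: "0 <= t" by simp
  let ?g = "%x. (-1) * fn F x + S t (fn F) x"
  have g: "square_integrable ?g" "lmk ?g = Sop t F - F"
   using square_integrable_linear[OF square_integrable_fn[of F] S_square_integrable[OF t square_integrable_fn[of F]], of "-1"]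
   by (simp_all add: Sop_def)
  let ?h = "%x. inverse t * ?g x + fn (- Y) x"
  have h: "square_integrable ?h" "lmk ?h = (Sop t F - F) /\<^sub>R t - Y"
   using square_integrable_linear[OF g(1) square_integrable_fn[of "- Y"], of "inverse t"] g(2) by simp_all
  have "(%x. (S t (fn F) x - fn F x) / t - (- fn (- Y) x)) = ?h" by (simp add: fun_eq_iff divide_inverse algebra_simps)
  then show "norm ((Sop t F - F) /\<^sub>R t - Y) = l2norm (%x. (S t (fn F) x - fn F x) / t - (- fn (- Y) x))"
   using h by (simp only: l2norm_lmk)
 qed simp
 moreover have "((%t. norm ((Sop t F - F) /\<^sub>R t - Y)) \<longlongrightarrow> 0) (at_right 0)"
  using assms unfolding sg.gen_def by (simp add: tendsto_norm_zero_iff LIM_zero_iff)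
 ultimately have "((%t. l2norm (%x. (S t (fn F) x - fn F x) / t - (- fn (- Y) x))) \<longlongrightarrow> 0) (at_right 0)"
  by (rule Lim_transform_eventually[rotated])
 then show ?thesis using S_generator[OF square_integrable_fn square_integrable_fn] by blast
qed

text \<open>The equation in the form used for comparison: \<open>Y\<close> is minus the Schroedinger
  operator applied to \<open>F\<close>, whence the signs.\<close>

lemma gen_weak_form:
 assumes "sg.gen F Y"
 shows "EX D. wgrad F D & integrable lebesgue (%x. V x * (fn F x)\<^sup>2) &
   (ALL v E. wgrad v E --> integrable lebesgue (%x. V x * (fn v x)\<^sup>2) -->
    Y \<bullet> v = - (\<Sum>b\<in>Basis. D b \<bullet> E b) - (LINT x|lebesgue. V x * fn F x * fn v x))"
proof -
 obtain D where D: "wgrad F D" "integrable lebesgue (%x. V x * (fn F x)\<^sup>2)"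
  and w: "!!v E. wgrad v E ==> integrable lebesgue (%x. V x * (fn v x)\<^sup>2) ==>
    (\<Sum>b\<in>Basis. D b \<bullet> E b) + (LINT x|lebesgue. V x * fn F x * fn v x) = lmk (fn (- Y)) \<bullet> v"
  using schroedinger_weak_form[OF gen_schroedinger[OF assms]] by blast
 have "Y \<bullet> v = - (\<Sum>b\<in>Basis. D b \<bullet> E b) - (LINT x|lebesgue. V x * fn F x * fn v x)"
  if "wgrad v E" "integrable lebesgue (%x. V x * (fn v x)\<^sup>2)" for v E
  using w[OF that] by (simp only: lmk_fn inner_minus_left)
 with D show ?thesis by blast
qed

end

section \<open>Parabolic comparison\<close>

lemma AE_balls:
 fixes x :: "'a::euclidean_space"
 assumes "!!i. AE y. y \<in> ball x (r + real i) --> P y" shows "AE y. P y"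
proof -
 have "AE y. ALL i. y \<in> ball x (r + real i) --> P y" unfolding AE_all_countable using assms by blast
 then show ?thesis
 proof eventually_elim
  case (elim y)
  obtain i where "dist x y - r < real i" using reals_Archimedean2 by blast
  with elim[rule_format, of i] show ?case by simp
 qed
qed

lemma fn_ppart_zero: "AE x. fn (ppart 0 F) x = max 0 (fn F x)"
 using fn_ppart[of 0 F] by simp

lemma heat_nonneg: "t > 0 ==> 0 <= heat t x"
 by (rule less_imp_le[OF heat_pos])

lemma heat_op_ge:
 assumes "t >= 0" "AE x. a <= fn F x" shows "AE x. a <= fn (heat_op t F) x"
proof (cases "t = 0")
 case False
 then have t: "t > 0" using assms by simp
 note m = sqi_measurable[OF sqi_fn[of F]]
 have "(LBINT y. heat t (x - y) * a) <= conv (heat t) (fn F) x" for x unfolding conv_def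
  by (rule integral_mono_AE)
    (use integrable_lborel_diff(1)[OF integrable_heat[OF t]] heat_conv_integrable[OF t sqi_fn[of F], of x] assms(2) heat_nonneg[OF t]
    in \<open>auto elim!: eventually_mono intro!: mult_left_mono\<close>)
 moreover have "(LBINT y. heat t (x - y)) = 1" for x :: 'a
  using integral_lborel_diff(1)[of "heat t" x] integral_heat[OF t, where 'a = 'a] by simp
 ultimately have "a <= conv (heat t) (fn F) x" for x by simp
 then show ?thesis using fn_heat_op[OF t, of F] by (auto elim!: eventually_mono)
qed (use assms in \<open>simp add: heat_op_def[of 0]\<close>)

lemma heat_op_le:
 assumes "t >= 0" "AE x. fn F x <= a" shows "AE x. fn (heat_op t F) x <= a"
proof -
 have "heat_op t (- F) = - heat_op t F" using heat_op_scale[OF assms(1), of "-1" F] by simp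
 moreover have "AE x. - a <= fn (- F) x" using assms(2) fn_uminus[of F] by eventually_elim simp
 ultimately have "AE x. - a <= fn (- heat_op t F) x" using heat_op_ge[OF assms(1), of "- a" "- F"] by simp
 then show ?thesis using fn_uminus[of "heat_op t F"] by eventually_elim simp
qed

text \<open>Normal contractions do not increase the energy: here the truncation \<open>W \<mapsto> max 0 (W - c)\<close>.\<close>

lemma heat_energy_ppart:
 assumes c: "0 <= c" and k: "0 < k" and L: "L = W - ppart c W"
 shows "0 <= (L - heat_op k L) \<bullet> ppart c W"
proof -
 have l: "AE x. fn L x = min (fn W x) c"
  using fn_diff[of W "ppart c W"] fn_ppart[OF c, of W] unfolding L by eventually_elim auto
 then have "AE x. fn L x <= c" by eventually_elim simp
 from heat_op_le[OF less_imp_le[OF k] this]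
 have "AE x. 0 <= fn (L - heat_op k L) x * fn (ppart c W) x"
  using l fn_ppart[OF c, of W] fn_diff[of L "heat_op k L"]
 proof eventually_elim
  case (elim x) then show ?case by (cases "fn W x <= c") auto
 qed
 then show ?thesis unfolding inner_l2_def by (rule integral_nonneg_AE)
qed

lemma heat_energy_nonneg: "0 < k ==> 0 <= (u - heat_op k u) \<bullet> u"
 using norm_cauchy_schwarz[of "heat_op k u" u] mult_right_mono[OF norm_heat_op_le[of k u] norm_ge_zero[of u]]
 by (simp add: inner_diff_left power2_norm_eq_inner[symmetric] power2_eq_square)

lemma heat_energy_sum:
 assumes k: "0 < k"
 shows "(u + v - heat_op k (u + v)) \<bullet> (u + v)
  = (u - heat_op k u) \<bullet> u + (v - heat_op k v) \<bullet> v + 2 * ((u - heat_op k u) \<bullet> v)"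
 using heat_op_adjoint[OF k, of v u] k
 by (simp add: heat.apply_simps inner_diff_left inner_diff_right inner_add_left inner_add_right inner_commute)

text \<open>The integral of a curve in the Hilbert space cannot be evaluated pointwise. The
  inequality is instead paired with the indicator of the part of a ball where it fails, and that
  part turns out to be null.\<close>

lemma integral_l2_AE_le:
 fixes X :: "real => 'a::euclidean_space l2"
 assumes ab: "a <= b" and X: "continuous_on {a..b} X" and [measurable]: "h \<in> Borel"
  and H: "!!x. \<bar>h x\<bar> <= H" and le: "!!s. s \<in> {a..b} ==> AE x. fn (X s) x <= h x"
 shows "AE x. fn (integral {a..b} X) x <= (b - a) * h x"
proof -
 let ?I = "integral {a..b} X"
 have int: "X integrable_on {a..b}" by (rule integrable_continuous_real[OF X])
 have "AE x. x \<in> ball 0 (real n) --> fn ?I x <= (b - a) * h x" for n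
 proof -
  define A where "A = ball 0 (real n) \<inter> {x. (b - a) * h x < fn ?I x}"
  have [measurable]: "A \<in> sets borel" unfolding A_def by simp
  have fin: "emeasure lborel A < \<infinity>"
   by (rule emeasure_bounded_finite) (auto simp: A_def intro: bounded_subset[OF bounded_ball])
  have sA: "sqi (indicator A :: 'a => real)" by (rule sqi_indicator) (use fin in auto)
  have inA: "F \<bullet> mk (indicator A) = (LBINT x. fn F x * indicator A x)" for F :: "'a l2"
   by (rule l2_inner_eq) (use fn_mk[OF sA] in auto)
  have ih: "integrable lborel (%x. h x * indicator A x)"
  proof (rule Bochner_Integration.integrable_bound)
   show "integrable lborel (%x. H * indicator A x :: real)" using fin by simp
   show "AE x. norm (h x * indicator A x) <= norm (H * indicator A x :: real)"
    using H by (auto simp: abs_mult indicator_def intro!: AE_I2 order_trans[OF H abs_ge_self])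
  qed simp
  let ?J = "LBINT x. h x * indicator A x"
  have "((%s. X s \<bullet> mk (indicator A)) has_integral (?I \<bullet> mk (indicator A))) {a..b}"
   using has_integral_linear[OF integrable_integral[OF int] bounded_linear_inner_left[of "mk (indicator A)"]]
   by (simp add: comp_def)
  moreover have "((%s. ?J) has_integral ((b - a) * ?J)) {a..b}"
   using has_integral_const_real[of ?J a b] ab by simp
  moreover have "X s \<bullet> mk (indicator A) <= ?J" if "s \<in> {a..b}" for s
   unfolding inA
  proof (rule integral_mono_AE)
   show "AE x. fn (X s) x * indicator A x <= h x * indicator A x"
    using le[OF that] by eventually_elim (auto simp: indicator_def)
  qed (use ih sqi_integrable_mult[OF sqi_fn sA] in auto)
  ultimately have le1: "?I \<bullet> mk (indicator A) <= (b - a) * ?J" by (rule has_integral_le)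
  have i0: "integrable lborel (%x. fn ?I x * indicator A x - (b - a) * (h x * indicator A x))"
   using ih sqi_integrable_mult[OF sqi_fn sA] by auto
  have "(LBINT x. fn ?I x * indicator A x - (b - a) * (h x * indicator A x)) <= 0"
   using le1 ih sqi_integrable_mult[OF sqi_fn[of ?I] sA] unfolding inA by simp
  moreover have pos: "0 <= fn ?I x * indicator A x - (b - a) * (h x * indicator A x)" for x
   by (auto simp: indicator_def A_def)
  ultimately have "(LBINT x. fn ?I x * indicator A x - (b - a) * (h x * indicator A x)) = 0"
   using integral_nonneg_AE[of "%x. fn ?I x * indicator A x - (b - a) * (h x * indicator A x)" lborel] by (simp add: pos order_antisym)
  then have "AE x. fn ?I x * indicator A x - (b - a) * (h x * indicator A x) = 0"
   using integral_nonneg_eq_0_iff_AE[OF i0] pos by auto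
  then show ?thesis
  proof eventually_elim
   case (elim x)
   show ?case
   proof
    assume x: "x \<in> ball 0 (real n)"
    show "fn ?I x <= (b - a) * h x"
    proof (rule ccontr)
     assume "~ fn ?I x <= (b - a) * h x"
     then have "(b - a) * h x < fn ?I x" by simp
     with x have "x \<in> A" by (simp add: A_def)
     with elim \<open>(b - a) * h x < fn ?I x\<close> show False by simp
    qed
   qed
  qed
 qed
 then show ?thesis by - (rule AE_balls[of 0 0], simp)
qed

lemma integral_l2_AE_ge:
 fixes X :: "real => 'a::euclidean_space l2"
 assumes ab: "a <= b" and X: "continuous_on {a..b} X" and [measurable]: "h \<in> Borel"
  and H: "!!x. \<bar>h x\<bar> <= H" and ge: "!!s. s \<in> {a..b} ==> AE x. h x <= fn (X s) x"
 shows "AE x. (b - a) * h x <= fn (integral {a..b} X) x"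
proof -
 have "AE x. fn (integral {a..b} (%s. - X s)) x <= (b - a) * (- h x)"
 proof (rule integral_l2_AE_le[OF ab])
  show "continuous_on {a..b} (%s. - X s)" by (intro continuous_intros X)
  show "AE x. fn (- X s) x <= - h x" if "s \<in> {a..b}" for s
   using ge[OF that] fn_uminus[of "X s"] by eventually_elim simp
 qed (use H in auto)
 then have "AE x. fn (- integral {a..b} X) x <= (b - a) * (- h x)" by simp
 with fn_uminus[of "integral {a..b} X"] show ?thesis by eventually_elim simp
qed

context schroedinger_flow
begin

lemma V_mult_integrable:
 assumes u: "integrable lebesgue (%x. V x * (fn u x)\<^sup>2)" and le: "AE x. \<bar>fn \<phi> x\<bar> <= \<bar>fn u x\<bar>"
 shows "integrable lebesgue (%x. V x * (fn \<phi> x)\<^sup>2)" "integrable lebesgue (%x. V x * fn u x * fn \<phi> x)"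
proof -
 note [measurable] = V_measurable lborel_lebesgue_measurable[OF fn_measurable]
 show "integrable lebesgue (%x. V x * (fn \<phi> x)\<^sup>2)"
 proof (rule Bochner_Integration.integrable_bound[OF u])
  show "AE x in lebesgue. norm (V x * (fn \<phi> x)\<^sup>2) <= norm (V x * (fn u x)\<^sup>2)"
   unfolding AE_lebesgue_iff using le
   by eventually_elim (auto simp: abs_mult V_nonneg abs_le_square_iff intro!: mult_left_mono)
 qed measurable
 show "integrable lebesgue (%x. V x * fn u x * fn \<phi> x)"
 proof (rule Bochner_Integration.integrable_bound[OF u])
  show "AE x in lebesgue. norm (V x * fn u x * fn \<phi> x) <= norm (V x * (fn u x)\<^sup>2)"
   unfolding AE_lebesgue_iff using le
  proof eventually_elim
   case (elim x)
   have "\<bar>fn u x\<bar> * \<bar>fn \<phi> x\<bar> <= \<bar>fn u x\<bar> * \<bar>fn u x\<bar>" using elim by (rule mult_left_mono) simp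
   then have "V x * (\<bar>fn u x\<bar> * \<bar>fn \<phi> x\<bar>) <= V x * (\<bar>fn u x\<bar> * \<bar>fn u x\<bar>)" by (rule mult_left_mono[OF _ V_nonneg])
   then show ?case by (simp add: abs_mult power2_eq_square V_nonneg mult.assoc)
  qed
 qed measurable
qed

text \<open>Half the squared norm of \<open>\<phi> = ppart c (Sop t f - v t)\<close> has derivative
  \<open>(Sop t Y - v' t) \<bullet> \<phi>\<close>. The condition \<open>dom\<close> and an energy
  bound make \<open>\<phi>\<close> admissible in the weak equation; the truncation inequality for
  the heat energy together with \<open>super\<close> then makes the derivative nonpositive. The
  curve \<open>v\<close> enters only through the heat generator.\<close>

lemma comparison:
 assumes c: "0 <= c" and T: "0 < T" and f: "sg.gen f Y"
  and v: "continuous_on {0..T} v" "!!t. 0 < t ==> t < T ==> (v has_vector_derivative v' t) (at t)"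
  and Z: "!!t. 0 < t ==> t < T ==> heat.gen (v t) (Z t)"
  and dom: "!!t. 0 < t ==> t < T ==> AE x. \<bar>fn (ppart c (Sop t f - v t)) x\<bar> <= \<bar>fn (Sop t f) x\<bar>"
  and super: "!!t \<phi>. 0 < t ==> t < T ==> \<phi> = ppart c (Sop t f - v t) ==>
    integrable lebesgue (%x. V x * fn (Sop t f) x * fn \<phi> x) ==>
    (Z t - v' t) \<bullet> \<phi> <= (LINT x|lebesgue. V x * fn (Sop t f) x * fn \<phi> x)"
 shows "norm (ppart c (Sop T f - v T)) <= norm (ppart c (f - v 0))"
proof -
 let ?y = "%t. Sop t f - v t"
 let ?G = "%t. (norm (ppart c (?y t)))\<^sup>2 / 2"
 have cont: "continuous_on {0..T} ?G"
 proof -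
  have "continuous_on {0..T} ?y"
   by (intro continuous_intros v(1) continuous_on_subset[OF sg.continuous]) auto
  then have "continuous_on {0..T} (%t. ppart c (?y t))"
   unfolding continuous_on_def using tendsto_ppart[OF _ c] by blast
  then show ?thesis by (intro continuous_intros) auto
 qed
 have "?G T <= ?G 0"
 proof (rule DERIV_nonpos_imp_decreasing_open[OF less_imp_le[OF T] _ cont])
  fix t assume t: "0 < t" "t < T"
  let ?u = "Sop t f"
  let ?\<phi> = "ppart c (?y t)"
  obtain D where D: "wgrad ?u D" and Vu: "integrable lebesgue (%x. V x * (fn ?u x)\<^sup>2)"
   and weak: "!!w E. wgrad w E ==> integrable lebesgue (%x. V x * (fn w x)\<^sup>2) ==>
    Sop t Y \<bullet> w = - (\<Sum>b\<in>Basis. D b \<bullet> E b) - (LINT x|lebesgue. V x * fn ?u x * fn w x)"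
   using gen_weak_form[OF sg.gen_invariant[OF f less_imp_le[OF t(1)]]] by blast
  let ?e = "%k u v. ((u - heat_op k u) \<bullet> v) / k"
  have Zt: "((%k. ?e k (v t) w) \<longlongrightarrow> - (Z t \<bullet> w)) (at_right 0)" for w
   using tendsto_minus[OF tendsto_inner[OF Z[OF t, unfolded heat.gen_def] tendsto_const, of w]]
   by (simp add: inner_diff_left divide_inverse algebra_simps)
  have pos: "\<forall>\<^sub>F k in at_right (0::real). 0 < k" by (simp add: eventually_at_right_less)
  let ?C = "2 * (\<Sum>b\<in>Basis. D b \<bullet> D b) + 2 * - (Z t \<bullet> v t)"
  have "((%k. 2 * ?e k ?u ?u + 2 * ?e k (v t) (v t)) \<longlongrightarrow> ?C) (at_right 0)"
   by (intro tendsto_add tendsto_mult tendsto_const heat_dirichlet_form[OF D D] Zt)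
  then have "\<forall>\<^sub>F k in at_right 0. 2 * ?e k ?u ?u + 2 * ?e k (v t) (v t) < ?C + 1"
   by (rule order_tendstoD) simp
  \<comment> \<open>Truncation lowers the energy of \<open>Sop t f - v t\<close>, which is at most
    twice the sum of the separate energies, and those converge. The bound lets
    \<open>wgrad_of_energy\<close> equip the truncation with a weak gradient.\<close>
  with pos have "\<forall>\<^sub>F k in at_right 0. ?e k ?\<phi> ?\<phi> <= ?C + 1"
  proof eventually_elim
   case (elim k)
   note s = heat_energy_sum[OF elim(1)] and n = heat_energy_nonneg[OF elim(1)]
   have "(?\<phi> - heat_op k ?\<phi>) \<bullet> ?\<phi> <= (?y t - heat_op k (?y t)) \<bullet> ?y t"
    using s[of "?y t - ?\<phi>" ?\<phi>] n[of "?y t - ?\<phi>"] heat_energy_ppart[OF c elim(1) refl, of "?y t"] by simp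
   also have "... <= 2 * ((?u - heat_op k ?u) \<bullet> ?u) + 2 * ((v t - heat_op k (v t)) \<bullet> v t)"
    using s[of ?u "v t"] s[of ?u "- v t"] n[of "?u + v t"] elim(1) heat_op_scale[of k "-1" "v t"]
     inner_minus_left[of "v t - heat_op k (v t)" "v t"] by (simp add: heat.apply_simps)
   finally have "?e k ?\<phi> ?\<phi> <= (2 * ((?u - heat_op k ?u) \<bullet> ?u) + 2 * ((v t - heat_op k (v t)) \<bullet> v t)) / k"
    using elim(1) by (intro divide_right_mono) auto
   then show ?case using elim(2) by (simp add: add_divide_distrib)
  qed
  from wgrad_of_energy[OF this] obtain E where E: "wgrad ?\<phi> E" by blast
  note dom' = dom[OF t]
  \<comment> \<open>The limit of the nonnegative energy of \<open>Sop t f - v t\<close> against its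
    own truncation; the contribution of \<open>v\<close> converges through its heat
    generator.\<close>
  have "0 <= (\<Sum>b\<in>Basis. D b \<bullet> E b) - - (Z t \<bullet> ?\<phi>)"
  proof (rule tendsto_lowerbound)
   show "((%k. ?e k ?u ?\<phi> - ?e k (v t) ?\<phi>) \<longlongrightarrow> (\<Sum>b\<in>Basis. D b \<bullet> E b) - - (Z t \<bullet> ?\<phi>)) (at_right 0)"
    by (intro tendsto_diff heat_dirichlet_form[OF D E] Zt)
   show "\<forall>\<^sub>F k in at_right 0. 0 <= ?e k ?u ?\<phi> - ?e k (v t) ?\<phi>"
    using pos
   proof eventually_elim
    case (elim k)
    have "0 <= (?y t - heat_op k (?y t)) \<bullet> ?\<phi>"
     using heat_energy_ppart[OF c elim refl, of "?y t"] heat_energy_nonneg[OF elim, of ?\<phi>] elim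
     by (simp add: heat.apply_simps inner_diff_left)
    then show ?case using elim by (simp add: heat.apply_simps inner_diff_left diff_divide_distrib[symmetric])
   qed
  qed simp
  then have "(Sop t Y - v' t) \<bullet> ?\<phi> <= 0"
   using weak[OF E V_mult_integrable(1)[OF Vu dom']] super[OF t refl V_mult_integrable(2)[OF Vu dom']]
   by (simp add: inner_diff_left)
  moreover have "(?G has_real_derivative (Sop t Y - v' t) \<bullet> ?\<phi>) (at t)"
  proof -
   have "(?y has_vector_derivative (Sop t Y - v' t)) (at t)"
    by (intro has_vector_derivative_diff sg.gen_has_vector_derivative[OF f] v(2) t)
   then have "(?y has_derivative (%h. h *\<^sub>R (Sop t Y - v' t))) (at t)" by (simp add: has_vector_derivative_def)
   from has_derivative_compose[OF this has_derivative_half_norm_ppart_sq[OF c]]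
   have "((%t. (norm (ppart c (?y t)))\<^sup>2 / 2) has_derivative (%h. (h *\<^sub>R (Sop t Y - v' t)) \<bullet> ?\<phi>)) (at t)" .
   then show ?thesis
    unfolding has_field_derivative_def inner_scaleR_left mult.commute[of "(Sop t Y - v' t) \<bullet> ?\<phi>"] .
  qed
  ultimately show "EX z. (?G has_real_derivative z) (at t) & z <= 0" by (intro exI conjI) auto
 qed
 then show ?thesis by (simp add: sg.zero power2_le_iff_abs_le)
qed

subsection \<open>Domination by the heat semigroup\<close>

lemma heat_tint_nonneg:
 assumes "AE x. 0 <= fn F x" "0 <= t" shows "AE x. 0 <= fn (heat.tint t F) x"
proof -
 have "AE x. (t - 0) * (%x. 0) x <= fn (integral {0..t} (%s. heat_op s F)) x"
  by (rule integral_l2_AE_ge[where H = 0]) (use assms heat_op_ge[OF _ assms(1)] in \<open>auto intro!: continuous_on_subset[OF heat.continuous]\<close>)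
 then show ?thesis by (simp add: heat.tint_def)
qed

lemma heat_tint_le:
 assumes "AE x. fn F x <= a" "0 <= t" shows "AE x. fn (heat.tint t F) x <= t * a"
proof -
 have "AE x. fn (integral {0..t} (%s. heat_op s F)) x <= (t - 0) * (%x. a) x"
  by (rule integral_l2_AE_le[where H = "\<bar>a\<bar>"]) (use assms heat_op_le[OF _ assms(1)] in \<open>auto intro!: continuous_on_subset[OF heat.continuous]\<close>)
 then show ?thesis by (simp add: heat.tint_def)
qed

text \<open>Where the truncated difference is positive, \<open>Sop t f\<close> exceeds a nonnegative
  heat flow and is itself positive, so the potential term has the sign that
  \<open>comparison\<close> asks for.\<close>

lemma domination_smooth:
 assumes T: "0 < T" and f: "sg.gen f Y" and g: "heat.gen g Z" "AE x. 0 <= fn g x"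
 shows "norm (ppart 0 (Sop T f - heat_op T g)) <= norm (ppart 0 (f - g))"
proof -
 have phi: "AE x. fn (ppart 0 (Sop t f - heat_op t g)) x = max 0 (fn (Sop t f) x - fn (heat_op t g) x)" for t
  using fn_ppart_zero[of "Sop t f - heat_op t g"] fn_diff[of "Sop t f" "heat_op t g"] by eventually_elim simp
 have "norm (ppart 0 (Sop T f - heat_op T g)) <= norm (ppart 0 (f - heat_op 0 g))"
 proof (rule comparison[OF order_refl T f, where v' = "%t. heat_op t Z" and Z = "%t. heat_op t Z"])
  show "continuous_on {0..T} (%t. heat_op t g)" by (auto intro: continuous_on_subset[OF heat.continuous])
  fix t assume t: "0 < t" "t < T"
  note vnn = heat_op_ge[OF less_imp_le[OF t(1)] g(2)]
  show "((%t. heat_op t g) has_vector_derivative heat_op t Z) (at t)" by (rule heat.gen_has_vector_derivative[OF g(1) t(1)])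
  show "heat.gen (heat_op t g) (heat_op t Z)" by (rule heat.gen_invariant[OF g(1) less_imp_le[OF t(1)]])
  show "AE x. \<bar>fn (ppart 0 (Sop t f - heat_op t g)) x\<bar> <= \<bar>fn (Sop t f) x\<bar>"
   using phi[of t] vnn by eventually_elim auto
  have "AE x in lebesgue. 0 <= V x * fn (Sop t f) x * fn (ppart 0 (Sop t f - heat_op t g)) x"
   unfolding AE_lebesgue_iff using phi[of t] vnn
  proof eventually_elim
   case (elim x)
   then show ?case using V_nonneg[of x] by (cases "fn (Sop t f) x >= 0") auto
  qed
  then show "(heat_op t Z - heat_op t Z) \<bullet> \<phi> <= (LINT x|lebesgue. V x * fn (Sop t f) x * fn \<phi> x)"
   if "\<phi> = ppart 0 (Sop t f - heat_op t g)" for \<phi>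
   unfolding that using integral_nonneg_AE by simp
 qed
 then show ?thesis by (simp add: heat.zero)
qed

lemma ppart_tendsto_le:
 assumes "(X \<longlongrightarrow> A) (at_right (0::real))" "(Z \<longlongrightarrow> B) (at_right 0)" "0 <= c"
  and "!!h. h > 0 ==> norm (ppart c (X h)) <= norm (ppart c (Z h))"
 shows "norm (ppart c A) <= norm (ppart c B)"
proof (rule tendsto_le[OF trivial_limit_at_right_real])
 show "((%h. norm (ppart c (X h))) \<longlongrightarrow> norm (ppart c A)) (at_right 0)"
  by (intro tendsto_norm tendsto_ppart assms)
 show "((%h. norm (ppart c (Z h))) \<longlongrightarrow> norm (ppart c B)) (at_right 0)"
  by (intro tendsto_norm tendsto_ppart assms)
 show "\<forall>\<^sub>F h in at_right 0. norm (ppart c (X h)) <= norm (ppart c (Z h))"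
  using assms(4) by (auto simp: eventually_at_right_field intro!: exI[of _ 1])
qed

lemma gen_average: "h > 0 ==> sg.gen (sg.tint h f /\<^sub>R h) ((Sop h f - f) /\<^sub>R h)"
 by (intro sg.gen_scale sg.gen_tint) simp

text \<open>Orbit averages replace data outside the domains of the generators, and averaging keeps
  the majorant nonnegative. In the limit the right-hand norm vanishes because \<open>f\<close> lies
  below its positive part.\<close>

lemma Sop_le_heat:
 assumes T: "0 <= T" shows "AE x. fn (Sop T f) x <= fn (heat_op T (ppart 0 f)) x"
proof (cases "T = 0")
 case True
 have "AE x. fn f x <= fn (ppart 0 f) x" using fn_ppart_zero[of f] by eventually_elim simp
 then show ?thesis using True by (simp add: sg.zero heat.zero)
next
 case False
 then have T: "0 < T" using T by simp
 let ?g = "ppart 0 f"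
 have g: "AE x. 0 <= fn ?g x" using fn_ppart_zero[of f] by eventually_elim simp
 have "norm (ppart 0 (Sop T f - heat_op T ?g)) <= norm (ppart 0 (f - ?g))"
 proof (rule ppart_tendsto_le)
  show "((%h. Sop T (sg.tint h f /\<^sub>R h) - heat_op T (heat.tint h ?g /\<^sub>R h)) \<longlongrightarrow> Sop T f - heat_op T ?g) (at_right 0)"
   by (intro tendsto_diff bounded_linear.tendsto[OF sg.lin] bounded_linear.tendsto[OF heat.lin] sg.tint_average heat.tint_average) (use T in auto)
  show "((%h. sg.tint h f /\<^sub>R h - heat.tint h ?g /\<^sub>R h) \<longlongrightarrow> f - ?g) (at_right 0)"
   by (intro tendsto_diff sg.tint_average heat.tint_average)
  fix h :: real assume h: "h > 0"
  let ?f = "sg.tint h f /\<^sub>R h" and ?g' = "heat.tint h ?g /\<^sub>R h"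
  have g': "heat.gen ?g' ((heat_op h ?g - ?g) /\<^sub>R h)" using h by (intro heat.gen_scale heat.gen_tint) simp
  have g'': "AE x. 0 <= fn ?g' x"
   using heat_tint_nonneg[OF g less_imp_le[OF h]] fn_scale[of "inverse h" "heat.tint h ?g"] by eventually_elim (use h in simp)
  show "norm (ppart 0 (Sop T ?f - heat_op T ?g')) <= norm (ppart 0 (?f - ?g'))"
   by (rule domination_smooth[OF T gen_average[OF h] g' g''])
 qed simp
 moreover have "ppart 0 (f - ?g) = 0"
  unfolding ppart_eq_0_iff[OF order_refl] using fn_ppart_zero[of f] fn_diff[of f ?g] by eventually_elim simp
 ultimately have "ppart 0 (Sop T f - heat_op T ?g) = 0" by simp
 then have "AE x. fn (Sop T f - heat_op T ?g) x <= 0" by (simp add: ppart_eq_0_iff)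
 then show ?thesis using fn_diff[of "Sop T f" "heat_op T ?g"] by eventually_elim simp
qed

text \<open>Domination applied to \<open>- f\<close>, whose positive part is zero.\<close>

lemma Sop_nonneg:
 assumes "0 <= t" "AE x. 0 <= fn f x" shows "AE x. 0 <= fn (Sop t f) x"
proof -
 have "ppart 0 (- f) = 0"
  unfolding ppart_eq_0_iff[OF order_refl] using assms(2) fn_uminus[of f] by eventually_elim simp
 moreover have "heat_op t (0 :: 'a l2) = 0" by (rule heat.apply_simps(4)[OF assms(1)])
 moreover have "Sop t (- f) = - Sop t f" using sg.apply_simps(3)[OF assms(1), of "-1" f] by simp
 ultimately have "AE x. fn (- Sop t f) x <= fn 0 x"
  using Sop_le_heat[OF assms(1), of "- f"] by simp
 with fn_uminus[of "Sop t f"] fn_zero show ?thesis by eventually_elim simp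
qed

lemma Sop_le_const:
 assumes t: "0 <= t" and "AE x. fn f x <= a" "0 <= a" shows "AE x. fn (Sop t f) x <= a"
proof -
 have "AE x. fn (ppart 0 f) x <= a"
  using assms(2) fn_ppart_zero[of f] by eventually_elim (use assms(3) in simp)
 from heat_op_le[OF t this] Sop_le_heat[OF t, of f] show ?thesis by eventually_elim simp
qed

subsection \<open>Absorption by the potential\<close>

text \<open>The barrier is \<open>1 - \<epsilon> * heat.tint t Q\<close>, with source term
  \<open>\<epsilon> * Q\<close>. The smallness of \<open>\<epsilon> * T * k\<close> keeps it above
  one half, so wherever the solution exceeds it the potential contributes at least
  \<open>V / 2\<close>, which covers the source.\<close>

lemma absorption:
 assumes T: "0 < T" and e: "0 < \<epsilon>"
  and Q: "AE x. 0 <= fn Q x" "AE x. fn Q x <= k" "\<epsilon> * T * k <= 1 / 2"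
  and QV: "AE x. 2 * \<epsilon> * fn Q x <= V x"
  and f: "AE x. fn f x <= 1"
 shows "AE x. fn (Sop T f) x + \<epsilon> * fn (heat.tint T Q) x <= 1"
proof -
 have k: "0 <= k"
 proof (rule ccontr)
  assume "~ 0 <= k"
  with Q(1,2) have "AE x::'a. False" by (auto elim: eventually_elim2)
  then show False using AE_iff_measurable[of UNIV "lborel::'a measure" "%_. False"] by simp
 qed
 let ?v = "%t. (- \<epsilon>) *\<^sub>R heat.tint t Q"
 have smooth: "norm (ppart 1 (Sop T f - ?v T)) <= norm (ppart 1 (f - ?v 0))" if f: "sg.gen f Y" for f Y
 \<comment> \<open>Constants are not square integrable, so the barrier is split into the truncation
   level 1 and the curve \<open>- \<epsilon> * heat.tint t Q\<close>.\<close>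
 proof (rule comparison[OF zero_le_one T f, where v' = "%t. (- \<epsilon>) *\<^sub>R heat_op t Q" and Z = "%t. (- \<epsilon>) *\<^sub>R (heat_op t Q - Q)"])
  show "continuous_on {0..T} ?v" by (intro continuous_intros heat.continuous_tint)
  fix t assume t: "0 < t" "t < T"
  note z0 = heat_tint_nonneg[OF Q(1) less_imp_le[OF t(1)]]
  have "\<epsilon> * (t * k) <= \<epsilon> * (T * k)" using t e k by (intro mult_left_mono mult_right_mono) auto
  then have le: "\<epsilon> * (t * k) <= 1 / 2" using Q(3) by (simp add: mult.assoc)
  have z1: "AE x. \<epsilon> * fn (heat.tint t Q) x <= 1 / 2"
   using heat_tint_le[OF Q(2) less_imp_le[OF t(1)]]
  proof eventually_elim
   case (elim x)
   then have "\<epsilon> * fn (heat.tint t Q) x <= \<epsilon> * (t * k)" using e by (intro mult_left_mono) auto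
   with le show ?case by linarith
  qed
  have phi: "AE x. fn (ppart 1 (Sop t f - ?v t)) x = max 0 (fn (Sop t f) x + \<epsilon> * fn (heat.tint t Q) x - 1)"
   using fn_ppart[OF zero_le_one, of "Sop t f - ?v t"] fn_diff[of "Sop t f" "?v t"] fn_scale[of "- \<epsilon>" "heat.tint t Q"]
   by eventually_elim simp
  show "(?v has_vector_derivative (- \<epsilon>) *\<^sub>R heat_op t Q) (at t)"
   by (intro bounded_linear.has_vector_derivative[OF bounded_linear_scaleR_right] heat.tint_has_vector_derivative t)
  show "heat.gen (?v t) ((- \<epsilon>) *\<^sub>R (heat_op t Q - Q))" by (intro heat.gen_scale heat.gen_tint less_imp_le t)
  show "AE x. \<bar>fn (ppart 1 (Sop t f - ?v t)) x\<bar> <= \<bar>fn (Sop t f) x\<bar>"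
   using phi z1 by eventually_elim auto
  fix \<phi> assume \<phi>: "\<phi> = ppart 1 (Sop t f - ?v t)" and int: "integrable lebesgue (%x. V x * fn (Sop t f) x * fn \<phi> x)"
  have "((- \<epsilon>) *\<^sub>R (heat_op t Q - Q) - (- \<epsilon>) *\<^sub>R heat_op t Q) \<bullet> \<phi> = (LINT x|lebesgue. \<epsilon> * (fn Q x * fn \<phi> x))"
   by (simp add: integral_lebesgue_lborel inner_l2_def[symmetric] inner_diff_left right_diff_distrib)
  also have "... <= (LINT x|lebesgue. V x * fn (Sop t f) x * fn \<phi> x)"
  proof (rule integral_mono_AE[OF _ int])
   show "integrable lebesgue (%x. \<epsilon> * (fn Q x * fn \<phi> x))"
    by (intro integrable_mult_right square_integrable_mult_integrable square_integrable_fn)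
   show "AE x in lebesgue. \<epsilon> * (fn Q x * fn \<phi> x) <= V x * fn (Sop t f) x * fn \<phi> x"
    unfolding AE_lebesgue_iff \<phi> using phi z1 QV
   proof eventually_elim
    case (elim x)
    let ?u = "fn (Sop t f) x" and ?p = "fn (ppart 1 (Sop t f - ?v t)) x"
    show ?case
    proof (cases "?p = 0")
     case False
     then have p: "?p > 0" and u: "?u >= 1 / 2" using elim by (auto simp: max_def split: if_splits)
     have "\<epsilon> * fn Q x <= V x * (1 / 2)" using elim(3) by simp
     also have "... <= V x * ?u" using u V_nonneg by (rule mult_left_mono)
     finally have "(\<epsilon> * fn Q x) * ?p <= (V x * ?u) * ?p" using p by (intro mult_right_mono) auto
     then show ?thesis by (simp only: mult.assoc)
    qed simp
   qed
  qed
  finally show "((- \<epsilon>) *\<^sub>R (heat_op t Q - Q) - (- \<epsilon>) *\<^sub>R heat_op t Q) \<bullet> \<phi>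
    <= (LINT x|lebesgue. V x * fn (Sop t f) x * fn \<phi> x)" .
 qed
 have "norm (ppart 1 (Sop T f + \<epsilon> *\<^sub>R heat.tint T Q)) <= norm (ppart 1 f)"
 proof (rule ppart_tendsto_le)
  show "((%h. Sop T (sg.tint h f /\<^sub>R h) + \<epsilon> *\<^sub>R heat.tint T Q) \<longlongrightarrow> Sop T f + \<epsilon> *\<^sub>R heat.tint T Q) (at_right 0)"
   by (intro tendsto_add tendsto_const bounded_linear.tendsto[OF sg.lin] sg.tint_average) (use T in auto)
  show "((%h. sg.tint h f /\<^sub>R h) \<longlongrightarrow> f) (at_right 0)" by (rule sg.tint_average)
  show "norm (ppart 1 (Sop T (sg.tint h f /\<^sub>R h) + \<epsilon> *\<^sub>R heat.tint T Q)) <= norm (ppart 1 (sg.tint h f /\<^sub>R h))" if "h > 0" for h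
   using smooth[OF gen_average[OF that]] by (simp add: heat.tint_def)
 qed simp
 also have "ppart 1 f = 0" using f by (simp add: ppart_eq_0_iff)
 finally have "ppart 1 (Sop T f + \<epsilon> *\<^sub>R heat.tint T Q) = 0" by simp
 then have "AE x. fn (Sop T f + \<epsilon> *\<^sub>R heat.tint T Q) x <= 1" by (simp add: ppart_eq_0_iff)
 with fn_add[of "Sop T f" "\<epsilon> *\<^sub>R heat.tint T Q"] fn_scale[of \<epsilon> "heat.tint T Q"]
 show ?thesis by eventually_elim simp
qed

end

subsection \<open>Weighted measures\<close>

lemma wmeas_mono:
 assumes "!!x. 0 <= u x" "set_integrable lebesgue B u" "E \<in> sets lebesgue" "E \<subseteq> B"
 shows "wmeas u E <= wmeas u B"
 unfolding wmeas_def set_lebesgue_integral_def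
 using assms(2) set_integrable_subset[OF assms(2-4)] assms(1,4)
 by (intro integral_mono) (auto simp: set_integrable_def indicator_def)

lemma wmeas_Un:
 assumes "set_integrable lebesgue A u" "set_integrable lebesgue B u" "A \<inter> B = {}"
 shows "wmeas u (A \<union> B) = wmeas u A + wmeas u B"
 unfolding wmeas_def by (rule set_integral_Un) (use assms in auto)

lemma wmeas_Diff:
 assumes "set_integrable lebesgue B u" "E \<in> sets lebesgue" "E \<subseteq> B" "B \<in> sets lebesgue"
 shows "wmeas u (B - E) = wmeas u B - wmeas u E"
proof -
 have "wmeas u (E \<union> (B - E)) = wmeas u E + wmeas u (B - E)"
  by (intro wmeas_Un set_integrable_subset[OF assms(1)]) (use assms in auto)
 moreover have "E \<union> (B - E) = B" using assms(3) by blast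
 ultimately show ?thesis by simp
qed

lemma wmeas_nonneg: "(!!x. 0 <= u x) ==> 0 <= wmeas u E"
 unfolding wmeas_def set_lebesgue_integral_def by (intro Bochner_Integration.integral_nonneg) (auto simp: indicator_def)

lemma locally_integrable_ball: "locally_integrable f ==> set_integrable lebesgue (ball x r) f"
 unfolding locally_integrable_def
 by (rule set_integrable_subset[of _ "cball x r"]) auto

lemma measure_lebesgue_ball:
 "0 <= r ==> measure lebesgue (ball (x::'a::euclidean_space) r) = measure lebesgue (ball (0::'a) 1) * r powr real DIM('a)"
 using content_ball[of r x] content_ball[of 1 "0::'a"] by (cases "r = 0") (simp_all add: powr_realpow)

lemma measure_ball_pos: "0 < r ==> 0 < measure lebesgue (ball (x::'a::euclidean_space) r)"
 by (simp add: content_ball_pos)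

lemma set_integral_const:
 "E \<in> lmeasurable ==> (LINT x:E|lebesgue. (c::real)) = c * measure lebesgue E"
 "E \<in> lmeasurable ==> set_integrable lebesgue E (%x. c)"
proof -
 assume E: "E \<in> lmeasurable"
 show "(LINT x:E|lebesgue. c) = c * measure lebesgue E"
  using E unfolding set_lebesgue_integral_def by (simp add: fmeasurable_def mult.commute)
 show "set_integrable lebesgue E (%x. c)"
  using E unfolding set_integrable_def
  by (intro integrable_scaleR_left) (auto simp: fmeasurable_def intro: integrable_real_indicator)
qed

lemma wmeas_le_const:
 assumes "set_integrable lebesgue E u" "E \<in> lmeasurable" "!!x. x \<in> E ==> u x <= c"
 shows "wmeas u E <= c * measure lebesgue E"
proof -
 have "wmeas u E <= (LINT x:E|lebesgue. c)" unfolding wmeas_def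
  by (intro set_integral_mono assms set_integral_const)
 then show ?thesis by (simp only: set_integral_const[OF assms(2)])
qed

lemma subset_ballI: "dist x y + r <= R ==> ball (x::'a::metric_space) r \<subseteq> ball y R"
proof
 fix z assume "dist x y + r <= R" "z \<in> ball x r"
 with dist_triangle[of y z x] show "z \<in> ball y R" by (simp add: dist_commute)
qed

text \<open>The step is iterated as often as the logarithm of \<open>R / r\<close> to the base
  \<open>1 / l\<close>, rounded up; the rounding costs the leading factor \<open>A\<close>.\<close>

lemma geometric_growth:
 fixes g :: "real => real"
 assumes mono: "!!r R. 0 < r ==> r <= R ==> g r <= g R" and nn: "!!r. 0 < r ==> 0 <= g r"
  and l: "0 < l" "l < 1" and A: "1 <= A" and step: "!!R. 0 < R ==> g R <= A * g (l * R)"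
  and r: "0 < r" "r <= R"
 shows "g R <= A * (R / r) powr (ln A / ln (1 / l)) * g r"
proof -
 have iter: "g R <= A ^ j * g (l ^ j * R)" if "0 < R" for j R
 proof (induction j)
  case (Suc j)
  have "g (l ^ j * R) <= A * g (l * (l ^ j * R))" by (rule step) (use l that in simp)
  with A have "A ^ j * g (l ^ j * R) <= A ^ j * (A * g (l * (l ^ j * R)))" by (intro mult_left_mono) auto
  with Suc show ?case by (simp add: mult_ac)
 qed simp
 have ll: "0 < ln (1 / l)" using l by simp
 define j where "j = nat \<lceil>ln (R / r) / ln (1 / l)\<rceil>"
 have R: "0 <= ln (R / r)" using r by simp
 have j1: "ln (R / r) / ln (1 / l) <= real j" unfolding j_def by linarith
 have j2: "real j <= 1 + ln (R / r) / ln (1 / l)" unfolding j_def using divide_nonneg_pos[OF R ll] by linarith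
 have "ln (R / r) <= real j * ln (1 / l)" using j1 ll by (simp add: field_simps)
 also have "... = ln ((1 / l) ^ j)" using l by (simp add: ln_realpow)
 finally have "R / r <= (1 / l) ^ j" using l r by (subst (asm) ln_le_cancel_iff) auto
 then have "l ^ j * R <= r" using l r by (simp add: field_simps)
 then have "g (l ^ j * R) <= g r" using l r by (intro mono) auto
 with iter[of R j] r A have "g R <= A ^ j * g r" by (meson less_le_trans mult_left_mono order_trans zero_le_power zero_le_one)
 also have "... <= (A * (R / r) powr (ln A / ln (1 / l))) * g r"
 proof (rule mult_right_mono)
  have "A ^ j = A powr real j" using A by (simp add: powr_realpow)
  also have "... <= A powr (1 + ln (R / r) / ln (1 / l))" using A j2 by (intro powr_mono) auto
  also have "... = A * (R / r) powr (ln A / ln (1 / l))" using A r by (simp add: powr_add) (simp add: powr_def mult.commute)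
  finally show "A ^ j <= A * (R / r) powr (ln A / ln (1 / l))" .
 qed (use nn r in auto)
 finally show ?thesis .
qed

subsection \<open>Reverse Hoelder potentials\<close>

locale rh_potential =
 fixes V :: "'a::euclidean_space => real" and s :: real
 assumes dim: "3 <= DIM('a)" and nonneg: "0 <= V x" and loc: "locally_integrable V"
  and nonzero: "~ (AE x in lebesgue. V x = 0)" and rh: "reverse_Holder s V" and s_ge: "real DIM('a) / 2 <= s"
begin

definition \<mu> :: "'a => real => real" where "\<mu> x r = wmeas V (ball x r)"
definition \<nu> :: "'a => real => real" where "\<nu> x r = wmeas (%y. V y powr s) (ball x r)"
definition vol :: "real => real" where "vol r = measure lebesgue (ball (0::'a) r)"

lemma s1: "1 < s" using rh by (simp add: reverse_Holder_def)

lemma vol: "0 < r ==> vol r = vol 1 * r powr real DIM('a)"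
 unfolding vol_def by (rule measure_lebesgue_ball) simp

lemma vol_pos: "0 < r ==> 0 < vol r" unfolding vol_def by (rule measure_ball_pos)

lemma measure_ball_vol: "0 < r ==> measure lebesgue (ball (x::'a) r) = vol r"
 using vol[of r] measure_lebesgue_ball[of r x] by (simp add: vol_def)

lemma V_int: "set_integrable lebesgue (ball x r) V" using loc by (rule locally_integrable_ball)

lemma Vs_int: "0 < r ==> set_integrable lebesgue (ball x r) (%y. V y powr s)"
 using rh by (auto simp: reverse_Holder_def)

lemma mu_nonneg: "0 <= \<mu> x r" unfolding \<mu>_def by (rule wmeas_nonneg) (rule nonneg)

lemma mu_mono: "ball x r \<subseteq> ball y R ==> \<mu> x r <= \<mu> y R"
 unfolding \<mu>_def by (intro wmeas_mono V_int nonneg) auto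

lemma nu_upper: "EX C>0. ALL x r. 0 < r --> \<nu> x r <= C * vol r powr (1 - s) * \<mu> x r powr s"
proof -
 obtain C where C: "C > 0" and le: "!!x r. 0 < r ==> avg (ball x r) (%y. V y powr s) powr (1 / s) <= C * avg (ball x r) V"
  using rh by (auto simp: reverse_Holder_def)
 have "\<nu> x r <= C powr s * vol r powr (1 - s) * \<mu> x r powr s" if r: "0 < r" for x r
 proof -
  have v: "vol r > 0" by (rule vol_pos[OF r])
  have n: "0 <= \<nu> x r" unfolding \<nu>_def by (rule wmeas_nonneg) simp
  have "(\<nu> x r / vol r) powr (1 / s) <= C * (\<mu> x r / vol r)"
   using le[OF r, of x] unfolding avg_def measure_ball_vol[OF r] \<mu>_def \<nu>_def wmeas_def .
  then have "((\<nu> x r / vol r) powr (1 / s)) powr s <= (C * (\<mu> x r / vol r)) powr s"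
   using s1 by (intro powr_mono2) auto
  then have "\<nu> x r / vol r <= C powr s * (\<mu> x r powr s / vol r powr s)"
   using s1 n v C mu_nonneg[of x r] by (simp add: powr_powr powr_mult powr_divide)
  then show ?thesis using v by (simp add: powr_diff field_simps)
 qed
 then show ?thesis using C by (intro exI[of _ "C powr s"]) auto
qed

text \<open>Below the level \<open>l\<close> the potential is at most \<open>l\<close>, above it at
  most \<open>l powr (1 - s) * V powr s\<close>. A free level takes the place of Hoelder's
  inequality.\<close>

lemma mu_split:
 assumes r: "0 < r" and E: "E \<in> sets lebesgue" "E \<subseteq> ball x r" and l: "0 < l"
 shows "wmeas V E <= l * measure lebesgue E + l powr (1 - s) * \<nu> x r"
proof -
 have Em: "E \<in> lmeasurable" using E(2,1) by (rule bounded_set_imp_lmeasurable[OF bounded_subset[OF bounded_ball]])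
 have iV: "set_integrable lebesgue E V" by (rule set_integrable_subset[OF V_int E])
 have iS: "set_integrable lebesgue E (%y. V y powr s)" by (rule set_integrable_subset[OF Vs_int[OF r] E])
 note ic = set_integral_const(2)[OF Em, of l]
 have pt: "V y <= l + l powr (1 - s) * V y powr s" for y
 proof (cases "V y <= l")
  case False
  then have "V y powr (1 - s) <= l powr (1 - s)" using l s1 by (intro powr_mono2') auto
  then have "V y powr (1 - s) * V y powr s <= l powr (1 - s) * V y powr s" by (rule mult_right_mono) simp
  moreover have "V y powr (1 - s) * V y powr s = V y" using False l by (simp add: powr_add[symmetric])
  ultimately show ?thesis using l by linarith
 qed (simp add: add_increasing2)
 have "wmeas V E <= (LINT y:E|lebesgue. l + l powr (1 - s) * V y powr s)" unfolding wmeas_def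
  by (intro set_integral_mono iV set_integral_add(1) ic set_integrable_mult_right iS pt)
 also have "... = l * measure lebesgue E + l powr (1 - s) * wmeas (%y. V y powr s) E"
  unfolding wmeas_def
  using Em by (simp add: set_integral_add(2)[OF ic set_integrable_mult_right[OF iS]] set_integral_const)
 also have "... <= l * measure lebesgue E + l powr (1 - s) * \<nu> x r"
  unfolding \<nu>_def by (intro add_left_mono mult_left_mono wmeas_mono Vs_int r E) auto
 finally show ?thesis .
qed

text \<open>The level in \<open>mu_split\<close> is \<open>t\<close> times the average of the
  potential over the ball; the reverse Hoelder bound on the \<open>s\<close>-th powers then makes
  both terms multiples of \<open>\<mu> x r\<close>.\<close>

lemma A_infinity:
 "EX C>0. ALL x r E t. 0 < r --> 0 < t --> E \<in> sets lebesgue --> E \<subseteq> ball x r -->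
   wmeas V E <= (t * (measure lebesgue E / vol r) + C * t powr (1 - s)) * \<mu> x r"
proof -
 obtain C where C: "C > 0" "!!x r. 0 < r ==> \<nu> x r <= C * vol r powr (1 - s) * \<mu> x r powr s" using nu_upper by blast
 have "wmeas V E <= (t * (measure lebesgue E / vol r) + C * t powr (1 - s)) * \<mu> x r"
  if r: "0 < r" and t: "0 < t" and E: "E \<in> sets lebesgue" "E \<subseteq> ball x r" for x r E t
 proof (cases "\<mu> x r = 0")
  case True
  moreover have "wmeas V E <= \<mu> x r" unfolding \<mu>_def by (intro wmeas_mono V_int nonneg E)
  ultimately show ?thesis by simp
 next
  case False
  then have m: "\<mu> x r > 0" using mu_nonneg[of x r] by linarith
  have v: "vol r > 0" by (rule vol_pos[OF r])
  define l where "l = t * \<mu> x r / vol r"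
  have l: "l > 0" using t m v by (simp add: l_def)
  have "wmeas V E <= l * measure lebesgue E + l powr (1 - s) * (C * vol r powr (1 - s) * \<mu> x r powr s)"
   using mu_split[OF r E l] C(2)[OF r, of x] by (meson add_left_mono mult_left_mono order_trans powr_ge_zero)
  also have "l powr (1 - s) = t powr (1 - s) * \<mu> x r powr (1 - s) / vol r powr (1 - s)"
   using t m v by (simp add: l_def powr_mult powr_divide)
  also have "... * (C * vol r powr (1 - s) * \<mu> x r powr s) = C * t powr (1 - s) * (\<mu> x r powr (1 - s) * \<mu> x r powr s)"
   using v by simp
  also have "\<mu> x r powr (1 - s) * \<mu> x r powr s = \<mu> x r" using m by (simp add: powr_add[symmetric])
  finally show ?thesis by (simp add: l_def algebra_simps)
 qed
 then show ?thesis by (intro exI[of _ C] conjI allI impI C(1))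
qed

text \<open>The A-infinity property of the potential: \<open>t\<close> is fixed so that the second
  term of \<open>A_infinity\<close> is half of \<beta>, and small relative volume makes the first
  term the other half.\<close>

lemma small_sets:
 assumes "0 < \<beta>"
 shows "EX \<epsilon>>0. ALL x r E. 0 < r --> E \<in> sets lebesgue --> E \<subseteq> ball x r --> measure lebesgue E <= \<epsilon> * vol r
   --> wmeas V E <= \<beta> * \<mu> x r"
proof -
 from A_infinity obtain C where C: "C > 0" "ALL x r E t. 0 < r --> 0 < t --> E \<in> sets lebesgue --> E \<subseteq> ball x r -->
   wmeas V E <= (t * (measure lebesgue E / vol r) + C * t powr (1 - s)) * \<mu> x r" by (elim exE conjE)
 define t where "t = (\<beta> / (2 * C)) powr (1 / (1 - s))"
 have t: "t > 0" "t powr (1 - s) = \<beta> / (2 * C)" using s1 assms C(1) by (auto simp: t_def powr_powr)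
 show ?thesis
 proof (intro exI[of _ "\<beta> / (2 * t)"] conjI allI impI)
  show "\<beta> / (2 * t) > 0" using assms t by simp
  fix x :: 'a and r E assume h: "0 < r" "E \<in> sets lebesgue" "E \<subseteq> ball x r" "measure lebesgue E <= \<beta> / (2 * t) * vol r"
  then have "measure lebesgue E / vol r <= \<beta> / (2 * t)" using vol_pos[of r] by (simp add: field_simps)
  then have "t * (measure lebesgue E / vol r) <= t * (\<beta> / (2 * t))" using t by (intro mult_left_mono) auto
  moreover have "t * (\<beta> / (2 * t)) = \<beta> / 2" "C * t powr (1 - s) = \<beta> / 2" using t C(1) by auto
  ultimately have "t * (measure lebesgue E / vol r) + C * t powr (1 - s) <= \<beta>" by linarith
  then have "(t * (measure lebesgue E / vol r) + C * t powr (1 - s)) * \<mu> x r <= \<beta> * \<mu> x r"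
   using mu_nonneg by (intro mult_right_mono) auto
  moreover have "wmeas V E <= (t * (measure lebesgue E / vol r) + C * t powr (1 - s)) * \<mu> x r"
   using h t(1) by (intro C(2)[rule_format]) auto
  ultimately show "wmeas V E <= \<beta> * \<mu> x r" by linarith
 qed
qed

text \<open>A thin spherical shell has small relative volume and carries at most half of the mass.
  Shrinking the radius by a fixed factor thus loses at most one half, and iteration gives polynomial
  growth.\<close>

lemma mu_growth: "EX m>=0. ALL x r R. 0 < r & r <= R --> \<mu> x R <= 2 * (R / r) powr m * \<mu> x r"
proof -
 have "0 < (1 / 2 :: real)" by simp
 from small_sets[OF this] obtain \<epsilon> where e: "\<epsilon> > 0" "ALL x r E. 0 < r --> E \<in> sets lebesgue --> E \<subseteq> ball x r --> measure lebesgue E <= \<epsilon> * vol r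
   --> wmeas V E <= 1 / 2 * \<mu> x r" by (elim exE conjE)
 define l where "l = (1 - min \<epsilon> (1 / 2)) powr (1 / real DIM('a))"
 have l: "0 < l" "l < 1" "1 - \<epsilon> <= l powr real DIM('a)"
  using e(1) dim powr_less_mono2[of "1 / real DIM('a)" "1 - min \<epsilon> (1 / 2)" 1] by (auto simp: l_def powr_powr)
 have step: "\<mu> x R <= 2 * \<mu> x (l * R)" if R: "0 < R" for x R
 proof -
  have sub: "ball x (l * R) \<subseteq> ball x R" using l R by (intro subset_ball) auto
  have "measure lebesgue (ball x R - ball x (l * R)) = vol R - vol (l * R)"
   using l R sub by (subst measurable_measure_Diff) (auto simp: measure_ball_vol simp del: measure_completion)
  also have "vol (l * R) = l powr real DIM('a) * vol R"
   using vol[of "l * R"] vol[OF R] l R by (simp add: powr_mult)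
  also have "vol R - l powr real DIM('a) * vol R <= \<epsilon> * vol R"
   using mult_right_mono[OF l(3), of "vol R"] vol_pos[OF R] by (simp add: algebra_simps)
  finally have "wmeas V (ball x R - ball x (l * R)) <= 1 / 2 * \<mu> x R" by (intro e(2)[rule_format]) (use R in auto)
  moreover have "wmeas V (ball x R - ball x (l * R)) = \<mu> x R - \<mu> x (l * R)"
   unfolding \<mu>_def by (intro wmeas_Diff V_int) (use sub in auto)
  ultimately show ?thesis by simp
 qed
 have "\<mu> x R <= 2 * (R / r) powr (ln 2 / ln (1 / l)) * \<mu> x r" if "0 < r" "r <= R" for x r R
  by (rule geometric_growth[where g = "\<mu> x"]) (use l(1,2) step that in \<open>auto intro!: mu_mono subset_ball mu_nonneg\<close>)
 then show ?thesis using l by (intro exI[of _ "ln 2 / ln (1 / l)"]) auto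
qed

text \<open>Hoelder's inequality up to a factor 2, obtained from \<open>mu_split\<close> at half the
  average.\<close>

lemma nu_lower:
 assumes r: "0 < r" shows "vol r powr (1 - s) * (\<mu> x r / 2) powr s <= \<nu> x r"
proof (cases "\<mu> x r = 0")
 case True then show ?thesis by (simp add: \<nu>_def wmeas_nonneg)
next
 case False
 then have m: "\<mu> x r > 0" using mu_nonneg[of x r] by linarith
 have v: "vol r > 0" by (rule vol_pos[OF r])
 define l where "l = \<mu> x r / 2 / vol r"
 have l: "l > 0" using m v by (simp add: l_def)
 have "\<mu> x r <= l * measure lebesgue (ball x r) + l powr (1 - s) * \<nu> x r"
  unfolding \<mu>_def by (rule mu_split[OF r _ _ l]) auto
 then have "\<mu> x r / 2 <= l powr (1 - s) * \<nu> x r" using v by (simp add: measure_ball_vol[OF r] l_def del: measure_completion)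
 then have "l powr (s - 1) * (\<mu> x r / 2) <= l powr (s - 1) * (l powr (1 - s) * \<nu> x r)" by (intro mult_left_mono) auto
 also have "... = (l powr (s - 1) * l powr (1 - s)) * \<nu> x r" by simp
 also have "l powr (s - 1) * l powr (1 - s) = 1" using l by (simp add: powr_add[symmetric])
 also have "l powr (s - 1) = vol r powr (1 - s) * (\<mu> x r / 2) powr (s - 1)"
  using m v powr_minus_divide[of "vol r" "s - 1"] by (simp add: l_def powr_divide powr_mult)
 also have "... * (\<mu> x r / 2) = vol r powr (1 - s) * (\<mu> x r / 2) powr s"
  using m powr_mult_base[of "\<mu> x r / 2" "s - 1"] by (simp add: mult_ac)
 finally show ?thesis by simp
qed

lemma mu_pos: assumes "0 < r" shows "0 < \<mu> x r"
proof (rule ccontr)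
 assume "~ 0 < \<mu> x r"
 then have 0: "\<mu> x r = 0" using mu_nonneg[of x r] by simp
 from mu_growth obtain m where "ALL x r R. 0 < r & r <= R --> \<mu> x R <= 2 * (R / r) powr m * \<mu> x r" by blast
 then have le: "\<mu> x R <= 0" if "r <= R" for R using that assms 0 by (metis mult_zero_right)
 have "AE y in lebesgue. y \<in> ball x (r + real n) --> V y = 0" for n
 proof -
  have "\<mu> x (r + real n) = 0" using le[of "r + real n"] mu_nonneg[of x "r + real n"] by simp
  then have "AE y in lebesgue. indicator (ball x (r + real n)) y *\<^sub>R V y = 0"
   unfolding \<mu>_def wmeas_def set_lebesgue_integral_def
   using V_int[of x "r + real n"] unfolding set_integrable_def
   by (subst (asm) integral_nonneg_eq_0_iff_AE) (auto simp: nonneg)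
  then show ?thesis by eventually_elim (auto simp: indicator_def)
 qed
 note this[unfolded AE_lebesgue_iff]
 from AE_balls[OF this] show False using nonzero unfolding AE_lebesgue_iff by simp
qed

text \<open>A disjoint ball of the same radius, centred at distance \<open>2 * r\<close>, lies in
  the tripled ball and carries a fixed fraction of its \<open>s\<close>-mass, by growth of
  \<open>\<mu>\<close> and the two-sided control of \<open>\<nu>\<close>. The concentric ball misses
  that fraction.\<close>

lemma nu_tripling: "EX \<gamma>. 0 < \<gamma> & \<gamma> < 1 & (ALL x r. 0 < r --> \<nu> x r <= \<gamma> * \<nu> x (3 * r))"
proof -
 from nu_upper obtain C where C: "C > 0" "ALL x r. 0 < r --> \<nu> x r <= C * vol r powr (1 - s) * \<mu> x r powr s" by blast
 from mu_growth obtain m where m: "ALL x r R. 0 < r & r <= R --> \<mu> x R <= 2 * (R / r) powr m * \<mu> x r" by blast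
 define D where "D = 1 + C * (4 * 5 powr m) powr s"
 have D: "1 < D" using C by (simp add: D_def)
 obtain b :: 'a where b: "b \<in> Basis" using nonempty_Basis by blast
 have "\<nu> x r <= (1 - 1 / D) * \<nu> x (3 * r)" if r: "0 < r" for x r
 proof -
  define z where "z = x + (2 * r) *\<^sub>R b"
  have xz: "dist x z = 2 * r" using r b by (simp add: z_def dist_norm)
  have sub: "ball z r \<subseteq> ball x (3 * r)" "ball x r \<subseteq> ball x (3 * r)" "ball x (3 * r) \<subseteq> ball z (5 * r)"
  proof -
   show "ball z r \<subseteq> ball x (3 * r)" by (rule subset_ballI) (use xz in \<open>simp add: dist_commute\<close>)
   show "ball x r \<subseteq> ball x (3 * r)" using r by (intro subset_ball) simp
   show "ball x (3 * r) \<subseteq> ball z (5 * r)" by (rule subset_ballI) (use xz in simp)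
  qed
  have disj: "ball x r \<inter> ball z r = {}"
  proof (rule ccontr)
   assume "ball x r \<inter> ball z r ~= {}"
   then obtain y where "dist x y < r" "dist z y < r" by auto
   with xz dist_triangle[of x z y] show False by (simp add: dist_commute)
  qed
  have "\<mu> x (3 * r) <= \<mu> z (5 * r)" by (rule mu_mono[OF sub(3)])
  also have "... <= 2 * (5 * r / r) powr m * \<mu> z r" using m r by (metis mult_le_cancel_right1 one_le_numeral order_less_asym)
  finally have mz: "\<mu> x (3 * r) <= (4 * 5 powr m) * (\<mu> z r / 2)" using r by (simp add: mult_ac)
  have "measure lebesgue (ball x r) <= measure lebesgue (ball x (3 * r))"
   using r by (intro measure_mono_fmeasurable subset_ball) auto
  then have "vol r <= vol (3 * r)" using measure_ball_vol[OF r, of x] measure_ball_vol[of "3 * r" x] r by simp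
  have "\<nu> x (3 * r) <= C * vol (3 * r) powr (1 - s) * \<mu> x (3 * r) powr s" using C(2) r by simp
  also have "... <= C * vol r powr (1 - s) * ((4 * 5 powr m) * (\<mu> z r / 2)) powr s"
   using C(1) s1 vol_pos[OF r] mu_nonneg \<open>vol r <= vol (3 * r)\<close> by (intro mult_mono powr_mono2 powr_mono2' mz) auto
  also have "((4 * 5 powr m) * (\<mu> z r / 2)) powr s = (4 * 5 powr m) powr s * (\<mu> z r / 2) powr s"
   using mu_nonneg[of z r] by (subst powr_mult) auto
  also have "C * vol r powr (1 - s) * ... = (D - 1) * (vol r powr (1 - s) * (\<mu> z r / 2) powr s)"
   unfolding D_def by (simp only: add_diff_cancel_left' mult_ac)
  also have "... <= (D - 1) * \<nu> z r" using D by (intro mult_left_mono nu_lower[OF r]) auto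
  also have "... <= D * \<nu> z r" using D by (intro mult_right_mono) (auto simp: \<nu>_def wmeas_nonneg)
  finally have 1: "\<nu> x (3 * r) / D <= \<nu> z r" using D by (simp add: field_simps)
  have "\<nu> x r + \<nu> z r = wmeas (%y. V y powr s) (ball x r \<union> ball z r)"
   unfolding \<nu>_def by (rule wmeas_Un[symmetric]) (use Vs_int r disj in auto)
  also have "... <= \<nu> x (3 * r)" unfolding \<nu>_def by (intro wmeas_mono Vs_int) (use sub r in auto)
  finally show ?thesis using 1 by (simp add: algebra_simps)
 qed
 then show ?thesis using D by (intro exI[of _ "1 - 1 / D"]) auto
qed

text \<open>The dimensionless mass whose sublevel set at 1 defines the critical radius.\<close>

definition \<psi> :: "'a => real => real" where "\<psi> x r = r powr (2 - real DIM('a)) * \<mu> x r"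

lemma nu_decay: "EX A>0. EX \<delta>>0. ALL x r R. 0 < r --> r <= R --> \<nu> x r <= A * (r / R) powr \<delta> * \<nu> x R"
proof -
 from nu_tripling obtain \<gamma> where g: "0 < \<gamma>" "\<gamma> < 1" "!!x r. 0 < r ==> \<nu> x r <= \<gamma> * \<nu> x (3 * r)" by blast
 have nn: "0 <= \<nu> x r" for x r by (simp add: \<nu>_def wmeas_nonneg)
 have iter: "\<nu> x r <= \<gamma> ^ j * \<nu> x (3 ^ j * r)" if "0 < r" for x r j
 proof (induction j)
  case (Suc j)
  have "\<gamma> ^ j * \<nu> x (3 ^ j * r) <= \<gamma> ^ j * (\<gamma> * \<nu> x (3 * (3 ^ j * r)))" using g that by (intro mult_left_mono) auto
  with Suc show ?case by (simp add: mult_ac)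
 qed simp
 define \<delta> where "\<delta> = - ln \<gamma> / ln 3"
 have d: "\<delta> > 0" using g by (simp add: \<delta>_def divide_neg_pos)
 have "\<nu> x r <= 1 / \<gamma> * (r / R) powr \<delta> * \<nu> x R" if r: "0 < r" "r <= R" for x r R
 proof -
  define j where "j = nat \<lfloor>ln (R / r) / ln 3\<rfloor>"
  have nonneg: "0 <= ln (R / r) / ln 3" using r by simp
  have j: "real j <= ln (R / r) / ln 3" "ln (R / r) / ln 3 - 1 <= real j" using nonneg unfolding j_def by linarith+
  have "ln (3 ^ j) <= ln (R / r)" using j(1) by (simp add: ln_realpow field_simps)
  then have "3 ^ j <= R / r" using r by (subst (asm) ln_le_cancel_iff) auto
  then have "3 ^ j * r <= R" using r by (simp add: field_simps)
  then have "\<nu> x (3 ^ j * r) <= \<nu> x R" unfolding \<nu>_def using r by (intro wmeas_mono Vs_int) (auto intro!: subset_ball)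
  with iter[OF r(1), of x j] g have "\<nu> x r <= \<gamma> ^ j * \<nu> x R" by (meson less_imp_le mult_left_mono order_trans zero_le_power)
  also have "... <= (1 / \<gamma> * (r / R) powr \<delta>) * \<nu> x R"
  proof (rule mult_right_mono[OF _ nn])
   have "\<gamma> ^ j = \<gamma> powr real j" using g by (simp add: powr_realpow)
   also have "... <= \<gamma> powr (ln (R / r) / ln 3 - 1)" using g j by (intro powr_mono') auto
   also have "... = (1 / \<gamma>) * exp (ln (R / r) / ln 3 * ln \<gamma>)" using g by (simp add: powr_diff) (simp add: powr_def)
   also have "ln (R / r) / ln 3 * ln \<gamma> = \<delta> * ln (r / R)" using r by (simp add: \<delta>_def ln_div field_simps)
   also have "exp (\<delta> * ln (r / R)) = (r / R) powr \<delta>" using r by (simp add: powr_def)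
   finally show "\<gamma> ^ j <= 1 / \<gamma> * (r / R) powr \<delta>" .
  qed
  finally show ?thesis .
 qed
 then show ?thesis using d g by (intro exI[of _ "1 / \<gamma>"] conjI exI[of _ \<delta>]) auto
qed

text \<open>Comparing the \<open>s\<close>-masses gives the exponent
  \<open>2 - d / s + \<delta> / s\<close>, with \<open>d\<close> the dimension. At the endpoint
  \<open>s = d / 2\<close> only \<open>\<delta> / s\<close> remains, so the decay is due to
  \<open>nu_decay\<close> there.\<close>

lemma psi_decay: "EX A>=1. EX \<delta>>0. ALL x r R. 0 < r --> r <= R --> \<psi> x r <= A * (r / R) powr \<delta> * \<psi> x R"
proof -
 let ?d = "real DIM('a)"
 from nu_upper obtain C where C: "C > 0" "!!x r. 0 < r ==> \<nu> x r <= C * vol r powr (1 - s) * \<mu> x r powr s" by blast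
 from nu_decay obtain A \<delta> where A: "A > 0" "\<delta> > 0" "!!x r R. 0 < r ==> r <= R ==> \<nu> x r <= A * (r / R) powr \<delta> * \<nu> x R" by blast
 define K where "K = 2 * (A * C) powr (1 / s)"
 define B where "B = max 1 K"
 have e0: "\<delta> / s <= (\<delta> + ?d * (s - 1)) / s + (2 - ?d)" using s_ge s1 by (simp add: field_simps)
 have "\<psi> x r <= B * (r / R) powr (\<delta> / s) * \<psi> x R" if r: "0 < r" "r <= R" for x r R
 proof -
  have R: "0 < R" using r by simp
  have v: "vol r > 0" "vol R > 0" using vol_pos r R by auto
  have m: "\<mu> x r > 0" "\<mu> x R > 0" using mu_pos r R by auto
  have "vol r powr (1 - s) * (\<mu> x r / 2) powr s <= A * (r / R) powr \<delta> * (C * vol R powr (1 - s) * \<mu> x R powr s)"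
   using nu_lower[OF r(1), of x] A(3)[OF r, of x] C(2)[OF R, of x] A(1)
   by (meson mult_left_mono order_trans mult_nonneg_nonneg less_imp_le powr_ge_zero)
  then have "(\<mu> x r / 2) powr s <= A * (r / R) powr \<delta> * (C * (vol R powr (1 - s) / vol r powr (1 - s)) * \<mu> x R powr s)"
   using v by (simp add: field_simps)
  also have "vol R powr (1 - s) / vol r powr (1 - s) = (vol R / vol r) powr (1 - s)" using v by (simp add: powr_divide)
  also have "vol R / vol r = (R / r) powr ?d" using vol[OF r(1)] vol[OF R] vol_pos[of 1] r R by (simp add: powr_divide)
  also have "((R / r) powr ?d) powr (1 - s) = (r / R) powr (?d * (s - 1))"
   using r R powr_minus_divide[of "R / r" "?d * (s - 1)"] by (simp add: powr_powr powr_divide right_diff_distrib powr_diff)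
  also have "A * (r / R) powr \<delta> * (C * (r / R) powr (?d * (s - 1)) * \<mu> x R powr s)
    = A * C * (r / R) powr (\<delta> + ?d * (s - 1)) * \<mu> x R powr s" by (simp add: powr_add)
  finally have "((\<mu> x r / 2) powr s) powr (1 / s) <= (A * C * (r / R) powr (\<delta> + ?d * (s - 1)) * \<mu> x R powr s) powr (1 / s)"
   using s1 by (intro powr_mono2) auto
  then have "\<mu> x r <= K * (r / R) powr ((\<delta> + ?d * (s - 1)) / s) * \<mu> x R"
   using s1 m A C by (simp add: powr_powr powr_mult K_def)
  then have "\<psi> x r <= r powr (2 - ?d) * (K * (r / R) powr ((\<delta> + ?d * (s - 1)) / s) * \<mu> x R)"
   unfolding \<psi>_def by (intro mult_left_mono) auto
  also have "r powr (2 - ?d) = (r / R) powr (2 - ?d) * R powr (2 - ?d)" using r R by (simp add: powr_divide)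
  also have "(r / R) powr (2 - ?d) * R powr (2 - ?d) * (K * (r / R) powr ((\<delta> + ?d * (s - 1)) / s) * \<mu> x R)
   = K * (r / R) powr ((\<delta> + ?d * (s - 1)) / s + (2 - ?d)) * \<psi> x R" by (simp add: \<psi>_def powr_add)
  also have "... <= B * (r / R) powr (\<delta> / s) * \<psi> x R"
   using m r R e0 by (intro mult_right_mono mult_mono powr_mono') (auto simp: B_def \<psi>_def)
  finally show ?thesis .
 qed
 then show ?thesis using A s1 by (intro exI[of _ B] conjI exI[of _ "\<delta> / s"]) (auto simp: B_def)
qed

lemma psi_pos: "0 < r ==> 0 < \<psi> x r" using mu_pos[of r x] by (simp add: \<psi>_def)

lemma psi_growth: "EX A>=1. EX m>=0. ALL x r R. 0 < r --> 0 < R --> \<psi> x R <= A * (1 + R / r) powr m * \<psi> x r"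
proof -
 let ?d = "real DIM('a)"
 from mu_growth obtain m where m: "0 <= m" "!!x r R. 0 < r ==> r <= R ==> \<mu> x R <= 2 * (R / r) powr m * \<mu> x r" by blast
 from psi_decay obtain A \<delta> where A: "1 <= A" "0 < \<delta>" "!!x r R. 0 < r ==> r <= R ==> \<psi> x r <= A * (r / R) powr \<delta> * \<psi> x R" by blast
 have "\<psi> x R <= (2 * A) * (1 + R / r) powr m * \<psi> x r" if r: "0 < r" "0 < R" for x r R
 proof (cases "r <= R")
  case True
  have "\<psi> x R <= r powr (2 - ?d) * (2 * (R / r) powr m * \<mu> x r)"
   unfolding \<psi>_def using m(2)[OF r(1) True] True r dim mu_nonneg by (intro mult_mono powr_mono2') auto
  also have "... = (2 * (R / r) powr m) * \<psi> x r" by (simp add: \<psi>_def)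
  also have "... <= ((2 * A) * (1 + R / r) powr m) * \<psi> x r"
   using m(1) A(1) r psi_pos[OF r(1), of x] by (intro mult_right_mono mult_mono powr_mono2) auto
  finally show ?thesis .
 next
  case False
  then have "\<psi> x R <= A * (R / r) powr \<delta> * \<psi> x r" using A(3)[of R r x] r by simp
  also have "... <= ((2 * A) * (1 + R / r) powr m) * \<psi> x r"
  proof (intro mult_right_mono mult_mono)
   have "(R / r) powr \<delta> <= 1 powr \<delta>" using False r A by (intro powr_mono2) auto
   also have "1 powr \<delta> <= (1 + R / r) powr m" using r m by (simp add: ge_one_powr_ge_zero)
   finally show "(R / r) powr \<delta> <= (1 + R / r) powr m" .
  qed (use A psi_pos[OF r(1), of x] in auto)
  finally show ?thesis .
 qed
 then show ?thesis using A m(1) by (intro exI[of _ "2 * A"] conjI exI[of _ m]) auto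
qed

section \<open>The critical radius\<close>

abbreviation "\<rho> \<equiv> critical_radius V"

lemma critical_radius_alt: "\<rho> x = Sup {r. 0 < r & \<psi> x r <= 1}"
 unfolding critical_radius_def \<psi>_def \<mu>_def wmeas_def by simp

text \<open>By \<open>psi_decay\<close> the set of admissible radii contains small radii and is
  bounded, so its supremum is genuine. Attainment is avoided: an admissible radius above half the
  supremum serves as well.\<close>

lemma critical_radius:
 shows critical_radius_pos: "0 < \<rho> x"
  and psi_gt_1: "\<rho> x < r ==> 1 < \<psi> x r"
  and ex_psi_le_1: "EX r>\<rho> x / 2. \<psi> x r <= 1"
proof -
 from psi_decay obtain A \<delta> where A: "1 <= A" "0 < \<delta>" "!!x r R. 0 < r ==> r <= R ==> \<psi> x r <= A * (r / R) powr \<delta> * \<psi> x R" by blast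
 let ?S = "{r. 0 < r & \<psi> x r <= 1}"
 define r where "r = min 1 ((1 / (A * \<psi> x 1)) powr (1 / \<delta>))"
 have p1: "0 < \<psi> x 1" by (rule psi_pos) simp
 have r: "0 < r" "r <= 1" using A p1 by (auto simp: r_def)
 have "r powr \<delta> <= ((1 / (A * \<psi> x 1)) powr (1 / \<delta>)) powr \<delta>" using r A by (intro powr_mono2) (auto simp: r_def)
 also have "... = 1 / (A * \<psi> x 1)" using A p1 by (simp add: powr_powr)
 finally have "A * r powr \<delta> * \<psi> x 1 <= 1" using A p1 by (simp add: field_simps)
 with A(3)[OF r, of x] r have ne: "r \<in> ?S" by simp
 define M where "M = max 1 ((A / \<psi> x 1) powr (1 / \<delta>))"
 have bdd: "r' <= M" if "r' \<in> ?S" for r'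
 proof (rule ccontr)
  assume "~ r' <= M"
  then have r': "1 < r'" "(A / \<psi> x 1) powr (1 / \<delta>) < r'" by (auto simp: M_def)
  then have "((A / \<psi> x 1) powr (1 / \<delta>)) powr \<delta> < r' powr \<delta>" using A by (intro powr_less_mono2) auto
  then have "A / \<psi> x 1 < r' powr \<delta>" using A p1 by (simp add: powr_powr)
  then have "A * (1 / r') powr \<delta> < \<psi> x 1" using p1 r' by (simp add: powr_divide field_simps)
  moreover have "\<psi> x 1 <= A * (1 / r') powr \<delta> * \<psi> x r'" using A(3)[of 1 r' x] r' by simp
  moreover have "A * (1 / r') powr \<delta> * \<psi> x r' <= A * (1 / r') powr \<delta> * 1" using that A by (intro mult_left_mono) auto
  ultimately show False by simp
 qed
 have bd: "bdd_above ?S" using bdd by (auto simp: bdd_above_def)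
 have "r <= \<rho> x" unfolding critical_radius_alt by (rule cSup_upper[OF ne bd])
 with r show pos: "0 < \<rho> x" by simp
 show "1 < \<psi> x r" if "\<rho> x < r" for r
 proof (rule ccontr)
  assume "~ 1 < \<psi> x r"
  then have "r \<in> ?S" using that pos by simp
  from cSup_upper[OF this bd] that show False unfolding critical_radius_alt by simp
 qed
 have "\<rho> x / 2 < \<rho> x" using pos by simp
 then obtain r where "r \<in> ?S" "\<rho> x / 2 < r"
  using less_cSupE[of "\<rho> x / 2" ?S] ne unfolding critical_radius_alt by blast
 then show "EX r>\<rho> x / 2. \<psi> x r <= 1" by auto
qed

text \<open>The doubled radius lies strictly beyond \<open>\<rho> x\<close>, where
  \<open>\<psi>\<close> exceeds 1, and growth bounds that value by a multiple of
  \<open>\<psi> x r\<close>; the endpoint \<open>r = \<rho> x\<close> is thereby included.\<close>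

lemma psi_large: "EX c>0. ALL x r. \<rho> x <= r --> c <= \<psi> x r"
proof -
 from psi_growth obtain A m where A: "1 <= A" "!!x r R. 0 < r ==> 0 < R ==> \<psi> x R <= A * (1 + R / r) powr m * \<psi> x r" by blast
 have "1 / (A * 3 powr m) <= \<psi> x r" if r: "\<rho> x <= r" for x r
 proof -
  have r0: "0 < r" using r critical_radius_pos[of x] by linarith
  have "1 < \<psi> x (2 * r)" by (rule psi_gt_1) (use r r0 in linarith)
  also have "... <= A * (1 + 2 * r / r) powr m * \<psi> x r" by (rule A(2)) (use r0 in auto)
  finally have "1 < (A * 3 powr m) * \<psi> x r" using r0 by simp
  then show ?thesis using A(1) by (simp add: field_simps)
 qed
 then show ?thesis using A(1) by (intro exI[of _ "1 / (A * 3 powr m)"]) auto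
qed

text \<open>Only \<open>R > \<rho> x\<close> needs work. Up to constants, decay between the radii
  \<open>\<rho> x\<close> and \<open>R\<close> makes \<open>\<psi> x R\<close> at least
  \<open>(R / \<rho> x) powr \<delta>\<close>, while inclusion in a ball about \<open>y\<close> and
  growth bound it by \<open>(1 + R / \<rho> y) powr m\<close>. Any \<open>R\<close> above the
  distance is allowed, so that a convenient scale can be chosen later.\<close>

lemma slow_variation:
 "EX C>=1. EX k>=1. ALL x y R. dist x y <= R --> 1 + R / \<rho> x <= C * (1 + R / \<rho> y) powr k"
proof -
 from psi_growth obtain A m where A: "1 <= A" "0 <= m" "!!x r R. 0 < r ==> 0 < R ==> \<psi> x R <= A * (1 + R / r) powr m * \<psi> x r" by blast
 from psi_decay obtain B \<delta> where B: "1 <= B" "0 < \<delta>" "!!x r R. 0 < r ==> r <= R ==> \<psi> x r <= B * (r / R) powr \<delta> * \<psi> x R" by blast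
 from psi_large obtain c where c: "c > 0" "!!x r. \<rho> x <= r ==> c <= \<psi> x r" by blast
 define D where "D = B * 2 powr (real DIM('a) - 2) * A * 4 powr m / c"
 \<comment> \<open>The quotient comes from taking the root of order \<delta>; adding 1 ensures
   \<open>1 \<le> k\<close>.\<close>
 define k where "k = m / \<delta> + 1"
 define C where "C = 2 * max 1 (D powr (1 / \<delta>))"
 have D: "D > 0" using A B c by (simp add: D_def)
 have "1 + R / \<rho> x <= C * (1 + R / \<rho> y) powr k" if R: "dist x y <= R" for x y R
 proof -
  have R0: "0 <= R" using R zero_le_dist[of x y] by linarith
  have px: "0 < \<rho> x" and py: "0 < \<rho> y" by (rule critical_radius_pos)+
  have ge1: "1 <= (1 + R / \<rho> y) powr k" using R0 py A B by (simp add: ge_one_powr_ge_zero k_def)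
  show ?thesis
  proof (cases "R <= \<rho> x")
   case True
   then have "1 + R / \<rho> x <= 2 * 1" using px by simp
   also have "... <= C * (1 + R / \<rho> y) powr k" using ge1 by (intro mult_mono) (auto simp: C_def)
   finally show ?thesis .
  next
   case False
   then have Rp: "0 < R" and xR: "\<rho> x <= R" using px by auto
   obtain r where r: "\<rho> y / 2 < r" "\<psi> y r <= 1" using ex_psi_le_1 by blast
   have r0: "0 < r" using r py by simp
   have "c <= \<psi> x (\<rho> x)" by (rule c(2)) simp
   also have "... <= B * (\<rho> x / R) powr \<delta> * \<psi> x R" by (rule B(3)[OF px xR])
   also have "\<psi> x R <= 2 powr (real DIM('a) - 2) * \<psi> y (2 * R)"
   proof -
    have "\<mu> x R <= \<mu> y (2 * R)" by (rule mu_mono, rule subset_ballI) (use R in simp)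
    then have "\<psi> x R <= R powr (2 - real DIM('a)) * \<mu> y (2 * R)" unfolding \<psi>_def by (intro mult_left_mono) auto
    also have "R powr (2 - real DIM('a)) = 2 powr (real DIM('a) - 2) * (2 * R) powr (2 - real DIM('a))"
     using Rp by (simp add: powr_mult powr_add[symmetric] mult.assoc[symmetric])
    finally show ?thesis by (simp add: \<psi>_def)
   qed
   also have "\<psi> y (2 * R) <= A * (1 + 2 * R / r) powr m * \<psi> y r" by (rule A(3)) (use r0 Rp in auto)
   also have "... <= A * (4 * (1 + R / \<rho> y)) powr m * 1"
   proof (intro mult_mono powr_mono2 r)
    have "R / r <= R / (\<rho> y / 2)" using r(1) Rp py r0 by (intro divide_left_mono) auto
    then have "2 * R / r <= 4 * (R / \<rho> y)" by simp
    then show "1 + 2 * R / r <= 4 * (1 + R / \<rho> y)" by simp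
   qed (use A psi_pos[OF r0, of y] Rp r0 in auto)
   finally have "c <= B * (\<rho> x / R) powr \<delta> * (2 powr (real DIM('a) - 2) * (A * (4 * (1 + R / \<rho> y)) powr m * 1))"
    using B by (simp add: mult_left_mono)
   also have "(\<rho> x / R) powr \<delta> = 1 / (R / \<rho> x) powr \<delta>" using px Rp by (simp add: powr_divide)
   also have "(4 * (1 + R / \<rho> y)) powr m = 4 powr m * (1 + R / \<rho> y) powr m" using py Rp by (subst powr_mult) auto
   finally have "c <= B * (1 / (R / \<rho> x) powr \<delta>) * (2 powr (real DIM('a) - 2) * (A * (4 powr m * (1 + R / \<rho> y) powr m) * 1))" .
   moreover have "0 < (R / \<rho> x) powr \<delta>" using px Rp by simp
   ultimately have "(R / \<rho> x) powr \<delta> <= D * (1 + R / \<rho> y) powr m"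
    using c(1) unfolding D_def by (simp add: pos_le_divide_eq mult_ac)
   then have "((R / \<rho> x) powr \<delta>) powr (1 / \<delta>) <= (D * (1 + R / \<rho> y) powr m) powr (1 / \<delta>)"
    using B by (intro powr_mono2) auto
   then have "R / \<rho> x <= D powr (1 / \<delta>) * (1 + R / \<rho> y) powr (m / \<delta>)"
    using B D Rp px py by (simp add: powr_powr powr_mult)
   also have "... <= max 1 (D powr (1 / \<delta>)) * (1 + R / \<rho> y) powr k"
    using Rp py by (intro mult_mono powr_mono) (auto simp: k_def)
   finally have 1: "R / \<rho> x <= max 1 (D powr (1 / \<delta>)) * (1 + R / \<rho> y) powr k" .
   have "1 * 1 <= max 1 (D powr (1 / \<delta>)) * (1 + R / \<rho> y) powr k" using ge1 by (intro mult_mono) auto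
   with 1 show ?thesis by (simp add: C_def)
  qed
 qed
 then show ?thesis using A B by (intro exI[of _ C] conjI exI[of _ k]) (auto simp: C_def k_def)
qed

text \<open>Otherwise the set would carry at most a quarter of the mass, and its complement in the
  ball, where the potential is below \<open>a / r\<^sup>2\<close>, at most half by the choice of
  \<open>a\<close>; this falls short of the whole.\<close>

lemma large_potential_set:
 "EX a>0. EX b>0. ALL x r. \<rho> x <= r --> b * r powr real DIM('a) <= measure lebesgue {z \<in> ball x r. a / r\<^sup>2 <= V z}"
proof -
 let ?d = "real DIM('a)"
 from psi_large obtain c where c: "c > 0" "!!x r. \<rho> x <= r ==> c <= \<psi> x r" by blast
 have "0 < (1 / 4 :: real)" by simp
 from small_sets[OF this] obtain \<epsilon> where e: "\<epsilon> > 0" "ALL x r E. 0 < r --> E \<in> sets lebesgue --> E \<subseteq> ball x r --> measure lebesgue E <= \<epsilon> * vol r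
   --> wmeas V E <= 1 / 4 * \<mu> x r" by (elim exE conjE)
 define a where "a = c / (2 * vol 1)"
 have v1: "vol 1 > 0" by (rule vol_pos) simp
 have "\<epsilon> * vol 1 * r powr ?d <= measure lebesgue {z \<in> ball x r. a / r\<^sup>2 <= V z}" if r: "\<rho> x <= r" for x r
 proof (rule ccontr)
  assume neg: "~ \<epsilon> * vol 1 * r powr ?d <= measure lebesgue {z \<in> ball x r. a / r\<^sup>2 <= V z}"
  have r0: "0 < r" using r critical_radius_pos[of x] by linarith
  let ?E = "{z \<in> ball x r. a / r\<^sup>2 <= V z}" let ?F = "ball x r - ?E"
  have "(%z. indicator (ball x r) z *\<^sub>R V z) \<in> borel_measurable lebesgue"
   using V_int[of x r] unfolding set_integrable_def by auto
  then have "{z \<in> space lebesgue. a / r\<^sup>2 <= indicator (ball x r) z *\<^sub>R V z} \<in> sets lebesgue"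
   by (intro borel_measurable_le) auto
  moreover have "ball x r \<inter> {z \<in> space lebesgue. a / r\<^sup>2 <= indicator (ball x r) z *\<^sub>R V z} = ?E"
   by (auto simp: indicator_def)
  ultimately have E: "?E \<in> sets lebesgue"
   using sets.Int[OF fmeasurableD[OF lmeasurable_ball[of x r]], of "{z \<in> space lebesgue. a / r\<^sup>2 <= indicator (ball x r) z *\<^sub>R V z}"]
   by (simp only:)
  have "measure lebesgue ?E <= \<epsilon> * vol r" using neg vol[OF r0] by simp
  then have 1: "wmeas V ?E <= 1 / 4 * \<mu> x r" by (intro e(2)[rule_format] r0 E) auto
  have F: "?F \<in> lmeasurable" using E by (intro fmeasurable_Diff) auto
  have "wmeas V ?F <= a / r\<^sup>2 * measure lebesgue ?F"
   by (rule wmeas_le_const[OF set_integrable_subset[OF V_int] F]) (use F in \<open>auto simp: fmeasurableD\<close>)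
  also have "... <= a / r\<^sup>2 * vol r"
   unfolding measure_ball_vol[OF r0, of x, symmetric]
   using F c v1 by (intro mult_left_mono measure_mono_fmeasurable) (auto simp: a_def fmeasurableD)
  also have "... = 1 / 2 * (c * (r powr ?d / r powr 2))"
   using v1 r0 by (simp add: a_def vol[OF r0])
  also have "r powr ?d / r powr 2 = r powr (?d - 2)" by (simp add: powr_diff)
  also have "c * r powr (?d - 2) <= \<mu> x r"
  proof -
   have "r powr (?d - 2) * c <= r powr (?d - 2) * \<psi> x r" by (intro mult_left_mono c(2) r) auto
   also have "... = (r powr (?d - 2) * r powr (2 - ?d)) * \<mu> x r" by (simp add: \<psi>_def)
   also have "r powr (?d - 2) * r powr (2 - ?d) = 1" using r0 by (simp add: powr_add[symmetric])
   finally show ?thesis by (simp add: mult.commute)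
  qed
  finally have "wmeas V ?F <= 1 / 2 * \<mu> x r" by simp
  moreover have "wmeas V ?F = \<mu> x r - wmeas V ?E" unfolding \<mu>_def by (rule wmeas_Diff[OF V_int E]) auto
  ultimately show False using 1 mu_pos[OF r0, of x] by simp
 qed
 moreover have "0 < a" "0 < \<epsilon> * vol 1" using c v1 e(1) by (simp_all add: a_def)
 ultimately show ?thesis by (intro exI[of _ a] exI[of _ "\<epsilon> * vol 1"] conjI allI impI)
qed

end

section \<open>Decay of the Schroedinger semigroup\<close>

lemma AE_ball_union:
 assumes "!!y. y \<in> U ==> AE z. z \<in> ball y (r y) --> P z" and r: "!!y. y \<in> U ==> 0 < r y"
 shows "AE z. z \<in> (U :: 'a::euclidean_space set) --> P z"
proof -
 obtain F where F: "F \<subseteq> (%y. ball y (r y)) ` U" "countable F" "\<Union>F = \<Union>((%y. ball y (r y)) ` U)"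
  by (rule Lindelof[of "(%y. ball y (r y)) ` U"]) auto
 have "AE z. z \<in> B --> P z" if "B \<in> F" for B using that F(1) assms(1) by auto
 then have "AE z. ALL B:F. z \<in> B --> P z" unfolding AE_ball_countable[OF F(2)] by (rule ballI)
 then show ?thesis
 proof eventually_elim
  case (elim z)
  show ?case
  proof
   assume "z \<in> U"
   then have "z \<in> \<Union>F" using r[of z] unfolding F(3) by (intro UN_I[of z]) auto
   with elim show "P z" by blast
  qed
 qed
qed

lemma borel_subset_lebesgue:
 assumes "E \<in> sets lebesgue"
 obtains E' where "E' \<in> sets lborel" "E' \<subseteq> E" "measure lborel E' = measure lebesgue E" "emeasure lborel E' = emeasure lebesgue E"
proof -
 obtain N' where m: "main_part lborel E \<union> null_part lborel E = E" by (simp add: main_part_null_part_Un assms)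
 have s: "main_part lborel E \<in> sets lborel" "emeasure lborel (main_part lborel E) = emeasure lebesgue E"
  using main_part_sets[OF assms] emeasure_completion[OF assms] by auto
 with m show ?thesis by (intro that[of "main_part lborel E"]) (auto simp: measure_def)
qed

text \<open>Markov's inequality for the moment of order \<open>k\<close>; since \<open>k\<close> is
  free, the tail can be beaten down to any power.\<close>

lemma heat_tail:
 assumes t: "0 < t" and l: "0 < l" and m: "m = (LBINT x::'a::euclidean_space. norm x ^ k * heat 1 x)"
 shows "(LBINT x::'a. indicator {x. l <= norm x} x * heat t x) <= m * (sqrt t / l) ^ k"
proof -
 have "(LBINT x::'a. indicator {x. l <= norm x} x * heat t x) <= (LBINT x::'a. norm x ^ k * heat t x / l ^ k)"
 proof (rule integral_mono)
  have *: "{x::'a. l <= norm x} \<in> sets lborel" by simp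
  show "integrable lborel (%x::'a. indicator {x. l <= norm x} x * heat t x)"
   using integrable_real_mult_indicator[OF * integrable_heat[OF t]] by (simp add: mult.commute)
  show "integrable lborel (%x::'a. norm x ^ k * heat t x / l ^ k)" by (intro integrable_divide integrable_heat_moment t)
  fix x :: 'a
  have "indicator {x. l <= norm x} x <= (norm x / l) ^ k"
   using l by (auto simp: indicator_def intro!: one_le_power)
  then show "indicator {x. l <= norm x} x * heat t x <= norm x ^ k * heat t x / l ^ k"
   using mult_right_mono[OF _ heat_nonneg[OF t, of x]] by (fastforce simp: power_divide)
 qed
 also have "(LBINT x::'a. norm x ^ k * heat t x / l ^ k) = m * sqrt t ^ k / l ^ k"
  using integral_heat_scale[OF t, of "%x::'a. norm x ^ k"] t
  by (simp add: m power_mult_distrib mult.commute[of _ "heat _ _"] mult.left_commute[of "heat _ _"])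
 finally show ?thesis by (simp add: power_divide)
qed

lemma heat_tail_nonneg: "0 <= (LBINT x::'a::euclidean_space. norm x ^ k * heat 1 x)"
 by (intro Bochner_Integration.integral_nonneg mult_nonneg_nonneg heat_nonneg) auto

lemma geometric_le_power:
 assumes "0 < (\<eta>::real)" "\<eta> < 1" shows "EX C>0. ALL n. (1 - \<eta>) ^ n * real (n + 1) ^ k <= C"
proof -
 have "(%n. (1 - \<eta>) ^ n * real (n + 1) ^ k) \<longlonglongrightarrow> 0" using assms by real_asymp
 then have "Bseq (%n. (1 - \<eta>) ^ n * real (n + 1) ^ k)" by (intro convergent_imp_Bseq convergentI)
 then obtain C where C: "C > 0" "!!n. norm ((1 - \<eta>) ^ n * real (n + 1) ^ k) <= C" by (auto elim: BseqE)
 have "(1 - \<eta>) ^ n * real (n + 1) ^ k <= C" for n using C(2)[of n] by (simp add: abs_le_iff)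
 then show ?thesis using C(1) by blast
qed

locale schroedinger_rh = rh_potential V s + schroedinger_flow V S
 for V :: "'a::euclidean_space => real" and s S
begin

text \<open>\<open>absorption\<close> over the time \<open>r\<^sup>2\<close>, with \<open>Q\<close>
  equal to \<open>1 / r\<^sup>2\<close> on a set where the potential is at least
  \<open>a / r\<^sup>2\<close>. That set has volume comparable to the ball, so the accumulated heat
  is bounded below on the ball independently of \<open>r\<close>.\<close>

lemma killing: "EX \<eta>>0. \<eta> < 1 & (ALL y r f. \<rho> y <= r --> (AE x. fn f x <= 1) -->
  (AE x. x \<in> ball y r --> fn (Sop (r\<^sup>2) f) x <= 1 - \<eta>))"
proof -
 let ?d = "real DIM('a)"
 from large_potential_set obtain a b where ab: "a > 0" "b > 0"
  "!!x r. \<rho> x <= r ==> b * r powr ?d <= measure lebesgue {z \<in> ball x r. a / r\<^sup>2 <= V z}" by blast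
 define M where "M = heat_mass 1 TYPE('a)"
 have M: "M > 0" unfolding M_def by (rule heat_mass_pos) simp
 \<comment> \<open>The bound \<open>a / 2\<close> gives \<open>2 * \<epsilon> * Q \<le> V\<close>;
   the bound \<open>1 / 2\<close> is the smallness condition of \<open>absorption\<close>, whose
   product \<open>T * k\<close> equals 1 here.\<close>
 define \<epsilon> where "\<epsilon> = min (a / 2) (1 / 2)"
 have e: "0 < \<epsilon>" "2 * \<epsilon> <= a" "\<epsilon> <= 1 / 2" using ab by (auto simp: \<epsilon>_def)
 define h where "h = exp (- 2) * b / (2 * M)"
 have h: "h > 0" using ab M by (simp add: h_def)
 define \<eta> where "\<eta> = min (\<epsilon> * h) (1 / 2)"
 have "AE x. x \<in> ball y r --> fn (Sop (r\<^sup>2) f) x <= 1 - \<eta>"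
  if r: "\<rho> y <= r" and f: "AE x. fn f x <= 1" for y r f
 proof -
  have r0: "0 < r" using r critical_radius_pos[of y] by linarith
  let ?E = "{z \<in> ball y r. a / r\<^sup>2 <= V z}"
  have "?E = ball y r \<inter> {z \<in> space lebesgue. a / r\<^sup>2 <= V z}" by auto
  also have "... \<in> sets lebesgue" using V_measurable by (intro sets.Int borel_measurable_le fmeasurableD[OF lmeasurable_ball]) auto
  finally have "?E \<in> sets lebesgue" .
  then obtain E where E: "E \<in> sets lborel" "E \<subseteq> ?E" "measure lborel E = measure lebesgue ?E" by (rule borel_subset_lebesgue)
  have "E \<subseteq> ball y r" using E(2) by auto
  then have fin: "emeasure lborel E < \<infinity>"
   by (rule order_le_less_trans[OF emeasure_mono emeasure_lborel_ball_finite]) simp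
  note [measurable] = E(1)
  define g where "g = (%z. (1 / r\<^sup>2) * indicator E z :: real)"
  have g: "sqi g" unfolding g_def by (intro sqi_scale sqi_indicator E fin)
  define Q where "Q = mk g"
  note Qg = fn_mk[OF g, folded Q_def]
  have Q: "AE x. 0 <= fn Q x" "AE x. fn Q x <= 1 / r\<^sup>2" "AE x. 2 * \<epsilon> * fn Q x <= V x"
  proof -
   show "AE x. 0 <= fn Q x" "AE x. fn Q x <= 1 / r\<^sup>2"
    using Qg by (eventually_elim, simp add: g_def indicator_def)+
   show "AE x. 2 * \<epsilon> * fn Q x <= V x" using Qg
   proof eventually_elim
    case (elim x)
    show ?case
    proof (cases "x \<in> E")
     case True
     have "2 * \<epsilon> * (1 / r\<^sup>2) <= a * (1 / r\<^sup>2)" using e by (intro mult_right_mono) auto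
     also have "... <= V x" using True E(2) by auto
     finally show ?thesis using True elim by (simp add: g_def)
    qed (use elim nonneg in \<open>simp add: g_def\<close>)
   qed
  qed
  \<comment> \<open>Only the second half of the time interval is used: two points of the ball are
    closer than \<open>2 * r\<close>, so the Gaussian factor is at least \<open>exp (- 2)\<close>
    there. This is the origin of \<open>h\<close>.\<close>
  have low: "AE x. 2 * h / r\<^sup>2 * indicator (ball y r) x <= fn (heat_op u Q) x" if u: "u \<in> {r\<^sup>2 / 2..r\<^sup>2}" for u
  proof -
   have u0: "0 < u" using u r0 by (auto intro: less_le_trans[of 0 "r\<^sup>2 / 2"])
   have "2 * h / r\<^sup>2 * indicator (ball y r) x <= conv (heat u) g x" for x
   proof (cases "x \<in> ball y r")
    case True
    have le: "exp (- 2) / (r powr ?d * M) <= heat u (x - z)" if "z \<in> E" for z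
    proof -
     have z: "z \<in> ball y r" using that E(2) by auto
     then have "dist x z < 2 * r" using True dist_triangle[of x z y] by (simp add: dist_commute)
     then have "(norm (x - z))\<^sup>2 <= (2 * r)\<^sup>2" by (intro power_mono) (auto simp: dist_norm)
     also have "... <= 8 * u" using u by (simp add: power_mult_distrib)
     finally have 1: "exp (- 2) <= exp (- (norm (x - z))\<^sup>2 / (4 * u))" using u0 by (simp add: field_simps)
     have "u powr (?d / 2) <= (r\<^sup>2) powr (?d / 2)" using u u0 by (intro powr_mono2) auto
     also have "(r\<^sup>2) powr (?d / 2) = r powr ?d" using r0 by (simp add: powr_powr powr_numeral[symmetric] del: powr_numeral)
     finally have "heat_mass u TYPE('a) <= r powr ?d * M"
      using heat_mass_scale[OF u0, where 'a = 'a] M by (simp add: M_def mult_right_mono)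
     then show ?thesis unfolding heat_def using heat_mass_pos[OF u0, where 'a = 'a] 1 by (intro frac_le) auto
    qed
    have "2 * h / r\<^sup>2 = (1 / r\<^sup>2) * (exp (- 2) / (r powr ?d * M)) * (b * r powr ?d)" using r0 M by (simp add: h_def)
    also have "... <= (1 / r\<^sup>2) * (exp (- 2) / (r powr ?d * M)) * measure lborel E"
     using ab(3)[OF r] E(3) M by (intro mult_left_mono) auto
    also have "... = (LBINT z. (exp (- 2) / (r powr ?d * M)) * g z)" using E fin by (simp add: g_def)
    also have "... <= (LBINT z. heat u (x - z) * g z)"
    proof (rule integral_mono)
     show "integrable lborel (%z. (exp (- 2) / (r powr ?d * M)) * g z)" using E fin by (simp add: g_def)
     show "integrable lborel (%z. heat u (x - z) * g z)" by (rule heat_conv_integrable[OF u0 g])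
     show "(exp (- 2) / (r powr ?d * M)) * g z <= heat u (x - z) * g z" for z
      using mult_right_mono[OF le[of z], of "1 / r\<^sup>2"] by (cases "z \<in> E") (simp_all add: g_def)
    qed
    finally show ?thesis using True by (simp add: conv_def)
   next
    case False
    have "0 <= conv (heat u) g x" unfolding conv_def g_def
     by (intro Bochner_Integration.integral_nonneg mult_nonneg_nonneg heat_nonneg u0) auto
    with False show ?thesis by simp
   qed
   then show ?thesis using fn_mk[OF young(3)[OF integrable_heat[OF u0] g]] unfolding Q_def heat_op_mk[OF u0 g]
    by (auto elim!: eventually_mono)
  qed
  have "AE x. (r\<^sup>2 - r\<^sup>2 / 2) * (2 * h / r\<^sup>2 * indicator (ball y r) x) <= fn (integral {r\<^sup>2 / 2..r\<^sup>2} (%u. heat_op u Q)) x"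
   by (rule integral_l2_AE_ge[where H = "2 * h / r\<^sup>2"])
     (use low h r0 in \<open>auto intro!: continuous_on_subset[OF heat.continuous] simp: indicator_def\<close>)
  moreover have "heat.tint (r\<^sup>2) Q = heat.tint (r\<^sup>2 / 2) Q + integral {r\<^sup>2 / 2..r\<^sup>2} (%u. heat_op u Q)"
   unfolding heat.tint_def by (rule Henstock_Kurzweil_Integration.integral_combine[symmetric]) auto
  moreover have "AE x. 0 <= fn (heat.tint (r\<^sup>2 / 2) Q) x" by (rule heat_tint_nonneg[OF Q(1)]) simp
  moreover note fn_add[of "heat.tint (r\<^sup>2 / 2) Q" "integral {r\<^sup>2 / 2..r\<^sup>2} (%u. heat_op u Q)"]
  ultimately have tint: "AE x. x \<in> ball y r --> h <= fn (heat.tint (r\<^sup>2) Q) x"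
   by (auto elim!: eventually_elim2 simp: r0[THEN less_imp_neq, symmetric])
  have "AE x. fn (Sop (r\<^sup>2) f) x + \<epsilon> * fn (heat.tint (r\<^sup>2) Q) x <= 1"
   by (rule absorption[OF _ e(1) Q(1,2) _ Q(3) f]) (use r0 e in auto)
  with tint show ?thesis
  proof eventually_elim
   case (elim x)
   show ?case
   proof
    assume "x \<in> ball y r"
    with elim(1) e have "\<epsilon> * h <= \<epsilon> * fn (heat.tint (r\<^sup>2) Q) x" by (intro mult_left_mono) auto
    with elim(2) show "fn (Sop (r\<^sup>2) f) x <= 1 - \<eta>" by (simp add: \<eta>_def)
   qed
  qed
 qed
 then show ?thesis using e h by (intro exI[of _ \<eta>]) (auto simp: \<eta>_def)
qed

text \<open>The datum is split at the ball of radius \<open>Q\<close>. The inner part divided by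
  \<open>A\<close> is at most 1 and loses the factor \<open>1 - \<eta>\<close> on the balls of
  radius \<open>r\<close> centred in \<open>ball x R\<close>; the outer part must cross the distance
  \<open>l\<close> to reach the ball of radius \<open>Q - l\<close>, and contributes only a Gaussian
  tail.\<close>

lemma propagation_step:
 assumes \<eta>: "0 < \<eta>" "\<eta> < 1"
  and kill: "!!y r f. \<rho> y <= r ==> AE x. fn f x <= 1 ==> AE x. x \<in> ball y r --> fn (Sop (r\<^sup>2) f) x <= 1 - \<eta>"
  and r: "0 < r" and l: "0 < l" and R: "!!y. y \<in> ball x R ==> \<rho> y <= r" and Q: "Q <= R"
  and f: "AE z. fn f z <= 1" and A: "0 < A" and fA: "AE z. z \<in> ball x Q --> fn f z <= A"
  and tail: "(LBINT z::'a. indicator {z. l <= norm z} z * heat (r\<^sup>2) z) <= \<tau>"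
 shows "AE z. z \<in> ball x (Q - l) --> fn (Sop (r\<^sup>2) f) z <= A * (1 - \<eta>) + \<tau>"
proof -
 have r2: "0 < r\<^sup>2" using r by simp
 let ?B = "ball x Q"
 define g1 where "g1 = (%z. indicator ?B z * fn f z)"
 define g2 where "g2 = (%z. indicator (- ?B) z * fn f z)"
 have s1: "sqi g1" unfolding g1_def by (rule sqi_mult_bounded[OF sqi_fn, where c = 1]) (measurable, auto split: split_indicator)
 have s2: "sqi g2" unfolding g2_def by (rule sqi_mult_bounded[OF sqi_fn, where c = 1]) (measurable, auto split: split_indicator)
 have "f = mk (%z. g1 z + g2 z)"
 proof (subst fn_eq_mk[OF sqi_add[OF s1 s2]])
  show "AE z. fn f z = g1 z + g2 z" by (rule AE_I2) (simp add: g1_def g2_def split: split_indicator)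
 qed
 then have f12: "Sop (r\<^sup>2) f = Sop (r\<^sup>2) (mk g1) + Sop (r\<^sup>2) (mk g2)"
  using mk_add[OF s1 s2] sg.apply_simps(1) r2 by simp
 have "AE z. fn ((1 / A) *\<^sub>R mk g1) z <= 1"
  using fn_scale[of "1 / A" "mk g1"] fn_mk[OF s1] fA
 proof eventually_elim
  case (elim z)
  then show ?case using A by (cases "z \<in> ?B") (auto simp: g1_def)
 qed
 then have "AE z. z \<in> ball y r --> fn (Sop (r\<^sup>2) ((1 / A) *\<^sub>R mk g1)) z <= 1 - \<eta>" if "y \<in> ball x R" for y
  by (rule kill[OF R[OF that]])
 then have "AE z. z \<in> ball x R --> fn (Sop (r\<^sup>2) ((1 / A) *\<^sub>R mk g1)) z <= 1 - \<eta>"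
  by (rule AE_ball_union[where r = "%_. r"]) (use r in auto)
 moreover have "Sop (r\<^sup>2) ((1 / A) *\<^sub>R mk g1) = (1 / A) *\<^sub>R Sop (r\<^sup>2) (mk g1)" using r2 by (simp add: sg.apply_simps)
 ultimately have "AE z. z \<in> ball x R --> fn ((1 / A) *\<^sub>R Sop (r\<^sup>2) (mk g1)) z <= 1 - \<eta>" by simp
 with fn_scale[of "1 / A" "Sop (r\<^sup>2) (mk g1)"]
 have 1: "AE z. z \<in> ball x R --> fn (Sop (r\<^sup>2) (mk g1)) z <= A * (1 - \<eta>)"
  by eventually_elim (use A in \<open>simp add: pos_divide_le_eq mult.commute\<close>)
 let ?p = "%z. max 0 (g2 z)"
 have sp: "sqi ?p"
  by (rule sqi_dominated[OF s2]) (use s2 in \<open>auto simp: sqi_def\<close>)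
 have pp: "ppart 0 (mk g2) = mk ?p"
  by (subst fn_eq_mk[OF sp]) (use fn_ppart_zero[of "mk g2"] fn_mk[OF s2] in \<open>auto elim!: eventually_elim2\<close>)
 have ple: "AE z. ?p z <= indicator (- ?B) z" using f by eventually_elim (auto simp: g2_def indicator_def)
 have a: "conv (heat (r\<^sup>2)) ?p z <= \<tau>" if z: "z \<in> ball x (Q - l)" for z
 proof -
  have "conv (heat (r\<^sup>2)) ?p z <= (LBINT y. indicator {z. l <= norm z} (z - y) * heat (r\<^sup>2) (z - y))"
   unfolding conv_def
  proof (rule integral_mono_AE[OF heat_conv_integrable[OF r2 sp]])
   have *: "{x::'a. l <= norm x} \<in> sets lborel" by simp
   have "integrable lborel (%x::'a. indicator {x. l <= norm x} x * heat (r\<^sup>2) x)"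
    using integrable_real_mult_indicator[OF * integrable_heat[OF r2]] by (simp add: mult.commute)
   then show "integrable lborel (%y. indicator {z. l <= norm z} (z - y) * heat (r\<^sup>2) (z - y))"
    by (rule integrable_lborel_diff(1))
   show "AE y. heat (r\<^sup>2) (z - y) * ?p y <= indicator {z. l <= norm z} (z - y) * heat (r\<^sup>2) (z - y)"
    using ple
   proof eventually_elim
    case (elim y)
    have "indicator (- ?B) y <= (indicator {z. l <= norm z} (z - y) :: real)"
    proof (cases "y \<in> ?B")
     case False
     then have "l <= dist z y" using z dist_triangle[of x y z] by simp
     then show ?thesis by (simp add: dist_norm)
    qed simp
    with elim have "?p y <= indicator {z. l <= norm z} (z - y)" by linarith
    then show ?case using heat_nonneg[OF r2, of "z - y"] by (metis mult.commute mult_left_mono)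
   qed
  qed
  also have "... = (LBINT z::'a. indicator {z. l <= norm z} z * heat (r\<^sup>2) z)"
   by (rule integral_lborel_diff(1)[of "%y. indicator {z. l <= norm z} y * heat (r\<^sup>2) y"]) measurable
  finally show ?thesis using tail by linarith
 qed
 have b: "AE z. fn (heat_op (r\<^sup>2) (mk ?p)) z = conv (heat (r\<^sup>2)) ?p z"
  unfolding heat_op_mk[OF r2 sp] by (rule fn_mk[OF young(3)[OF integrable_heat[OF r2] sp]])
 have "AE z. fn (Sop (r\<^sup>2) (mk g2)) z <= fn (heat_op (r\<^sup>2) (mk ?p)) z"
  using Sop_le_heat[of "r\<^sup>2" "mk g2"] r2 by (simp add: pp)
 with b have 2: "AE z. z \<in> ball x (Q - l) --> fn (Sop (r\<^sup>2) (mk g2)) z <= \<tau>"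
  by eventually_elim (use a in fastforce)
 have sub: "ball x (Q - l) \<subseteq> ball x R" using Q l by (intro subset_ball) auto
 from 1 2 fn_add[of "Sop (r\<^sup>2) (mk g1)" "Sop (r\<^sup>2) (mk g2)"] show ?thesis unfolding f12
 proof eventually_elim
  case (elim z) then show ?case using sub by auto
 qed
qed

text \<open>There are \<open>n\<close> steps of time \<open>r\<^sup>2\<close>, each giving up a
  collar of width \<open>l\<close>. With \<open>r = R / n\<^sup>2\<close> and
  \<open>l = R / (2 * n)\<close> the radius drops by \<open>R / 2\<close> in total, while the ratio
  \<open>r / l = 2 / n\<close> makes every tail small. The surplus of the time
  \<open>R\<^sup>2\<close> is spent beforehand, where the bound 1 persists.\<close>

lemma propagation:
 "EX \<eta>>0. \<eta> < 1 & (ALL m n x R f. 0 < R --> 0 < n --> (ALL y:ball x R. \<rho> y <= R / (real n)\<^sup>2) -->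
   (AE z. fn f z <= 1) --> (AE z. z \<in> ball x (R / 2) -->
    fn (Sop (R\<^sup>2) f) z <= (1 - \<eta>) ^ n + real n * ((LBINT x::'a. norm x ^ m * heat 1 x) * (2 / real n) ^ m)))"
proof -
 from killing obtain \<eta> where eta: "0 < \<eta>" "\<eta> < 1" and kill: "!!y r f. \<rho> y <= r ==> AE x. fn f x <= 1 ==>
  AE x. x \<in> ball y r --> fn (Sop (r\<^sup>2) f) x <= 1 - \<eta>" by blast
 have "AE z. z \<in> ball x (R / 2) -->
    fn (Sop (R\<^sup>2) f) z <= (1 - \<eta>) ^ n + real n * ((LBINT x::'a. norm x ^ m * heat 1 x) * (2 / real n) ^ m)"
  if R: "0 < R" and n: "0 < n" and rho: "!!y. y \<in> ball x R ==> \<rho> y <= R / (real n)\<^sup>2" and f: "AE z. fn f z <= 1"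
  for m n x R f
 proof -
  define r where "r = R / (real n)\<^sup>2"
  define l where "l = R / (2 * real n)"
  define \<tau> where "\<tau> = (LBINT x::'a. norm x ^ m * heat 1 x) * (2 / real n) ^ m"
  have r: "0 < r" and l: "0 < l" using R n by (auto simp: r_def l_def)
  have r2: "0 <= r\<^sup>2" by simp
  have "r / l = 2 / real n" using R n by (simp add: r_def l_def power2_eq_square)
  then have "sqrt (r\<^sup>2) / l = 2 / real n" using r by simp
  with heat_tail[OF _ l refl, of "r\<^sup>2" m, where 'a = 'a] r
  have tail: "(LBINT z::'a. indicator {z. l <= norm z} z * heat (r\<^sup>2) z) <= \<tau>" by (simp add: \<tau>_def)
  have t0: "0 <= \<tau>" unfolding \<tau>_def using heat_tail_nonneg[of m, where 'a = 'a] by simp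
  have nr: "real n * r\<^sup>2 <= R\<^sup>2"
  proof -
   have "real n * r\<^sup>2 = R\<^sup>2 / real n ^ 3" using n by (simp add: r_def power_divide field_simps power_numeral_reduce)
   also have "... <= R\<^sup>2 / 1" using n by (intro divide_left_mono one_le_power) auto
   finally show ?thesis by simp
  qed
  define g where "g = Sop (R\<^sup>2 - real n * r\<^sup>2) f"
  have g1: "AE z. fn g z <= 1" unfolding g_def by (rule Sop_le_const[OF _ f]) (use nr in auto)
  have le1: "AE z. fn (Sop (real k * r\<^sup>2) g) z <= 1" for k by (rule Sop_le_const[OF _ g1]) auto
  have step: "AE z. z \<in> ball x (R - real k * l) --> fn (Sop (real k * r\<^sup>2) g) z <= (1 - \<eta>) ^ k + real k * \<tau>" for k
  proof (induction k)
   case 0 show ?case using le1[of 0] by eventually_elim simp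
  next
   case (Suc k)
   let ?A = "(1 - \<eta>) ^ k + real k * \<tau>"
   have A: "0 < ?A" using eta t0 by (simp add: add_pos_nonneg)
   have "AE z. z \<in> ball x ((R - real k * l) - l) --> fn (Sop (r\<^sup>2) (Sop (real k * r\<^sup>2) g)) z <= ?A * (1 - \<eta>) + \<tau>"
    by (rule propagation_step[OF eta kill r l _ _ le1 A Suc tail, of R]) (use rho l in \<open>auto simp: r_def\<close>)
   moreover have "Sop (r\<^sup>2) (Sop (real k * r\<^sup>2) g) = Sop (real (Suc k) * r\<^sup>2) g"
    by (subst sg.add[symmetric]) (auto simp: algebra_simps)
   moreover have "(R - real k * l) - l = R - real (Suc k) * l" by (simp add: algebra_simps)
   moreover have "?A * (1 - \<eta>) + \<tau> <= (1 - \<eta>) ^ Suc k + real (Suc k) * \<tau>"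
    using eta mult_left_mono[of "1 - \<eta>" 1 "real k * \<tau>"] t0 by (simp add: algebra_simps)
   ultimately show ?case by (auto elim!: eventually_mono)
  qed
  have e1: "R - real n * l = R / 2" using n by (simp add: l_def)
  have e2: "Sop (real n * r\<^sup>2) g = Sop (R\<^sup>2) f"
   unfolding g_def by (subst sg.add[symmetric]) (use nr in auto)
  show ?thesis using step[of n] unfolding e1 e2 \<tau>_def .
 qed
 then show ?thesis using eta by (intro exI[of _ \<eta>] conjI allI impI) auto
qed

text \<open>With \<open>X = 1 + sqrt t / \<rho> x\<close> and
  \<open>Z = (X / C) powr (1 / k)\<close>, slow variation bounds every \<open>\<rho> y\<close> in
  the ball by \<open>sqrt t / (Z - 1)\<close>, so about \<open>sqrt Z\<close> steps are admissible.
  The geometric factor and tails of high order in the number of steps outweigh any power of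
  \<open>X\<close>.\<close>

lemma sup_decay:
 "EX C>=1. ALL x t f. 0 < t --> (AE z. fn f z <= 1) -->
   (AE z. z \<in> ball x (sqrt t / 2) --> fn (Sop t f) z <= C * (1 + sqrt t / \<rho> x) powr (- N))"
proof -
 from propagation obtain \<eta> where eta: "0 < \<eta>" "\<eta> < 1" and propag: "!!m n x R f. 0 < R ==> 0 < n ==> ALL y:ball x R. \<rho> y <= R / (real n)\<^sup>2 ==>
   AE z. fn f z <= 1 ==> AE z. z \<in> ball x (R / 2) -->
    fn (Sop (R\<^sup>2) f) z <= (1 - \<eta>) ^ n + real n * ((LBINT x::'a. norm x ^ m * heat 1 x) * (2 / real n) ^ m)" by blast
 from slow_variation obtain C k where C: "1 <= C" "1 <= k" and slow: "!!x y R. dist x y <= R ==> 1 + R / \<rho> x <= C * (1 + R / \<rho> y) powr k" by blast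
 \<comment> \<open>\<open>X\<close> is of the order of the \<open>2 * k\<close>-th power of the
   number of steps, so decay of order \<open>j\<close> in that number gives order
   \<open>\<bar>N\<bar>\<close> in \<open>X\<close>.\<close>
 define j where "j = nat \<lceil>2 * k * \<bar>N\<bar>\<rceil>"
 have j: "2 * k * \<bar>N\<bar> <= real j" unfolding j_def by linarith
 from geometric_le_power[OF eta, of j] obtain K where K: "K > 0" "!!n. (1 - \<eta>) ^ n * real (n + 1) ^ j <= K" by blast
 define M where "M = (LBINT x::'a. norm x ^ (j + 1) * heat 1 x)"
 have M: "0 <= M" unfolding M_def by (rule heat_tail_nonneg)
 have poly: "(1 - \<eta>) ^ n + real n * (M * (2 / real n) ^ (j + 1)) <= (K + M * 2 ^ (2 * j + 1)) / real (n + 1) ^ j" if n: "0 < n" for n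
 proof -
  have "(1 - \<eta>) ^ n <= K / real (n + 1) ^ j" using K(2)[of n] by (simp add: field_simps)
  moreover have "real n * (M * (2 / real n) ^ (j + 1)) = M * 2 ^ (2 * j + 1) * (1 / (2 * real n) ^ j)"
   using n by (simp add: power_divide power_mult_distrib power_add power_mult field_simps power2_eq_square)
  moreover have "M * 2 ^ (2 * j + 1) * (1 / (2 * real n) ^ j) <= M * 2 ^ (2 * j + 1) * (1 / real (n + 1) ^ j)"
   using n M by (intro mult_left_mono divide_left_mono power_mono mult_pos_pos) auto
  ultimately show ?thesis by (simp add: add_divide_distrib)
 qed
 define D where "D = max (C powr \<bar>N\<bar> * 2 powr (k * \<bar>N\<bar>)) ((K + M * 2 ^ (2 * j + 1)) * (C powr \<bar>N\<bar> * 2 powr (k * \<bar>N\<bar>)))"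
 have "AE z. z \<in> ball x (sqrt t / 2) --> fn (Sop t f) z <= D * (1 + sqrt t / \<rho> x) powr (- \<bar>N\<bar>)"
  if t: "0 < t" and f: "AE z. fn f z <= 1" for x t f
 proof -
  define R where "R = sqrt t"
  have R: "0 < R" "R\<^sup>2 = t" using t by (auto simp: R_def)
  define X where "X = 1 + R / \<rho> x"
  have X: "1 <= X" using R critical_radius_pos[of x] by (simp add: X_def)
  define Z where "Z = (X / C) powr (1 / k)"
  have Z: "0 < Z" "X = C * Z powr k" using X C by (auto simp: Z_def powr_powr)
  have XN: "X powr (- \<bar>N\<bar>) = 1 / (C powr \<bar>N\<bar> * Z powr (k * \<bar>N\<bar>))"
   using Z C by (simp add: powr_mult powr_powr powr_minus_divide)
  show ?thesis
  proof (cases "Z < 2")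
   case True
   have "Z powr (k * \<bar>N\<bar>) <= 2 powr (k * \<bar>N\<bar>)" using True Z C by (intro powr_mono2) auto
   then have "C powr \<bar>N\<bar> * Z powr (k * \<bar>N\<bar>) <= D" unfolding D_def by (intro max.coboundedI1 mult_left_mono) auto
   then have "1 <= D * X powr (- \<bar>N\<bar>)" unfolding XN using Z C by (simp add: field_simps)
   then show ?thesis using Sop_le_const[OF less_imp_le[OF t] f] by (auto elim!: eventually_mono simp: X_def R_def)
  next
   case False
   define n where "n = nat \<lfloor>sqrt (Z - 1)\<rfloor>"
   have sq: "1 <= sqrt (Z - 1)" using False by simp
   then have n: "0 < n" "real n <= sqrt (Z - 1)" "sqrt (Z - 1) <= real (n + 1)" unfolding n_def by linarith+
   have n2: "(real n)\<^sup>2 <= Z - 1"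
    using power_mono[OF n(2), of 2] False by simp
   have "Z - 1 <= (real (n + 1))\<^sup>2" using power_mono[OF n(3), of 2] sq False by simp
   then have Zn: "Z / 2 <= (real (n + 1))\<^sup>2" using False by linarith
   have "\<rho> y <= R / (real n)\<^sup>2" if "y \<in> ball x R" for y
   proof -
    have y: "0 < \<rho> y" by (rule critical_radius_pos)
    have "X <= C * (1 + R / \<rho> y) powr k" unfolding X_def by (rule slow) (use that in simp)
    then have "Z powr k <= (1 + R / \<rho> y) powr k" using Z C by simp
    then have "Z <= 1 + R / \<rho> y"
     using powr_less_mono2[of k "1 + R / \<rho> y" Z] C y R by (force simp: not_le[symmetric])
    with n2 have "(real n)\<^sup>2 <= R / \<rho> y" by linarith
    then show ?thesis using y n by (simp add: field_simps)
   qed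
   then have "AE z. z \<in> ball x (R / 2) --> fn (Sop (R\<^sup>2) f) z <= (1 - \<eta>) ^ n + real n * (M * (2 / real n) ^ (j + 1))"
    unfolding M_def using propag[OF R(1) n(1) _ f, of x "j + 1"] by blast
   moreover have "(1 - \<eta>) ^ n + real n * (M * (2 / real n) ^ (j + 1)) <= D * X powr (- \<bar>N\<bar>)"
   proof -
    have "(Z / 2) powr (k * \<bar>N\<bar>) <= ((real (n + 1))\<^sup>2) powr (k * \<bar>N\<bar>)" using Zn Z C by (intro powr_mono2) auto
    also have "... = real (n + 1) powr (2 * k * \<bar>N\<bar>)" by (simp add: powr_powr powr_numeral[symmetric] mult.assoc del: powr_numeral)
    also have "... <= real (n + 1) powr real j" using j by (intro powr_mono) auto
    also have "... = real (n + 1) ^ j" by (subst powr_realpow) auto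
    finally have p: "(Z / 2) powr (k * \<bar>N\<bar>) <= real (n + 1) ^ j" .
    have "(1 - \<eta>) ^ n + real n * (M * (2 / real n) ^ (j + 1)) <= (K + M * 2 ^ (2 * j + 1)) / real (n + 1) ^ j" by (rule poly[OF n(1)])
    also have "... <= (K + M * 2 ^ (2 * j + 1)) / (Z / 2) powr (k * \<bar>N\<bar>)"
     using K M p Z by (intro divide_left_mono) auto
    also have "... = (K + M * 2 ^ (2 * j + 1)) * (C powr \<bar>N\<bar> * 2 powr (k * \<bar>N\<bar>)) * X powr (- \<bar>N\<bar>)"
     unfolding XN using Z C by (simp add: powr_divide)
    also have "... <= D * X powr (- \<bar>N\<bar>)" unfolding D_def by (intro mult_right_mono) auto
    finally show ?thesis .
   qed
   ultimately show ?thesis unfolding X_def R_def using t by (auto elim!: eventually_mono)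
  qed
 qed
 note main = this
 show ?thesis
 proof (intro exI[of _ "max 1 D"] conjI allI impI)
  fix x :: 'a and f :: "'a l2" and t :: real assume t: "0 < t" and f: "AE z. fn f z <= 1"
  have X: "1 <= 1 + sqrt t / \<rho> x" using t critical_radius_pos[of x] by simp
  have "D * (1 + sqrt t / \<rho> x) powr (- \<bar>N\<bar>) <= max 1 D * (1 + sqrt t / \<rho> x) powr (- N)"
   using X by (intro mult_mono powr_mono) auto
  then show "AE z. z \<in> ball x (sqrt t / 2) --> fn (Sop t f) z <= max 1 D * (1 + sqrt t / \<rho> x) powr (- N)"
   using main[OF t f, of x] by (auto elim!: eventually_mono)
 qed simp
qed

lemma Sop_le_L1:
 assumes t: "0 < t" and f: "integrable lborel (%x. \<bar>fn f x\<bar>)" "(LBINT x. \<bar>fn f x\<bar>) <= L"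
 shows "AE x. fn (Sop t f) x <= t powr (- real DIM('a) / 2) / heat_mass 1 TYPE('a) * L"
proof -
 let ?h = "t powr (- real DIM('a) / 2) / heat_mass 1 TYPE('a)"
 have h: "0 <= ?h" using heat_mass_pos[of 1, where 'a = 'a] by simp
 let ?p = "fn (ppart 0 f)"
 have "conv (heat t) ?p x <= ?h * L" for x
 proof -
  have "conv (heat t) ?p x <= (LBINT y. ?h * \<bar>fn f y\<bar>)" unfolding conv_def
  proof (rule integral_mono_AE[OF heat_conv_integrable[OF t sqi_fn]])
   show "AE y. heat t (x - y) * ?p y <= ?h * \<bar>fn f y\<bar>" using fn_ppart_zero[of f]

   proof eventually_elim
    case (elim y)
    have "heat t (x - y) * ?p y <= ?h * ?p y" using elim by (intro mult_right_mono heat_le[OF t]) auto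
    also have "... <= ?h * \<bar>fn f y\<bar>" using elim h by (intro mult_left_mono) auto
    finally show ?case .
   qed
  qed (use f in simp)
  also have "... = ?h * (LBINT y. \<bar>fn f y\<bar>)" by simp
  also have "... <= ?h * L" using f(2) h by (intro mult_left_mono) auto
  finally show ?thesis .
 qed
 then have "AE x. fn (heat_op t (ppart 0 f)) x <= ?h * L"
  using fn_heat_op[OF t, of "ppart 0 f"] by (auto elim!: eventually_mono)
 with Sop_le_heat[OF less_imp_le[OF t], of f] show ?thesis by eventually_elim simp
qed

text \<open>Half of the time turns an integrable datum into a bounded one, the other half decays by
  \<open>sup_decay\<close>. For \<open>sqrt t \<le> 3 * \<rho> x\<close> the decay factor is bounded
  below and smoothing alone is enough; beyond that, the ball of radius \<open>\<rho> x\<close> fits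
  into the ball where the decay is known.\<close>

lemma L1_decay:
 "EX C>0. ALL x t f L. 0 < t --> 0 < L --> integrable lborel (%x. \<bar>fn f x\<bar>) --> (LBINT x. \<bar>fn f x\<bar>) <= L -->
   (AE z. z \<in> ball x (\<rho> x) --> fn (Sop t f) z <= C * t powr (- real DIM('a) / 2) * (1 + sqrt t / \<rho> x) powr (- N) * L)"
proof -
 obtain C where C: "1 <= C" and decay: "!!x t f. 0 < t ==> AE z. fn f z <= 1 ==>
   AE z. z \<in> ball x (sqrt t / 2) --> fn (Sop t f) z <= C * (1 + sqrt t / \<rho> x) powr (- \<bar>N\<bar>)" using sup_decay[of "\<bar>N\<bar>"] by blast
 define M where "M = 1 / heat_mass 1 TYPE('a)"
 have M: "0 < M" unfolding M_def using heat_mass_pos[of 1, where 'a = 'a] by simp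
 define D where "D = C * (M * 2 powr (real DIM('a) / 2)) * 4 powr \<bar>N\<bar>"
 have "AE z. z \<in> ball x (\<rho> x) --> fn (Sop t f) z <= D * t powr (- real DIM('a) / 2) * (1 + sqrt t / \<rho> x) powr (- N) * L"
  if t: "0 < t" and L: "0 < L" and f: "integrable lborel (%x. \<bar>fn f x\<bar>)" "(LBINT x. \<bar>fn f x\<bar>) <= L" for x t f L
 proof -
  have px: "0 < \<rho> x" by (rule critical_radius_pos)
  let ?X = "1 + sqrt t / \<rho> x"
  let ?a = "M * t powr (- real DIM('a) / 2) * L"
  have X: "1 <= ?X" using t px by simp
  have XN: "?X powr (- \<bar>N\<bar>) <= ?X powr (- N)" using X by (intro powr_mono) auto
  have two: "1 <= 2 powr (real DIM('a) / 2)" by (simp add: ge_one_powr_ge_zero)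
  show ?thesis
  proof (cases "sqrt t <= 3 * \<rho> x")
   case True
   have "4 powr (- \<bar>N\<bar>) <= ?X powr (- \<bar>N\<bar>)" using True X px by (intro powr_mono2') (auto simp: pos_divide_le_eq)
   with XN have "4 powr (- \<bar>N\<bar>) <= ?X powr (- N)" by simp
   then have "1 <= 4 powr \<bar>N\<bar> * ?X powr (- N)" by (simp add: powr_minus field_simps)
   moreover have "1 * 1 <= C * 2 powr (real DIM('a) / 2)" using C two by (intro mult_mono) auto
   ultimately have "1 * 1 <= (C * 2 powr (real DIM('a) / 2)) * (4 powr \<bar>N\<bar> * ?X powr (- N))" by (intro mult_mono) auto
   then have "?a * 1 <= ?a * ((C * 2 powr (real DIM('a) / 2)) * (4 powr \<bar>N\<bar> * ?X powr (- N)))"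
    using M L by (intro mult_left_mono) auto
   then have "?a <= D * t powr (- real DIM('a) / 2) * ?X powr (- N) * L" by (simp add: D_def mult_ac)
   then show ?thesis using Sop_le_L1[OF t f] by (auto elim!: eventually_mono simp: M_def)
  next
   case False
   have t2: "0 < t / 2" using t by simp
   let ?b = "M * (t / 2) powr (- real DIM('a) / 2) * L"
   have b: "0 < ?b" using M L t by simp
   have "AE z. fn (Sop (t / 2) f) z <= ?b" using Sop_le_L1[OF t2 f] by (simp add: M_def)
   then have "AE z. fn ((1 / ?b) *\<^sub>R Sop (t / 2) f) z <= 1"
    using fn_scale[of "1 / ?b" "Sop (t / 2) f"] by eventually_elim (use b in simp)
   from decay[OF t2 this, of x]
   have d1: "AE z. z \<in> ball x (sqrt (t / 2) / 2) --> fn ((1 / ?b) *\<^sub>R Sop t f) z <= C * (1 + sqrt (t / 2) / \<rho> x) powr (- \<bar>N\<bar>)"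
    using sg.add[of "t / 2" "t / 2" f] t2 by (simp add: sg.apply_simps)
   have d2: "ball x (\<rho> x) \<subseteq> ball x (sqrt (t / 2) / 2)"
   proof (rule subset_ball)
    have "\<rho> x * \<rho> x * 9 <= t" using power_mono[of "3 * \<rho> x" "sqrt t" 2] False px t by (simp add: power2_eq_square)
    with mult_pos_pos[OF px px] have "(2 * \<rho> x)\<^sup>2 <= t / 2" by (simp add: power2_eq_square)
    then have "2 * \<rho> x <= sqrt (t / 2)" by (rule real_le_rsqrt)
    then show "\<rho> x <= sqrt (t / 2) / 2" by simp
   qed
   have d3: "C * (1 + sqrt (t / 2) / \<rho> x) powr (- \<bar>N\<bar>) <= C * (4 powr \<bar>N\<bar> * ?X powr (- N))"
   proof -
    have "sqrt t <= sqrt (4\<^sup>2 * (t / 2))" using t by (intro real_sqrt_le_mono) simp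
    also have "... = 4 * sqrt (t / 2)" unfolding real_sqrt_mult by simp
    finally have "sqrt t <= 4 * sqrt (t / 2)" .
    then have "sqrt t / \<rho> x <= 4 * sqrt (t / 2) / \<rho> x" using px by (intro divide_right_mono) auto
    then have "sqrt t / \<rho> x <= 4 * (sqrt (t / 2) / \<rho> x)" by simp
    moreover have "a <= 4 * b ==> (1 + a) / 4 <= 1 + b" for a b :: real by simp
    ultimately have "?X / 4 <= 1 + sqrt (t / 2) / \<rho> x" by blast
    then have "(1 + sqrt (t / 2) / \<rho> x) powr (- \<bar>N\<bar>) <= (?X / 4) powr (- \<bar>N\<bar>)" using X by (intro powr_mono2') auto
    also have "... = 4 powr \<bar>N\<bar> * ?X powr (- \<bar>N\<bar>)" using X by (simp add: powr_divide powr_minus field_simps)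
    also have "... <= 4 powr \<bar>N\<bar> * ?X powr (- N)" using XN by (intro mult_left_mono) auto
    finally show ?thesis using C by (intro mult_left_mono) auto
   qed
   have aux: "1 / b * u <= c ==> 0 < b ==> u <= b * c" for b u c :: real by (simp add: pos_divide_le_eq mult.commute)
   from d1 fn_scale[of "1 / ?b" "Sop t f"]
   have "AE z. z \<in> ball x (\<rho> x) --> fn (Sop t f) z <= ?b * (C * (4 powr \<bar>N\<bar> * ?X powr (- N)))"
   proof eventually_elim
    case (elim z)
    show ?case
    proof
     assume "z \<in> ball x (\<rho> x)"
     with d2 d3 elim have "1 / ?b * fn (Sop t f) z <= C * (4 powr \<bar>N\<bar> * ?X powr (- N))" by auto
     then show "fn (Sop t f) z <= ?b * (C * (4 powr \<bar>N\<bar> * ?X powr (- N)))"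
      using aux[OF _ b] by blast
    qed
   qed
   moreover have eq: "?b * (C * (4 powr \<bar>N\<bar> * ?X powr (- N))) = D * t powr (- real DIM('a) / 2) * ?X powr (- N) * L"
    using t by (simp add: D_def powr_divide powr_minus field_simps)
   ultimately show ?thesis by (simp only: eq)
  qed
 qed
 moreover have "0 < D" using C M by (simp add: D_def)
 ultimately show ?thesis by (intro exI[of _ D] conjI allI impI)
qed

end

section \<open>Bounds for the heat kernel and the fractional kernel\<close>

text \<open>Only countably many sets may be tested, because in the application each test holds off
  its own null set of parameters. Finite unions of basis sets enclose a compact part of the negative
  set with arbitrarily small excess, by regularity of the finite measure \<open>M\<close>.\<close>

lemma AE_nonneg_of_test_sets:
 fixes h :: "'a::euclidean_space => real"
 assumes [measurable]: "h \<in> Borel" and B: "topological_basis B" "countable B"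
  and int: "!!F. finite F ==> F \<subseteq> {b\<in>B. bounded b} ==> integrable lborel (%y. indicator (\<Union>F) y * h y)"
  and nonneg: "!!F. finite F ==> F \<subseteq> {b\<in>B. bounded b} ==> 0 <= (LBINT y. indicator (\<Union>F) y * h y)"
 shows "AE y. 0 <= h y"
proof -
 have cover: "EX b:{b\<in>B. bounded b}. x \<in> b & b \<subseteq> W" if W: "open W" "x \<in> W" for W x
 proof -
  obtain b where "b \<in> B" "x \<in> b" "b \<subseteq> W \<inter> ball x 1" using topological_basisE[OF B(1) open_Int[OF W(1) open_ball], of x x 1] W(2) by (metis Int_iff centre_in_ball zero_less_one)
  then show ?thesis using bounded_subset[OF bounded_ball, of b x 1] by (intro bexI[of _ b]) auto
 qed
 have "AE y. y \<in> K --> 0 <= h y" if K: "K \<in> {b\<in>B. bounded b}" for K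
 proof -
  have oK: "open K" using K topological_basis_open[OF B(1)] by auto
  then have [measurable]: "K \<in> sets borel" by simp
  define k where "k = (%y. indicator K y * \<bar>h y\<bar>)"
  have k: "integrable lborel k" using integrable_abs[OF int[of "{K}"]] K by (simp add: k_def abs_mult)
  have [measurable]: "k \<in> Borel" unfolding k_def by measurable
  let ?k = "%A. LBINT y. indicator A y * k y"
  have kA: "integrable lborel (%y. indicator A y * k y)" if "A \<in> sets borel" for A
   using integrable_real_mult_indicator[of A lborel k] that k by (simp add: mult.commute)
  have kn: "0 <= ?k A" for A by (intro Bochner_Integration.integral_nonneg) (auto simp: k_def)
  define M where "M = density lborel (%y. ennreal (k y))"
  have M: "emeasure M A = ennreal (?k A)" if A: "A \<in> sets borel" for A
  proof -
   have "emeasure M A = (\<integral>\<^sup>+y. ennreal (indicator A y * k y))"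
    unfolding M_def using A by (subst emeasure_density) (auto intro!: nn_integral_cong split: split_indicator)
   also have "... = ennreal (?k A)" by (rule nn_integral_eq_integral[OF kA[OF A]]) (auto simp: k_def)
   finally show ?thesis .
  qed
  have reg: "sets M = sets borel" "emeasure M (space M) ~= \<infinity>" using M[of UNIV] by (auto simp: M_def)
  have zero: "?k C = 0" if C: "compact C" "C \<subseteq> {y \<in> K. h y < 0}" for C
  proof (rule antisym[OF _ kn], rule field_le_epsilon)
   fix e :: real assume e: "0 < e"
   have Cb [measurable]: "C \<in> sets borel" using C(1) by (simp add: compact_imp_closed)
   have "emeasure M C < emeasure M C + ennreal e" using e by (simp add: M[OF Cb])
   then have "EX U:{U. C \<subseteq> U & open U}. emeasure M U < emeasure M C + ennreal e"
    using outer_regular[OF reg Cb] by (metis (no_types, lifting) INF_less_iff)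
   then obtain U where U: "open U" "C \<subseteq> U" "emeasure M U < ennreal (?k C + e)"
    using e by (auto simp: M[OF Cb] ennreal_plus kn)
   then have Ub [measurable]: "U \<in> sets borel" by simp
   have 1: "?k U < ?k C + e" using U(3) kn by (simp add: M[OF Ub] ennreal_less_iff)
   have "EX b:{b\<in>B. bounded b}. x \<in> b & b \<subseteq> U \<inter> K" if "x \<in> C" for x
    using that C(2) U oK by (intro cover) auto
   then have "C \<subseteq> \<Union>{b\<in>B. bounded b & b \<subseteq> U \<inter> K}" by blast
   moreover have "open b" if "b \<in> {b\<in>B. bounded b & b \<subseteq> U \<inter> K}" for b using that topological_basis_open[OF B(1)] by auto
   ultimately obtain F where F: "F \<subseteq> {b\<in>B. bounded b & b \<subseteq> U \<inter> K}" "finite F" "C \<subseteq> \<Union>F"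
    by (rule compactE[OF C(1)])
   then have F': "F \<subseteq> {b\<in>B. bounded b}" by auto
   have "0 <= (LBINT y. indicator (\<Union>F) y * h y)" by (rule nonneg[OF F(2) F'])
   \<comment> \<open>On \<open>C\<close> the integrand is \<open>- k\<close>, elsewhere at most
     \<open>k\<close>. Twice the mass of \<open>C\<close> is therefore at most the mass of
     \<open>U\<close>, which exceeds that of \<open>C\<close> by less than \<open>e\<close>.\<close>
   also have "... <= (LBINT y. indicator U y * k y - 2 * (indicator C y * k y))"
   proof (rule integral_mono[OF int[OF F(2) F']])
    show "integrable lborel (%y. indicator U y * k y - 2 * (indicator C y * k y))"
     by (intro Bochner_Integration.integrable_diff integrable_mult_right kA Cb Ub)
    show "indicator (\<Union>F) y * h y <= indicator U y * k y - 2 * (indicator C y * k y)" for y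
    proof (cases "y \<in> \<Union>F")
     case True
     then have "y \<in> U" "y \<in> K" using F(1) by auto
     then show ?thesis using True C(2) by (auto simp: k_def split: split_indicator)
    next
     case False
     then show ?thesis using F(3) by (auto simp: k_def split: split_indicator)
    qed
   qed
   also have "... = ?k U - 2 * ?k C"
    by (subst Bochner_Integration.integral_diff) (auto intro!: kA integrable_mult_right)
   finally show "?k C <= 0 + e" using 1 by simp
  qed
  let ?G = "{y \<in> K. h y < 0}"
  have G: "?G \<in> sets borel" by measurable
  have "emeasure M C = 0" if "compact C" "C \<subseteq> ?G" for C
   using zero[OF that] that(1) M[of C] by (simp add: borel_compact)
  then have "emeasure M ?G <= 0" unfolding inner_regular[OF reg G] by (intro SUP_least) auto
  then have "?k ?G = 0" using kn[of ?G] by (simp add: M[OF G])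
  then have "AE y. indicator ?G y * k y = 0"
   by (subst (asm) integral_nonneg_eq_0_iff_AE[OF kA[OF G]]) (auto simp: k_def)
  then show ?thesis by eventually_elim (auto simp: k_def indicator_eq_0_iff)
 qed
 then have "AE y. ALL K:{b\<in>B. bounded b}. y \<in> K --> 0 <= h y"
  using B(2) by (subst AE_ball_countable) auto
 then show ?thesis by eventually_elim (use cover[of UNIV] in blast)
qed

lemma measure_open_pos:
 assumes "open (U::'a::euclidean_space set)" "bounded U" "U ~= {}" shows "0 < measure lborel U" "emeasure lborel U < \<infinity>"
proof -
 show fin: "emeasure lborel U < \<infinity>" by (rule emeasure_bounded_finite[OF assms(2)])
 have "~ negligible U" by (rule open_not_negligible) (use assms in auto)
 then have "emeasure lborel U ~= 0" using assms(1) by (auto simp: negligible_iff_null_sets null_sets_def)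
 then show "0 < measure lborel U" using fin by (simp add: emeasure_eq_ennreal_measure less_top zero_less_measure_iff)
qed

lemma integrable_lebesgue_cong:
 assumes "AE y. f y = (g y::real)" and g: "g \<in> Borel" and f: "integrable lebesgue f"
 shows "integrable lborel g" "(LINT y|lebesgue. f y) = (LBINT y. g y)"
proof -
 have ae: "AE y in lebesgue. f y = g y" using assms(1) unfolding AE_lebesgue_iff .
 have fm: "f \<in> borel_measurable lebesgue" using f by simp
 have gm: "g \<in> borel_measurable lebesgue" by (rule lborel_lebesgue_measurable[OF g])
 have "integrable lebesgue g" using integrable_cong_AE[OF fm gm ae] f by simp
 then show "integrable lborel g" using g by (subst (asm) integrable_completion) auto
 show "(LINT y|lebesgue. f y) = (LBINT y. g y)"
  using integral_cong_AE[OF fm gm ae] integral_lebesgue_lborel[OF g] by simp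
qed

text \<open>The action on indicators of open sets determines the inequality between kernels; the
  countable family of finite unions of basis sets makes one exceptional set of \<open>x\<close>
  serve all tests.\<close>

lemma kernel_le_of_test_sets:
 fixes p q b :: "'a::euclidean_space => 'a => real" and T :: "('a => real) => 'a => real"
 assumes T: "!!f. square_integrable f ==> AE x in lebesgue. integrable lebesgue (%y. p x y * f y) & T f x = (LINT y|lebesgue. p x y * f y)"
  and q: "!!x. q x \<in> Borel" and eq: "AE x. AE y. p x y = q x y"
  and b: "!!x. b x \<in> Borel" "!!x U. open U ==> bounded U ==> integrable lborel (%y. indicator U y * b x y)"
  and le: "!!U. open U ==> bounded U ==> U ~= {} ==> AE x. x \<in> A --> c * T (indicator U) x <= (LBINT y. indicator U y * b x y)"
 shows "AE x. x \<in> A --> (AE y. c * q x y <= b x y)"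
proof -
 obtain B :: "'a set set" where B: "countable B" "topological_basis B" using ex_countable_basis by blast
 define \<U> where "\<U> = Union ` {F. finite F & F \<subseteq> {b\<in>B. bounded b}}"
 have U: "countable \<U>" unfolding \<U>_def by (intro countable_image countable_Collect_finite_subset) (simp add: B)
 have oU: "open U" "bounded U" if "U \<in> \<U>" for U
  using that topological_basis_open[OF B(2)] by (auto simp: \<U>_def intro!: open_Union bounded_Union)
 have "AE x. x \<in> A --> integrable lborel (%y. q x y * indicator U y) &
   c * (LBINT y. q x y * indicator U y) <= (LBINT y. indicator U y * b x y)" if "U \<in> \<U>" for U
 proof (cases "U = {}")
  case False
  note oU = oU[OF that]
  have "sqi (indicator U)" by (rule sqi_indicator[OF _ measure_open_pos(2)[OF oU False]]) (use oU in simp)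
  then have "square_integrable (indicator U :: 'a => real)" using oU by (subst sqi_iff_square_integrable) auto
  from T[OF this] have "AE x. integrable lebesgue (%y. p x y * indicator U y) & T (indicator U) x = (LINT y|lebesgue. p x y * indicator U y)"
   unfolding AE_lebesgue_iff .
  with eq le[OF oU False] show ?thesis
  proof eventually_elim
   case (elim x)
   have "AE y. p x y * indicator U y = q x y * indicator U y" using elim(1) by eventually_elim simp
   note * = integrable_lebesgue_cong[OF this _ conjunct1[OF elim(3)]]
   have "(%y. q x y * indicator U y) \<in> Borel" using q[of x] oU by (intro borel_measurable_times borel_measurable_indicator) auto
   with * elim show ?case by auto
  qed
 qed simp
 then have "AE x. ALL U:\<U>. x \<in> A --> integrable lborel (%y. q x y * indicator U y) &
   c * (LBINT y. q x y * indicator U y) <= (LBINT y. indicator U y * b x y)" unfolding AE_ball_countable[OF U] by blast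
 then show ?thesis
 proof eventually_elim
  case (elim x)
  show ?case
  proof
   assume x: "x \<in> A"
   have h: "integrable lborel (%y. indicator U y * (b x y - c * q x y)) & 0 <= (LBINT y. indicator U y * (b x y - c * q x y))"
    if "U \<in> \<U>" for U
   proof -
    from elim x that have e: "integrable lborel (%y. q x y * indicator U y)"
     "c * (LBINT y. q x y * indicator U y) <= (LBINT y. indicator U y * b x y)" by auto
    have i: "integrable lborel (%y. indicator U y * b x y)" by (rule b(2)[OF oU[OF that]])
    have eq: "(%y. indicator U y * (b x y - c * q x y)) = (%y. indicator U y * b x y - c * (q x y * indicator U y))"
     by (simp add: fun_eq_iff algebra_simps)
    show ?thesis unfolding eq using e i by (auto simp: Bochner_Integration.integral_diff)
   qed
   have "AE y. 0 <= b x y - c * q x y"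
    by (rule AE_nonneg_of_test_sets[OF _ B(2,1)]) (use b(1)[of x] q[of x] h in \<open>auto simp: \<U>_def\<close>)
   then show "AE y. c * q x y <= b x y" by simp
  qed
 qed
qed

context schroedinger_rh
begin

lemma fn_Sop_mk:
 assumes "0 <= t" "sqi f" shows "AE x. fn (Sop t (mk f)) x = S t f x"
proof -
 have f: "square_integrable f" using assms(2) sqi_iff_square_integrable[OF sqi_measurable] by blast
 have "Sop t (mk f) = lmk (S t f)" using Sop_lmk[OF assms(1) f] lmk_mk[OF assms(2)] by simp
 then show ?thesis using fn_lmk[OF S_square_integrable[OF assms(1) f]] by simp
qed

lemma kernel_bounds:
 assumes t: "0 < t"
  and T: "!!f. square_integrable f ==> AE x in lebesgue. integrable lebesgue (%y. p x y * f y) & S t f x = (LINT y|lebesgue. p x y * f y)"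
  and q: "!!x. q x \<in> Borel" and eq: "AE x. AE y. p x y = q x y"
 shows "AE x. AE y. 0 <= q x y" "AE x. AE y. q x y <= heat t (x - y)"
proof -
 note le = kernel_le_of_test_sets[OF T q eq, where A = UNIV]
 have U: "sqi (indicator U)" if "open U" "bounded U" "U ~= {}" for U :: "'a set"
  by (rule sqi_indicator[OF _ measure_open_pos(2)[OF that]]) (use that in simp)
 \<comment> \<open>Nonnegativity is the case of the factor \<open>-1\<close> and the bound
   0.\<close>
 have "AE x. x \<in> UNIV --> (AE y. -1 * q x y <= 0)"
 proof (rule le)
  fix U :: "'a set" assume "open U" "bounded U" "U ~= {}"
  note s = U[OF this]
  have "AE x. 0 <= fn (mk (indicator U)) x" using fn_mk[OF s] by eventually_elim simp
  from Sop_nonneg[OF less_imp_le[OF t] this] fn_Sop_mk[OF less_imp_le[OF t] s]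
  show "AE x. x \<in> UNIV --> -1 * S t (indicator U) x <= (LBINT y. indicator U y * 0)" by eventually_elim simp
 qed auto
 then show "AE x. AE y. 0 <= q x y" by simp
 have "AE x. x \<in> UNIV --> (AE y. 1 * q x y <= heat t (x - y))"
 proof (rule le)
  show "(%y. heat t (x - y)) \<in> Borel" for x :: 'a by measurable
  show "integrable lborel (%y. indicator U y * heat t (x - y))" if "open U" "bounded U" for U and x :: 'a
   using heat_conv_integrable[OF t, of "indicator U" x] U[OF that] by (cases "U = {}") (auto simp: mult.commute)
  fix U :: "'a set" assume "open U" "bounded U" "U ~= {}"
  note s = U[OF this]
  have "ppart 0 (mk (indicator U)) = mk (indicator U)"
   by (rule l2_eqI) (use fn_ppart_zero[of "mk (indicator U)"] fn_mk[OF s] in \<open>eventually_elim, simp\<close>)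
  then have "AE x. fn (Sop t (mk (indicator U))) x <= fn (mk (conv (heat t) (indicator U))) x"
   using Sop_le_heat[OF less_imp_le[OF t], of "mk (indicator U)"] heat_op_mk[OF t s] by simp
  with fn_Sop_mk[OF less_imp_le[OF t] s] fn_mk[OF young(3)[OF integrable_heat[OF t] s]]
  show "AE x. x \<in> UNIV --> 1 * S t (indicator U) x <= (LBINT y. indicator U y * heat t (x - y))"
   by eventually_elim (simp add: conv_def mult.commute)
 qed
 then show "AE x. AE y. q x y <= heat t (x - y)" by simp
qed

text \<open>\<open>L1_decay\<close> applied to indicators of open sets, with \<open>L\<close> their
  volume. The constant is chosen before \<open>t\<close>, the kernel and the centre, so it survives
  the later integration in time.\<close>

lemma kernel_decay:
 "EX C>0. ALL t p q z. 0 < t --> (ALL f. square_integrable f --> (AE x in lebesgue. integrable lebesgue (%y. p x y * f y) & S t f x = (LINT y|lebesgue. p x y * f y)))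
  --> (ALL x. q x \<in> Borel) --> (AE x. AE y. p x y = q x y)
  --> (AE x. x \<in> ball z (\<rho> z) --> (AE y. q x y <= C * t powr (- real DIM('a) / 2) * (1 + sqrt t / \<rho> z) powr (- N)))"
proof -
 obtain C where C: "C > 0" "!!x t f L. 0 < t ==> 0 < L ==> integrable lborel (%x. \<bar>fn f x\<bar>) ==> (LBINT x. \<bar>fn f x\<bar>) <= L ==>
   AE z. z \<in> ball x (\<rho> x) --> fn (Sop t f) z <= C * t powr (- real DIM('a) / 2) * (1 + sqrt t / \<rho> x) powr (- N) * L"
  using L1_decay[of N] by blast
 have "AE x. x \<in> ball z (\<rho> z) --> (AE y. 1 * q x y <= C * t powr (- real DIM('a) / 2) * (1 + sqrt t / \<rho> z) powr (- N))"
  if t: "0 < t" and T: "!!f. square_integrable f ==> AE x in lebesgue. integrable lebesgue (%y. p x y * f y) & S t f x = (LINT y|lebesgue. p x y * f y)"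
   and q: "!!x. q x \<in> Borel" and eq: "AE x. AE y. p x y = q x y" for t p q z
 proof (rule kernel_le_of_test_sets[OF T q eq])
  let ?c = "C * t powr (- real DIM('a) / 2) * (1 + sqrt t / \<rho> z) powr (- N)"
  show "integrable lborel (%y. indicator U y * ?c)" if "open U" "bounded U" for U :: "'a set"
   using that emeasure_bounded_finite[OF that(2)] by (intro integrable_mult_left integrable_real_indicator) auto
  fix U :: "'a set" assume U: "open U" "bounded U" "U ~= {}"
  have s: "sqi (indicator U)" by (rule sqi_indicator[OF _ measure_open_pos(2)[OF U]]) (use U in simp)
  have iU: "integrable lborel (indicator U :: 'a => real)" using U measure_open_pos(2)[OF U] by (intro integrable_real_indicator) auto
  have ae: "AE x. \<bar>fn (mk (indicator U)) x\<bar> = indicator U x" using fn_mk[OF s] by eventually_elim simp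
  have "integrable lborel (%x. \<bar>fn (mk (indicator U)) x\<bar>)" "(LBINT x. \<bar>fn (mk (indicator U)) x\<bar>) = measure lborel U"
   using U iU integrable_cong_AE[OF _ _ ae] integral_cong_AE[OF _ _ ae] by auto
  from C(2)[OF t measure_open_pos(1)[OF U] this(1), of z] this(2) fn_Sop_mk[OF less_imp_le[OF t] s]
  show "AE x. x \<in> ball z (\<rho> z) --> 1 * S t (indicator U) x <= (LBINT y. indicator U y * ?c)"
   using U by (auto elim!: eventually_elim2 simp: mult_ac)
 qed (assumption, rule borel_measurable_const)
 note main = this
 show ?thesis
 proof (intro exI[of _ C] conjI allI impI C(1))
  fix t p q z
  assume h: "0 < t" "ALL f. square_integrable f --> (AE x in lebesgue. integrable lebesgue (%y. p x y * f y) & S t f x = (LINT y|lebesgue. p x y * f y))"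
   "ALL x. q x \<in> Borel" "AE x. AE y. p x y = q x y"
  show "AE x. x \<in> ball z (\<rho> z) --> (AE y. q x y <= C * t powr (- real DIM('a) / 2) * (1 + sqrt t / \<rho> z) powr (- N))"
   by (rule main[unfolded mult_1_left, OF h(1) h(2)[rule_format] h(3)[rule_format] h(4)])
 qed
qed

end

section \<open>Null sets in time and two space variables\<close>

lemma AE_triple_measure:
 fixes R :: "real \<times> 'a::euclidean_space \<times> 'a => bool"
 assumes R: "{z. R z} \<in> sets borel" and ae: "AE t. AE x. AE y. R (t, x, y)"
 shows "AE z. R z"
proof -
 have "AE z in lborel \<Otimes>\<^sub>M lborel. R z"
 proof (rule lborel_pair.AE_pair_measure)
  show "{z \<in> space (lborel \<Otimes>\<^sub>M lborel). R z} \<in> sets (lborel \<Otimes>\<^sub>M lborel)" unfolding lborel_prod using R by simp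
  show "AE t. AE w. R (t, w)" using ae
  proof eventually_elim
   case (elim t)
   have "AE w in lborel \<Otimes>\<^sub>M lborel. R (t, w)"
   proof (rule lborel_pair.AE_pair_measure)
    have "(%w::'a \<times> 'a. (t, w)) -` {z. R z} \<in> sets borel" using measurable_sets[OF _ R, of "%w. (t, w)" borel] by simp
    then show "{w \<in> space (lborel \<Otimes>\<^sub>M lborel). R (t, w)} \<in> sets (lborel \<Otimes>\<^sub>M lborel)"
     unfolding lborel_prod by (simp add: vimage_def)
   qed (use elim in simp)
   then show ?case unfolding lborel_prod .
  qed
 qed
 then show ?thesis unfolding lborel_prod .
qed

lemma AE_lborel_pair:
 fixes Q :: "'c::euclidean_space \<times> 'd::euclidean_space => bool"
 assumes "AE w. Q w" shows "AE x. AE y. Q (x, y)"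
 using lborel_pair.AE_pair[of Q, unfolded lborel_prod] assms by blast

text \<open>The second conclusion moves time to the innermost place; the exceptions are first
  enclosed in a Borel null set so that the quantifiers can be exchanged.\<close>

lemma AE_triple:
 fixes R :: "real \<times> 'a::euclidean_space \<times> 'a => bool"
 assumes "AE z. R z"
 shows "AE t. AE x. AE y. R (t, x, y)" "AE x. AE y. AE t. R (t, x, y)"
proof -
 have "AE t. AE w. R (t, w)" by (rule AE_lborel_pair[OF assms])
 then show "AE t. AE x. AE y. R (t, x, y)" by eventually_elim (rule AE_lborel_pair)
 obtain N where N: "{z. ~ R z} \<subseteq> N" "N \<in> sets borel" "emeasure lborel N = 0"
  using AE_E[OF assms] by auto
 have "AE z. z \<notin> N" using N by (intro AE_not_in) (auto simp: null_sets_def)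
 then have "AE t. AE w. (t, w) \<notin> N" by (rule AE_lborel_pair)
 then have "AE w. AE t. (t, w) \<notin> N"
  by (subst (asm) lborel_pair.AE_commute[unfolded lborel_prod]) (use N(2) in \<open>auto simp: Compl_eq[symmetric]\<close>)
 from AE_lborel_pair[OF this] show "AE x. AE y. AE t. R (t, x, y)"
 proof eventually_elim
  case (elim x)
  then show ?case
  proof eventually_elim
   case (elim y)
   then show ?case by eventually_elim (use N(1) in auto)
  qed
 qed
qed

lemma exp_power_bound:
 "EX c>=1. ALL u>=1. u powr m * exp (- u / 8) <= (c::real)"
proof -
 define n where "n = nat \<lceil>\<bar>m\<bar>\<rceil> + 1"
 have n: "m <= real n" "0 < n" unfolding n_def by linarith+
 have "u powr m * exp (- u / 8) <= (8 * real n) ^ n" if u: "1 <= u" for u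
 proof -
  have "u / (8 * real n) <= exp (u / (8 * real n))" using exp_ge_add_one_self[of "u / (8 * real n)"] by linarith
  then have "u <= 8 * real n * exp (u / (8 * real n))" using n by (simp add: field_simps)
  then have "u ^ n <= (8 * real n * exp (u / (8 * real n))) ^ n" using u by (intro power_mono) auto
  also have "... = (8 * real n) ^ n * exp (u / 8)" using n by (simp add: power_mult_distrib exp_of_nat_mult[symmetric])
  finally have "u powr m <= (8 * real n) ^ n * exp (u / 8)"
   using powr_mono[OF n(1) u] u by (simp add: powr_realpow)
  then show ?thesis by (simp add: exp_minus field_simps)
 qed
 then show ?thesis by (intro exI[of _ "max 1 ((8 * real n) ^ n)"]) (auto intro: max.coboundedI2)
qed

text \<open>The minimum of the Gaussian bound and the decay bound is at most their geometric mean,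
  which is why the hypothesis has exponent \<open>2 * N\<close> and the conclusion \<open>N\<close>.
  Half of the Gaussian exponent is retained, and the integral is split at
  \<open>t = r\<^sup>2\<close>.\<close>

lemma time_integral:
 fixes k :: "real => real"
 assumes r: "0 < r" and \<rho>: "0 < \<rho>" and N: "0 <= N" and \<alpha>: "0 < \<alpha>" "\<alpha> < d" and B: "0 < B" and k [measurable]: "k \<in> Borel"
  and c: "1 <= c" "!!u. 1 <= u ==> u powr ((d + N) / 2) * exp (- u / 8) <= c"
  and bd: "AE t. 0 < t --> 0 <= k t & k t <= B * t powr (- d / 2) * exp (- r\<^sup>2 / (4 * t)) &
    k t <= B * t powr (- d / 2) * (1 + sqrt t / \<rho>) powr (- 2 * N)"
 shows "integrable lborel (%t. indicator {0<..} t * (k t * t powr (\<alpha> / 2 - 1)))"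
  and "\<bar>LBINT t. indicator {0<..} t * (k t * t powr (\<alpha> / 2 - 1))\<bar> <= B * c * (2 / \<alpha> + 2 / (d - \<alpha>)) * r powr (\<alpha> - d) * (1 + r / \<rho>) powr (- N)"
proof -
 define D where "D = B * c * (1 + r / \<rho>) powr (- N)"
 have "0 < 1 + r / \<rho>" using r \<rho> by (simp add: add_pos_pos)
 then have D: "0 < D" using B c by (simp add: D_def)
 let ?g = "%t. indicator {0<..} t * (k t * t powr (\<alpha> / 2 - 1))"
 let ?a = "%t. t powr (\<alpha> / 2 - 1)" and ?b = "%t. t powr ((\<alpha> - d) / 2 - 1)"
 have dom: "AE t. ennreal \<bar>?g t\<bar> <= ennreal (D * r powr - d) * (indicator {0..r\<^sup>2} t * ennreal (?a t)) + ennreal D * (indicator {r\<^sup>2..} t * ennreal (?b t))"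
  using bd
 proof eventually_elim
  case (elim t)
  show ?case
  proof (cases "0 < t")
   case t: True
   define E where "E = exp (- r\<^sup>2 / (8 * t))"
   define X where "X = 1 + sqrt t / \<rho>"
   define b where "b = B * t powr (- d / 2)"
   have b: "0 < b" using B t by (simp add: b_def)
   have X: "1 <= X" using t \<rho> by (simp add: X_def)
   have E: "0 < E" "E <= 1" using t by (auto simp: E_def)
   have EE: "exp (- r\<^sup>2 / (4 * t)) = E * E" using t by (simp add: E_def exp_add[symmetric] field_simps)
   have XX: "X powr (- 2 * N) = X powr (- N) * X powr (- N)" by (simp add: powr_add[symmetric])
   have "k t <= b * (E * X powr (- N))"
   proof (cases "E <= X powr (- N)")
    case True
    then have "b * (E * E) <= b * (E * X powr (- N))" using b E by (intro mult_left_mono) auto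
    then show ?thesis using elim t unfolding EE b_def by simp
   next
    case False
    then have "b * (X powr (- N) * X powr (- N)) <= b * (E * X powr (- N))" using b E by (intro mult_left_mono mult_right_mono) auto
    then show ?thesis using elim t unfolding XX[unfolded X_def] b_def X_def by simp
   qed
   then have ke: "\<bar>?g t\<bar> <= b * (E * X powr (- N)) * ?a t" using elim t by (simp add: mult_right_mono)
   show ?thesis
   proof (cases "t <= r\<^sup>2")
    case True
    \<comment> \<open>For small times \<open>X\<close> can fall below \<open>1 + r / \<rho>\<close>
      by a factor of at most \<open>sqrt u\<close>; this loss and the singular power of
      \<open>t\<close> are powers of \<open>u\<close>, absorbed by
      \<open>exp (- u / 8)\<close>.\<close>
    define u where "u = r\<^sup>2 / t"
    have u: "1 <= u" "E = exp (- u / 8)" using True t by (auto simp: u_def E_def)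
    have t_eq: "t = r\<^sup>2 / u" using t r by (simp add: u_def)
    have "X powr (- N) <= ((1 + r / \<rho>) / sqrt u) powr (- N)"
    proof (rule powr_mono2')
     have "1 / sqrt u <= 1" using u by simp
     moreover have "sqrt t = r / sqrt u" using r by (simp add: t_eq real_sqrt_divide)
     ultimately show "(1 + r / \<rho>) / sqrt u <= X" unfolding X_def by (simp add: add_divide_distrib mult.commute)
    qed (use N u r \<rho> in \<open>auto intro!: divide_pos_pos add_pos_pos\<close>)
    also have "... = (1 + r / \<rho>) powr (- N) * u powr (N / 2)"
    proof -
     have sq: "sqrt u powr (- N) = u powr - (N / 2)" using u by (simp add: powr_half_sqrt[symmetric] powr_powr)
     show ?thesis unfolding powr_divide sq powr_minus[of u] by (simp only: divide_inverse inverse_inverse_eq)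
    qed
    finally have x: "X powr (- N) <= (1 + r / \<rho>) powr (- N) * u powr (N / 2)" .
    have tb: "b = B * (r powr - d * u powr (d / 2))"
    proof -
     have "t powr (- d / 2) = (r\<^sup>2) powr (- d / 2) / u powr (- d / 2)" using u r by (simp add: t_eq powr_divide)
     also have "(r\<^sup>2) powr (- d / 2) = r powr - d" using r by (simp add: powr_powr powr_numeral[symmetric] del: powr_numeral)
     finally show ?thesis unfolding b_def using powr_minus_divide[of u "d / 2"] by simp
    qed
    have "b * (E * X powr (- N)) <= b * (E * ((1 + r / \<rho>) powr (- N) * u powr (N / 2)))" using b E x by (intro mult_left_mono) auto
    also have "... = B * r powr - d * (1 + r / \<rho>) powr (- N) * ((u powr (d / 2) * u powr (N / 2)) * exp (- u / 8))"
     by (simp add: tb u(2))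
    also have "u powr (d / 2) * u powr (N / 2) = u powr ((d + N) / 2)" by (simp add: powr_add[symmetric] add_divide_distrib)
    also have "B * r powr - d * (1 + r / \<rho>) powr (- N) * (u powr ((d + N) / 2) * exp (- u / 8)) <= B * r powr - d * (1 + r / \<rho>) powr (- N) * c"
     using B u by (intro mult_left_mono c(2)) auto
    also have "... = D * r powr - d" by (simp add: D_def)
    finally have "\<bar>?g t\<bar> <= D * r powr - d * ?a t" using ke by (meson mult_right_mono order_trans powr_ge_zero)
    then have "ennreal \<bar>?g t\<bar> <= ennreal (D * r powr - d) * ennreal (?a t)" using D by (simp add: ennreal_mult[symmetric])
    then show ?thesis using True t by (simp add: add_increasing2)
   next
    case False
    have "sqrt (r\<^sup>2) <= sqrt t" using False by (intro real_sqrt_le_mono) simp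
    then have "1 + r / \<rho> <= X" using r \<rho> by (simp add: X_def divide_right_mono)
    then have "X powr (- N) <= (1 + r / \<rho>) powr (- N)" using N r \<rho> by (intro powr_mono2') (auto intro!: add_pos_pos)
    then have "E * X powr (- N) <= c * (1 + r / \<rho>) powr (- N)" using E c(1) by (intro mult_mono) auto
    then have "b * (E * X powr (- N)) * ?a t <= b * (c * (1 + r / \<rho>) powr (- N)) * ?a t" using b by (intro mult_right_mono mult_left_mono) auto
    also have "... = D * (t powr (- d / 2) * ?a t)" by (simp add: b_def D_def)
    also have "t powr (- d / 2) * ?a t = t powr (- d / 2 + (\<alpha> / 2 - 1))" by (rule powr_add[symmetric])
    also have "- d / 2 + (\<alpha> / 2 - 1) = (\<alpha> - d) / 2 - 1" by (simp add: field_simps)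
    finally have "\<bar>?g t\<bar> <= D * ?b t" using ke by linarith
    then have "ennreal \<bar>?g t\<bar> <= ennreal D * ennreal (?b t)" using D by (simp add: ennreal_mult[symmetric])
    then show ?thesis using False by (simp add: add_increasing)
   qed
  qed simp
 qed
 have a: "(\<integral>\<^sup>+t. indicator {0..r\<^sup>2} t * ennreal (?a t)) = ennreal (2 / \<alpha> * r powr \<alpha>)"
 proof -
  have "(?a has_integral ((r\<^sup>2) powr (\<alpha> / 2 - 1 + 1) / (\<alpha> / 2 - 1 + 1))) {0..r\<^sup>2}"
   by (rule has_integral_powr_from_0) (use \<alpha> in auto)
  moreover have "(r\<^sup>2) powr (\<alpha> / 2 - 1 + 1) / (\<alpha> / 2 - 1 + 1) = 2 / \<alpha> * r powr \<alpha>"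
   using r \<alpha> by (simp add: powr_powr powr_numeral[symmetric] del: powr_numeral)
  ultimately have "(?a has_integral (2 / \<alpha> * r powr \<alpha>)) {0..r\<^sup>2}" by (simp only:)
  from nn_integral_has_integral_lebesgue'[OF _ this] show ?thesis by (simp add: mult.commute)
 qed
 have b: "(\<integral>\<^sup>+t. indicator {r\<^sup>2..} t * ennreal (?b t)) = ennreal (2 / (d - \<alpha>) * r powr (\<alpha> - d))"
 proof -
  have "(?b has_integral (- ((r\<^sup>2) powr ((\<alpha> - d) / 2 - 1 + 1)) / ((\<alpha> - d) / 2 - 1 + 1))) {r\<^sup>2..}"
   by (rule has_integral_powr_to_inf) (use \<alpha> r in auto)
  moreover have "- ((r\<^sup>2) powr ((\<alpha> - d) / 2 - 1 + 1)) / ((\<alpha> - d) / 2 - 1 + 1) = 2 / (d - \<alpha>) * r powr (\<alpha> - d)"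
  proof -
   have "(r\<^sup>2) powr y = r powr (2 * y)" for y using r by (simp add: powr_powr powr_numeral[symmetric] del: powr_numeral)
   from this[of "(\<alpha> - d) / 2"] have "(r\<^sup>2) powr ((\<alpha> - d) / 2) = r powr (\<alpha> - d)" by (simp only: nonzero_mult_div_cancel_left times_divide_eq_right zero_neq_numeral not_False_eq_True)
   moreover have "- x / ((\<alpha> - d) / 2) = 2 / (d - \<alpha>) * x" for x using \<alpha> by (simp add: divide_simps) (simp add: algebra_simps)
   ultimately show ?thesis by (simp only: diff_add_cancel)
  qed
  ultimately have "(?b has_integral (2 / (d - \<alpha>) * r powr (\<alpha> - d))) {r\<^sup>2..}" by (simp only:)
  from nn_integral_has_integral_lebesgue'[OF _ this] show ?thesis by (simp add: mult.commute)
 qed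
 have "(\<integral>\<^sup>+t. ennreal \<bar>?g t\<bar>) <= (\<integral>\<^sup>+t. ennreal (D * r powr - d) * (indicator {0..r\<^sup>2} t * ennreal (?a t)) + ennreal D * (indicator {r\<^sup>2..} t * ennreal (?b t)))"
  by (rule nn_integral_mono_AE[OF dom])
 also have "... = ennreal (D * r powr - d) * ennreal (2 / \<alpha> * r powr \<alpha>) + ennreal D * ennreal (2 / (d - \<alpha>) * r powr (\<alpha> - d))"
  by (subst nn_integral_add) (auto simp: nn_integral_cmult a b)
 also have "... = ennreal (D * r powr - d * (2 / \<alpha> * r powr \<alpha>) + D * (2 / (d - \<alpha>) * r powr (\<alpha> - d)))"
  using D \<alpha> by (simp add: ennreal_mult[symmetric] ennreal_plus[symmetric] del: ennreal_plus)
 also have "D * r powr - d * (2 / \<alpha> * r powr \<alpha>) + D * (2 / (d - \<alpha>) * r powr (\<alpha> - d)) = B * c * (2 / \<alpha> + 2 / (d - \<alpha>)) * r powr (\<alpha> - d) * (1 + r / \<rho>) powr (- N)"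
  using r by (simp add: D_def powr_diff powr_minus divide_inverse algebra_simps)
 finally have nn: "(\<integral>\<^sup>+t. ennreal \<bar>?g t\<bar>) <= ennreal (B * c * (2 / \<alpha> + 2 / (d - \<alpha>)) * r powr (\<alpha> - d) * (1 + r / \<rho>) powr (- N))" .
 show int: "integrable lborel ?g"
  by (rule integrableI_bounded) (use order_le_less_trans[OF nn ennreal_less_top] in auto)
 have K: "0 <= B * c * (2 / \<alpha> + 2 / (d - \<alpha>))" using B c(1) \<alpha> by simp
 have "ennreal (LBINT t. \<bar>?g t\<bar>) = (\<integral>\<^sup>+t. ennreal \<bar>?g t\<bar>)"
  by (rule nn_integral_eq_integral[symmetric]) (use integrable_abs[OF int] in auto)
 with nn have "ennreal (LBINT t. \<bar>?g t\<bar>) <= ennreal (B * c * (2 / \<alpha> + 2 / (d - \<alpha>)) * r powr (\<alpha> - d) * (1 + r / \<rho>) powr (- N))" by simp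
 then have "(LBINT t. \<bar>?g t\<bar>) <= B * c * (2 / \<alpha> + 2 / (d - \<alpha>)) * r powr (\<alpha> - d) * (1 + r / \<rho>) powr (- N)"
  by (rule ennreal_le_iff[OF mult_nonneg_nonneg[OF mult_nonneg_nonneg[OF K powr_ge_zero] powr_ge_zero], THEN iffD1])
 then show "\<bar>LBINT t. ?g t\<bar> <= B * c * (2 / \<alpha> + 2 / (d - \<alpha>)) * r powr (\<alpha> - d) * (1 + r / \<rho>) powr (- N)"
  using integral_abs_bound[of lborel ?g] by linarith
qed

section \<open>The kernel of the fractional integral\<close>

lemma borel_measurable_fst_snd:
 fixes f :: "'m => 'a::second_countable_topology \<times> 'b::second_countable_topology"
 assumes "f \<in> borel_measurable M" shows "(%x. fst (f x)) \<in> borel_measurable M" "(%x. snd (f x)) \<in> borel_measurable M"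
 by (rule measurable_compose[OF assms borel_measurable_continuous_onI], rule continuous_on_fst continuous_on_snd, rule continuous_on_id)+

lemma measurable_borel_prod_iff:
 fixes f :: "'a::second_countable_topology \<times> 'b::euclidean_space => 'c"
 shows "f \<in> measurable (borel \<Otimes>\<^sub>M lborel) N \<longleftrightarrow> f \<in> measurable borel N"
proof -
 have "sets (borel \<Otimes>\<^sub>M lborel :: ('a \<times> 'b) measure) = sets (borel \<Otimes>\<^sub>M borel)" by (rule sets_pair_measure_cong) simp_all
 then show ?thesis unfolding borel_prod by (intro arg_cong2[where f = "(\<in>)"] measurable_cong_sets refl)
qed

lemma lebesgue_cong_borel:
 fixes f g :: "'a::euclidean_space => 'b::euclidean_space"
 assumes ae: "AE x. f x = g x" and g: "g \<in> Borel"
 shows "f \<in> borel_measurable lebesgue" "integrable lebesgue f \<longleftrightarrow> integrable lborel g" "(LINT x|lebesgue. f x) = (LBINT x. g x)"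
proof -
 have gm: "g \<in> borel_measurable lebesgue" using g by (intro measurable_completion) simp
 have ae': "AE x in lebesgue. g x = f x" using ae unfolding AE_lebesgue_iff by eventually_elim simp
 show fm: "f \<in> borel_measurable lebesgue" by (rule borel_measurable_AE[OF gm ae'])
 show "integrable lebesgue f \<longleftrightarrow> integrable lborel g"
  unfolding integrable_cong_AE[OF fm gm AE_symmetric[OF ae']] by (rule integrable_completion) (use g in simp)
 show "(LINT x|lebesgue. f x) = (LBINT x. g x)"
  unfolding integral_cong_AE[OF fm gm AE_symmetric[OF ae']] by (rule integral_completion) (use g in simp)
qed

text \<open>The decay of the kernel is known almost everywhere on a critical ball with fixed centre;
  a countable cover allows the exceptional sets to be united.\<close>

lemma (in rh_potential) countable_critical_cover: "EX I. countable I & (\<Union>z\<in>I. ball z (\<rho> z)) = UNIV"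
proof -
 obtain F where F: "F \<subseteq> range (%z. ball z (\<rho> z))" "countable F" "\<Union>F = \<Union>(range (%z. ball z (\<rho> z)))"
  by (rule Lindelof[of "range (%z. ball z (\<rho> z))"]) auto
 from countable_subset_image[THEN iffD1, OF conjI[OF F(2) F(1)]]
 obtain I where "countable I" "I \<subseteq> UNIV" "F = (%z. ball z (\<rho> z)) ` I" by (elim exE conjE)
 moreover have "x \<in> \<Union>F" for x using critical_radius_pos[of x] unfolding F(3) by (intro UN_I[of x]) auto
 ultimately show ?thesis by (intro exI[of _ I]) blast
qed

text \<open>A Borel version \<open>q\<close> of the heat kernel carries all bounds off one null set.
  For given \<open>x\<close> the time integral is estimated with the critical radius of the centre
  \<open>z\<close> of a covering ball, which is then exchanged for \<open>\<rho> x\<close>.\<close>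

lemma (in schroedinger_rh) frac_kernel_bound:
 assumes meas: "(%(t, x, y). p t x y) \<in> borel_measurable (lebesgue_on ({0<..} \<times> UNIV))"
  and ker: "!!t f. 0 < t ==> square_integrable f ==>
   AE x in lebesgue. integrable lebesgue (%y. p t x y * f y) & S t f x = (LINT y|lebesgue. p t x y * f y)"
  and \<alpha>: "0 < \<alpha>" "\<alpha> < real DIM('a)" and N: "0 <= N"
 obtains K C where "K \<in> Borel" "0 < C" "AE x. AE y.
   (%t. p t x y * t powr (\<alpha> / 2 - 1)) absolutely_integrable_on {0<..} & frac_kernel p \<alpha> x y = K (x, y) &
   \<bar>K (x, y)\<bar> <= C * dist x y powr (\<alpha> - real DIM('a)) * (1 + dist x y / \<rho> x) powr (- N)"
proof -
 let ?d = "real DIM('a)"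
 have O: "{0<..} \<times> UNIV \<in> sets (lebesgue :: (real \<times> 'a \<times> 'a) measure)"
  using open_Times[OF open_greaterThan[of "0::real"] open_UNIV[where 'a = "'a \<times> 'a"]] by (intro sets_completionI_sets) simp
 have "(%z. if z \<in> {0<..} \<times> UNIV then (case z of (t, x, y) => p t x y) else 0) \<in> borel_measurable lebesgue"
  using meas by (subst borel_measurable_if[OF O]) simp
 from completion_ex_borel_measurable_real[OF this] obtain q :: "real \<times> 'a \<times> 'a => real" where q: "q \<in> Borel"
  and pq0: "AE z. (if z \<in> {0<..} \<times> UNIV then (case z of (t, x, y) => p t x y) else 0) = q z" by auto
 note [measurable] = q
 have pq: "AE z. 0 < fst z --> p (fst z) (fst (snd z)) (snd (snd z)) = q z"
  using pq0 by eventually_elim (auto split: prod.splits)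
 define K where "K = (%w. LBINT t. indicator {0<..} t * (q (t, fst w, snd w) * t powr (\<alpha> / 2 - 1)))"
 have K: "K \<in> Borel" unfolding K_def
 proof (rule lborel.borel_measurable_lebesgue_integral)
  have "continuous_on UNIV (%z::('a \<times> 'a) \<times> real. (snd z, fst (fst z), snd (fst z)))" by (intro continuous_intros)
  then have "(%z::('a \<times> 'a) \<times> real. q (snd z, fst (fst z), snd (fst z))) \<in> Borel"
   by (intro measurable_compose[OF borel_measurable_continuous_onI q])
  moreover have "(%z::('a \<times> 'a) \<times> real. indicator {0<..} (snd z) :: real) \<in> Borel"
   "(%z::('a \<times> 'a) \<times> real. snd z powr (\<alpha> / 2 - 1)) \<in> Borel"
   by (rule measurable_compose[OF borel_measurable_fst_snd(2)[OF measurable_ident_sets[OF refl]]], simp)+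
  ultimately show "(%(w, t). indicator {0<..} t * (q (t, fst w, snd w) * t powr (\<alpha> / 2 - 1))) \<in> borel_measurable (borel \<Otimes>\<^sub>M lborel)"
   unfolding measurable_borel_prod_iff case_prod_beta' by (intro borel_measurable_times)
 qed
 have f1 [measurable]: "(%w::real \<times> 'a \<times> 'a. fst w) \<in> Borel"
  and [measurable]: "(%w::real \<times> 'a \<times> 'a. dist (fst (snd w)) (snd (snd w))) \<in> Borel"
  "(%w::real \<times> 'a \<times> 'a. dist z (fst (snd w))) \<in> Borel" for z
  by (rule borel_measurable_continuous_onI, intro continuous_intros)+
 obtain I where I: "countable I" "(\<Union>z\<in>I. ball z (\<rho> z)) = UNIV" using countable_critical_cover by blast
 from kernel_decay[of "2 * N"] obtain C where C: "0 < C" and decay: "!!t p q z. 0 < t ==>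
   ALL f. square_integrable f --> (AE x in lebesgue. integrable lebesgue (%y. p x y * f y) & S t f x = (LINT y|lebesgue. p x y * f y))
  ==> ALL x. q x \<in> Borel ==> AE x. AE y. p x y = q x y
  ==> AE x. x \<in> ball z (\<rho> z) --> (AE y. q x y <= C * t powr (- ?d / 2) * (1 + sqrt t / \<rho> z) powr (- (2 * N)))" by blast
 have qt: "(%y. q (t, x, y)) \<in> Borel" for t x by measurable
 note T1 = AE_triple(1)[OF pq]
 define M where "M = heat_mass 1 TYPE('a)"
 have M: "0 < M" unfolding M_def by (rule heat_mass_pos) simp
 let ?G = "%t r. 1 / M * (t powr (- ?d / 2) * exp (- r\<^sup>2 / (4 * t)))"
 define h where "h z t = C * t powr (- ?d / 2) * (1 + sqrt t / \<rho> z) powr (- (2 * N))" for z t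
 let ?Q = "%z w. 0 < fst w --> 0 <= q w & q w <= ?G (fst w) (dist (fst (snd w)) (snd (snd w))) &
   (fst (snd w) \<in> ball z (\<rho> z) --> q w <= h z (fst w))"
 have "AE w. ?Q z w" for z
 proof (rule AE_triple_measure)
  have [measurable]: "(%w::real \<times> 'a \<times> 'a. h z (fst w)) \<in> Borel"
   by (rule measurable_compose[OF f1]) (simp add: h_def)
  have "{w. 0 < fst w --> 0 <= q w & q w <= ?G (fst w) (dist (fst (snd w)) (snd (snd w))) &
   (dist z (fst (snd w)) < \<rho> z --> q w <= h z (fst w))} \<in> sets borel" by measurable
  then show "{w. ?Q z w} \<in> sets borel" unfolding mem_ball .
  show "AE t. AE x. AE y. ?Q z (t, x, y)" using T1
  proof eventually_elim
   case (elim t)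
   show ?case
   proof (cases "0 < t")
    case True
    have eq: "AE x. AE y. p t x y = q (t, x, y)" using elim True by simp
    have heat: "heat t (x - y) = ?G t (dist x y)" for x y :: 'a
     unfolding heat_def heat_mass_scale[OF True] dist_norm M_def using powr_minus_divide[of t "?d / 2"] by simp
    have "AE x. x \<in> ball z (\<rho> z) --> (AE y. q (t, x, y) <= h z t)"
     unfolding h_def by (rule decay[OF True _ _ eq]) (use ker[OF True] qt in auto)
    moreover have "AE x. AE y. 0 <= q (t, x, y)" "AE x. AE y. q (t, x, y) <= ?G t (dist x y)"
     using kernel_bounds[OF True ker[OF True] qt eq] by (simp_all add: heat)
    ultimately show ?thesis
    proof eventually_elim
     case (elim x)
     then have "AE y. x \<in> ball z (\<rho> z) --> q (t, x, y) <= h z t" by (cases "x \<in> ball z (\<rho> z)") auto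
     with elim(2,3) show ?case by eventually_elim simp
    qed
   qed simp
  qed
 qed
 then have Q: "AE x. AE y. ALL z:I. AE t. ?Q z (t, x, y)"
  unfolding AE_ball_countable[OF I(1)] using AE_triple(2) by blast
 obtain Cs k where Cs: "1 <= Cs" "1 <= k" and slow: "!!x y R. dist x y <= R ==> 1 + R / \<rho> x <= Cs * (1 + R / \<rho> y) powr k"
  using slow_variation by blast
 \<comment> \<open>Slow variation at scale \<open>\<rho> z\<close> bounds
   \<open>1 + \<rho> z / \<rho> x\<close> by this constant, which compares the two critical
   radii.\<close>
 define s0 where "s0 = Cs * 2 powr k"
 have s0: "1 <= s0" using mult_mono[OF Cs(1) ge_one_powr_ge_zero[of 2 k]] Cs by (simp add: s0_def)
 define B where "B = max C (1 / M)"
 have B: "0 < B" "C <= B" "1 / M <= B" using C by (auto simp: B_def)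
 obtain c where c: "1 <= c" "!!u. 1 <= u ==> u powr ((?d + N) / 2) * exp (- u / 8) <= c" using exp_power_bound by blast
 define A where "A = B * c * (2 / \<alpha> + 2 / (?d - \<alpha>))"
 have A: "0 < A" using B c(1) \<alpha> by (simp add: A_def add_pos_pos)
 have "AE x. AE y.
   (%t. p t x y * t powr (\<alpha> / 2 - 1)) absolutely_integrable_on {0<..} & frac_kernel p \<alpha> x y = K (x, y) &
   \<bar>K (x, y)\<bar> <= (A * s0 powr N) * dist x y powr (\<alpha> - ?d) * (1 + dist x y / \<rho> x) powr (- N)"
  using AE_triple(2)[OF pq] Q
 proof eventually_elim
  case (elim x)
  have "AE y. y ~= x" by (rule AE_lborel_singleton)
  with elim show ?case
  proof eventually_elim
   case (elim y)
   define r where "r = dist x y"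
   have r: "0 < r" using elim by (simp add: r_def)
   obtain z where z: "z \<in> I" "x \<in> ball z (\<rho> z)" using I(2) by blast
   have pz: "0 < \<rho> z" and px: "0 < \<rho> x" by (rule critical_radius_pos)+
   let ?g = "%t. indicator {0<..} t * (q (t, x, y) * t powr (\<alpha> / 2 - 1))"
   have bd: "AE t. 0 < t --> 0 <= q (t, x, y) & q (t, x, y) <= B * t powr (- ?d / 2) * exp (- r\<^sup>2 / (4 * t)) &
     q (t, x, y) <= B * t powr (- ?d / 2) * (1 + sqrt t / \<rho> z) powr (- 2 * N)"
    using bspec[OF elim(2) z(1)]
   proof eventually_elim
    case (elim t)
    show ?case
    proof (intro impI conjI)
     assume t: "0 < t"
     show "0 <= q (t, x, y)" using elim t by simp
     have "q (t, x, y) <= ?G t r" using elim t by (simp add: r_def)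
     also have "... <= B * (t powr (- ?d / 2) * exp (- r\<^sup>2 / (4 * t)))" using B by (intro mult_right_mono) auto
     finally show "q (t, x, y) <= B * t powr (- ?d / 2) * exp (- r\<^sup>2 / (4 * t))" by (simp only: mult.assoc)
     have "q (t, x, y) <= C * (t powr (- ?d / 2) * (1 + sqrt t / \<rho> z) powr (- 2 * N))" using elim t z by (simp add: h_def)
     also have "... <= B * (t powr (- ?d / 2) * (1 + sqrt t / \<rho> z) powr (- 2 * N))" using B by (intro mult_right_mono) auto
     finally show "q (t, x, y) <= B * t powr (- ?d / 2) * (1 + sqrt t / \<rho> z) powr (- 2 * N)" by (simp only: mult.assoc)
    qed
   qed
   note ti = time_integral[OF r pz N \<alpha> B(1) _ c bd]
   have g: "integrable lborel ?g" by (rule ti(1)) simp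
   have "AE t. indicator {0<..} t *\<^sub>R (p t x y * t powr (\<alpha> / 2 - 1)) = ?g t"
    using elim(1) by eventually_elim (auto split: split_indicator)
   note cong = lebesgue_cong_borel[OF this]
   have gm: "?g \<in> Borel" by measurable
   have 1: "(%t. p t x y * t powr (\<alpha> / 2 - 1)) absolutely_integrable_on {0<..}"
    unfolding set_integrable_def cong(2)[OF gm] by (rule g)
   have 2: "frac_kernel p \<alpha> x y = K (x, y)"
    unfolding frac_kernel_def set_lebesgue_integral_def cong(3)[OF gm] by (simp add: K_def)
   have 3: "\<bar>K (x, y)\<bar> <= A * r powr (\<alpha> - ?d) * (1 + r / \<rho> z) powr (- N)"
    using ti(2) by (simp add: K_def A_def)
   have "(1 + r / \<rho> z) powr (- N) <= ((1 + r / \<rho> x) / s0) powr (- N)"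
   proof (rule powr_mono2')
    have "1 + \<rho> z / \<rho> x <= s0" using slow[of x z "\<rho> z"] z(2) pz by (simp add: s0_def dist_commute)
    then have "1 / \<rho> x <= s0 / \<rho> z" using px pz by (simp add: field_simps)
    then have "r * (1 / \<rho> x) <= r * (s0 / \<rho> z)" using r by (intro mult_left_mono) auto
    then have "1 + r / \<rho> x <= s0 + s0 * (r / \<rho> z)" using s0 by (simp add: mult.commute)
    then show "(1 + r / \<rho> x) / s0 <= 1 + r / \<rho> z" using s0 by (simp add: pos_divide_le_eq algebra_simps)
   qed (use N s0 r px in \<open>auto intro!: divide_pos_pos add_pos_pos\<close>)
   also have "((1 + r / \<rho> x) / s0) powr (- N) = s0 powr N * (1 + r / \<rho> x) powr (- N)"
    unfolding powr_divide powr_minus[of s0] by (simp add: divide_inverse)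
   finally have "A * r powr (\<alpha> - ?d) * (1 + r / \<rho> z) powr (- N) <= A * r powr (\<alpha> - ?d) * (s0 powr N * (1 + r / \<rho> x) powr (- N))"
    using A by (intro mult_left_mono) auto
   with 3 have "\<bar>K (x, y)\<bar> <= (A * s0 powr N) * r powr (\<alpha> - ?d) * (1 + r / \<rho> x) powr (- N)" by (simp add: mult_ac)
   with 1 2 show ?case by (simp add: r_def)
  qed
 qed
 moreover have "0 < A * s0 powr N" using A s0 by simp
 ultimately show thesis using K that by blast
qed

section \<open>Weak type estimates in Morrey spaces\<close>

lemma dyadic_down: fixes t R :: real assumes "0 < t" "t < R" shows "EX j. R / 2 ^ Suc j <= t & t < R / 2 ^ (j::nat)"
proof -
 have ex: "EX j. R / 2 ^ Suc j <= t"
 proof -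
  obtain j where "R / t < 2 ^ j" using real_arch_pow[of 2 "R / t"] by auto
  then have "R / 2 ^ Suc j <= t" using assms by (simp add: field_simps)
  then show ?thesis ..
 qed
 define j where "j = (LEAST j. R / 2 ^ Suc j <= t)"
 have "R / 2 ^ Suc j <= t" unfolding j_def by (rule LeastI_ex[OF ex])
 moreover have "t < R / 2 ^ j"
 proof (cases j)
  case (Suc i)
  then have "i < j" by simp
  then have "~ R / 2 ^ Suc i <= t" unfolding j_def by (rule not_less_Least)
  then show ?thesis using Suc by simp
 qed (use assms in simp)
 ultimately show ?thesis by blast
qed

lemma dyadic_up: fixes t R :: real assumes "0 < R" "R <= t" shows "EX j. 2 ^ j * R <= t & t < 2 ^ Suc j * R"
proof -
 obtain j where "t / R < 2 ^ j" using real_arch_pow[of 2 "t / R"] by auto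
 then have ex: "EX j. t < 2 ^ Suc j * R" using assms by (intro exI[of _ j]) (simp add: field_simps)
 define j where "j = (LEAST j. t < 2 ^ Suc j * R)"
 have "t < 2 ^ Suc j * R" unfolding j_def by (rule LeastI_ex[OF ex])
 moreover have "2 ^ j * R <= t"
 proof (cases j)
  case (Suc i)
  then have "i < j" by simp
  then have "~ t < 2 ^ Suc i * R" unfolding j_def by (rule not_less_Least)
  then show ?thesis using Suc by simp
 qed (use assms in simp)
 ultimately show ?thesis by blast
qed

lemma suminf_geometric_ennreal:
 assumes "0 <= (a::real)" "0 <= g" "g < 1" shows "(\<Sum>j. ennreal (a * g ^ j)) = ennreal (a / (1 - g))"
 by (rule suminf_ennreal_eq) (use assms sums_mult[OF geometric_sums[of g], of a] in auto)

lemma le_suminf_ennreal: fixes f :: "nat => ennreal" shows "f j <= (\<Sum>i. f i)"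
 using sum_le_suminf[of f "{j}"] by simp

text \<open>The radius \<open>R\<close> solves \<open>b powr q * R powr d = e\<close>, so the mass
  of \<open>E\<close> balances the growth bound. Outside the ball of radius \<open>R\<close> the
  kernel is at most \<open>R powr (- d / q)\<close>; inside, dyadic shells form a geometric series
  because \<open>q\<close> exceeds 1.\<close>

lemma weak_kernel_integral:
 fixes M :: "'a::euclidean_space measure"
 assumes M [measurable_cong]: "sets M = sets borel" and E [measurable]: "E \<in> sets borel" and e: "emeasure M E = ennreal e" "0 < e"
  and b: "0 < b" and q: "1 < q" and d: "0 < d"
  and growth: "!!R. 0 < R ==> emeasure M (E \<inter> ball y R) <= ennreal (b powr q * R powr d)"
 shows "(\<integral>\<^sup>+x. indicator E x * ennreal (dist x y powr (- d / q)) \<partial>M)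
  <= ennreal ((1 + 2 powr (d / q) / (1 - (1 / 2) powr (d - d / q))) * b * e powr (1 - 1 / q))"
proof -
 define R where "R = (e / b powr q) powr (1 / d)"
 have R: "0 < R" using e b by (simp add: R_def)
 define g where "g = (1 / 2 :: real) powr (d - d / q)"
 have dq: "0 < d - d / q" using q d by (simp add: field_simps)
 have g: "0 <= g" "g < 1" using powr_less_mono2[OF dq, of "1/2" 1] by (auto simp: g_def)
 have bq: "0 < b powr q" using b by simp
 have Rd: "R powr z = e powr (z / d) / b powr (q * z / d)" for z
  unfolding R_def powr_powr powr_divide by simp
 have half: "(R / 2 ^ j) powr z = R powr z * ((1 / 2) powr z) ^ j" for z j
 proof -
  have "R / 2 ^ j = R * (1 / 2) ^ j" by (simp add: power_one_over)
  then show ?thesis by (simp add: powr_mult powr_realpow[symmetric] powr_powr mult.commute del: powr_realpow)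
 qed
 let ?c = "%j. 2 powr (d / q) * (R / 2 ^ j) powr (- d / q)"
 have pt: "ennreal (dist x y powr (- d / q)) <= ennreal (R powr (- d / q)) + (\<Sum>j. ennreal (?c j) * indicator (ball y (R / 2 ^ j)) x)" for x
 proof (cases "x = y \<or> R <= dist x y")
  case True
  then have "dist x y powr (- d / q) <= R powr (- d / q)" using R q d powr_mono2'[of "- (d / q)" R "dist x y"] by (cases "x = y") (simp, simp add: divide_nonneg_nonneg)
  then show ?thesis by (simp add: add_increasing2 ennreal_leI)
 next
  case False
  then obtain j where j: "R / 2 ^ Suc j <= dist x y" "dist x y < R / 2 ^ j" using dyadic_down[of "dist x y" R] by auto
  have "dist x y powr (- d / q) <= (R / 2 ^ j / 2) powr (- d / q)" using j R q d by (intro powr_mono2') auto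
  also have "... = ?c j" unfolding powr_divide[of "R / 2 ^ j" 2] by (simp add: powr_minus divide_inverse)
  finally have "ennreal (dist x y powr (- d / q)) <= ennreal (?c j) * indicator (ball y (R / 2 ^ j)) x"
   using j by (simp add: ennreal_leI dist_commute)
  also have "... <= (\<Sum>j. ennreal (?c j) * indicator (ball y (R / 2 ^ j)) x)"
   by (rule le_suminf_ennreal)
  finally show ?thesis by (simp add: add_increasing)
 qed
 have "(\<integral>\<^sup>+x. indicator E x * ennreal (dist x y powr (- d / q)) \<partial>M)
   <= (\<integral>\<^sup>+x. ennreal (R powr (- d / q)) * indicator E x + (\<Sum>j. ennreal (?c j) * indicator (E \<inter> ball y (R / 2 ^ j)) x) \<partial>M)"
 proof (rule nn_integral_mono)
  fix x
  have "indicator (E \<inter> ball y r) x = (indicator (ball y r) x :: ennreal)" if "x \<in> E" for r using that by (simp add: indicator_def)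
  then show "indicator E x * ennreal (dist x y powr (- d / q)) <= ennreal (R powr (- d / q)) * indicator E x + (\<Sum>j. ennreal (?c j) * indicator (E \<inter> ball y (R / 2 ^ j)) x)"
   using pt[of x] by (cases "x \<in> E") simp_all
 qed
 also have "... = ennreal (R powr (- d / q)) * emeasure M E + (\<Sum>j. ennreal (?c j) * emeasure M (E \<inter> ball y (R / 2 ^ j)))"
 proof -
  have EB: "E \<inter> ball y r \<in> sets M" "E \<in> sets M" for r using E by (auto simp: M)
  have m: "(%x. ennreal c * indicator (E \<inter> ball y r) x) \<in> borel_measurable M" "(%x. ennreal c * indicator E x) \<in> borel_measurable M" for c r
   by (rule measurable_compose[OF borel_measurable_indicator[OF EB(1)], of "%u. ennreal c * u"] measurable_compose[OF borel_measurable_indicator[OF EB(2)], of "%u. ennreal c * u"], simp)+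
  show ?thesis
   by (simp only: nn_integral_add[OF m(2) borel_measurable_suminf_order[OF m(1)]] nn_integral_suminf[OF m(1)] nn_integral_cmult_indicator[OF EB(1)] nn_integral_cmult_indicator[OF EB(2)])
 qed
 also have "... <= ennreal (R powr (- d / q) * e) + (\<Sum>j. ennreal (2 powr (d / q) * b powr q * R powr (d - d / q) * g ^ j))"
 proof (intro add_mono suminf_le)
  show "ennreal (R powr (- d / q)) * emeasure M E <= ennreal (R powr (- d / q) * e)" using e by (simp add: ennreal_mult)
  fix j
  have "ennreal (?c j) * emeasure M (E \<inter> ball y (R / 2 ^ j)) <= ennreal (?c j) * ennreal (b powr q * (R / 2 ^ j) powr d)"
   using R by (intro mult_left_mono growth) auto
  also have "... = ennreal (2 powr (d / q) * b powr q * ((R / 2 ^ j) powr (- d / q) * (R / 2 ^ j) powr d))"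
   by (simp add: ennreal_mult[symmetric] mult_ac)
  also have "(R / 2 ^ j) powr (- d / q) * (R / 2 ^ j) powr d = (R / 2 ^ j) powr (d - d / q)" by (simp add: powr_add[symmetric])
  also have "... = R powr (d - d / q) * g ^ j" unfolding half g_def ..
  finally show "ennreal (?c j) * emeasure M (E \<inter> ball y (R / 2 ^ j)) <= ennreal (2 powr (d / q) * b powr q * R powr (d - d / q) * g ^ j)"
   by (simp add: mult.assoc)
 qed auto
 also have "(\<Sum>j. ennreal (2 powr (d / q) * b powr q * R powr (d - d / q) * g ^ j)) = ennreal (2 powr (d / q) * b powr q * R powr (d - d / q) / (1 - g))"
  by (rule suminf_geometric_ennreal) (use g in auto)
 also have "ennreal (R powr (- d / q) * e) + ... = ennreal (R powr (- d / q) * e + 2 powr (d / q) * b powr q * R powr (d - d / q) / (1 - g))"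
  using e g by (intro ennreal_plus[symmetric]) auto
 also have "R powr (- d / q) * e = b * e powr (1 - 1 / q)"
 proof -
  have "R powr (- d / q) = e powr (- (1 / q)) / b powr - 1" unfolding Rd[of "- d / q"] using d q by simp
  also have "... = b * e powr (- (1 / q))" using b by (simp add: powr_minus divide_inverse)
  finally show ?thesis using e powr_add[of e "- (1 / q)" 1] by (simp add: mult.assoc)
 qed
 also have "2 powr (d / q) * b powr q * R powr (d - d / q) = 2 powr (d / q) * (b * e powr (1 - 1 / q))"
 proof -
  have "R powr (d - d / q) = e powr (1 - 1 / q) / b powr (q - 1)"
   unfolding Rd[of "d - d / q"] using d q by (simp add: diff_divide_distrib right_diff_distrib)
  moreover have "b powr q / b powr (q - 1) = b" using b by (simp add: powr_diff[symmetric])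
  ultimately show ?thesis by (metis (no_types, opaque_lifting) mult.assoc times_divide_eq_left times_divide_eq_right mult.commute)
 qed
 also have "b * e powr (1 - 1 / q) + 2 powr (d / q) * (b * e powr (1 - 1 / q)) / (1 - g) = (1 + 2 powr (d / q) / (1 - g)) * b * e powr (1 - 1 / q)"
  by (simp add: algebra_simps)
 finally show ?thesis unfolding g_def .
qed

text \<open>The weight enters through a Borel version \<open>v\<close>. In \<open>A1\<close> almost
  every value of \<open>v\<close> on the ball replaces the essential infimum, and the volume in the
  average is reduced to a power of the radius.\<close>

locale morrey_weight =
 fixes \<rho> v :: "'a::euclidean_space => real" and q C \<tau> Cs k :: real
 assumes rho: "0 < \<rho> x" and Cs: "1 <= Cs" and k: "1 <= k" and slow: "dist x y <= R ==> 1 + R / \<rho> x <= Cs * (1 + R / \<rho> y) powr k"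
  and q: "1 < q" and C: "0 < C" and tau: "0 < \<tau>" and v: "v \<in> Borel" "0 <= v x"
  and finite_Nu: "emeasure (density lborel (%x. ennreal (v x powr q))) (ball x r) < \<infinity>"
  and Nu_pos: "0 < r ==> 0 < measure (density lborel (%x. ennreal (v x powr q))) (ball x r)"
  and A1: "0 < r ==> AE y. y \<in> ball x r -->
   measure (density lborel (%x. ennreal (v x powr q))) (ball x r) powr (1 / q) * r powr (- real DIM('a) / q) <= C * (1 + r / \<rho> x) powr \<tau> * v y"
begin

definition "Nu = density lborel (%x. ennreal (v x powr q))"
definition n :: "'a => real => real" where "n x r = measure Nu (ball x r)"
abbreviation "\<Phi> x r \<equiv> 1 + r / \<rho> x"

lemma Phi: "0 <= r ==> 1 <= \<Phi> x r" using rho[of x] by simp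

lemma v_measurable [measurable]: "v \<in> Borel" by (rule v)

lemma ball_borel [measurable]: "ball x r \<in> sets (borel :: 'a measure)" by simp

lemma sets_Nu [measurable_cong, simp]: "sets Nu = sets borel" by (simp add: Nu_def)

lemma nn_integral_Nu: "f \<in> Borel ==> (\<integral>\<^sup>+x. f x \<partial>Nu) = (\<integral>\<^sup>+x. ennreal (v x powr q) * f x)"
 unfolding Nu_def by (rule nn_integral_density) auto

lemma n_pos: "0 < r ==> 0 < n x r" unfolding n_def Nu_def by (rule Nu_pos)

lemma emeasure_n: "emeasure Nu (ball x r) = ennreal (n x r)"
 unfolding n_def using finite_Nu[of x r] by (intro emeasure_eq_ennreal_measure) (simp add: Nu_def)

lemma finite_sub: assumes "E \<in> sets borel" "E \<subseteq> ball x r" shows "emeasure Nu E = ennreal (measure Nu E)" "measure Nu E <= n x r"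
proof -
 have le: "emeasure Nu E <= ennreal (n x r)" unfolding emeasure_n[symmetric] using assms by (intro emeasure_mono) auto
 then show eq: "emeasure Nu E = ennreal (measure Nu E)"
  by (intro emeasure_eq_ennreal_measure) (use order_le_less_trans[OF le ennreal_less_top] in simp)
 show "measure Nu E <= n x r" using le unfolding eq by (simp add: n_def)
qed

lemma A1': "0 < r ==> AE y. y \<in> ball x r --> n x r powr (1 / q) * r powr (- real DIM('a) / q) <= C * \<Phi> x r powr \<tau> * v y"
 unfolding n_def Nu_def by (rule A1)

text \<open>The \<open>q\<close>-th power of the weight condition, integrated over
  \<open>E\<close>.\<close>

lemma doubling:
 assumes r: "0 < r" and E: "E \<in> sets borel" "E \<subseteq> ball x r"
 shows "n x r * r powr (- real DIM('a)) * measure lborel E <= (C * \<Phi> x r powr \<tau>) powr q * measure Nu E"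
proof -
 have E_fin: "emeasure lborel E < \<infinity>" using E(2) by (intro emeasure_bounded_finite bounded_subset[OF bounded_ball])
 let ?c = "(C * \<Phi> x r powr \<tau>) powr q"
 have pt: "AE y. y \<in> ball x r --> n x r * r powr (- real DIM('a)) <= ?c * v y powr q" using A1'[OF r, of x]
 proof eventually_elim
  case (elim y)
  show ?case
  proof
   assume "y \<in> ball x r"
   then have "(n x r powr (1 / q) * r powr (- real DIM('a) / q)) powr q <= (C * \<Phi> x r powr \<tau> * v y) powr q"
    using elim q by (intro powr_mono2) auto
   then show "n x r * r powr (- real DIM('a)) <= ?c * v y powr q" using q n_pos[OF r, of x] by (simp add: powr_mult powr_powr)
  qed
 qed
 have "ennreal (n x r * r powr (- real DIM('a))) * emeasure lborel E = (\<integral>\<^sup>+y. ennreal (n x r * r powr (- real DIM('a))) * indicator E y)"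
  using E by (simp add: nn_integral_cmult_indicator)
 also have "... <= (\<integral>\<^sup>+y. ennreal ?c * (ennreal (v y powr q) * indicator E y))"
  by (rule nn_integral_mono_AE) (use pt E in \<open>auto elim!: eventually_mono simp: ennreal_mult[symmetric] split: split_indicator intro!: ennreal_leI\<close>)
 also have "... = ennreal ?c * emeasure Nu E"
  using E by (simp add: nn_integral_cmult Nu_def emeasure_density)
 finally have "ennreal (n x r * r powr (- real DIM('a)) * measure lborel E) <= ennreal (?c * measure Nu E)"
  unfolding finite_sub(1)[OF E] using E_fin n_pos[OF r, of x] by (simp add: emeasure_eq_ennreal_measure less_top ennreal_mult)
 then show ?thesis by (subst (asm) ennreal_le_iff) auto
qed

lemma n_mono: "ball x r \<subseteq> ball y R ==> n x r <= n y R"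
 using finite_sub(2)[of "ball x r" y R] by (simp add: n_def)

definition "vol1 = measure lborel (ball (0::'a) 1)"
definition "rd = max (1 / 2) (1 - vol1 * 4 powr (- real DIM('a)) / (C * 3 powr \<tau>) powr q)"

lemma vol1: "0 < vol1" "0 < r ==> measure lborel (ball (x::'a) r) = vol1 * r powr real DIM('a)"
 using measure_lebesgue_ball[of r x] by (simp_all add: vol1_def content_ball_pos)

lemma rd: "0 < rd" "rd < 1" using vol1 C by (auto simp: rd_def)

text \<open>A disjoint ball inside the doubled one carries a fixed part of its mass by
  \<open>doubling\<close>. The restriction to \<open>R \<le> \<rho> x\<close> bounds
  \<open>\<Phi> x (2 * R)\<close> by 3; at larger scales the constant of the weight condition is not
  uniform.\<close>

lemma reverse_doubling:
 assumes R: "0 < R" "R <= \<rho> x"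
 shows "n x R <= rd * n x (2 * R)"
proof -
 let ?c = "vol1 * 4 powr (- real DIM('a)) / (C * 3 powr \<tau>) powr q"
 obtain b :: 'a where b: "b \<in> Basis" using nonempty_Basis by blast
 define z where "z = x + (3 / 2 * R) *\<^sub>R b"
 have xz: "dist x z = 3 / 2 * R" using R b by (simp add: z_def dist_norm)
 have sub: "ball z (R / 2) \<subseteq> ball x (2 * R)" by (rule subset_ballI) (use xz in \<open>simp add: dist_commute\<close>)
 have sub2: "ball x R \<subseteq> ball x (2 * R)" using R by (intro subset_ball) simp
 have disj: "ball x R \<inter> ball z (R / 2) = {}"
 proof (rule ccontr)
  assume "ball x R \<inter> ball z (R / 2) ~= {}"
  then obtain y where "dist x y < R" "dist z y < R / 2" by auto
  with xz dist_triangle[of x z y] show False by (simp add: dist_commute)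
 qed
 have "n x (2 * R) * (2 * R) powr (- real DIM('a)) * measure lborel (ball z (R / 2)) <= (C * \<Phi> x (2 * R) powr \<tau>) powr q * n z (R / 2)"
  using doubling[of "2 * R" "ball z (R / 2)" x] R sub by (simp add: n_def)
 also have "... <= (C * 3 powr \<tau>) powr q * n z (R / 2)"
 proof (intro mult_right_mono powr_mono2 mult_left_mono)
  show "\<Phi> x (2 * R) <= 3" using R rho[of x] by (simp add: field_simps)
 qed (use R rho[of x] C q tau n_pos[of "R / 2" z] in auto)
 also have "n x (2 * R) * (2 * R) powr (- real DIM('a)) * measure lborel (ball z (R / 2)) = n x (2 * R) * (vol1 * ((2 * R) powr (- real DIM('a)) * (R / 2) powr real DIM('a)))"
  using R by (simp add: vol1(2))
 also have "(2 * R) powr (- real DIM('a)) * (R / 2) powr real DIM('a) = 4 powr (- real DIM('a))"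
 proof -
  have "(2 * R) powr (- real DIM('a)) * (R / 2) powr real DIM('a) = (2 * R) powr (- real DIM('a)) * (2 * R / 4) powr real DIM('a)" by simp
  also have "... = (2 * R) powr (- real DIM('a)) * (2 * R) powr real DIM('a) * 4 powr (- real DIM('a))" unfolding powr_divide[of "2 * R"] by (simp add: powr_minus divide_inverse)
  also have "(2 * R) powr (- real DIM('a)) * (2 * R) powr real DIM('a) = 1" using R by (simp add: powr_add[symmetric])
  finally show ?thesis by simp
 qed
 finally have "?c * n x (2 * R) <= n z (R / 2)" using C by (simp add: field_simps)
 moreover have "n x R + n z (R / 2) = measure Nu (ball x R \<union> ball z (R / 2))"
  unfolding n_def by (rule measure_Union[symmetric]) (use disj in \<open>auto simp: emeasure_n\<close>)
 moreover have "measure Nu (ball x R \<union> ball z (R / 2)) <= n x (2 * R)" by (rule finite_sub(2)) (use sub sub2 in auto)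
 ultimately have "n x R <= (1 - ?c) * n x (2 * R)" by (simp add: left_diff_distrib)
 also have "... <= rd * n x (2 * R)" using n_pos[of "2 * R" x] R by (intro mult_right_mono) (auto simp: rd_def)
 finally show ?thesis .
qed

definition "sr \<beta> = max (rd powr \<beta>) (2 / 3)"

lemma sr: "0 <= sr \<beta>" "0 < \<beta> ==> sr \<beta> < 1"
 using rd powr_less_mono2[of \<beta> rd 1] by (auto simp: sr_def)

text \<open>Up to the critical radius the mass grows by reverse doubling; beyond it
  \<open>\<Phi>\<close> itself grows by at least the factor \<open>3 / 2\<close>. A single factor
  \<open>1 / \<Phi>\<close> thus secures geometric decay at every scale.\<close>

lemma scale_ratio:
 assumes \<beta>: "0 < \<beta>" and R: "0 < R"
 shows "n x (2 * R) powr (- \<beta>) / \<Phi> x (2 * R) <= sr \<beta> * (n x R powr (- \<beta>) / \<Phi> x R)"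
proof (cases "R <= \<rho> x")
 case True
 have P: "1 <= \<Phi> x R" "\<Phi> x R <= \<Phi> x (2 * R)" using R rho[of x] by (auto simp: field_simps)
 have "n x R / rd <= n x (2 * R)" using reverse_doubling[OF R True] rd(1) by (simp add: field_simps)
 then have "n x (2 * R) powr (- \<beta>) <= (n x R / rd) powr (- \<beta>)" using n_pos[OF R, of x] rd \<beta> by (intro powr_mono2') auto
 also have "... = rd powr \<beta> * n x R powr (- \<beta>)" unfolding powr_divide by (simp add: powr_minus divide_inverse)
 also have "... <= sr \<beta> * n x R powr (- \<beta>)" by (intro mult_right_mono) (auto simp: sr_def)
 finally have "n x (2 * R) powr (- \<beta>) / \<Phi> x (2 * R) <= (sr \<beta> * n x R powr (- \<beta>)) / \<Phi> x R"
  using P by (intro frac_le) (auto simp: sr_def)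
 then show ?thesis by simp
next
 case False
 have P: "0 < \<Phi> x R" "3 / 2 * \<Phi> x R <= \<Phi> x (2 * R)" using R False rho[of x] by (auto simp: field_simps)
 have "n x (2 * R) powr (- \<beta>) <= n x R powr (- \<beta>)"
  using n_pos[OF R, of x] \<beta> R by (intro powr_mono2' n_mono subset_ball) auto
 then have "n x (2 * R) powr (- \<beta>) / \<Phi> x (2 * R) <= n x R powr (- \<beta>) / (3 / 2 * \<Phi> x R)" using P by (intro frac_le) auto
 also have "... = 2 / 3 * (n x R powr (- \<beta>) / \<Phi> x R)" by simp
 also have "... <= sr \<beta> * (n x R powr (- \<beta>) / \<Phi> x R)" using P by (intro mult_right_mono) (auto simp: sr_def)
 finally show ?thesis .
qed

definition "Sg = C * (Cs * 9 powr k) powr \<tau> * 3 powr (real DIM('a) / q)"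

lemma Sg: "0 < Sg" using C Cs by (simp add: Sg_def)

text \<open>The exceptional set of \<open>y\<close> must not depend on \<open>R\<close> or
  \<open>E\<close>. The weight condition is therefore imposed on countably many balls, with centres
  in a dense set and rational radii, and an arbitrary ball about \<open>y\<close> is enclosed in one
  of them of comparable size.\<close>

lemma local_growth:
 assumes r: "0 < r"
 shows "AE y. y \<in> ball x (2 * r) --> 0 < v y & (ALL R E. 0 < R --> E \<in> sets borel --> E \<subseteq> ball x r -->
   emeasure Nu (E \<inter> ball y R) <= ennreal ((Sg * \<Phi> x r powr (k * \<tau>) * v y) powr q * R powr real DIM('a)))"
proof -
 obtain D :: "'a set" where D: "countable D" "!!X. open X ==> X ~= {} ==> EX d:D. d \<in> X" using countable_dense_exists by blast
 have "AE y. ALL c:D. ALL m:\<rat>. 0 < m --> y \<in> ball c m --> n c m powr (1 / q) * m powr (- real DIM('a) / q) <= C * \<Phi> c m powr \<tau> * v y"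
  unfolding AE_ball_countable[OF D(1)] AE_ball_countable[OF countable_rat] using A1' by auto
 note all = this
 have r2: "0 < 2 * r" using r by simp
 from all A1'[OF r2, of x] show ?thesis
 proof eventually_elim
  case (elim y)
  show ?case
  proof (intro impI conjI allI)
   assume y: "y \<in> ball x (2 * r)"
   have "0 < n x (2 * r) powr (1 / q) * (2 * r) powr (- real DIM('a) / q)" using n_pos[OF r2, of x] r by simp
   also have "... <= C * \<Phi> x (2 * r) powr \<tau> * v y" using elim(2) y by blast
   finally have "v y ~= 0" by auto
   with v(2)[of y] show vy: "0 < v y" by simp
   fix R :: real and E :: "'a set" assume R: "0 < R" and E: "E \<in> sets borel" "E \<subseteq> ball x r"
   \<comment> \<open>\<open>E\<close> lies in the ball of radius \<open>3 * r\<close> about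
     \<open>y\<close>, so larger radii capture nothing new. The cap keeps the auxiliary radius
     \<open>m\<close> below \<open>9 * r\<close>, the origin of the 9 in \<open>Sg\<close>.\<close>
   define R1 where "R1 = min R (3 * r)"
   have R1: "0 < R1" "R1 <= R" "R1 <= 3 * r" using R r by (auto simp: R1_def)
   obtain c where c: "c \<in> D" "c \<in> ball y R1" using D(2)[of "ball y R1"] R1 by auto
   obtain m where m: "m \<in> \<rat>" "2 * R1 < m" "m < 3 * R1" using Rats_dense_in_real[of "2 * R1" "3 * R1"] R1 by auto
   have m0: "0 < m" using m R1 by simp
   have sub: "ball x r \<subseteq> ball y (3 * r)" by (rule subset_ballI) (use y in simp)
   have "E \<inter> ball y R \<subseteq> ball y R1" using E(2) sub by (auto simp: R1_def min_def)
   also have "... \<subseteq> ball c m" by (rule subset_ballI) (use c m in simp)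
   finally have Ec: "E \<inter> ball y R \<subseteq> ball c m" .
   have yc: "y \<in> ball c m" using c m R1 by (simp add: dist_commute)
   have nc: "n c m powr (1 / q) * m powr (- real DIM('a) / q) <= C * \<Phi> c m powr \<tau> * v y"
    using elim(1) c(1) m(1) m0 yc by blast
   define X where "X = C * ((Cs * 9 powr k) powr \<tau> * \<Phi> x r powr (k * \<tau>)) * v y"
   have X: "0 <= X" using C vy by (simp add: X_def)
   have "\<Phi> c m powr \<tau> <= (Cs * 9 powr k) powr \<tau> * \<Phi> x r powr (k * \<tau>)"
   proof -
    have "\<Phi> c m <= \<Phi> c (9 * r)" using m R1 rho[of c] by (simp add: divide_right_mono)
    also have "... <= Cs * \<Phi> x (9 * r) powr k"
    proof (rule slow)
     show "dist c x <= 9 * r" using c y R1 r dist_triangle[of c x y] by (simp add: dist_commute)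
    qed
    also have "... <= Cs * (9 * \<Phi> x r) powr k" using k r rho[of x] Cs by (intro mult_left_mono powr_mono2) auto
    finally have "\<Phi> c m <= (Cs * 9 powr k) * \<Phi> x r powr k" unfolding powr_mult mult.assoc .
    then have "\<Phi> c m powr \<tau> <= ((Cs * 9 powr k) * \<Phi> x r powr k) powr \<tau>" using tau Phi[of m c] m0 by (intro powr_mono2) auto
    then show ?thesis unfolding powr_mult[of "Cs * 9 powr k"] powr_powr .
   qed
   then have "C * \<Phi> c m powr \<tau> * v y <= X" unfolding X_def using C vy by (intro mult_right_mono mult_left_mono) auto
   with nc have "n c m powr (1 / q) * m powr (- real DIM('a) / q) <= X" by (rule order_trans)
   then have "(n c m powr (1 / q) * m powr (- real DIM('a) / q)) * m powr (real DIM('a) / q) <= X * (3 * R) powr (real DIM('a) / q)"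
    using m R1 m0 q X by (intro mult_mono powr_mono2) auto
   also have "(n c m powr (1 / q) * m powr (- real DIM('a) / q)) * m powr (real DIM('a) / q) = n c m powr (1 / q)"
    using m0 by (simp add: mult.assoc powr_add[symmetric])
   also have "X * (3 * R) powr (real DIM('a) / q) = Sg * \<Phi> x r powr (k * \<tau>) * v y * R powr (real DIM('a) / q)"
    unfolding powr_mult[of 3 R] X_def Sg_def by (simp only: mult_ac)
   finally have "n c m powr (1 / q) <= Sg * \<Phi> x r powr (k * \<tau>) * v y * R powr (real DIM('a) / q)" .
   then have "(n c m powr (1 / q)) powr q <= (Sg * \<Phi> x r powr (k * \<tau>) * v y * R powr (real DIM('a) / q)) powr q"
    using q by (intro powr_mono2) auto
   then have le: "n c m <= (Sg * \<Phi> x r powr (k * \<tau>) * v y) powr q * R powr real DIM('a)"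
    using q n_pos[OF m0, of c] by (simp add: powr_powr powr_mult)
   have "emeasure Nu (E \<inter> ball y R) <= emeasure Nu (ball c m)" using Ec by (intro emeasure_mono) auto
   also have "... <= ennreal ((Sg * \<Phi> x r powr (k * \<tau>) * v y) powr q * R powr real DIM('a))"
    unfolding emeasure_n by (rule ennreal_leI[OF le])
   finally show "emeasure Nu (E \<inter> ball y R) <= ennreal ((Sg * \<Phi> x r powr (k * \<tau>) * v y) powr q * R powr real DIM('a))" .
  qed
 qed
qed

definition near :: "('a => real) => 'a => real => 'a => ennreal" where
 "near g x r z = (\<integral>\<^sup>+y. indicator (ball x (2 * r)) y * ennreal (dist z y powr (- real DIM('a) / q) * g y))"

lemma near_measurable:
 assumes [measurable]: "g \<in> Borel" shows "near g x r \<in> Borel"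
 unfolding near_def by (rule lborel.borel_measurable_nn_integral) measurable

definition "Sw = 1 + 2 powr (real DIM('a) / q) / (1 - (1 / 2) powr (real DIM('a) - real DIM('a) / q))"

lemma Sw: "1 <= Sw"
proof -
 have "0 < real DIM('a) - real DIM('a) / q" using q by (simp add: field_simps)
 from powr_less_mono2[OF this, of "1/2" 1] show ?thesis by (simp add: Sw_def)
qed

text \<open>A duality argument: \<open>near\<close> is integrated over its level set of mass
  \<open>e\<close>, the order is exchanged, and the inner integral is bounded by a multiple of
  \<open>v y * e powr (1 - 1 / q)\<close>. Dividing by this power of \<open>e\<close> leaves the
  weak bound, with \<open>v\<close> on the right-hand side.\<close>

lemma near_weak_type:
 assumes g: "g \<in> Borel" "!!y. 0 <= g y" and r: "0 < r" and l: "0 < l" and A: "0 <= A"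
  and int: "(\<integral>\<^sup>+y. indicator (ball x (2 * r)) y * ennreal (g y * v y)) <= ennreal A"
 shows "l * measure Nu {z \<in> ball x r. ennreal l < near g x r z} powr (1 / q) <= Sw * Sg * \<Phi> x r powr (k * \<tau>) * A"
proof -
 note [measurable] = g(1) near_measurable[OF g(1)]
 let ?E = "{z \<in> ball x r. ennreal l < near g x r z}" let ?B = "ball x (2 * r)"
 have E [measurable]: "?E \<in> sets borel" by measurable
 have Es: "?E \<subseteq> ball x r" by auto
 define e where "e = measure Nu ?E"
 have em: "emeasure Nu ?E = ennreal e" unfolding e_def by (rule finite_sub(1)[OF E Es])
 show ?thesis
 proof (cases "e = 0")
  case True then show ?thesis unfolding e_def using Sw Sg A by simp
 next
  case False
  then have e: "0 < e" by (simp add: e_def less_le)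
  define s where "s = Sg * \<Phi> x r powr (k * \<tau>)"
  have s: "0 < s" using Sg Phi[of r x] r by (simp add: s_def)
  let ?K = "%z y. ennreal (v z powr q) * (indicator ?E z * (indicator ?B y * ennreal (dist z y powr (- real DIM('a) / q) * g y)))"
  have "ennreal l * emeasure Nu ?E = (\<integral>\<^sup>+z. ennreal l * indicator ?E z \<partial>Nu)" using E by (simp add: nn_integral_cmult_indicator)
  also have "... <= (\<integral>\<^sup>+z. indicator ?E z * near g x r z \<partial>Nu)" by (intro nn_integral_mono) (auto split: split_indicator)
  also have "... = (\<integral>\<^sup>+z. ennreal (v z powr q) * (indicator ?E z * near g x r z))" by (rule nn_integral_Nu) measurable
  also have "... = (\<integral>\<^sup>+z. (\<integral>\<^sup>+y. ?K z y))"
   unfolding near_def by (intro nn_integral_cong) (simp add: nn_integral_cmult)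
  also have "... = (\<integral>\<^sup>+y. (\<integral>\<^sup>+z. ?K z y))" by (rule lborel_pair.Fubini') measurable
  also have "... <= (\<integral>\<^sup>+y. ennreal (Sw * s * e powr (1 - 1 / q)) * (indicator ?B y * ennreal (g y * v y)))"
  proof (rule nn_integral_mono_AE)
   show "AE y. (\<integral>\<^sup>+z. ?K z y) <= ennreal (Sw * s * e powr (1 - 1 / q)) * (indicator ?B y * ennreal (g y * v y))"
    using local_growth[OF r, of x]
   proof eventually_elim
    case (elim y)
    show ?case
    proof (cases "y \<in> ?B")
     case True
     with elim have vy: "0 < v y" and growth: "!!R. 0 < R ==> emeasure Nu (?E \<inter> ball y R) <= ennreal ((s * v y) powr q * R powr real DIM('a))"
      using E Es unfolding s_def by blast+
     have "(\<integral>\<^sup>+z. ?K z y) = (\<integral>\<^sup>+z. ennreal (g y) * (ennreal (v z powr q) * (indicator ?E z * ennreal (dist z y powr (- real DIM('a) / q)))))"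
      using True g(2) by (intro nn_integral_cong) (simp add: ennreal_mult mult_ac)
     also have "... = ennreal (g y) * (\<integral>\<^sup>+z. ennreal (v z powr q) * (indicator ?E z * ennreal (dist z y powr (- real DIM('a) / q))))"
      by (rule nn_integral_cmult) measurable
     also have "(\<integral>\<^sup>+z. ennreal (v z powr q) * (indicator ?E z * ennreal (dist z y powr (- real DIM('a) / q))))
       = (\<integral>\<^sup>+z. indicator ?E z * ennreal (dist z y powr (- real DIM('a) / q)) \<partial>Nu)" by (rule nn_integral_Nu[symmetric]) measurable
     also have "... <= ennreal (Sw * (s * v y) * e powr (1 - 1 / q))"
      unfolding Sw_def by (rule weak_kernel_integral[OF sets_Nu E em e _ q _ growth]) (use s vy in auto)
     finally have "(\<integral>\<^sup>+z. ?K z y) <= ennreal (g y) * ennreal (Sw * (s * v y) * e powr (1 - 1 / q))" by (simp add: mult_left_mono)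
     also have "... = ennreal (Sw * s * e powr (1 - 1 / q)) * ennreal (g y * v y)"
      using g(2) s Sw v(2) by (simp add: ennreal_mult[symmetric] mult_ac)
     finally show ?thesis using True by simp
    qed simp
   qed
  qed
  also have "... = ennreal (Sw * s * e powr (1 - 1 / q)) * (\<integral>\<^sup>+y. indicator ?B y * ennreal (g y * v y))"
   by (rule nn_integral_cmult) measurable
  also have "... <= ennreal (Sw * s * e powr (1 - 1 / q)) * ennreal A" by (rule mult_left_mono[OF int]) simp
  finally have "ennreal (l * e) <= ennreal (Sw * s * e powr (1 - 1 / q) * A)"
   unfolding em using l e A s Sw by (simp add: ennreal_mult)
  then have "l * e <= Sw * s * e powr (1 - 1 / q) * A" using A s Sw by (subst (asm) ennreal_le_iff) auto
  then have "l * e * e powr (1 / q - 1) <= Sw * s * e powr (1 - 1 / q) * A * e powr (1 / q - 1)" by (intro mult_right_mono) auto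
  moreover have "e * e powr (1 / q - 1) = e powr (1 / q)" using e powr_mult_base[of e "1 / q - 1"] by simp
  moreover have "e powr (1 - 1 / q) * e powr (1 / q - 1) = 1" using e by (simp add: powr_add[symmetric])
  ultimately have "l * e powr (1 / q) <= Sw * s * A" by (metis (no_types, opaque_lifting) mult.assoc mult.commute mult_1_right)
  then show ?thesis by (simp add: e_def s_def mult.assoc)
 qed
qed

text \<open>On the ball the weight condition makes a multiple of \<open>v\<close> at least 1, so the
  weight can be inserted under the integral at the price of that multiple.\<close>

lemma integral_g_le:
 assumes g: "g \<in> Borel" "!!y. 0 <= g y" and R: "0 < R" and A: "0 <= A"
  and int: "(\<integral>\<^sup>+y. indicator (ball x R) y * ennreal (g y * v y)) <= ennreal A"
 shows "(\<integral>\<^sup>+y. indicator (ball x R) y * ennreal (g y)) <= ennreal (C * \<Phi> x R powr \<tau> * R powr (real DIM('a) / q) * n x R powr (- 1 / q) * A)"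
proof -
 note [measurable] = g(1)
 let ?c = "C * \<Phi> x R powr \<tau> * R powr (real DIM('a) / q) * n x R powr (- 1 / q)"
 have c: "0 <= ?c" using C by simp
 have "(\<integral>\<^sup>+y. indicator (ball x R) y * ennreal (g y)) <= (\<integral>\<^sup>+y. ennreal ?c * (indicator (ball x R) y * ennreal (g y * v y)))"
 proof (rule nn_integral_mono_AE)
  show "AE y. indicator (ball x R) y * ennreal (g y) <= ennreal ?c * (indicator (ball x R) y * ennreal (g y * v y))"
   using A1'[OF R, of x]
  proof eventually_elim
   case (elim y)
   show ?case
   proof (cases "y \<in> ball x R")
    case True
    have "(n x R powr (1 / q) * R powr (- real DIM('a) / q)) * (R powr (real DIM('a) / q) * n x R powr (- 1 / q))
      <= (C * \<Phi> x R powr \<tau> * v y) * (R powr (real DIM('a) / q) * n x R powr (- 1 / q))" using elim True by (intro mult_right_mono) auto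
    also have "(n x R powr (1 / q) * R powr (- real DIM('a) / q)) * (R powr (real DIM('a) / q) * n x R powr (- 1 / q))
     = (n x R powr (1 / q) * n x R powr (- 1 / q)) * (R powr (- real DIM('a) / q) * R powr (real DIM('a) / q))" by (simp only: mult_ac)
    also have "... = 1" using n_pos[OF R, of x] R by (simp add: powr_add[symmetric])
    finally have "1 <= ?c * v y" by (simp only: mult_ac)
    then have "1 * g y <= ?c * v y * g y" using g(2) by (rule mult_right_mono)
    then have "ennreal (g y) <= ennreal (?c * (g y * v y))" by (intro ennreal_leI) (simp only: mult_ac mult_1_right)
    also have "... = ennreal ?c * ennreal (g y * v y)" using c g(2) v(2) by (intro ennreal_mult) auto
    finally show ?thesis using True by simp
   qed simp
  qed
 qed
 also have "... = ennreal ?c * (\<integral>\<^sup>+y. indicator (ball x R) y * ennreal (g y * v y))" by (rule nn_integral_cmult) measurable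
 also have "... <= ennreal ?c * ennreal A" by (rule mult_left_mono[OF int]) simp
 also have "... = ennreal (?c * A)" using c A by (rule ennreal_mult[symmetric])
 finally show ?thesis .
qed

text \<open>Finiteness of the Morrey norm without suprema and roots: \<open>A\<close> stands for the
  norm and \<open>g\<close> for the modulus of the function.\<close>

definition morrey_bounded :: "real => real => ('a => real) => real => bool" where
 "morrey_bounded \<theta> \<kappa> g A \<longleftrightarrow> g \<in> Borel & (ALL y. 0 <= g y) & 0 <= A &
  (ALL x R. 0 < R --> (\<integral>\<^sup>+y. indicator (ball x R) y * ennreal (g y * v y)) <= ennreal (A * \<Phi> x R powr \<theta> * n x R powr \<kappa>))"

definition far :: "real => ('a => real) => 'a => real => 'a => ennreal" where
 "far N g x r z = (\<integral>\<^sup>+y. indicator (- ball x (2 * r)) y * ennreal (dist z y powr (- (real DIM('a) / q)) * \<Phi> z (dist z y) powr (- N) * g y))"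

definition "Sf \<theta> \<kappa> = 4 powr (real DIM('a) / q) * (4 * Cs) powr (1 + \<theta> + \<tau>) * C / (1 - sr (1 / q - \<kappa>))"

lemma Sf: "\<kappa> < 1 / q ==> 0 < Sf \<theta> \<kappa>"
 using sr(2)[of "1 / q - \<kappa>"] Cs C by (simp add: Sf_def)

text \<open>In the order \<open>k * (1 + \<theta> + \<tau>)\<close> the factor \<open>k\<close> pays
  for the passage from \<open>\<rho> z\<close> to \<open>\<rho> x\<close>, while
  \<open>\<theta>\<close> and \<open>\<tau>\<close> cancel the growth allowed by the Morrey norm and
  by the weight condition. The remaining 1 supplies the factor \<open>1 / \<Phi>\<close>, and with
  \<open>\<kappa> < 1 / q\<close> the sum over annuli is controlled by
  \<open>scale_ratio\<close>.\<close>

lemma far_bound: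
 assumes \<kappa>: "\<kappa> < 1 / q" and \<theta>: "0 < \<theta>" and mb: "morrey_bounded \<theta> \<kappa> g A" and r: "0 < r" and z: "z \<in> ball x r"
 shows "far (k * (1 + \<theta> + \<tau>)) g x r z <= ennreal (Sf \<theta> \<kappa> * A * n x r powr (\<kappa> - 1 / q))"
proof -
 have g: "g \<in> Borel" "!!y. 0 <= g y" and A: "0 <= A"
  and int: "!!R. 0 < R ==> (\<integral>\<^sup>+y. indicator (ball x R) y * ennreal (g y * v y)) <= ennreal (A * \<Phi> x R powr \<theta> * n x R powr \<kappa>)"
  using mb by (auto simp: morrey_bounded_def)
 have b: "0 < 1 / q - \<kappa>" using \<kappa> by simp
 define \<gamma> where "\<gamma> = sr (1 / q - \<kappa>)"
 have gam: "0 <= \<gamma>" "\<gamma> < 1" using sr b by (auto simp: \<gamma>_def)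
 note ratio = scale_ratio[OF b, folded \<gamma>_def]
 let ?D = "real DIM('a) / q" let ?M = "1 + \<theta> + \<tau>"
 define c0 where "c0 = 4 powr ?D * (4 * Cs) powr ?M"
 have c0: "0 < c0" using Cs by (simp add: c0_def)
 note [measurable] = g(1)
 let ?R = "%j::nat. 2 ^ Suc j * (2 * r)"
 let ?c = "%j. c0 * ?R j powr (- ?D) * \<Phi> x (?R j) powr (- ?M)"
 let ?a = "%R. n x R powr (- (1 / q - \<kappa>)) / \<Phi> x R"
 have R0: "0 < ?R j" for j using r by simp
 have pt: "indicator (- ball x (2 * r)) y * ennreal (dist z y powr (- ?D) * \<Phi> z (dist z y) powr (- (k * ?M)) * g y)
   <= (\<Sum>j. ennreal (?c j) * (indicator (ball x (?R j)) y * ennreal (g y)))" for y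
 proof (cases "y \<in> ball x (2 * r)")
  case False
  then obtain j where j: "2 ^ j * (2 * r) <= dist x y" "dist x y < ?R j" using dyadic_up[of "2 * r" "dist x y"] r by auto
  have "1 * r <= 2 ^ j * r" using r by (intro mult_right_mono) auto
  \<comment> \<open>Since \<open>z\<close> is within \<open>r\<close> of \<open>x\<close>, every
    point of this annulus is at least a quarter of the outer radius away from
    \<open>z\<close>.\<close>
  then have t: "?R j / 4 <= dist z y" "dist x z <= ?R j / 4" using j(1) z dist_triangle[of x y z] by auto
  have t0: "0 < ?R j / 4" using r by simp
  have 1: "dist z y powr (- ?D) <= (?R j / 4) powr (- ?D)" using t t0 q by (intro powr_mono2') auto
  have "\<Phi> z (dist z y) powr (- (k * ?M)) = (\<Phi> z (dist z y) powr k) powr (- ?M)" by (simp only: powr_powr mult_minus_right)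
  also have "... <= (\<Phi> x (?R j) / (4 * Cs)) powr (- ?M)"
  proof (rule powr_mono2')
   have "\<Phi> x (?R j) / 4 <= \<Phi> x (?R j / 4)" by (simp add: add_divide_distrib)
   also have "... <= Cs * \<Phi> z (?R j / 4) powr k" by (rule slow[OF t(2)])
   also have "... <= Cs * \<Phi> z (dist z y) powr k"
    using t t0 k Cs rho[of z] by (intro mult_left_mono powr_mono2 add_left_mono divide_right_mono add_nonneg_nonneg divide_nonneg_pos) auto
   finally show "\<Phi> x (?R j) / (4 * Cs) <= \<Phi> z (dist z y) powr k" using Cs by (simp add: field_simps)
  qed (use \<theta> tau Cs Phi[OF less_imp_le[OF R0[of j]], of x] in \<open>auto intro!: divide_pos_pos\<close>)
  finally have 2: "\<Phi> z (dist z y) powr (- (k * ?M)) <= (\<Phi> x (?R j) / (4 * Cs)) powr (- ?M)" .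
  have "dist z y powr (- ?D) * \<Phi> z (dist z y) powr (- (k * ?M)) <= (?R j / 4) powr (- ?D) * (\<Phi> x (?R j) / (4 * Cs)) powr (- ?M)"
   by (rule mult_mono[OF 1 2]) auto
  also have "... = ?c j" unfolding powr_divide[of _ 4] powr_divide[of _ "4 * Cs"] c0_def powr_minus[of 4] powr_minus[of "4 * Cs"] by (simp add: divide_inverse)
  finally have "dist z y powr (- ?D) * \<Phi> z (dist z y) powr (- (k * ?M)) * g y <= ?c j * g y" using g(2) by (rule mult_right_mono)
  then have "ennreal (dist z y powr (- ?D) * \<Phi> z (dist z y) powr (- (k * ?M)) * g y) <= ennreal (?c j * g y)" by (rule ennreal_leI)
  also have "... = ennreal (?c j) * (indicator (ball x (?R j)) y * ennreal (g y))" using j(2) c0 g(2) by (simp add: ennreal_mult del: power_Suc)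
  also have "... <= (\<Sum>j. ennreal (?c j) * (indicator (ball x (?R j)) y * ennreal (g y)))" by (rule le_suminf_ennreal)
  finally show ?thesis using False by simp
 qed simp
 have iter: "?a (2 ^ i * r) <= \<gamma> ^ i * ?a r" for i
 proof (induction i)
  case (Suc i)
  have "?a (2 ^ Suc i * r) <= \<gamma> * ?a (2 ^ i * r)" using ratio[of "2 ^ i * r" x] r by (simp add: mult.assoc)
  also have "... <= \<gamma> * (\<gamma> ^ i * ?a r)" by (rule mult_left_mono[OF Suc gam(1)])
  finally show ?case by (simp add: mult.assoc)
 qed simp
 have term_le: "ennreal (?c j) * (\<integral>\<^sup>+y. indicator (ball x (?R j)) y * ennreal (g y)) <= ennreal (c0 * C * A * n x r powr (\<kappa> - 1 / q) * \<gamma> ^ j)" for j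
 proof -
  let ?P = "\<Phi> x (?R j)" let ?n = "n x (?R j)"
  have A': "0 <= A * ?P powr \<theta> * ?n powr \<kappa>" using A by simp
  have P: "1 <= ?P" by (rule Phi[OF less_imp_le[OF R0]])
  have np: "0 < ?n" by (rule n_pos[OF R0])
  have "ennreal (?c j) * (\<integral>\<^sup>+y. indicator (ball x (?R j)) y * ennreal (g y))
    <= ennreal (?c j) * ennreal (C * ?P powr \<tau> * ?R j powr ?D * ?n powr (- 1 / q) * (A * ?P powr \<theta> * ?n powr \<kappa>))"
   by (rule mult_left_mono[OF integral_g_le[OF g R0 A' int[OF R0]]]) simp
  also have "... = ennreal (?c j * (C * ?P powr \<tau> * ?R j powr ?D * ?n powr (- 1 / q) * (A * ?P powr \<theta> * ?n powr \<kappa>)))"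
   using c0 C A by (intro ennreal_mult[symmetric]) auto
  also have "?c j * (C * ?P powr \<tau> * ?R j powr ?D * ?n powr (- 1 / q) * (A * ?P powr \<theta> * ?n powr \<kappa>))
    = c0 * C * A * (?R j powr (- ?D) * ?R j powr ?D) * (?P powr (- ?M) * ?P powr \<tau> * ?P powr \<theta>) * (?n powr (- 1 / q) * ?n powr \<kappa>)"
   by (simp only: mult_ac)
  also have "?R j powr (- ?D) * ?R j powr ?D = 1" using r by (simp add: powr_add[symmetric])
  also have "?P powr (- ?M) * ?P powr \<tau> * ?P powr \<theta> = 1 / ?P"
  proof -
   have "?P powr (- ?M) * ?P powr \<tau> * ?P powr \<theta> = ?P powr - 1" unfolding powr_add[symmetric] by simp
   then show ?thesis using P by (simp add: powr_minus_divide)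
  qed
  also have "?n powr (- 1 / q) * ?n powr \<kappa> = ?n powr (- (1 / q - \<kappa>))" by (simp add: powr_add[symmetric])
  also have "c0 * C * A * 1 * (1 / ?P) * ?n powr (- (1 / q - \<kappa>)) = c0 * C * A * ?a (?R j)" by simp
  also have "ennreal ... <= ennreal (c0 * C * A * (n x r powr (\<kappa> - 1 / q) * \<gamma> ^ j))"
  proof (intro ennreal_leI mult_left_mono)
   have "?a (?R j) <= \<gamma> ^ (j + 2) * ?a r" using iter[of "j + 2"] by (simp add: mult_ac)
   also have "... <= \<gamma> ^ j * n x r powr (- (1 / q - \<kappa>))"
   proof (rule mult_mono)
    show "\<gamma> ^ (j + 2) <= \<gamma> ^ j" using gam by (intro power_decreasing) auto
    show "?a r <= n x r powr (- (1 / q - \<kappa>))" using Phi[of r x] r divide_left_mono[of 1 "\<Phi> x r" "n x r powr (- (1 / q - \<kappa>))"] by simp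
   qed (use gam Phi[of r x] r in auto)
   finally show "?a (?R j) <= n x r powr (\<kappa> - 1 / q) * \<gamma> ^ j" by (simp add: mult.commute)
  qed (use c0 C A in auto)
  finally show ?thesis by (simp only: mult.assoc)
 qed
 have m: "(%y. ennreal (?c j) * (indicator (ball x (?R j)) y * ennreal (g y))) \<in> borel_measurable lborel" for j by measurable
 have m': "(%y. indicator (ball x (?R j)) y * ennreal (g y)) \<in> borel_measurable lborel" for j by measurable
 have "far (k * ?M) g x r z <= (\<integral>\<^sup>+y. (\<Sum>j. ennreal (?c j) * (indicator (ball x (?R j)) y * ennreal (g y))))"
  unfolding far_def by (rule nn_integral_mono[OF pt])
 also have "... = (\<Sum>j. ennreal (?c j) * (\<integral>\<^sup>+y. indicator (ball x (?R j)) y * ennreal (g y)))"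
  by (simp only: nn_integral_suminf[OF m] nn_integral_cmult[OF m'])
 also have "... <= (\<Sum>j. ennreal (c0 * C * A * n x r powr (\<kappa> - 1 / q) * \<gamma> ^ j))" by (intro suminf_le term_le) auto
 also have "... = ennreal (c0 * C * A * n x r powr (\<kappa> - 1 / q) / (1 - \<gamma>))"
  by (rule suminf_geometric_ennreal) (use gam c0 C A in auto)
 finally show ?thesis by (simp add: Sf_def c0_def \<gamma>_def mult_ac)
qed

end

section \<open>Finiteness and weak type of the full potential\<close>

context morrey_weight
begin

definition "Wd = 2 powr real DIM('a) * (C * 2 powr \<tau>) powr q / vol1"

lemma n_double:
 assumes r: "0 < r" shows "n x (2 * r) <= Wd * \<Phi> x r powr (q * \<tau>) * n x r"
proof -
 have sub: "ball x r \<subseteq> ball x (2 * r)" using r by (intro subset_ball) simp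
 have "n x (2 * r) * (2 * r) powr (- real DIM('a)) * (vol1 * r powr real DIM('a)) <= (C * \<Phi> x (2 * r) powr \<tau>) powr q * n x r"
  using doubling[of "2 * r" "ball x r" x] r sub vol1(2)[OF r, of x] by (simp add: n_def)
 also have "... <= (C * (2 * \<Phi> x r) powr \<tau>) powr q * n x r"
  using r C q tau rho[of x] n_pos[OF r, of x] Phi[of "2 * r" x] by (intro mult_right_mono powr_mono2 mult_left_mono) auto
 also have "... = (C * 2 powr \<tau>) powr q * \<Phi> x r powr (q * \<tau>) * n x r"
  unfolding powr_mult[of 2 "\<Phi> x r"] mult.assoc[symmetric] powr_mult[of "C * 2 powr \<tau>"] powr_powr by (simp add: mult.commute)
 also have "n x (2 * r) * (2 * r) powr (- real DIM('a)) * (vol1 * r powr real DIM('a)) = n x (2 * r) * vol1 * 2 powr (- real DIM('a)) * (r powr (- real DIM('a)) * r powr real DIM('a))"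
  unfolding powr_mult by (simp only: mult_ac)
 also have "r powr (- real DIM('a)) * r powr real DIM('a) = 1" using r by (simp add: powr_add[symmetric])
 finally show ?thesis using vol1(1) unfolding Wd_def by (simp add: powr_minus field_simps)
qed

lemma measure_le:
 assumes F: "F \<in> sets borel" "F \<subseteq> ball x r" and "emeasure Nu E <= emeasure Nu F" shows "measure Nu E <= measure Nu F"
proof -
 have "emeasure Nu F < top" unfolding finite_sub(1)[OF F] by simp
 then show ?thesis unfolding measure_def using assms(3) by (intro enn2real_mono)
qed

text \<open>If the infinity set had positive mass \<open>e\<close>, the weak bound would limit
  \<open>l * e powr (1 / q)\<close> for all \<open>l\<close> at once. Positivity of \<open>v\<close>
  turns the resulting null set of the weighted measure into a Lebesgue null set.\<close>

lemma near_finite: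
 assumes g: "g \<in> Borel" "!!y. 0 <= g y" and r: "0 < r" and A: "0 <= A"
  and int: "(\<integral>\<^sup>+y. indicator (ball x (2 * r)) y * ennreal (g y * v y)) <= ennreal A"
 shows "AE z. z \<in> ball x r --> near g x r z < \<infinity>"
proof -
 note [measurable] = near_measurable[OF g(1)]
 define X where "X = Sw * Sg * \<Phi> x r powr (k * \<tau>) * A"
 have X: "0 <= X" using Sw Sg A by (simp add: X_def)
 let ?E = "{z \<in> ball x r. near g x r z = \<infinity>}"
 have E: "?E \<in> sets borel" by measurable
 define e where "e = measure Nu ?E"
 have le: "l * e powr (1 / q) <= X" if l: "0 < l" for l
 proof -
  have F: "{z \<in> ball x r. ennreal l < near g x r z} \<in> sets borel" by measurable
  have "emeasure Nu ?E <= emeasure Nu {z \<in> ball x r. ennreal l < near g x r z}" using F by (intro emeasure_mono) auto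
  then have "e <= measure Nu {z \<in> ball x r. ennreal l < near g x r z}"
   unfolding e_def by (rule measure_le[OF F, rotated]) auto
  then have "l * e powr (1 / q) <= l * measure Nu {z \<in> ball x r. ennreal l < near g x r z} powr (1 / q)"
   using l q by (intro mult_left_mono powr_mono2) (auto simp: e_def)
  with near_weak_type[OF g r l A int] show ?thesis unfolding X_def by linarith
 qed
 have "e = 0"
 proof (rule ccontr)
  assume "e ~= 0"
  then have e: "0 < e powr (1 / q)" by simp
  have "0 < (X + 1) / e powr (1 / q)" using e X by simp
  from le[OF this] have "(X + 1) / e powr (1 / q) * e powr (1 / q) <= X" .
  then show False using e by simp
 qed
 then have "emeasure Nu ?E = 0" using finite_sub(1)[OF E, of x r] unfolding e_def[symmetric] by (simp add: subset_eq)
 then have "(\<integral>\<^sup>+z. ennreal (v z powr q) * indicator ?E z) = 0" using E by (simp add: Nu_def emeasure_density)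
 then have "AE z. ennreal (v z powr q) * indicator ?E z = 0"
  using E by (subst (asm) nn_integral_0_iff_AE) auto
 moreover note local_growth[OF r, of x]
 ultimately show ?thesis
 proof eventually_elim
  case (elim z)
  show ?case
  proof
   assume z: "z \<in> ball x r"
   then have "0 < v z" using elim(2) r by auto
   then have "z \<notin> ?E" using elim(1) by (auto simp: indicator_def)
   then show "near g x r z < \<infinity>" using z by (simp add: less_top)
  qed
 qed
qed

definition potential :: "real => ('a => real) => 'a => ennreal" where
 "potential N g z = (\<integral>\<^sup>+y. ennreal (dist z y powr (- real DIM('a) / q) * \<Phi> z (dist z y) powr (- N) * g y))"

definition "Sp \<theta> \<kappa> = 2 * Sf \<theta> \<kappa> + 2 * (Sw * Sg) * 2 powr \<theta> * Wd powr \<kappa>"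

lemma Sp: "\<kappa> < 1 / q ==> 0 < Sp \<theta> \<kappa>" "2 * Sf \<theta> \<kappa> <= Sp \<theta> \<kappa>" "\<kappa> < 1 / q ==> 2 * (Sw * Sg) * 2 powr \<theta> * Wd powr \<kappa> <= Sp \<theta> \<kappa>"
 using Sw Sg Sf[of \<kappa> \<theta>] by (auto simp: Sp_def add_pos_nonneg)

context
 fixes \<theta> \<kappa> A :: real and g :: "'a => real"
 assumes \<kappa>: "0 < \<kappa>" "\<kappa> < 1 / q" and \<theta>: "0 < \<theta>" and mb: "morrey_bounded \<theta> \<kappa> g A"
begin

lemma g: "g \<in> Borel" "0 <= g y" and A: "0 <= A"
 and int2: "0 < r ==> (\<integral>\<^sup>+y. indicator (ball x (2 * r)) y * ennreal (g y * v y)) <= ennreal (A * \<Phi> x (2 * r) powr \<theta> * n x (2 * r) powr \<kappa>)"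
 using mb by (auto simp: morrey_bounded_def)

lemma A2: "0 <= A * \<Phi> x (2 * r) powr \<theta> * n x (2 * r) powr \<kappa>" using A by simp

lemmas far_le = far_bound[OF \<kappa>(2) \<theta> mb]

abbreviation (input) "N \<equiv> k * (1 + \<theta> + \<tau>)"

lemma potential_split: "potential N g z <= near g x r z + far N g x r z"
proof -
 note [measurable] = g(1)
 have "potential N g z <= (\<integral>\<^sup>+y. indicator (ball x (2 * r)) y * ennreal (dist z y powr (- real DIM('a) / q) * g y)
   + indicator (- ball x (2 * r)) y * ennreal (dist z y powr (- real DIM('a) / q) * \<Phi> z (dist z y) powr (- N) * g y))"
  unfolding potential_def
 proof (rule nn_integral_mono)
  fix y
  have "1 <= \<Phi> z (dist z y)" by (rule Phi) simp
  then have "\<Phi> z (dist z y) powr (- N) <= \<Phi> z (dist z y) powr 0" using k \<theta> tau by (intro powr_mono) auto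
  then have "dist z y powr (- real DIM('a) / q) * \<Phi> z (dist z y) powr (- N) * g y <= dist z y powr (- real DIM('a) / q) * 1 * g y"
   using g(2) \<open>1 <= \<Phi> z (dist z y)\<close> by (intro mult_right_mono mult_left_mono) auto
  then show "ennreal (dist z y powr (- real DIM('a) / q) * \<Phi> z (dist z y) powr (- N) * g y) <= indicator (ball x (2 * r)) y * ennreal (dist z y powr (- real DIM('a) / q) * g y)
   + indicator (- ball x (2 * r)) y * ennreal (dist z y powr (- real DIM('a) / q) * \<Phi> z (dist z y) powr (- N) * g y)"
   by (cases "y \<in> ball x (2 * r)") (simp_all add: ennreal_leI)
 qed
 also have "... = near g x r z + far N g x r z" unfolding near_def far_def minus_divide_left by (rule nn_integral_add) measurable
 finally show ?thesis .
qed

lemma potential_finite: "AE z. potential N g z < \<infinity>"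
proof -
 have "AE z. z \<in> ball 0 (real (Suc m)) --> potential N g z < \<infinity>" for m
 proof -
  have "AE z. z \<in> ball 0 (real (Suc m)) --> near g 0 (real (Suc m)) z < \<infinity>"
   by (rule near_finite[OF g _ A2 int2]) auto
  then show ?thesis
  proof eventually_elim
   case (elim z)
   show ?case
   proof
    assume z: "z \<in> ball 0 (real (Suc m))"
    have "far N g 0 (real (Suc m)) z <= ennreal (Sf \<theta> \<kappa> * A * n 0 (real (Suc m)) powr (\<kappa> - 1 / q))" by (rule far_le[OF _ z]) simp
    also have "... < \<infinity>" by simp
    finally have "near g 0 (real (Suc m)) z + far N g 0 (real (Suc m)) z < \<infinity>" using elim z by simp
    then show "potential N g z < \<infinity>" by (rule order_le_less_trans[OF potential_split])
   qed
  qed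
 qed
 then show ?thesis by - (rule AE_balls[of 0 1], simp)
qed

text \<open>Levels up to twice the bound \<open>b\<close> of the far part are settled by the mass of
  the whole ball. For higher levels the far part is at most \<open>l / 2\<close>, so the near part
  exceeds \<open>l / 2\<close>. Both routes end with the power \<kappa> of the mass.\<close>

lemma potential_weak_type:
 assumes r: "0 < r" and l: "0 < l" and E: "E \<in> sets borel" "E \<subseteq> ball x r" and lE: "AE z. z \<in> E --> ennreal l < potential N g z"
 shows "l * measure Nu E powr (1 / q) <= Sp \<theta> \<kappa> * A * \<Phi> x r powr (k * \<tau> + \<theta> + q * \<tau> * \<kappa>) * n x r powr \<kappa>"
proof -
 note [measurable] = near_measurable[OF g(1)]
 note c = Sp(1)[OF \<kappa>(2), of \<theta>] Sp(2)[of \<theta> \<kappa>] Sp(3)[OF \<kappa>(2), of \<theta>] and c1 = Sf[OF \<kappa>(2), of \<theta>]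
 have P: "1 <= \<Phi> x r" by (rule Phi[OF less_imp_le[OF r]])
 have np: "0 < n x r" by (rule n_pos[OF r])
 define b where "b = Sf \<theta> \<kappa> * A * n x r powr (\<kappa> - 1 / q)"
 have b: "0 <= b" using c1 A by (simp add: b_def)
 show ?thesis
 proof (cases "l <= 2 * b")
  case True
  have "l * measure Nu E powr (1 / q) <= 2 * b * n x r powr (1 / q)"
   using True b q l finite_sub(2)[OF E] by (intro mult_mono powr_mono2) auto
  also have "... = 2 * Sf \<theta> \<kappa> * A * 1 * n x r powr \<kappa>" by (simp add: b_def mult.assoc powr_add[symmetric])
  also have "... <= Sp \<theta> \<kappa> * A * \<Phi> x r powr (k * \<tau> + \<theta> + q * \<tau> * \<kappa>) * n x r powr \<kappa>"
   using c P A k tau \<theta> q \<kappa> c1 by (intro mult_right_mono mult_mono ge_one_powr_ge_zero) auto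
  finally show ?thesis .
 next
  case False
  let ?F = "{z \<in> ball x r. ennreal (l / 2) < near g x r z}"
  have F: "?F \<in> sets borel" by measurable
  have "AE z. z \<in> E --> z \<in> ?F" using lE
  proof eventually_elim
   case (elim z)
   show ?case
   proof
    assume z: "z \<in> E"
    then have zx: "z \<in> ball x r" using E(2) by auto
    have "ennreal (l / 2) + ennreal (l / 2) = ennreal l" using l by (simp add: ennreal_plus[symmetric] del: ennreal_plus)
    also have "... < potential N g z" using elim z by simp
    also have "... <= near g x r z + far N g x r z" by (rule potential_split)
    also have "far N g x r z <= ennreal b" unfolding b_def by (rule far_le[OF r zx])
    also have "ennreal b <= ennreal (l / 2)" using False by (intro ennreal_leI) simp
    finally have "ennreal (l / 2) + ennreal (l / 2) < near g x r z + ennreal (l / 2)" by (simp add: add_left_mono)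
    then have "ennreal (l / 2) < near g x r z" by (meson add_right_mono leI leD)
    then show "z \<in> ?F" using zx by simp
   qed
  qed
  then have "AE z in Nu. z \<in> E --> z \<in> ?F" unfolding Nu_def by (subst AE_density) (auto elim!: eventually_mono)
  then have "emeasure Nu E <= emeasure Nu ?F" using F by (intro emeasure_mono_AE) auto
  then have EF: "measure Nu E <= measure Nu ?F" by (rule measure_le[OF F, rotated]) auto
  have "l * measure Nu E powr (1 / q) <= 2 * (l / 2 * measure Nu ?F powr (1 / q))"
   using l q EF by (simp add: powr_mono2)
  also have "... <= 2 * (Sw * Sg * \<Phi> x r powr (k * \<tau>) * (A * \<Phi> x (2 * r) powr \<theta> * n x (2 * r) powr \<kappa>))"
   using l by (intro mult_left_mono near_weak_type[OF g r _ A2 int2[OF r]]) auto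
  also have "... <= 2 * (Sw * Sg * \<Phi> x r powr (k * \<tau>) * (A * (2 * \<Phi> x r) powr \<theta> * (Wd * \<Phi> x r powr (q * \<tau>) * n x r) powr \<kappa>))"
   using Sw Sg A \<theta> \<kappa> r rho[of x] P n_pos[of "2 * r" x] n_double[OF r, of x]
   by (intro mult_left_mono mult_mono powr_mono2) auto
  also have "... = (2 * (Sw * Sg) * 2 powr \<theta> * Wd powr \<kappa>) * A * (\<Phi> x r powr (k * \<tau>) * \<Phi> x r powr \<theta> * \<Phi> x r powr (q * \<tau> * \<kappa>)) * n x r powr \<kappa>"
   unfolding powr_mult powr_powr by (simp only: mult_ac)
  also have "\<Phi> x r powr (k * \<tau>) * \<Phi> x r powr \<theta> * \<Phi> x r powr (q * \<tau> * \<kappa>) = \<Phi> x r powr (k * \<tau> + \<theta> + q * \<tau> * \<kappa>)" by (simp only: powr_add)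
  also have "(2 * (Sw * Sg) * 2 powr \<theta> * Wd powr \<kappa>) * A * ... * n x r powr \<kappa> <= Sp \<theta> \<kappa> * A * \<Phi> x r powr (k * \<tau> + \<theta> + q * \<tau> * \<kappa>) * n x r powr \<kappa>"
   using c A by (intro mult_right_mono) auto
  finally show ?thesis .
 qed
qed

end

end

section \<open>From the given weights and Morrey norms to Borel versions\<close>

lemma ess_inf_on_le_AE:
 fixes w :: "'a::euclidean_space => real"
 assumes w: "!!x. 0 <= w x" and r: "0 < r"
 shows "AE y. y \<in> ball x r --> ess_inf_on (ball x r) w <= w y"
proof -
 let ?S = "{m. AE y in lebesgue. y \<in> ball x r --> m <= w y}"
 have zero: "0 \<in> ?S" using w by simp
 \<comment> \<open>The supremum that encodes the essential infimum is meaningful only for a set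
   bounded above; an unbounded one would make the ball null.\<close>
 have bdd: "bdd_above ?S"
 proof (rule ccontr)
  assume nb: "~ bdd_above ?S"
  have "AE y. y \<in> ball x r --> real i <= w y" for i
  proof -
   obtain m where "m \<in> ?S" "real i < m" using nb unfolding bdd_above_def by (meson not_le)
   then have "AE y. y \<in> ball x r --> m <= w y" unfolding AE_lebesgue_iff by simp
   then show ?thesis by eventually_elim (use \<open>real i < m\<close> in auto)
  qed
  then have "AE y. ALL i. y \<in> ball x r --> real i <= w y" unfolding AE_all_countable by (rule allI)
  then have "AE y. y \<notin> ball x r"
  proof eventually_elim
   case (elim y)
   obtain i where "w y < real i" using reals_Archimedean2 by blast
   then show ?case using elim[rule_format, of i] by (auto simp: not_le)
  qed
  then have "emeasure lborel (ball x r) = 0" by (subst (asm) AE_iff_measurable[of "ball x r"]) auto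
  then show False using measure_ball_pos[OF r, of x] by (simp add: measure_def)
 qed
 have "AE y. y \<in> ball x r --> Sup ?S - 1 / real (Suc i) <= w y" for i
 proof -
  have "Sup ?S - 1 / real (Suc i) < Sup ?S" by simp
  then obtain m where m: "m \<in> ?S" "Sup ?S - 1 / real (Suc i) < m" using zero by (elim less_cSupE) auto
  then have "AE y. y \<in> ball x r --> m <= w y" unfolding AE_lebesgue_iff by simp
  then show ?thesis by eventually_elim (use m(2) in auto)
 qed
 then have "AE y. ALL i. y \<in> ball x r --> Sup ?S - 1 / real (Suc i) <= w y" unfolding AE_all_countable by (rule allI)
 then show ?thesis unfolding ess_inf_on_def
 proof eventually_elim
  case (elim y)
  show ?case
  proof
   assume y: "y \<in> ball x r"
   show "Sup ?S <= w y"
   proof (rule field_le_epsilon)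
    fix e :: real assume "0 < e"
    then obtain i where "1 / real (Suc i) < e" by (rule nat_approx_posE)
    with elim[rule_format, OF y, of i] show "Sup ?S <= w y + e" by linarith
   qed
  qed
 qed
qed

lemma locally_integrable_measurable:
 fixes f :: "'a::euclidean_space => real"
 assumes "locally_integrable f" shows "f \<in> borel_measurable lebesgue"
proof (rule borel_measurable_LIMSEQ_real)
 show "(%i. indicator (ball 0 (real i)) x *\<^sub>R f x) \<longlonglongrightarrow> f x" for x
 proof (rule tendsto_eventually)
  obtain i where "norm x < real i" using reals_Archimedean2 by blast
  then show "\<forall>\<^sub>F i in sequentially. indicator (ball 0 (real i)) x *\<^sub>R f x = f x"
   by (intro eventually_sequentiallyI[of i]) auto
 qed
 show "(%x. indicator (ball 0 (real i)) x *\<^sub>R f x) \<in> borel_measurable lebesgue" for i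
  using locally_integrable_ball[OF assms, of 0 "real i"] unfolding set_integrable_def by (rule borel_measurable_integrable)
qed

lemma borel_version_complex:
 fixes f :: "'a::euclidean_space => complex"
 assumes "f \<in> borel_measurable lebesgue" obtains F where "F \<in> Borel" "AE x. f x = F x"
proof -
 have "(%x. Re (f x)) \<in> borel_measurable lebesgue" "(%x. Im (f x)) \<in> borel_measurable lebesgue" using assms by auto
 then obtain a b where "a \<in> borel_measurable lborel" "AE x. Re (f x) = a x" "b \<in> borel_measurable lborel" "AE x. Im (f x) = b x"
  using completion_ex_borel_measurable_real by metis
 note ab = this
 show thesis
 proof
  show "(%x. Complex (a x) (b x)) \<in> Borel" using ab(1,3) by (simp add: borel_measurable_complex_iff)
  show "AE x. f x = Complex (a x) (b x)" using ab(2,4) by eventually_elim (simp add: complex_eq_iff)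
 qed
qed

lemma wmeas_density:
 fixes w v :: "'a::euclidean_space => real"
 assumes wv: "AE x. w x = v x" and v: "v \<in> Borel" and E: "E \<in> sets borel"
  and E': "AE x. x \<in> E' \<longleftrightarrow> x \<in> E"
 shows "wmeas (%x. w x powr q) E' = measure (density lborel (%x. ennreal (v x powr q))) E"
proof -
 note [measurable] = v E
 have ae: "AE x. indicator E' x *\<^sub>R (w x powr q) = indicator E x *\<^sub>R (v x powr q)"
  using wv E' by eventually_elim (simp add: indicator_def)
 have "wmeas (%x. w x powr q) E' = (LBINT x. indicator E x *\<^sub>R (v x powr q))"
  unfolding wmeas_def set_lebesgue_integral_def by (rule lebesgue_cong_borel(3)[OF ae]) measurable
 also have "... = enn2real (\<integral>\<^sup>+x. ennreal (indicator E x *\<^sub>R (v x powr q)))"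
  by (rule integral_eq_nn_integral) auto
 also have "(\<integral>\<^sup>+x. ennreal (indicator E x *\<^sub>R (v x powr q))) = emeasure (density lborel (%x. ennreal (v x powr q))) E"
  by (subst emeasure_density) (auto intro!: nn_integral_cong split: split_indicator)
 finally show ?thesis by (simp add: measure_def)
qed

text \<open>Besides the passage to a Borel version, the point not written in the definition of the
  class is that every ball has positive weighted mass.\<close>

lemma (in rh_potential) morrey_weight_A1q:
 assumes A: "A1q \<rho> \<tau> q w" and q: "1 < q" and tau: "0 < \<tau>"
  and slow: "1 <= Cs" "1 <= k" "!!x y R. dist x y <= R ==> 1 + R / \<rho> x <= Cs * (1 + R / \<rho> y) powr k"
 obtains v C where "morrey_weight \<rho> v q C \<tau> Cs k" "AE x. w x = v x"
proof -
 have w: "!!x. 0 <= w x" "locally_integrable w" "~ (AE x in lebesgue. w x = 0)" using A by (auto simp: A1q_def weight_def)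
 obtain C0 where C0: "0 < C0" and int: "!!x r. 0 < r ==> (%y. w y powr q) absolutely_integrable_on ball x r"
  and A1: "!!x r. 0 < r ==> avg (ball x r) (%y. w y powr q) powr (1 / q) <= C0 * (1 + r / \<rho> x) powr \<tau> * ess_inf_on (ball x r) w"
  using A unfolding A1q_def by blast
 obtain v0 where v0: "v0 \<in> borel_measurable lborel" "AE x. w x = v0 x"
  using completion_ex_borel_measurable_real[OF locally_integrable_measurable[OF w(2)]] by blast
 define v where "v = (%x. max 0 (v0 x))"
 have v: "v \<in> Borel" "!!x. 0 <= v x" using v0(1) by (auto simp: v_def)
 have wv: "AE x. w x = v x" using v0(2)
 proof eventually_elim
  case (elim x) then show ?case using w(1)[of x] by (simp add: v_def)
 qed
 note [measurable] = v(1)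
 have [measurable]: "ball x r \<in> sets (borel :: 'a measure)" for x r by simp
 define M where "M = density lborel (%x. ennreal (v x powr q))"
 have wm: "wmeas (%x. w x powr q) (ball x r) = measure M (ball x r)" for x r
  unfolding M_def by (rule wmeas_density[OF wv v(1)]) auto
 define C where "C = C0 * vol 1 powr (1 / q)"
 have u: "0 < vol 1" by (rule vol_pos) simp
 have C: "0 < C" using C0 u by (simp add: C_def)
 have main: "AE y. y \<in> ball x r --> measure M (ball x r) powr (1 / q) * r powr (- real DIM('a) / q) <= C * (1 + r / \<rho> x) powr \<tau> * v y"
  if r: "0 < r" for x r
  using ess_inf_on_le_AE[of w r x, OF w(1) r] wv
 proof eventually_elim
  case (elim y)
  show ?case
  proof
   assume y: "y \<in> ball x r"
   have "(measure M (ball x r) / (vol 1 * r powr real DIM('a))) powr (1 / q) <= C0 * (1 + r / \<rho> x) powr \<tau> * ess_inf_on (ball x r) w"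
    using A1[OF r, of x] wm[of x r] measure_ball_vol[OF r, of x] vol[OF r] by (simp add: avg_def wmeas_def del: measure_completion)
   also have "... <= C0 * (1 + r / \<rho> x) powr \<tau> * v y" using elim y C0 by (intro mult_left_mono) auto
   finally have "vol 1 powr (1 / q) * (measure M (ball x r) / (vol 1 * r powr real DIM('a))) powr (1 / q) <= vol 1 powr (1 / q) * (C0 * (1 + r / \<rho> x) powr \<tau> * v y)"
    by (rule mult_left_mono) simp
   also have "vol 1 powr (1 / q) * (measure M (ball x r) / (vol 1 * r powr real DIM('a))) powr (1 / q) = measure M (ball x r) powr (1 / q) * r powr (- real DIM('a) / q)"
    unfolding powr_divide[of "measure M (ball x r)"] powr_mult[of "vol 1"] powr_powr using u by (simp add: powr_minus divide_inverse)
   finally show "measure M (ball x r) powr (1 / q) * r powr (- real DIM('a) / q) <= C * (1 + r / \<rho> x) powr \<tau> * v y"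
    by (simp add: C_def mult_ac)
  qed
 qed
 have fin: "emeasure M (ball x r) < \<infinity>" for x r
 proof (cases "0 < r")
  case True
  have ae: "AE y. indicator (ball x r) y *\<^sub>R (w y powr q) = indicator (ball x r) y *\<^sub>R (v y powr q)" using wv by eventually_elim simp
  have "integrable lborel (%y. indicator (ball x r) y *\<^sub>R (v y powr q))"
   using int[OF True, of x] unfolding set_integrable_def by (subst (asm) lebesgue_cong_borel(2)[OF ae]) measurable
  then have "(\<integral>\<^sup>+y. ennreal (norm (indicator (ball x r) y *\<^sub>R (v y powr q)))) < \<infinity>" by (simp add: integrable_iff_bounded)
  moreover have "emeasure M (ball x r) = (\<integral>\<^sup>+y. ennreal (norm (indicator (ball x r) y *\<^sub>R (v y powr q))))"
   unfolding M_def by (subst emeasure_density) (auto intro!: nn_integral_cong split: split_indicator)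
  ultimately show ?thesis by simp
 next
  case False
  then have "ball x r = {}" by simp
  then show ?thesis by (simp only: emeasure_empty) simp
 qed
 have null: "AE y. y \<in> ball x r --> v y = 0" if "measure M (ball x r) = 0" for x r
 proof -
  have "emeasure M (ball x r) = 0" using that fin[of x r] by (simp add: emeasure_eq_ennreal_measure less_top)
  then have "(\<integral>\<^sup>+y. ennreal (v y powr q) * indicator (ball x r) y) = 0" by (simp add: M_def emeasure_density)
  then have "AE y. ennreal (v y powr q) * indicator (ball x r) y = 0" by (subst (asm) nn_integral_0_iff_AE) auto
  then show ?thesis by eventually_elim (auto simp: indicator_def)
 qed
 \<comment> \<open>If the weight vanished on one ball, a larger concentric ball of positive mass
   would force it, through the weight condition, to be positive there. So it would vanish
   everywhere, which is excluded for a weight.\<close>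
 have pos: "0 < measure M (ball x r)" if r: "0 < r" for x r
 proof (rule ccontr)
  assume "~ 0 < measure M (ball x r)"
  then have z: "measure M (ball x r) = 0" using measure_nonneg[of M "ball x r"] by linarith
  have "AE y. y \<in> ball x (r + real i) --> v y = 0" for i
  proof (rule null, rule ccontr)
   let ?R = "r + real i"
   assume "measure M (ball x ?R) ~= 0"
   then have m: "0 < measure M (ball x ?R) powr (1 / q) * ?R powr (- real DIM('a) / q)" using r by simp
   have "0 < ?R" using r by simp
   from null[OF z] main[OF this, of x] have "AE y. y \<notin> ball x r"
   proof eventually_elim
    case (elim y)
    show ?case
    proof
     assume y: "y \<in> ball x r"
     moreover have "y \<in> ball x ?R" using y by simp
     ultimately show False using elim m r by auto
    qed
   qed
   then have "emeasure lborel (ball x r) = 0" by (subst (asm) AE_iff_measurable[of "ball x r"]) auto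
   then show False using measure_ball_pos[OF r, of x] by (simp add: measure_def)
  qed
  from AE_balls[OF this] have "AE y. w y = 0" using wv by eventually_elim simp
  with w(3) show False unfolding AE_lebesgue_iff by blast
 qed
 have "morrey_weight \<rho> v q C \<tau> Cs k"
  by unfold_locales (use critical_radius_pos slow q C tau v fin pos main in \<open>simp_all add: M_def\<close>)
 then show thesis using wv by (rule that)
qed

text \<open>A single ball in the supremum, solved for the integral; membership in the Morrey space
  makes the norm finite, so \<open>enn2real\<close> loses nothing.\<close>

lemma morrey_integral_bound:
 fixes f :: "'a::euclidean_space => complex"
 assumes f: "f \<in> morrey \<rho> \<theta> 1 \<kappa> w \<nu>" and rho: "!!x. 0 < \<rho> x" and w: "!!x. 0 <= w x"
  and wv: "AE x. w x = v x" "v \<in> Borel" and fF: "AE x. f x = F x" "F \<in> Borel"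
  and R: "0 < R" and n: "0 < wmeas \<nu> (ball x R)"
 shows "(\<integral>\<^sup>+y. indicator (ball x R) y * ennreal (norm (F y) * v y))
  <= ennreal (enn2real (morrey_norm \<rho> \<theta> 1 \<kappa> w \<nu> f) * (1 + R / \<rho> x) powr \<theta> * wmeas \<nu> (ball x R) powr \<kappa>)"
proof -
 let ?A = "enn2real (morrey_norm \<rho> \<theta> 1 \<kappa> w \<nu> f)" let ?P = "1 + R / \<rho> x"
 let ?n = "wmeas \<nu> (ball x R)" let ?I = "LINT y:ball x R|lebesgue. norm (f y) powr 1 * w y"
 have fin: "morrey_norm \<rho> \<theta> 1 \<kappa> w \<nu> f = ennreal ?A" using f by (simp add: morrey_def less_top)
 have I0: "0 <= ?I" unfolding set_lebesgue_integral_def using w by (intro Bochner_Integration.integral_nonneg) (simp add: indicator_def)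
 have P: "0 < ?P" using R rho[of x] by (simp add: add_pos_pos)
 have "ennreal (?P powr (- \<theta>) * (1 / ?n powr \<kappa> * ?I) powr (1 / 1)) <= morrey_norm \<rho> \<theta> 1 \<kappa> w \<nu> f"
  unfolding morrey_norm_def by (rule SUP_upper2[of "(x, R)"]) (use R in auto)
 from order_trans[OF this eq_refl[OF fin]]
 have "?P powr (- \<theta>) * (1 / ?n powr \<kappa> * ?I) powr (1 / 1) <= ?A" by (rule ennreal_le_iff[OF enn2real_nonneg, THEN iffD1])
 moreover have "(1 / ?n powr \<kappa> * ?I) powr (1 / 1) = 1 / ?n powr \<kappa> * ?I" using I0 by simp
 ultimately have "?P powr (- \<theta>) * (1 / ?n powr \<kappa> * ?I) <= ?A" by (simp only:)
 then have le: "?I <= ?A * ?P powr \<theta> * ?n powr \<kappa>" using P n by (simp add: powr_minus field_simps)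
 have ae: "AE y. indicator (ball x R) y *\<^sub>R (norm (f y) powr 1 * w y) = indicator (ball x R) y * (norm (F y) * v y)"
  using wv(1) fF(1) by eventually_elim simp
 have m: "(%y. indicator (ball x R) y * (norm (F y) * v y)) \<in> Borel"
  using wv(2) fF(2) by (intro borel_measurable_times borel_measurable_norm borel_measurable_indicator) auto
 have "locally_integrable (%x. norm (f x) powr 1 * w x)" using f by (simp add: morrey_def)
 then have "integrable lborel (%y. indicator (ball x R) y * (norm (F y) * v y))"
  using locally_integrable_ball[of _ x R] lebesgue_cong_borel(2)[OF ae m] unfolding set_integrable_def by blast
 moreover have "AE y. 0 <= indicator (ball x R) y * (norm (F y) * v y)" using wv(1) by eventually_elim (use w in \<open>metis indicator_pos_le mult_nonneg_nonneg norm_ge_zero\<close>)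
 ultimately have "(\<integral>\<^sup>+y. ennreal (indicator (ball x R) y * (norm (F y) * v y))) = ennreal (LBINT y. indicator (ball x R) y * (norm (F y) * v y))"
  by (rule nn_integral_eq_integral)
 also have "(LBINT y. indicator (ball x R) y * (norm (F y) * v y)) = ?I"
  unfolding set_lebesgue_integral_def by (rule lebesgue_cong_borel(3)[OF ae m, symmetric])
 also have "(\<integral>\<^sup>+y. ennreal (indicator (ball x R) y * (norm (F y) * v y))) = (\<integral>\<^sup>+y. indicator (ball x R) y * ennreal (norm (F y) * v y))"
  by (intro nn_integral_cong) (simp add: indicator_def)
 finally show ?thesis using ennreal_leI[OF le] by simp
qed

text \<open>The kernel bound dominates the operator by \<open>CK\<close> times
  \<open>potential\<close> of the modulus of \<open>f\<close>, whose finiteness almost everywhere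
  gives absolute convergence. Level sets are measured for a Borel version \<open>G\<close> of the
  image, and \<open>\<theta>'\<close> is the power of \<open>\<Phi>\<close> left over in
  \<open>potential_weak_type\<close>.\<close>

lemma (in schroedinger_rh) frac_integral_weak_morrey:
 fixes w :: "'a => real" and p :: "real => 'a => 'a => real"
 assumes meas: "(%(t, x, y). p t x y) \<in> borel_measurable (lebesgue_on ({0<..} \<times> UNIV))"
  and ker: "!!t f. 0 < t ==> square_integrable f ==>
   AE x in lebesgue. integrable lebesgue (%y. p t x y * f y) & S t f x = (LINT y|lebesgue. p t x y * f y)"
  and \<alpha>: "0 < \<alpha>" "\<alpha> < real DIM('a)" and q: "q = real DIM('a) / (real DIM('a) - \<alpha>)"
  and w: "A1q \<rho> \<tau> q w" "0 < \<tau>" and \<kappa>: "0 < \<kappa>" "\<kappa> < 1 / q" and \<theta>: "0 < \<theta>"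
 shows "EX \<theta>'>0. EX C>0. ALL f: morrey \<rho> \<theta> 1 \<kappa> w (%x. w x powr q).
      (AE x in lebesgue. frac_integral_converges p \<alpha> f x) &
      frac_integral p \<alpha> f \<in> weak_morrey \<rho> \<theta>' q (\<kappa> * q) (%x. w x powr q) &
      weak_morrey_norm \<rho> \<theta>' q (\<kappa> * q) (%x. w x powr q) (frac_integral p \<alpha> f)
       <= ennreal C * morrey_norm \<rho> \<theta> 1 \<kappa> w (%x. w x powr q) f"
proof -
 let ?\<nu> = "%x. w x powr q"
 have q1: "1 < q" using \<alpha> unfolding q by simp
 \<comment> \<open>The relation between \<open>q\<close> and \<alpha> makes the singularity of the
   kernel the one built into \<open>potential\<close>.\<close>
 have dq: "- real DIM('a) / q = \<alpha> - real DIM('a)" using \<alpha> unfolding q by simp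
 have w0: "!!x. 0 <= w x" using w(1) by (auto simp: A1q_def weight_def)
 obtain Cs k where slow: "1 <= Cs" "1 <= k" "!!x y R. dist x y <= R ==> 1 + R / \<rho> x <= Cs * (1 + R / \<rho> y) powr k"
  using slow_variation by blast
 obtain v C where mw: "morrey_weight \<rho> v q C \<tau> Cs k" and wv: "AE x. w x = v x"
  by (rule morrey_weight_A1q[OF w(1) q1 w(2) slow])
 interpret mw: morrey_weight \<rho> v q C \<tau> Cs k by (rule mw)
 let ?N = "k * (1 + \<theta> + \<tau>)"
 have N: "0 <= ?N" using slow(2) \<theta> w(2) by simp
 obtain K CK where K: "K \<in> Borel" and CK: "0 < CK" and bd: "AE x. AE y.
   (%t. p t x y * t powr (\<alpha> / 2 - 1)) absolutely_integrable_on {0<..} & frac_kernel p \<alpha> x y = K (x, y) &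
   \<bar>K (x, y)\<bar> <= CK * dist x y powr (\<alpha> - real DIM('a)) * (1 + dist x y / \<rho> x) powr (- ?N)"
  by (rule frac_kernel_bound[OF meas ker \<alpha> N])
 define c where "c = mw.Sp \<theta> \<kappa>"
 have c: "0 < c" unfolding c_def by (rule mw.Sp(1)[OF \<kappa>(2)])
 define \<theta>' where "\<theta>' = k * \<tau> + \<theta> + q * \<tau> * \<kappa>"
 have t': "0 < \<theta>'" using slow(2) w(2) \<theta> q1 \<kappa>(1) by (simp add: \<theta>'_def add_pos_pos)
 have nW: "wmeas ?\<nu> (ball x r) = mw.n x r" for x r
  unfolding mw.n_def mw.Nu_def by (rule wmeas_density[OF wv mw.v(1)]) auto
 show ?thesis
 proof (rule exI[of _ \<theta>'], intro conjI t', rule exI[of _ "CK * c"], intro conjI ballI)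
  show "0 < CK * c" using CK c by simp
  fix f assume f: "f \<in> morrey \<rho> \<theta> 1 \<kappa> w ?\<nu>"
  obtain F where F: "F \<in> Borel" "AE x. f x = F x"
   using borel_version_complex[of f] f by (auto simp: morrey_def)
  define A where "A = enn2real (morrey_norm \<rho> \<theta> 1 \<kappa> w ?\<nu> f)"
  have A: "0 <= A" "morrey_norm \<rho> \<theta> 1 \<kappa> w ?\<nu> f = ennreal A" using f by (auto simp: A_def morrey_def less_top)
  define g where "g = (%y. norm (F y))"
  have g: "g \<in> Borel" "ALL y. 0 <= g y" using F(1) by (auto simp: g_def)
  note [measurable] = K F(1) g(1)
  have mb: "mw.morrey_bounded \<theta> \<kappa> g A"
   using morrey_integral_bound[OF f critical_radius_pos w0 wv mw.v(1) F(2,1)] mw.n_pos g A(1)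
   unfolding mw.morrey_bounded_def g_def nW A_def by blast
  have Ky: "(%y. K (z, y)) \<in> Borel" for z
   by (rule measurable_compose[OF borel_measurable_continuous_onI K]) (intro continuous_intros)
  define G where "G = (%z. LBINT y. K (z, y) *\<^sub>R F y)"
  have G: "G \<in> Borel" unfolding G_def
  proof (rule lborel.borel_measurable_lebesgue_integral)
   have "(%z. K z *\<^sub>R F (snd z)) \<in> Borel"
    by (intro borel_measurable_scaleR K measurable_compose[OF borel_measurable_continuous_onI F(1)]) (intro continuous_intros)
   then show "(%(z, y). K (z, y) *\<^sub>R F y) \<in> borel_measurable (borel \<Otimes>\<^sub>M lborel)"
    unfolding measurable_borel_prod_iff by (simp add: case_prod_beta')
  qed
  have KG: "AE z. frac_integral_converges p \<alpha> f z & frac_integral p \<alpha> f z = G z & ennreal (norm (G z)) <= ennreal CK * mw.potential ?N g z"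
   using bd mw.potential_finite[OF \<kappa> \<theta> mb]
  proof eventually_elim
   case (elim z)
   have ae: "AE y. frac_kernel p \<alpha> z y *\<^sub>R f y = K (z, y) *\<^sub>R F y" using elim(1) F(2) by eventually_elim simp
   have m: "(%y. K (z, y) *\<^sub>R F y) \<in> Borel" using Ky[of z] F(1) by (rule borel_measurable_scaleR)
   let ?P = "%y. dist z y powr (- real DIM('a) / q) * (1 + dist z y / \<rho> z) powr (- ?N) * g y"
   have "(\<integral>\<^sup>+y. ennreal (norm (K (z, y) *\<^sub>R F y))) <= (\<integral>\<^sup>+y. ennreal CK * ennreal (?P y))"
   proof (rule nn_integral_mono_AE)
    show "AE y. ennreal (norm (K (z, y) *\<^sub>R F y)) <= ennreal CK * ennreal (?P y)" using elim(1)
    proof eventually_elim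
     case (elim y)
     then have "\<bar>K (z, y)\<bar> * g y <= (CK * dist z y powr (\<alpha> - real DIM('a)) * (1 + dist z y / \<rho> z) powr (- ?N)) * g y"
      using g(2) by (intro mult_right_mono) auto
     then have "norm (K (z, y) *\<^sub>R F y) <= CK * ?P y" unfolding dq g_def by (simp add: mult.assoc)
     then have "ennreal (norm (K (z, y) *\<^sub>R F y)) <= ennreal (CK * ?P y)" by (rule ennreal_leI)
     also have "... = ennreal CK * ennreal (?P y)" using CK g(2) by (intro ennreal_mult) auto
     finally show ?case .
    qed
   qed
   also have "... = ennreal CK * mw.potential ?N g z" unfolding mw.potential_def by (rule nn_integral_cmult) measurable
   finally have nn: "(\<integral>\<^sup>+y. ennreal (norm (K (z, y) *\<^sub>R F y))) <= ennreal CK * mw.potential ?N g z" .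
   also have "... < \<infinity>" using elim(2) by (simp add: ennreal_mult_less_top)
   finally have int: "integrable lborel (%y. K (z, y) *\<^sub>R F y)" using m by (intro integrableI_bounded) simp_all
   have "integrable lebesgue (%y. frac_kernel p \<alpha> z y *\<^sub>R f y)" using int lebesgue_cong_borel(2)[OF ae m] by blast
   moreover have "AE y in lebesgue. (%t. p t z y * t powr (\<alpha> / 2 - 1)) absolutely_integrable_on {0<..}"
    unfolding AE_lebesgue_iff using elim(1) by eventually_elim simp
   moreover have "frac_integral p \<alpha> f z = G z" unfolding frac_integral_def G_def by (rule lebesgue_cong_borel(3)[OF ae m])
   moreover have "ennreal (norm (G z)) <= (\<integral>\<^sup>+y. ennreal (norm (K (z, y) *\<^sub>R F y)))"
    unfolding G_def by (rule integral_norm_bound_ennreal[OF int])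
   ultimately show ?case using nn unfolding frac_integral_converges_def by (blast intro: order_trans)
  qed
  show "AE x in lebesgue. frac_integral_converges p \<alpha> f x" unfolding AE_lebesgue_iff using KG by eventually_elim simp
  have eq: "AE z. frac_integral p \<alpha> f z = G z" using KG by eventually_elim simp
  have fm: "frac_integral p \<alpha> f \<in> borel_measurable lebesgue" by (rule lebesgue_cong_borel(1)[OF eq G])
  have level: "l * wmeas ?\<nu> {y \<in> ball x r. norm (frac_integral p \<alpha> f y) > l} powr (1 / q) <= CK * c * A * (1 + r / \<rho> x) powr \<theta>' * mw.n x r powr \<kappa>"
   if r: "0 < r" and l: "0 < l" for x r l
  proof -
   let ?E = "{y \<in> ball x r. norm (G y) > l}"
   have "?E = ball x r \<inter> {y. norm (G y) > l}" by auto
   also have "... \<in> sets borel" using G by (intro sets.Int) auto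
   finally have E: "?E \<in> sets borel" .
   have Eq: "wmeas ?\<nu> {y \<in> ball x r. norm (frac_integral p \<alpha> f y) > l} = measure mw.Nu ?E"
    unfolding mw.Nu_def by (rule wmeas_density[OF wv mw.v(1) E]) (use eq in \<open>eventually_elim, simp\<close>)
   have "AE z. z \<in> ?E --> ennreal (l / CK) < mw.potential ?N g z" using KG
   proof eventually_elim
    case (elim z)
    show ?case
    proof
     assume "z \<in> ?E"
     then have "ennreal CK * ennreal (l / CK) < ennreal (norm (G z))" using CK l by (simp add: ennreal_mult[symmetric] ennreal_less_iff)
     also have "... <= ennreal CK * mw.potential ?N g z" using elim by simp
     finally show "ennreal (l / CK) < mw.potential ?N g z" by (meson leD leI mult_left_mono zero_le)
    qed
   qed
   moreover have "?E \<subseteq> ball x r" by auto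
   ultimately have "l / CK * measure mw.Nu ?E powr (1 / q) <= c * A * (1 + r / \<rho> x) powr \<theta>' * mw.n x r powr \<kappa>"
    unfolding \<theta>'_def c_def using l CK by (intro mw.potential_weak_type[OF \<kappa> \<theta> mb r _ E]) simp_all
   then show ?thesis unfolding Eq using CK by (simp add: field_simps)
  qed
  have "weak_morrey_norm \<rho> \<theta>' q (\<kappa> * q) ?\<nu> (frac_integral p \<alpha> f) <= ennreal (CK * c * A)"
   unfolding weak_morrey_norm_def
  proof (rule SUP_least, clarify)
   fix x :: 'a and r :: real assume r: "0 < r"
   have P: "0 < 1 + r / \<rho> x" using r critical_radius_pos[of x] by (simp add: add_pos_pos)
   have n: "0 < mw.n x r" by (rule mw.n_pos[OF r])
   let ?B = "CK * c * A * (1 + r / \<rho> x) powr \<theta>' * mw.n x r powr \<kappa>"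
   have "(SUP l\<in>{0<..}. ennreal (l * wmeas ?\<nu> {y \<in> ball x r. norm (frac_integral p \<alpha> f y) > l} powr (1 / q))) <= ennreal ?B"
    by (rule SUP_least) (use level[OF r] in \<open>auto intro!: ennreal_leI\<close>)
   then have "ennreal ((1 + r / \<rho> x) powr (- \<theta>') * (1 / mw.n x r powr (\<kappa> * q / q))) *
     (SUP l\<in>{0<..}. ennreal (l * wmeas ?\<nu> {y \<in> ball x r. norm (frac_integral p \<alpha> f y) > l} powr (1 / q)))
    <= ennreal ((1 + r / \<rho> x) powr (- \<theta>') * (1 / mw.n x r powr (\<kappa> * q / q))) * ennreal ?B" by (rule mult_left_mono) simp
   also have "... = ennreal (((1 + r / \<rho> x) powr (- \<theta>') * (1 / mw.n x r powr (\<kappa> * q / q))) * ?B)"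
    using CK c A(1) by (intro ennreal_mult[symmetric]) auto
   also have "((1 + r / \<rho> x) powr (- \<theta>') * (1 / mw.n x r powr (\<kappa> * q / q))) * ?B = CK * c * A * ((1 + r / \<rho> x) powr (- \<theta>') * (1 + r / \<rho> x) powr \<theta>')"
    using n q1 by simp
   also have "(1 + r / \<rho> x) powr (- \<theta>') * (1 + r / \<rho> x) powr \<theta>' = 1" using P by (simp only: powr_add[symmetric]) simp
   finally show "ennreal ((1 + r / \<rho> x) powr (- \<theta>') * (1 / wmeas ?\<nu> (ball x r) powr (\<kappa> * q / q))) *
     (SUP l\<in>{0<..}. ennreal (l * wmeas ?\<nu> {y \<in> ball x r. norm (frac_integral p \<alpha> f y) > l} powr (1 / q))) <= ennreal (CK * c * A)"
    by (simp only: nW mult_1_right)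
  qed
  also have "... = ennreal (CK * c) * morrey_norm \<rho> \<theta> 1 \<kappa> w ?\<nu> f" unfolding A(2) using CK c A(1) by (intro ennreal_mult) auto
  finally show le: "weak_morrey_norm \<rho> \<theta>' q (\<kappa> * q) ?\<nu> (frac_integral p \<alpha> f) <= ennreal (CK * c) * morrey_norm \<rho> \<theta> 1 \<kappa> w ?\<nu> f" .
  also have "... < \<infinity>" using f by (simp add: morrey_def ennreal_mult_less_top)
  finally show "frac_integral p \<alpha> f \<in> weak_morrey \<rho> \<theta>' q (\<kappa> * q) ?\<nu>" using fm by (simp add: weak_morrey_def)
 qed
qed

theorem theorem2p4:
  fixes V w :: "'a::euclidean_space \<Rightarrow> real"
    and p :: "real \<Rightarrow> 'a \<Rightarrow> 'a \<Rightarrow> real"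
    and \<rho> :: "'a \<Rightarrow> real"
    and s \<alpha> q \<kappa> :: real
  assumes "3 \<le> DIM('a)"
    and "\<forall>x. 0 \<le> V x" and "locally_integrable V" and "\<not> (AE x in lebesgue. V x = 0)"
    and "reverse_Holder s V" and "real DIM('a) / 2 \<le> s"
    and "\<rho> = critical_radius V"
    and "heat_kernel V p"
    and "0 < \<alpha>" and "\<alpha> < real DIM('a)"
    and "q = real DIM('a) / (real DIM('a) - \<alpha>)"
    and "A1q_infinity \<rho> q w"
    and "0 < \<kappa>" and "\<kappa> < 1 / q"
  shows "\<forall>\<theta>>0. \<exists>\<theta>'>0. \<exists>C>0. \<forall>f \<in> morrey \<rho> \<theta> 1 \<kappa> w (\<lambda>x. w x powr q).
           (AE x in lebesgue. frac_integral_converges p \<alpha> f x) \<and>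
           frac_integral p \<alpha> f \<in> weak_morrey \<rho> \<theta>' q (\<kappa> * q) (\<lambda>x. w x powr q) \<and>
           weak_morrey_norm \<rho> \<theta>' q (\<kappa> * q) (\<lambda>x. w x powr q) (frac_integral p \<alpha> f)
             \<le> ennreal C * morrey_norm \<rho> \<theta> 1 \<kappa> w (\<lambda>x. w x powr q) f"
proof (intro allI impI, goal_cases)
  case (1 \<theta>)
  from assms(8) obtain S where meas: "(\<lambda>(t, x, y). p t x y) \<in> borel_measurable (lebesgue_on ({0<..} \<times> UNIV))"
    and S: "schroedinger_semigroup V S"
    and ker: "\<forall>t>0. \<forall>f. square_integrable f \<longrightarrow> (AE x in lebesgue. integrable lebesgue (\<lambda>y. p t x y * f y) \<and> S t f x = (LINT y|lebesgue. p t x y * f y))"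
    unfolding heat_kernel_def by (elim exE conjE)
  \<comment> \<open>Measurability of \<open>V\<close>, asked for by
    \<open>schroedinger_flow\<close>, follows from local integrability.\<close>
  interpret schroedinger_rh V s S
    by unfold_locales (use assms(1-6) S locally_integrable_measurable[OF assms(3)] in auto)
  from assms(12) obtain \<tau> where "0 < \<tau>" "A1q \<rho> \<tau> q w" unfolding A1q_infinity_def by (elim exE conjE)
  then show ?case
    unfolding assms(7) by (intro frac_integral_weak_morrey[OF meas _ assms(9-11) _ _ assms(13,14) 1] ker[rule_format])
qed

end
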